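(* Let $R=R_0[x_1,\dots,x_d]$ be a Noetherian $\mathbb{N}$-graded ring, let $L$ and $M$ be finitely generated $\mathbb{Z}$-graded $R$-modules, let $N$ be a graded submodule of $M$, and let $I$ be a homogeneous ideal of $R$. Let $J$ be a reduction ideal of $I$ generated by homogeneous elements $y_1,\dots,y_c$ of degrees $d_1\le\cdots\le d_c$ respectively. Fix $k\in\mathbb{N}$, and put $H:=\operatorname{Ext}_R^k(L,M)$ and $H_n:=\operatorname{Ext}_R^k(L,M/I^nN)$ for each $n\ge 0$. Assume that $(0:_H I)=0$. (1) Let $\mathfrak{p}$ be such that $\mathfrak{p}\in\operatorname{Ass}_R(H_n)$ for all $n\gg 0$, and suppose that $I\subseteq\mathfrak{p}$. Then there exist $a_{\mathfrak{p}}\in\{d_1,\dots,d_c\}$ and $b_{\mathfrak{p}}\in\mathbb{Z}$ such that $v_{\mathfrak{p}}(H_n)=a_{\mathfrak{p}}n+b_{\mathfrak{p}}$ for all $n\gg 0$. (2) Suppose that $I^{n_0}M\subseteq N$ for some $n_0\in\mathbb{N}$ (e.g., $N=M$, or $N=\mathfrak{a}M$ for some homogeneous ideal $\mathfrak{a}$ with $I\subseteq\sqrt{\mathfrak{a}}$). Then there exist $a\in\{d_1,\dots,d_c\}$ and $b\in\mathbb{Z}\cup\{\infty\}$ such that $v(H_n)=an+b$ for all $n\gg 0$.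
   Context: Rings are commutative and $\mathbb{N}=\{0,1,2,\dots\}$. $R=R_0[x_1,\dots,x_d]$ means that $R$ is generated over its degree-zero component $R_0$ by homogeneous elements $x_1,\dots,x_d$. An ideal $J\subseteq I$ is a reduction of $I$ if $JI^m=I^{m+1}$ for some $m\ge 0$. Ext of finitely generated graded $R$-modules carries its natural $\mathbb{Z}$-graded structure. For an $R$-module $H$, $(0:_H I):=\{x\in H: Ix=0\}$. v-numbers: for a finitely generated $\mathbb{Z}$-graded $R$-module $E$ with graded components $E_n$ and $\mathfrak{p}\in\operatorname{Ass}_R(E)$, the local v-number is $v_{\mathfrak{p}}(E):=\inf\{n:\text{there exists }x\in E_n\text{ with }\mathfrak{p}=(0:_R x)\}$, where $(0:_R x)$ is the annihilator of $x$ in $R$. The v-number is $v(E):=\inf\{v_{\mathfrak{p}}(E):\mathfrak{p}\in\operatorname{Ass}_R(E)\}$, with $v(0)=\infty$. *)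

theory Defs
  imports "HOL-Algebra.Ring_Divisibility" "HOL-Algebra.Generated_Rings" "HOL-Algebra.Generated_Groups"
    "HOL-Algebra.Ideal_Product"
    "HOL-Library.Extended_Real"
begin

section \<open>Graded rings and graded modules\<close>

record 'a graded_ring = "'a ring" +
  rcomp :: "int \<Rightarrow> 'a set"

record ('a, 'b) graded_module = "('a, 'b) module" +
  mcomp :: "int \<Rightarrow> 'b set"

definition decomposes :: "('b, 'z) ring_scheme \<Rightarrow> (int \<Rightarrow> 'b set) \<Rightarrow> 'b \<Rightarrow> (int \<Rightarrow> 'b) \<Rightarrow> bool" where
  "decomposes G C x f \<longleftrightarrow>
     (\<forall>n. f n \<in> C n) \<and> finite {n. f n \<noteq> \<zero>\<^bsub>G\<^esub>} \<and> x = (\<Oplus>\<^bsub>G\<^esub>n\<in>{n. f n \<noteq> \<zero>\<^bsub>G\<^esub>}. f n)"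

text \<open>The additive group is the internal direct sum of the subgroups \<open>C n\<close>.\<close>

definition is_grading :: "('b, 'z) ring_scheme \<Rightarrow> (int \<Rightarrow> 'b set) \<Rightarrow> bool" where
  "is_grading G C \<longleftrightarrow>
     (\<forall>n. subgroup (C n) (add_monoid G)) \<and> (\<forall>x\<in>carrier G. \<exists>!f. decomposes G C x f)"

text \<open>For a subgroup \<open>K\<close> this says that \<open>K\<close> is the direct sum of the \<open>K \<inter> C n\<close>.\<close>

definition homogeneous_subset :: "('b, 'z) ring_scheme \<Rightarrow> (int \<Rightarrow> 'b set) \<Rightarrow> 'b set \<Rightarrow> bool" where
  "homogeneous_subset G C K \<longleftrightarrow> (\<forall>x\<in>K. \<exists>f. decomposes G (\<lambda>n. K \<inter> C n) x f)"

text \<open>An \<open>\<nat>\<close>-grading is a \<open>\<int>\<close>-grading whose components of negative degree vanish.\<close>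

locale nat_graded_ring = cring R for R :: "'a graded_ring" (structure) +
  assumes grading: "is_grading R (rcomp R)"
    and one_degree: "\<one> \<in> rcomp R 0"
    and mult_degree: "\<And>m n a b. a \<in> rcomp R m \<Longrightarrow> b \<in> rcomp R n \<Longrightarrow> a \<otimes> b \<in> rcomp R (m + n)"
    and negative_degree: "\<And>n. n < 0 \<Longrightarrow> rcomp R n = {\<zero>}"

locale graded_module = module R M
  for R :: "'a graded_ring" (structure) and M :: "('a, 'b) graded_module" (structure) +
  assumes module_grading: "is_grading M (mcomp M)"
    and smult_degree:
      "\<And>m n a x. a \<in> rcomp R m \<Longrightarrow> x \<in> mcomp M n \<Longrightarrow> a \<odot>\<^bsub>M\<^esub> x \<in> mcomp M (m + n)"

definition homogeneous_ideal :: "'a graded_ring \<Rightarrow> 'a set \<Rightarrow> bool" where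
  "homogeneous_ideal R I \<longleftrightarrow> ideal I R \<and> homogeneous_subset R (rcomp R) I"

definition graded_submodule :: "'a graded_ring \<Rightarrow> ('a, 'b) graded_module \<Rightarrow> 'b set \<Rightarrow> bool" where
  "graded_submodule R M N \<longleftrightarrow> submodule N R M \<and> homogeneous_subset M (mcomp M) N"

text \<open>Finite sums of products \<open>a x\<close> with \<open>a \<in> I\<close>, \<open>x \<in> N\<close>: for an ideal \<open>I\<close> this is the
  submodule \<open>I N\<close>, and for \<open>I = R\<close> it is the submodule generated by \<open>N\<close>.\<close>

definition ideal_smult :: "('a, 'b, 'z) module_scheme \<Rightarrow> 'a set \<Rightarrow> 'b set \<Rightarrow> 'b set" where
  "ideal_smult M I N = generate (add_monoid M) {a \<odot>\<^bsub>M\<^esub> x | a x. a \<in> I \<and> x \<in> N}"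

definition finitely_generated :: "('a, 'y) ring_scheme \<Rightarrow> ('a, 'b, 'z) module_scheme \<Rightarrow> bool" where
  "finitely_generated R M \<longleftrightarrow>
     (\<exists>A. finite A \<and> A \<subseteq> carrier M \<and> ideal_smult M (carrier R) A = carrier M)"

abbreviation ideal_power :: "('a, 'y) ring_scheme \<Rightarrow> 'a set \<Rightarrow> nat \<Rightarrow> 'a set" where
  "ideal_power R I n \<equiv> I [^]\<^bsub>ideals_set R\<^esub> n"

definition is_reduction :: "('a, 'y) ring_scheme \<Rightarrow> 'a set \<Rightarrow> 'a set \<Rightarrow> bool" where
  "is_reduction R J I \<longleftrightarrow>
     ideal J R \<and> J \<subseteq> I \<and> (\<exists>m. ideal_prod R J (ideal_power R I m) = ideal_power R I (m + 1))"

definition graded_sub :: "('a, 'b) graded_module \<Rightarrow> 'b set \<Rightarrow> ('a, 'b) graded_module" where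
  "graded_sub M K = M\<lparr>carrier := K, mcomp := \<lambda>n. K \<inter> mcomp M n\<rparr>"

text \<open>The ring multiplication and unit that \<open>module\<close> records inherit from \<open>ring\<close> carry no
  meaning for a module; they are left unspecified here and below.\<close>

definition graded_quot :: "('a, 'b) graded_module \<Rightarrow> 'b set \<Rightarrow> ('a, 'b set) graded_module" where
  "graded_quot M N =
     \<lparr>carrier = a_rcosets\<^bsub>M\<^esub> N, mult = undefined, one = undefined,
      zero = N, add = set_add M,
      smult = (\<lambda>a S. \<Union>x\<in>S. N +>\<^bsub>M\<^esub> (a \<odot>\<^bsub>M\<^esub> x)),
      mcomp = (\<lambda>n. (\<lambda>x. N +>\<^bsub>M\<^esub> x) ` mcomp M n)\<rparr>"


section \<open>Graded Hom and Ext\<close>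

definition mod_hom ::
  "('a, 'y) ring_scheme \<Rightarrow> ('a, 'b, 'z) module_scheme \<Rightarrow> ('a, 'c, 'w) module_scheme \<Rightarrow> ('b \<Rightarrow> 'c) set"
  where
  "mod_hom R F M = {f \<in> hom (add_monoid F) (add_monoid M).
     \<forall>a\<in>carrier R. \<forall>x\<in>carrier F. f (a \<odot>\<^bsub>F\<^esub> x) = a \<odot>\<^bsub>M\<^esub> f x}"

definition has_degree ::
  "('a, 'b) graded_module \<Rightarrow> ('a, 'c) graded_module \<Rightarrow> ('b \<Rightarrow> 'c) \<Rightarrow> int \<Rightarrow> bool" where
  "has_degree F M f n \<longleftrightarrow> (\<forall>m. f ` mcomp F m \<subseteq> mcomp M (m + n))"

text \<open>\<open>Hom\<^sub>R(F, M)\<close>, with its homomorphisms of degree \<open>n\<close> as component of degree \<open>n\<close>; this is a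
  grading of all of \<open>Hom\<^sub>R(F, M)\<close> when \<open>F\<close> is finitely generated.\<close>

definition graded_hom ::
  "'a graded_ring \<Rightarrow> ('a, 'b) graded_module \<Rightarrow> ('a, 'c) graded_module \<Rightarrow> ('a, 'b \<Rightarrow> 'c) graded_module"
  where
  "graded_hom R F M =
     \<lparr>carrier = mod_hom R F M \<inter> extensional (carrier F), mult = undefined, one = undefined,
      zero = (\<lambda>x\<in>carrier F. \<zero>\<^bsub>M\<^esub>),
      add = (\<lambda>f g. \<lambda>x\<in>carrier F. f x \<oplus>\<^bsub>M\<^esub> g x),
      smult = (\<lambda>a f. \<lambda>x\<in>carrier F. a \<odot>\<^bsub>M\<^esub> f x),
      mcomp = (\<lambda>n. {f \<in> mod_hom R F M \<inter> extensional (carrier F). has_degree F M f n})\<rparr>"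

text \<open>The graded free module with basis elements of the degrees listed in \<open>as\<close>, that is
  \<open>R(-a\<^sub>1) \<oplus> \<dots> \<oplus> R(-a\<^sub>r)\<close> with \<open>R(-a)\<^sub>n = R\<^sub>n\<^sub>-\<^sub>a\<close>.\<close>

definition graded_free :: "'a graded_ring \<Rightarrow> int list \<Rightarrow> ('a, nat \<Rightarrow> 'a) graded_module" where
  "graded_free R as =
     \<lparr>carrier = (\<Pi>\<^sub>E j\<in>{..<length as}. carrier R), mult = undefined, one = undefined,
      zero = (\<lambda>j\<in>{..<length as}. \<zero>\<^bsub>R\<^esub>),
      add = (\<lambda>v w. \<lambda>j\<in>{..<length as}. v j \<oplus>\<^bsub>R\<^esub> w j),
      smult = (\<lambda>a v. \<lambda>j\<in>{..<length as}. a \<otimes>\<^bsub>R\<^esub> v j),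
      mcomp = (\<lambda>n. \<Pi>\<^sub>E j\<in>{..<length as}. rcomp R (n - as ! j))\<rparr>"

text \<open>Data of a complex \<open>\<dots> \<rightarrow> F\<^sub>2 \<rightarrow> F\<^sub>1 \<rightarrow> F\<^sub>0 \<rightarrow> L\<close>, where \<open>F\<^sub>i\<close> is the graded free module with
  basis degrees \<open>basis_degs F i\<close>, \<open>diff F i\<close> maps \<open>F\<^sub>i\<^sub>+\<^sub>1\<close> to \<open>F\<^sub>i\<close>, and \<open>aug F\<close> maps \<open>F\<^sub>0\<close> to \<open>L\<close>.\<close>

record ('a, 'l) resolution =
  basis_degs :: "nat \<Rightarrow> int list"
  diff :: "nat \<Rightarrow> (nat \<Rightarrow> 'a) \<Rightarrow> (nat \<Rightarrow> 'a)"
  aug :: "(nat \<Rightarrow> 'a) \<Rightarrow> 'l"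

abbreviation res_term ::
  "'a graded_ring \<Rightarrow> ('a, 'l) resolution \<Rightarrow> nat \<Rightarrow> ('a, nat \<Rightarrow> 'a) graded_module" where
  "res_term R F i \<equiv> graded_free R (basis_degs F i)"

definition graded_free_resolution ::
  "'a graded_ring \<Rightarrow> ('a, 'l) graded_module \<Rightarrow> ('a, 'l) resolution \<Rightarrow> bool" where
  "graded_free_resolution R L F \<longleftrightarrow>
     aug F \<in> mod_hom R (res_term R F 0) L \<and> has_degree (res_term R F 0) L (aug F) 0 \<and>
     (\<forall>i. diff F i \<in> mod_hom R (res_term R F (Suc i)) (res_term R F i) \<and>
          has_degree (res_term R F (Suc i)) (res_term R F i) (diff F i) 0) \<and>
     aug F ` carrier (res_term R F 0) = carrier L \<and>
     a_kernel (res_term R F 0) L (aug F) = diff F 0 ` carrier (res_term R F 1) \<and>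
     (\<forall>i. a_kernel (res_term R F (Suc i)) (res_term R F i) (diff F i) =
          diff F (Suc i) ` carrier (res_term R F (Suc (Suc i))))"

definition hom_cochains ::
  "'a graded_ring \<Rightarrow> ('a, 'l) resolution \<Rightarrow> ('a, 'b) graded_module \<Rightarrow> nat \<Rightarrow>
     ('a, (nat \<Rightarrow> 'a) \<Rightarrow> 'b) graded_module" where
  "hom_cochains R F M i = graded_hom R (res_term R F i) M"

definition hom_codiff ::
  "'a graded_ring \<Rightarrow> ('a, 'l) resolution \<Rightarrow> nat \<Rightarrow> ((nat \<Rightarrow> 'a) \<Rightarrow> 'b) \<Rightarrow> ((nat \<Rightarrow> 'a) \<Rightarrow> 'b)" where
  "hom_codiff R F i f = compose (carrier (res_term R F (Suc i))) f (diff F i)"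

definition hom_cocycles ::
  "'a graded_ring \<Rightarrow> ('a, 'l) resolution \<Rightarrow> ('a, 'b) graded_module \<Rightarrow> nat \<Rightarrow>
     ((nat \<Rightarrow> 'a) \<Rightarrow> 'b) set" where
  "hom_cocycles R F M k =
     a_kernel (hom_cochains R F M k) (hom_cochains R F M (Suc k)) (hom_codiff R F k)"

definition hom_coboundaries ::
  "'a graded_ring \<Rightarrow> ('a, 'l) resolution \<Rightarrow> ('a, 'b) graded_module \<Rightarrow> nat \<Rightarrow>
     ((nat \<Rightarrow> 'a) \<Rightarrow> 'b) set" where
  "hom_coboundaries R F M k =
     (case k of 0 \<Rightarrow> {\<zero>\<^bsub>hom_cochains R F M 0\<^esub>}
      | Suc j \<Rightarrow> hom_codiff R F j ` carrier (hom_cochains R F M j))"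

definition hom_cohomology ::
  "'a graded_ring \<Rightarrow> ('a, 'l) resolution \<Rightarrow> ('a, 'b) graded_module \<Rightarrow> nat \<Rightarrow>
     ('a, ((nat \<Rightarrow> 'a) \<Rightarrow> 'b) set) graded_module" where
  "hom_cohomology R F M k =
     graded_quot (graded_sub (hom_cochains R F M k) (hom_cocycles R F M k)) (hom_coboundaries R F M k)"

text \<open>\<open>Ext\<^sub>R\<^sup>k(L, M)\<close> with its natural grading, computed from a graded resolution of \<open>L\<close> by finitely
  generated graded free modules. Such a resolution exists for every finitely generated graded
  module over a Noetherian graded ring (lemma \<open>ex_graded_free_resolution\<close> below), and up to
  isomorphism of graded modules the result does not depend on the one selected.\<close>

definition graded_Ext ::
  "'a graded_ring \<Rightarrow> nat \<Rightarrow> ('a, 'l) graded_module \<Rightarrow> ('a, 'b) graded_module \<Rightarrow>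
     ('a, ((nat \<Rightarrow> 'a) \<Rightarrow> 'b) set) graded_module" where
  "graded_Ext R k L M = hom_cohomology R (SOME F. graded_free_resolution R L F) M k"


section \<open>Associated primes and v-numbers\<close>

definition annih :: "('a, 'y) ring_scheme \<Rightarrow> ('a, 'b, 'z) module_scheme \<Rightarrow> 'b \<Rightarrow> 'a set" where
  "annih R E x = {a \<in> carrier R. a \<odot>\<^bsub>E\<^esub> x = \<zero>\<^bsub>E\<^esub>}"

definition ideal_torsion :: "('a, 'b, 'z) module_scheme \<Rightarrow> 'a set \<Rightarrow> 'b set" where
  "ideal_torsion E I = {x \<in> carrier E. \<forall>a\<in>I. a \<odot>\<^bsub>E\<^esub> x = \<zero>\<^bsub>E\<^esub>}"

definition Ass :: "('a, 'y) ring_scheme \<Rightarrow> ('a, 'b, 'z) module_scheme \<Rightarrow> 'a set set" where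
  "Ass R E = {p. primeideal p R \<and> (\<exists>x\<in>carrier E. p = annih R E x)}"

text \<open>Infima are taken in the extended reals, so that \<open>Inf {} = \<infinity>\<close>.\<close>

definition local_v_number :: "'a graded_ring \<Rightarrow> 'a set \<Rightarrow> ('a, 'b) graded_module \<Rightarrow> ereal" where
  "local_v_number R p E = Inf {ereal (real_of_int n) | n. \<exists>x\<in>mcomp E n. p = annih R E x}"

definition v_number :: "'a graded_ring \<Rightarrow> ('a, 'b) graded_module \<Rightarrow> ereal" where
  "v_number R E = Inf {local_v_number R p E | p. p \<in> Ass R E}"


section \<open>Existence of graded free resolutions\<close>

lemma mod_homD:
  assumes "f \<in> mod_hom R F M"
  shows "x \<in> carrier F \<Longrightarrow> f x \<in> carrier M"
    and "x \<in> carrier F \<Longrightarrow> y \<in> carrier F \<Longrightarrow> f (x \<oplus>\<^bsub>F\<^esub> y) = f x \<oplus>\<^bsub>M\<^esub> f y"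
    and "a \<in> carrier R \<Longrightarrow> x \<in> carrier F \<Longrightarrow> f (a \<odot>\<^bsub>F\<^esub> x) = a \<odot>\<^bsub>M\<^esub> f x"
  using assms unfolding mod_hom_def hom_def by auto

lemma mod_hom_finsum:
  assumes "module R F" "module R M" "f \<in> mod_hom R F M" "finite A" "g \<in> A \<rightarrow> carrier F"
  shows "f (finsum F g A) = finsum M (\<lambda>i. f (g i)) A"
proof -
  interpret F: module R F by fact
  interpret M: module R M by fact
  note fD = mod_homD[OF assms(3)]
  have z: "f \<zero>\<^bsub>F\<^esub> = \<zero>\<^bsub>M\<^esub>"
    using fD(3)[of "\<zero>\<^bsub>R\<^esub>" "\<zero>\<^bsub>F\<^esub>"] fD(1)[of "\<zero>\<^bsub>F\<^esub>"] by simp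
  show ?thesis using assms(4,5)
  proof (induction A rule: finite_induct)
    case empty then show ?case using z by simp
  next
    case (insert x A)
    have "(\<lambda>i. f (g i)) \<in> insert x A \<rightarrow> carrier M" using insert.prems fD(1) by auto
    moreover have "finsum F g A \<in> carrier F" using insert.prems by (auto intro: F.M.finsum_closed)
    ultimately show ?case using insert fD(2) by (auto simp: Pi_iff)
  qed
qed

lemma (in module) submodule_finsum:
  assumes "submodule K R M" "finite A" "g \<in> A \<rightarrow> K"
  shows "finsum M g A \<in> K"
proof -
  note KE = submoduleE[OF assms(1)]
  show ?thesis using assms(2,3)
  proof (induction A rule: finite_induct)
    case empty
    obtain k where "k \<in> K" using KE(2) by auto
    then have "\<zero> \<odot>\<^bsub>M\<^esub> k \<in> K" using KE(4) by auto
    then show ?case using KE(1) \<open>k \<in> K\<close> by auto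
  next
    case (insert x A)
    have "g \<in> A \<rightarrow> carrier M" "g x \<in> carrier M" using insert.prems KE(1) by auto
    then show ?case using insert KE(5) by (auto simp: Pi_iff)
  qed
qed

lemma (in module) ideal_smult_carrier_submodule:
  assumes "A \<subseteq> carrier M"
  shows "submodule (ideal_smult M (carrier R) A) R M" "A \<subseteq> ideal_smult M (carrier R) A"
proof -
  let ?S = "{a \<odot>\<^bsub>M\<^esub> x |a x. a \<in> carrier R \<and> x \<in> A}"
  have S: "?S \<subseteq> carrier M" using assms by auto
  have sub: "subgroup (generate (add_monoid M) ?S) (add_monoid M)"
    using M.add.generate_is_subgroup[of ?S] S by simp
  have "a \<odot>\<^bsub>M\<^esub> x \<in> generate (add_monoid M) ?S"
    if "x \<in> generate (add_monoid M) ?S" and a: "a \<in> carrier R" for a x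
    using that(1)
  proof (induction rule: generate.induct)
    case one
    then show ?case using a generate.one[of "add_monoid M" ?S] by simp
  next
    case (incl h)
    then obtain b y where h: "h = b \<odot>\<^bsub>M\<^esub> y" "b \<in> carrier R" "y \<in> A" by auto
    then have "a \<odot>\<^bsub>M\<^esub> h = (a \<otimes> b) \<odot>\<^bsub>M\<^esub> y" using a assms smult_assoc1 by auto
    then show ?case using h a by (intro generate.incl) auto
  next
    case (inv h)
    then obtain b y where h: "h = b \<odot>\<^bsub>M\<^esub> y" "b \<in> carrier R" "y \<in> A" by auto
    then have hc: "h \<in> carrier M" using assms by auto
    have "a \<odot>\<^bsub>M\<^esub> (\<ominus>\<^bsub>M\<^esub> h) = (\<ominus>(a \<otimes> b)) \<odot>\<^bsub>M\<^esub> y"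
      using h a assms hc by (auto simp: smult_r_minus smult_l_minus smult_assoc1)
    moreover have "inv\<^bsub>add_monoid M\<^esub> h = \<ominus>\<^bsub>M\<^esub> h" by (simp add: a_inv_def)
    ultimately show ?case using h a by (auto intro!: generate.incl exI[of _ "\<ominus>(a \<otimes> b)"])
  next
    case (eng h1 h2)
    have "h1 \<in> carrier M" "h2 \<in> carrier M"
      using eng(1,2) subgroup.subset[OF sub] by auto
    then show ?case using eng a generate.eng[OF eng(3,4)] by (simp add: smult_r_distr)
  qed
  then show "submodule (ideal_smult M (carrier R) A) R M"
    unfolding ideal_smult_def using sub by (auto intro!: submodule.intro simp: submodule_axioms_def)
  show "A \<subseteq> ideal_smult M (carrier R) A"
    unfolding ideal_smult_def
    using assms by (auto intro!: generate.incl) (metis R.one_closed smult_one subsetD)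
qed

lemma (in module) ideal_smult_least:
  assumes "submodule K R M" "A \<subseteq> K"
  shows "ideal_smult M (carrier R) A \<subseteq> K"
  unfolding ideal_smult_def
  using M.add.generate_subgroup_incl[of "{a \<odot>\<^bsub>M\<^esub> x |a x. a \<in> carrier R \<and> x \<in> A}" K]
    submodule.axioms(1)[OF assms(1)] submoduleE(4)[OF assms(1)] assms(2)
  by auto

lemma kernel_submodule:
  assumes "module R F" "module R M" "f \<in> mod_hom R F M"
  shows "submodule (a_kernel F M f) R F"
proof -
  interpret F: module R F by fact
  interpret M: module R M by fact
  note fD = mod_homD[OF assms(3)]
  have z: "f \<zero>\<^bsub>F\<^esub> = \<zero>\<^bsub>M\<^esub>"
    using fD(3)[of "\<zero>\<^bsub>R\<^esub>" "\<zero>\<^bsub>F\<^esub>"] fD(1)[of "\<zero>\<^bsub>F\<^esub>"] by simp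
  have inv: "f (\<ominus>\<^bsub>F\<^esub> x) = \<ominus>\<^bsub>M\<^esub> f x" if "x \<in> carrier F" for x
  proof -
    have "\<ominus>\<^bsub>F\<^esub> x = (\<ominus>\<^bsub>R\<^esub> \<one>\<^bsub>R\<^esub>) \<odot>\<^bsub>F\<^esub> x" using that by (simp add: F.smult_l_minus)
    then show ?thesis using fD that by (simp add: M.smult_l_minus)
  qed
  show ?thesis
    by (rule F.submoduleI) (auto simp: a_kernel_def kernel_def z inv fD)
qed

text \<open>Submodules of \<open>M\<close> are finitely generated if finitely many linear forms separate points.\<close>

lemma (in module) submodule_fg:
  fixes p :: "nat \<Rightarrow> 'c \<Rightarrow> 'a" and n :: nat
  assumes "noetherian_ring R"
    and pc: "\<And>j x. j < n \<Longrightarrow> x \<in> carrier M \<Longrightarrow> p j x \<in> carrier R"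
    and padd: "\<And>j x y. j < n \<Longrightarrow> x \<in> carrier M \<Longrightarrow> y \<in> carrier M \<Longrightarrow> p j (x \<oplus>\<^bsub>M\<^esub> y) = p j x \<oplus> p j y"
    and psm: "\<And>j a x. j < n \<Longrightarrow> a \<in> carrier R \<Longrightarrow> x \<in> carrier M \<Longrightarrow> p j (a \<odot>\<^bsub>M\<^esub> x) = a \<otimes> p j x"
    and sep: "\<And>x. x \<in> carrier M \<Longrightarrow> (\<And>j. j < n \<Longrightarrow> p j x = \<zero>) \<Longrightarrow> x = \<zero>\<^bsub>M\<^esub>"
    and K: "submodule K R M"
  shows "\<exists>A. finite A \<and> A \<subseteq> K \<and> K = ideal_smult M (carrier R) A"
proof -
  interpret N: noetherian_ring R by fact
  have pinv: "p j (\<ominus>\<^bsub>M\<^esub> x) = \<ominus> p j x" if "j < n" "x \<in> carrier M" for j x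
  proof -
    have "\<ominus>\<^bsub>M\<^esub> x = (\<ominus> \<one>) \<odot>\<^bsub>M\<^esub> x" using that by (simp add: smult_l_minus)
    then show ?thesis using that pc psm by (simp add: R.l_minus)
  qed
  have pz: "p j \<zero>\<^bsub>M\<^esub> = \<zero>" if "j < n" for j
    using psm[OF that, of \<zero> "\<zero>\<^bsub>M\<^esub>"] pc[OF that, of "\<zero>\<^bsub>M\<^esub>"] by simp
  have "\<exists>A. finite A \<and> A \<subseteq> K \<and> K = ideal_smult M (carrier R) A"
    if "m \<le> n" "submodule K R M" "\<forall>x\<in>K. \<forall>j. m \<le> j \<and> j < n \<longrightarrow> p j x = \<zero>" for m K
    using that
  proof (induction m arbitrary: K)
    case 0
    note KE = submoduleE[OF 0(2)]
    have "K \<subseteq> {\<zero>\<^bsub>M\<^esub>}" using 0(3) sep KE(1) by auto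
    then have "K = {\<zero>\<^bsub>M\<^esub>}" using KE(2) by auto
    moreover have "ideal_smult M (carrier R) {\<zero>\<^bsub>M\<^esub>} = {\<zero>\<^bsub>M\<^esub>}"
      using ideal_smult_least[OF 0(2)] ideal_smult_carrier_submodule(2)[of "{\<zero>\<^bsub>M\<^esub>}"] calculation by auto
    ultimately show ?case by (intro exI[of _ "{\<zero>\<^bsub>M\<^esub>}"]) auto
  next
    case (Suc m)
    note KE = submoduleE[OF Suc.prems(2)]
    have mn: "m < n" using Suc.prems by auto
    have id: "ideal (p m ` K') R" if "submodule K' R M" for K'
    proof -
      note K'E = submoduleE[OF that]
      have sg: "subgroup (p m ` K') (add_monoid R)"
      proof (rule R.add.subgroupI)
        show "p m ` K' \<subseteq> carrier R" using K'E(1) pc[OF mn] by auto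
        show "p m ` K' \<noteq> {}" using K'E(2) by auto
        show "\<ominus> a \<in> p m ` K'" if "a \<in> p m ` K'" for a
        proof -
          from that obtain x where "x \<in> K'" "a = p m x" by blast
          then show ?thesis using pinv[OF mn, of x] subsetD[OF K'E(1), of x] K'E(3)[of x] by (auto intro!: image_eqI[of _ _ "\<ominus>\<^bsub>M\<^esub> x"])
        qed
        show "a \<oplus> b \<in> p m ` K'" if "a \<in> p m ` K'" "b \<in> p m ` K'" for a b
        proof -
          from that obtain x y where "x \<in> K'" "a = p m x" "y \<in> K'" "b = p m y" by blast
          then show ?thesis using padd[OF mn, of x y] subsetD[OF K'E(1), of x] subsetD[OF K'E(1), of y] K'E(5)[of x y]
            by (auto intro!: image_eqI[of _ _ "x \<oplus>\<^bsub>M\<^esub> y"])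
        qed
      qed
      have l: "a \<otimes> b \<in> p m ` K'" if "b \<in> p m ` K'" "a \<in> carrier R" for a b
      proof -
        from that obtain x where "x \<in> K'" "b = p m x" by blast
        then show ?thesis using that psm[OF mn, of a x] subsetD[OF K'E(1), of x] K'E(4)[of a x]
          by (auto intro!: image_eqI[of _ _ "a \<odot>\<^bsub>M\<^esub> x"])
      qed
      show ?thesis
      proof (rule idealI)
        show "ring R" by (rule R.ring_axioms)
        show "subgroup (p m ` K') (add_monoid R)" by (rule sg)
        show "a \<otimes> b \<in> p m ` K'" if "b \<in> p m ` K'" "a \<in> carrier R" for a b using l that .
        show "b \<otimes> a \<in> p m ` K'" if "b \<in> p m ` K'" "a \<in> carrier R" for a b
          using l[OF that] that(2) subsetD[OF subgroup.subset[OF sg] that(1)] R.m_comm[of a b] by simp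
      qed
    qed
    obtain B where B: "finite B" "B \<subseteq> carrier R" "p m ` K = Idl B"
      using N.finetely_gen[OF id[OF Suc.prems(2)]] by auto
    have "B \<subseteq> p m ` K" using B R.genideal_self by auto
    then obtain A1 where A1: "A1 \<subseteq> K" "finite A1" "p m ` A1 = B"
      using finite_subset_image[OF B(1)] by (metis)
    define K1 where "K1 = ideal_smult M (carrier R) A1"
    have A1c: "A1 \<subseteq> carrier M" using A1 KE(1) by auto
    have K1: "submodule K1 R M" "A1 \<subseteq> K1" "K1 \<subseteq> K"
      using ideal_smult_carrier_submodule[OF A1c] ideal_smult_least[OF Suc.prems(2) A1(1)]
      by (auto simp: K1_def)
    have sub: "p m ` K \<subseteq> p m ` K1"
      unfolding B(3) using A1(3) K1(2) by (intro R.genideal_minimal id K1(1)) auto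
    define K2 where "K2 = {x\<in>K. p m x = \<zero>}"
    have K2: "submodule K2 R M"
      using KE pz[OF mn] pinv[OF mn] padd[OF mn] psm[OF mn] submodule_finsum[OF Suc.prems(2), of "{}"]
      by (intro submoduleI) (auto simp: K2_def subset_iff)
    have "\<forall>x\<in>K2. \<forall>j. m \<le> j \<and> j < n \<longrightarrow> p j x = \<zero>"
      using Suc.prems(3) by (auto simp: K2_def) (metis le_antisym not_less_eq_eq)
    then obtain A2 where A2: "finite A2" "A2 \<subseteq> K2" "K2 = ideal_smult M (carrier R) A2"
      using Suc.IH[OF _ K2] mn by auto
    let ?A = "A1 \<union> A2"
    have AK: "?A \<subseteq> K" using A1 A2 by (auto simp: K2_def)
    have Ac: "?A \<subseteq> carrier M" using AK KE(1) by auto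
    note S = ideal_smult_carrier_submodule[OF Ac]
    note SE = submoduleE[OF S(1)]
    have "x \<in> ideal_smult M (carrier R) ?A" if x: "x \<in> K" for x
    proof -
      obtain w where w: "w \<in> K1" "p m x = p m w" using sub x by blast
      have c: "x \<in> carrier M" "w \<in> carrier M" "w \<in> K" using x w K1 KE(1) by auto
      have "p m (x \<oplus>\<^bsub>M\<^esub> \<ominus>\<^bsub>M\<^esub> w) = \<zero>"
        using c w padd[OF mn] pinv[OF mn] pc[OF mn] by (simp add: R.r_neg)
      then have "x \<oplus>\<^bsub>M\<^esub> \<ominus>\<^bsub>M\<^esub> w \<in> K2" using x c KE by (auto simp: K2_def)
      then have 1: "x \<oplus>\<^bsub>M\<^esub> \<ominus>\<^bsub>M\<^esub> w \<in> ideal_smult M (carrier R) ?A"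
        using A2(3) ideal_smult_least[OF S(1), of A2] S(2) by auto
      have 2: "w \<in> ideal_smult M (carrier R) ?A"
        using w(1) ideal_smult_least[OF S(1), of A1] S(2) by (auto simp: K1_def)
      have "x = (x \<oplus>\<^bsub>M\<^esub> \<ominus>\<^bsub>M\<^esub> w) \<oplus>\<^bsub>M\<^esub> w" using c by (simp add: M.a_assoc M.l_neg)
      then show ?thesis using SE(5)[OF 1 2] by simp
    qed
    then have "K = ideal_smult M (carrier R) ?A"
      using ideal_smult_least[OF Suc.prems(2) AK] by auto
    then show ?case using AK A1 A2 by (intro exI[of _ ?A]) auto
  qed
  from this[of n, OF _ K] show ?thesis by (meson leD order_refl)
qed


lemma gradingD:
  assumes "is_grading G C" "abelian_group G"
  shows "x \<in> C n \<Longrightarrow> x \<in> carrier G" "\<zero>\<^bsub>G\<^esub> \<in> C n"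
    "x \<in> C n \<Longrightarrow> y \<in> C n \<Longrightarrow> x \<oplus>\<^bsub>G\<^esub> y \<in> C n"
    "x \<in> C n \<Longrightarrow> \<ominus>\<^bsub>G\<^esub> x \<in> C n"
    "x \<in> carrier G \<Longrightarrow> \<exists>f. decomposes G C x f"
    "x \<in> carrier G \<Longrightarrow> decomposes G C x f \<Longrightarrow> decomposes G C x g \<Longrightarrow> f = g"
proof -
  have s: "subgroup (C n) (add_monoid G)" for n using assms(1) by (simp add: is_grading_def)
  show "x \<in> C n \<Longrightarrow> x \<in> carrier G" using subgroup.subset[OF s[of n]] by auto
  show "\<zero>\<^bsub>G\<^esub> \<in> C n" using subgroup.one_closed[OF s[of n]] by simp
  show "x \<in> C n \<Longrightarrow> y \<in> C n \<Longrightarrow> x \<oplus>\<^bsub>G\<^esub> y \<in> C n" using subgroup.m_closed[OF s[of n]] by simp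
  show "x \<in> C n \<Longrightarrow> \<ominus>\<^bsub>G\<^esub> x \<in> C n" using subgroup.m_inv_closed[OF s[of n]] by (simp add: a_inv_def)
  show "x \<in> carrier G \<Longrightarrow> \<exists>f. decomposes G C x f" using assms(1) unfolding is_grading_def by blast
  show "x \<in> carrier G \<Longrightarrow> decomposes G C x f \<Longrightarrow> decomposes G C x g \<Longrightarrow> f = g"
    using assms(1) unfolding is_grading_def by blast
qed

text \<open>The support in \<open>decomposes\<close> may be replaced by any finite set containing it.\<close>

lemma decomposes_sum:
  assumes "abelian_group G" "decomposes G C x f" "finite A" "{n. f n \<noteq> \<zero>\<^bsub>G\<^esub>} \<subseteq> A" "\<And>n. C n \<subseteq> carrier G"
  shows "x = finsum G f A"
proof -
  interpret abelian_group G by fact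
  have "finsum G f {n. f n \<noteq> \<zero>\<^bsub>G\<^esub>} = finsum G f A"
    using assms(2-5) by (intro add.finprod_mono_neutral_cong_left) (auto simp: decomposes_def)
  then show ?thesis using assms(2) by (simp add: decomposes_def)
qed

lemma decomposesI:
  assumes "abelian_group G" "\<And>n. f n \<in> C n" "finite A" "\<And>n. n \<notin> A \<Longrightarrow> f n = \<zero>\<^bsub>G\<^esub>"
    "x = finsum G f A" "\<And>n. C n \<subseteq> carrier G"
  shows "decomposes G C x f"
proof -
  interpret abelian_group G by fact
  have sub: "{n. f n \<noteq> \<zero>\<^bsub>G\<^esub>} \<subseteq> A" using assms(4) by auto
  have "finsum G f {n. f n \<noteq> \<zero>\<^bsub>G\<^esub>} = finsum G f A"
    using assms sub by (intro add.finprod_mono_neutral_cong_left) auto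
  then show ?thesis using assms sub finite_subset[OF sub] by (auto simp: decomposes_def)
qed

text \<open>Graded free modules\<close>

lemma graded_free_simps:
  "carrier (graded_free R as) = (\<Pi>\<^sub>E j\<in>{..<length as}. carrier R)"
  "\<zero>\<^bsub>graded_free R as\<^esub> = (\<lambda>j\<in>{..<length as}. \<zero>\<^bsub>R\<^esub>)"
  "v \<oplus>\<^bsub>graded_free R as\<^esub> w = (\<lambda>j\<in>{..<length as}. v j \<oplus>\<^bsub>R\<^esub> w j)"
  "a \<odot>\<^bsub>graded_free R as\<^esub> v = (\<lambda>j\<in>{..<length as}. a \<otimes>\<^bsub>R\<^esub> v j)"
  "mcomp (graded_free R as) n = (\<Pi>\<^sub>E j\<in>{..<length as}. rcomp R (n - as ! j))"
  by (simp_all add: graded_free_def)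

context nat_graded_ring
begin

lemma free_module: "module R (graded_free R as)"
proof (rule moduleI)
  show "cring R" by (rule cring_axioms)
  show "abelian_group (graded_free R as)"
  proof (rule abelian_groupI)
    fix x assume "x \<in> carrier (graded_free R as)"
    then show "\<exists>y\<in>carrier (graded_free R as). y \<oplus>\<^bsub>graded_free R as\<^esub> x = \<zero>\<^bsub>graded_free R as\<^esub>"
      by (intro bexI[of _ "\<lambda>j\<in>{..<length as}. \<ominus> x j"])
        (auto simp: graded_free_simps PiE_iff l_neg intro!: restrict_ext)
  qed (auto simp: graded_free_simps PiE_iff a_ac extensional_def fun_eq_iff)
qed (auto simp: graded_free_simps PiE_iff m_assoc l_distr r_distr extensional_def fun_eq_iff)

lemma finsum_free:
  assumes "finite A" "g \<in> A \<rightarrow> carrier (graded_free R as)" "j < length as"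
  shows "finsum (graded_free R as) g A j = (\<Oplus>n\<in>A. g n j)"
proof -
  interpret F: module R "graded_free R as" by (rule free_module)
  show ?thesis using assms
  proof (induction A rule: finite_induct)
    case empty then show ?case by (simp add: graded_free_simps)
  next
    case (insert x A)
    have "(\<lambda>n. g n j) \<in> insert x A \<rightarrow> carrier R" using insert.prems
      by (auto simp: graded_free_simps PiE_iff Pi_iff)
    moreover have "finsum (graded_free R as) g (insert x A) = g x \<oplus>\<^bsub>graded_free R as\<^esub> finsum (graded_free R as) g A"
      using insert by (intro F.M.finsum_insert) auto
    ultimately show ?case using insert by (simp add: graded_free_simps(3))
  qed
qed

lemma free_graded: "graded_module R (graded_free R as)"
proof -
  let ?F = "graded_free R as"
  interpret F: module R ?F by (rule free_module)
  note gD = gradingD[OF grading abelian_group_axioms]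
  have sg: "subgroup (mcomp ?F n) (add_monoid ?F)" for n
  proof (rule F.M.add.subgroupI)
    show "mcomp ?F n \<subseteq> carrier ?F" using gD(1) by (auto simp: graded_free_simps PiE_iff)
    have "\<zero>\<^bsub>?F\<^esub> \<in> mcomp ?F n" using gD(2) by (auto simp: graded_free_simps PiE_iff)
    then show "mcomp ?F n \<noteq> {}" by blast
    show "a \<oplus>\<^bsub>?F\<^esub> b \<in> mcomp ?F n" if "a \<in> mcomp ?F n" "b \<in> mcomp ?F n" for a b
      using that gD(3) by (auto simp: graded_free_simps PiE_iff)
    show "\<ominus>\<^bsub>?F\<^esub> a \<in> mcomp ?F n" if a: "a \<in> mcomp ?F n" for a
    proof -
      have ac: "a \<in> carrier ?F" using a gD(1) by (auto simp: graded_free_simps PiE_iff)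
      then have "\<ominus>\<^bsub>?F\<^esub> a = (\<ominus> \<one>) \<odot>\<^bsub>?F\<^esub> a" by (simp add: F.smult_l_minus)
      also have "\<dots> = (\<lambda>j\<in>{..<length as}. \<ominus> (a j))"
        using ac by (auto simp: graded_free_simps PiE_iff l_minus)
      finally show ?thesis using a gD(4) by (auto simp: graded_free_simps PiE_iff)
    qed
  qed
  have Fc: "mcomp ?F n \<subseteq> carrier ?F" for n using subgroup.subset[OF sg] by simp
  have comp: "decomposes R (rcomp R) (v j) (\<lambda>n. f (n + as ! j) j)"
    if f: "decomposes ?F (mcomp ?F) v f" and j: "j < length as" for v f j
  proof -
    let ?A = "{n. f n \<noteq> \<zero>\<^bsub>?F\<^esub>}"
    have fm: "f n \<in> mcomp ?F n" for n using f by (simp add: decomposes_def)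
    have fc: "f \<in> ?A \<rightarrow> carrier ?F" using fm Fc by blast
    have fcj: "f n j \<in> carrier R" for n
      using fm[of n] gD(1) j by (auto simp: graded_free_simps PiE_iff)
    have fin: "finite ?A" using f by (simp add: decomposes_def)
    have "v j = (\<Oplus>n\<in>?A. f n j)"
      using f finsum_free[OF fin fc j] by (simp add: decomposes_def)
    also have "\<dots> = (\<Oplus>n\<in>(\<lambda>n. n + as ! j) ` ((\<lambda>n. n - as ! j) ` ?A). f n j)"
      by (simp add: image_image)
    also have "\<dots> = (\<Oplus>n\<in>(\<lambda>n. n - as ! j) ` ?A. f (n + as ! j) j)"
      using fcj by (intro add.finprod_reindex) (auto simp: inj_on_def)
    finally have s: "v j = (\<Oplus>n\<in>(\<lambda>n. n - as ! j) ` ?A. f (n + as ! j) j)" .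
    show ?thesis
    proof (rule decomposesI[OF abelian_group_axioms _ _ _ s])
      show "f (n + as ! j) j \<in> rcomp R n" for n
        using fm[of "n + as ! j"] j by (force simp: graded_free_simps PiE_iff)
      show "finite ((\<lambda>n. n - as ! j) ` ?A)" using fin by simp
      show "f (n + as ! j) j = \<zero>" if "n \<notin> (\<lambda>n. n - as ! j) ` ?A" for n
      proof -
        have "f (n + as ! j) = \<zero>\<^bsub>?F\<^esub>" using that by (force simp: image_iff)
        then show ?thesis using j by (simp add: graded_free_simps)
      qed
      show "rcomp R n \<subseteq> carrier R" for n using gD(1) by auto
    qed
  qed
  have ex: "\<exists>f. decomposes ?F (mcomp ?F) v f" if v: "v \<in> carrier ?F" for v
  proof -
    have "\<forall>j<length as. \<exists>h. decomposes R (rcomp R) (v j) h"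
      using v gD(5) by (auto simp: graded_free_simps PiE_iff)
    then obtain h where h: "\<And>j. j < length as \<Longrightarrow> decomposes R (rcomp R) (v j) (h j)"
      by metis
    define f where "f n = (\<lambda>j\<in>{..<length as}. h j (n - as ! j))" for n
    define A where "A = (\<Union>j<length as. (\<lambda>n. n + as ! j) ` {n. h j n \<noteq> \<zero>})"
    have fin: "finite A" using h by (auto simp: A_def decomposes_def)
    have fm: "f n \<in> mcomp ?F n" for n using h by (auto simp: f_def graded_free_simps PiE_iff decomposes_def)
    have f0: "h j (n - as ! j) = \<zero>" if "n \<notin> A" "j < length as" for n j
    proof (rule ccontr)
      assume "h j (n - as ! j) \<noteq> \<zero>"
      then have "n \<in> (\<lambda>n. n + as ! j) ` {n. h j n \<noteq> \<zero>}" by (intro image_eqI[of _ _ "n - as ! j"]) auto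
      then show False using that by (auto simp: A_def)
    qed
    have hc: "h j n \<in> carrier R" if "j < length as" for j n
      using h[OF that] gD(1) by (auto simp: decomposes_def)
    have fc: "f \<in> A \<rightarrow> carrier ?F" using fm Fc by blast
    have "v = finsum ?F f A"
    proof (rule extensionalityI[of _ "{..<length as}"])
      show "v \<in> extensional {..<length as}" using v by (auto simp: graded_free_simps PiE_iff)
      have "finsum ?F f A \<in> carrier ?F" using fc by (rule F.M.finsum_closed)
      then show "finsum ?F f A \<in> extensional {..<length as}" by (auto simp: graded_free_simps PiE_iff)
      fix j assume "j \<in> {..<length as}"
      then have j: "j < length as" by simp
      let ?B = "(\<lambda>n. n - as ! j) ` A"
      have "v j = finsum R (h j) ?B"
      proof (rule decomposes_sum[OF abelian_group_axioms h[OF j]])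
        show "finite ?B" using fin by simp
        show "{n. h j n \<noteq> \<zero>} \<subseteq> ?B"
        proof
          fix n assume "n \<in> {n. h j n \<noteq> \<zero>}"
          then have "n + as ! j \<in> A" using f0[of "n + as ! j" j] j by auto
          then show "n \<in> ?B" by (intro image_eqI[of _ _ "n + as ! j"]) auto
        qed
        show "rcomp R n \<subseteq> carrier R" for n using gD(1) by auto
      qed
      also have "\<dots> = (\<Oplus>n\<in>A. h j (n - as ! j))"
        using hc[OF j] by (intro add.finprod_reindex) (auto simp: inj_on_def)
      also have "\<dots> = finsum ?F f A j"
        using finsum_free[OF fin fc j] j by (simp add: f_def)
      finally show "v j = finsum ?F f A j" .
    qed
    then have "decomposes ?F (mcomp ?F) v f"
      using fm fin f0 Fc by (intro decomposesI[OF F.M.abelian_group_axioms, where A = A])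
        (auto simp: f_def graded_free_simps(2) intro!: restrict_ext)
    then show ?thesis by blast
  qed
  have uniq: "f = g" if "decomposes ?F (mcomp ?F) v f" "decomposes ?F (mcomp ?F) v g" "v \<in> carrier ?F" for v f g
  proof
    fix n
    have fm: "f n \<in> mcomp ?F n" "g n \<in> mcomp ?F n" using that by (simp_all add: decomposes_def)
    show "f n = g n"
    proof (rule extensionalityI[of _ "{..<length as}"])
      show "f n \<in> extensional {..<length as}" "g n \<in> extensional {..<length as}"
        using fm by (auto simp: graded_free_simps PiE_iff)
      fix j assume "j \<in> {..<length as}"
      then have j: "j < length as" by simp
      have "v j \<in> carrier R" using that(3) j by (auto simp: graded_free_simps PiE_iff)
      from gD(6)[OF this comp[OF that(1) j] comp[OF that(2) j]]
      show "f n j = g n j" using fun_cong[of _ _ "n - as ! j"] by fastforce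
    qed
  qed
  show ?thesis
  proof (intro graded_module.intro F.module_axioms graded_module_axioms.intro)
    show "is_grading ?F (mcomp ?F)"
      unfolding is_grading_def using sg ex uniq by blast
    show "a \<odot>\<^bsub>?F\<^esub> x \<in> mcomp ?F (m + n)" if "a \<in> rcomp R m" "x \<in> mcomp ?F n" for m n a x
      using that mult_degree[of a m] by (auto simp: graded_free_simps PiE_iff add_diff_eq[symmetric])
  qed
qed

text \<open>A graded submodule that is finitely generated has homogeneous generators, and is thus the
  image of a homomorphism of degree \<open>0\<close> from a graded free module.\<close>

lemma free_cover:
  assumes G: "graded_module R G" and K: "graded_submodule R G K"
    and fg: "finite A" "A \<subseteq> K" "K = ideal_smult G (carrier R) A"
  shows "\<exists>as f. f \<in> mod_hom R (graded_free R as) G \<and> has_degree (graded_free R as) G f 0 \<and>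
           f ` carrier (graded_free R as) = K"
proof -
  interpret G: graded_module R G by fact
  note gD = gradingD[OF G.module_grading G.M.abelian_group_axioms]
  have Ks: "submodule K R G" using K by (simp add: graded_submodule_def)
  note KE = G.submoduleE[OF Ks]
  have "\<forall>x\<in>K. \<exists>f. decomposes G (\<lambda>n. K \<inter> mcomp G n) x f"
    using K by (simp add: graded_submodule_def homogeneous_subset_def)
  then obtain D where D: "\<And>x. x \<in> K \<Longrightarrow> decomposes G (\<lambda>n. K \<inter> mcomp G n) x (D x)"
    by metis
  define P where "P = (SIGMA x:A. {n. D x n \<noteq> \<zero>\<^bsub>G\<^esub>})"
  have finP: "finite P" unfolding P_def using fg D by (intro finite_SigmaI) (auto simp: decomposes_def)
  then obtain ps where ps: "set ps = P" using finite_list by blast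
  define as where "as = map snd ps"
  define gs where "gs = (\<lambda>j. case ps ! j of (x, n) \<Rightarrow> D x n)"
  let ?F = "graded_free R as" and ?n = "length ps"
  have len: "length as = ?n" by (simp add: as_def)
  have gj: "gs j \<in> K \<inter> mcomp G (as ! j)" if "j < ?n" for j
  proof -
    obtain x n where xn: "ps ! j = (x, n)" by (cases "ps ! j")
    then have "x \<in> A" using nth_mem[OF that] ps by (auto simp: P_def)
    then show ?thesis using D[of x] fg(2) xn that by (auto simp: gs_def as_def decomposes_def)
  qed
  then have gc: "gs j \<in> carrier G" if "j < ?n" for j using that KE(1) by auto
  define f where "f v = (\<Oplus>\<^bsub>G\<^esub>j\<in>{..<?n}. v j \<odot>\<^bsub>G\<^esub> gs j)" for v
  interpret F: module R ?F by (rule free_module)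
  have vc: "v j \<in> carrier R" if "v \<in> carrier ?F" "j < ?n" for v j
    using that len by (auto simp: graded_free_simps PiE_iff)
  have hom: "f \<in> mod_hom R ?F G"
    unfolding mod_hom_def hom_def
  proof (intro CollectI conjI ballI Pi_I)
    show "f x \<in> carrier (add_monoid G)" if "x \<in> carrier (add_monoid ?F)" for x
      using that vc gc by (auto simp: f_def intro!: G.M.finsum_closed)
    fix x assume x: "x \<in> carrier (add_monoid ?F)"
    { fix y assume y: "y \<in> carrier (add_monoid ?F)"
      have "f (x \<oplus>\<^bsub>?F\<^esub> y) = (\<Oplus>\<^bsub>G\<^esub>j\<in>{..<?n}. x j \<odot>\<^bsub>G\<^esub> gs j \<oplus>\<^bsub>G\<^esub> y j \<odot>\<^bsub>G\<^esub> gs j)"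
        unfolding f_def using x y vc gc
        by (intro G.M.finsum_cong') (auto simp: graded_free_simps(3) len G.smult_l_distr)
      also have "\<dots> = f x \<oplus>\<^bsub>G\<^esub> f y"
        unfolding f_def using x y vc gc by (intro G.M.finsum_addf) auto
      finally show "f (x \<otimes>\<^bsub>add_monoid ?F\<^esub> y) = f x \<otimes>\<^bsub>add_monoid G\<^esub> f y" by simp }
  next
    fix a x assume a: "a \<in> carrier R" and x: "x \<in> carrier ?F"
    have "f (a \<odot>\<^bsub>?F\<^esub> x) = (\<Oplus>\<^bsub>G\<^esub>j\<in>{..<?n}. a \<odot>\<^bsub>G\<^esub> (x j \<odot>\<^bsub>G\<^esub> gs j))"
      unfolding f_def using x a vc gc
      by (intro G.M.finsum_cong') (auto simp: graded_free_simps(4) len G.smult_assoc1)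
    also have "\<dots> = a \<odot>\<^bsub>G\<^esub> f x"
      unfolding f_def using x a vc gc by (intro G.finsum_smult_ldistr[symmetric]) auto
    finally show "f (a \<odot>\<^bsub>?F\<^esub> x) = a \<odot>\<^bsub>G\<^esub> f x" .
  qed
  have compsum: "finsum G g B \<in> mcomp G m" if "finite B" "g \<in> B \<rightarrow> mcomp G m" for g :: "nat \<Rightarrow> _" and B m
    using that
  proof (induction B rule: finite_induct)
    case empty then show ?case using gD(2) by simp
  next
    case (insert x B)
    have "g \<in> B \<rightarrow> carrier G" "g x \<in> carrier G" using insert.prems gD(1) by auto
    then show ?case using insert gD(3) by (auto simp: Pi_iff)
  qed
  have deg: "has_degree ?F G f 0"
    unfolding has_degree_def
  proof (intro allI subsetI, elim imageE)
    fix m w v assume w: "w = f v" and v: "v \<in> mcomp ?F m"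
    have "v j \<odot>\<^bsub>G\<^esub> gs j \<in> mcomp G m" if "j < ?n" for j
      using G.smult_degree[of "v j" "m - as ! j" "gs j" "as ! j"] v gj[OF that] that len
      by (auto simp: graded_free_simps PiE_iff)
    then show "w \<in> mcomp G (m + 0)" unfolding w f_def by (auto intro!: compsum)
  qed
  have imK: "f ` carrier ?F \<subseteq> K"
    using vc gj KE(4) by (auto simp: f_def intro!: G.submodule_finsum[OF Ks])
  note fD = mod_homD[OF hom]
  have gim: "gs i \<in> f ` carrier ?F" if i: "i < ?n" for i
  proof (rule image_eqI)
    let ?e = "\<lambda>j\<in>{..<length as}. if j = i then \<one> else \<zero>"
    show "?e \<in> carrier ?F" by (auto simp: graded_free_simps)
    have "f ?e = (\<Oplus>\<^bsub>G\<^esub>j\<in>{..<?n}. if i = j then gs j else \<zero>\<^bsub>G\<^esub>)"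
      unfolding f_def using gc by (intro G.M.finsum_cong') (auto simp: len)
    also have "\<dots> = gs i" using i gc by (intro G.M.finsum_singleton) auto
    finally show "gs i = f ?e" by simp
  qed
  have imS: "submodule (f ` carrier ?F) R G"
  proof (rule G.submoduleI)
    show "f ` carrier ?F \<subseteq> carrier G" using fD(1) by auto
    have "f (\<zero> \<odot>\<^bsub>?F\<^esub> \<zero>\<^bsub>?F\<^esub>) = \<zero>\<^bsub>G\<^esub>"
      using fD(1)[of "\<zero>\<^bsub>?F\<^esub>"] by (subst fD(3)) auto
    then show "\<zero>\<^bsub>G\<^esub> \<in> f ` carrier ?F" by (auto intro!: image_eqI[of _ _ "\<zero>\<^bsub>?F\<^esub>"])
    show sm: "a \<odot>\<^bsub>G\<^esub> x \<in> f ` carrier ?F" if "a \<in> carrier R" "x \<in> f ` carrier ?F" for a x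
      using that fD(3) by (auto intro!: image_eqI[of _ _ "a \<odot>\<^bsub>?F\<^esub> _"])
    show "\<ominus>\<^bsub>G\<^esub> x \<in> f ` carrier ?F" if "x \<in> f ` carrier ?F" for x
      using sm[of "\<ominus> \<one>" x] that fD(1) by (auto simp: G.smult_l_minus)
    show "x \<oplus>\<^bsub>G\<^esub> y \<in> f ` carrier ?F" if xy: "x \<in> f ` carrier ?F" "y \<in> f ` carrier ?F" for x y
    proof -
      from xy obtain v w where "v \<in> carrier ?F" "w \<in> carrier ?F" "x = f v" "y = f w" by blast
      then show ?thesis using fD(2)[of v w] by (intro image_eqI[of _ _ "v \<oplus>\<^bsub>?F\<^esub> w"]) auto
    qed
  qed
  have "A \<subseteq> f ` carrier ?F"
  proof
    fix x assume x: "x \<in> A"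
    then have dx: "decomposes G (\<lambda>n. K \<inter> mcomp G n) x (D x)" using D fg(2) by auto
    have "D x n \<in> f ` carrier ?F" if "D x n \<noteq> \<zero>\<^bsub>G\<^esub>" for n
    proof -
      have "(x, n) \<in> set ps" using x that ps by (auto simp: P_def)
      then obtain j where "j < ?n" "ps ! j = (x, n)" by (auto simp: in_set_conv_nth)
      then show ?thesis using gim[of j] by (simp add: gs_def)
    qed
    then show "x \<in> f ` carrier ?F"
      using dx by (auto simp: decomposes_def intro!: G.submodule_finsum[OF imS] elim!: ssubst)
  qed
  then have "K \<subseteq> f ` carrier ?F" using fg(3) G.ideal_smult_least[OF imS] by simp
  then show ?thesis using hom deg imK by blast
qed

lemma kernel_graded:
  assumes F: "graded_module R F" and G: "graded_module R G"
    and f: "f \<in> mod_hom R F G" "has_degree F G f 0"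
  shows "graded_submodule R F (a_kernel F G f)"
proof -
  interpret F: graded_module R F by fact
  interpret G: graded_module R G by fact
  note fD = mod_homD[OF f(1)]
  note gF = gradingD[OF F.module_grading F.M.abelian_group_axioms]
  note gG = gradingD[OF G.module_grading G.M.abelian_group_axioms]
  let ?K = "a_kernel F G f"
  have z: "f \<zero>\<^bsub>F\<^esub> = \<zero>\<^bsub>G\<^esub>"
    using fD(3)[of "\<zero>" "\<zero>\<^bsub>F\<^esub>"] fD(1)[of "\<zero>\<^bsub>F\<^esub>"] by simp
  have "\<exists>h. decomposes F (\<lambda>n. ?K \<inter> mcomp F n) x h" if x: "x \<in> ?K" for x
  proof -
    have xc: "x \<in> carrier F" and fx: "f x = \<zero>\<^bsub>G\<^esub>" using x by (auto simp: a_kernel_def kernel_def)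
    obtain h where h: "decomposes F (mcomp F) x h" using gF(5)[OF xc] by auto
    let ?A = "{n. h n \<noteq> \<zero>\<^bsub>F\<^esub>}"
    have hm: "h n \<in> mcomp F n" for n using h by (simp add: decomposes_def)
    have hc: "h n \<in> carrier F" for n using gF(1)[OF hm] .
    have fin: "finite ?A" using h by (simp add: decomposes_def)
    have "f x = (\<Oplus>\<^bsub>G\<^esub>n\<in>?A. f (h n))"
      using h mod_hom_finsum[OF F.module_axioms G.module_axioms f(1) fin, of h] hc
      by (auto simp: decomposes_def)
    then have 1: "decomposes G (mcomp G) \<zero>\<^bsub>G\<^esub> (\<lambda>n. f (h n))"
      using fx fin hm f(2) z gG(1)
      by (intro decomposesI[OF G.M.abelian_group_axioms, where A = ?A])
        (auto simp: has_degree_def image_subset_iff)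
    have 2: "decomposes G (mcomp G) \<zero>\<^bsub>G\<^esub> (\<lambda>n. \<zero>\<^bsub>G\<^esub>)"
      using gG(1,2) by (intro decomposesI[OF G.M.abelian_group_axioms, where A = "{}"]) auto
    have "f (h n) = \<zero>\<^bsub>G\<^esub>" for n
      using fun_cong[OF gG(6)[OF _ 1 2]] by simp
    then have "decomposes F (\<lambda>n. ?K \<inter> mcomp F n) x h"
      using h hc by (auto simp: decomposes_def a_kernel_def kernel_def)
    then show ?thesis by blast
  qed
  then show ?thesis
    using kernel_submodule[OF F.module_axioms G.module_axioms f(1)]
    by (auto simp: graded_submodule_def homogeneous_subset_def)
qed

lemma ex_graded_free_resolution:
  assumes "noetherian_ring R" and L: "graded_module R L" "finitely_generated R L"
  shows "\<exists>F. graded_free_resolution R L F"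
proof -
  interpret L: graded_module R L by (rule L(1))
  obtain A where A: "finite A" "A \<subseteq> carrier L" "carrier L = ideal_smult L (carrier R) A"
    using L(2) by (auto simp: finitely_generated_def)
  have "(\<lambda>n. carrier L \<inter> mcomp L n) = mcomp L"
    using gradingD(1)[OF L.module_grading L.M.abelian_group_axioms] by blast
  then have "graded_submodule R L (carrier L)"
    using L.carrier_is_submodule gradingD(5)[OF L.module_grading L.M.abelian_group_axioms]
    by (simp add: graded_submodule_def homogeneous_subset_def)
  from free_cover[OF L(1) this A] obtain bs \<epsilon> where \<epsilon>: "\<epsilon> \<in> mod_hom R (graded_free R bs) L"
    "has_degree (graded_free R bs) L \<epsilon> 0" "\<epsilon> ` carrier (graded_free R bs) = carrier L"
    by auto
  let ?P = "\<lambda>(as, bs, f). f \<in> mod_hom R (graded_free R bs) (graded_free R as) \<and>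
    has_degree (graded_free R bs) (graded_free R as) f 0"
  have cover: "\<exists>cs f. ?P (bs, cs, f) \<and> f ` carrier (graded_free R cs) = K"
    if K: "graded_submodule R (graded_free R bs) K" for bs K
  proof -
    interpret B: module R "graded_free R bs" by (rule free_module)
    have "\<exists>A. finite A \<and> A \<subseteq> K \<and> K = ideal_smult (graded_free R bs) (carrier R) A"
    proof (rule B.submodule_fg[where p = "\<lambda>j v. v j" and n = "length bs"])
      show "submodule K R (graded_free R bs)" using K by (simp add: graded_submodule_def)
      show "x = \<zero>\<^bsub>graded_free R bs\<^esub>"
        if "x \<in> carrier (graded_free R bs)" "\<And>j. j < length bs \<Longrightarrow> x j = \<zero>" for x
        using that by (auto simp: graded_free_simps PiE_iff extensional_def fun_eq_iff)
    qed (use assms(1) in \<open>auto simp: graded_free_simps PiE_iff\<close>)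
    then obtain A where "finite A" "A \<subseteq> K" "K = ideal_smult (graded_free R bs) (carrier R) A" by blast
    from free_cover[OF free_graded K this] show ?thesis by auto
  qed
  have ker: "graded_submodule R (graded_free R bs) (a_kernel (graded_free R bs) (graded_free R as) f)"
    if "?P (as, bs, f)" for as bs f
    using that kernel_graded[OF free_graded free_graded] by auto
  obtain cs f0 where f0: "?P (bs, cs, f0)"
    "f0 ` carrier (graded_free R cs) = a_kernel (graded_free R bs) L \<epsilon>"
    using cover[OF kernel_graded[OF free_graded L(1) \<epsilon>(1,2)]] by auto
  let ?Q = "\<lambda>(as, bs, f) (as', bs', f'). as' = bs \<and>
    f' ` carrier (graded_free R bs') = a_kernel (graded_free R bs) (graded_free R as) f"
  have "\<exists>s. \<forall>n. (?P (s n) \<and> (n = 0 \<longrightarrow> s n = (bs, cs, f0))) \<and> ?Q (s n) (s (Suc n))"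
  proof (rule dependent_nat_choice[where P = "\<lambda>n t. ?P t \<and> (n = 0 \<longrightarrow> t = (bs, cs, f0))" and Q = "\<lambda>n. ?Q"])
    show "\<exists>t. ?P t \<and> ((0::nat) = 0 \<longrightarrow> t = (bs, cs, f0))" using f0(1) by blast
  next
    fix t :: "int list \<times> int list \<times> ((nat \<Rightarrow> 'a) \<Rightarrow> nat \<Rightarrow> 'a)" and n :: nat
    assume "?P t \<and> (n = 0 \<longrightarrow> t = (bs, cs, f0))"
    then obtain as' bs' f' where t: "t = (as', bs', f')" "?P (as', bs', f')" by (cases t) auto
    from cover[OF ker[OF t(2)]] obtain cs' g where
      "?P (bs', cs', g)" "g ` carrier (graded_free R cs') = a_kernel (graded_free R bs') (graded_free R as') f'"
      by auto
    then show "\<exists>u. (?P u \<and> (Suc n = 0 \<longrightarrow> u = (bs, cs, f0))) \<and> ?Q t u"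
      by (intro exI[of _ "(bs', cs', g)"]) (auto simp: t(1))
  qed
  then obtain s where s': "\<forall>n. (?P (s n) \<and> (n = 0 \<longrightarrow> s n = (bs, cs, f0))) \<and> ?Q (s n) (s (Suc n))" ..
  have s: "?P (s n)" "s 0 = (bs, cs, f0)" "?Q (s n) (s (Suc n))" for n
    using spec[OF s', of n] spec[OF s', of 0] by argo+
  define F where "F = \<lparr>basis_degs = \<lambda>n. fst (s n), diff = \<lambda>n. snd (snd (s n)), aug = \<epsilon>\<rparr>"
  have nxt: "fst (snd (s n)) = basis_degs F (Suc n)" for n
    using s(3)[of n] by (simp add: F_def case_prod_beta)
  have F0: "basis_degs F 0 = bs" "diff F 0 = f0" "basis_degs F 1 = cs" "aug F = \<epsilon>"
    using s(2) nxt[of 0] by (simp_all add: F_def)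
  have P: "diff F n \<in> mod_hom R (res_term R F (Suc n)) (res_term R F n) \<and>
      has_degree (res_term R F (Suc n)) (res_term R F n) (diff F n) 0" for n
    using s(1)[of n] unfolding case_prod_beta nxt by (simp add: F_def)
  have Q: "diff F (Suc n) ` carrier (res_term R F (Suc (Suc n))) =
      a_kernel (res_term R F (Suc n)) (res_term R F n) (diff F n)" for n
    using s(3)[of n] unfolding case_prod_beta nxt by (simp add: F_def)
  have "graded_free_resolution R L F"
    unfolding graded_free_resolution_def F0 using \<epsilon> f0(2) P Q by auto
  then show ?thesis ..
qed

end

end

theory Submission
  imports Defs
begin

text \<open>Let \<open>C = Hom(F\<^sub>k, M)\<close> for a graded free resolution \<open>F\<close> of \<open>L\<close>, with cocycles \<open>Z\<close> and coboundaries \<open>B\<close>. As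
  the \<open>F\<^sub>i\<close> are free, \<open>H\<^sub>n = Z\<^sub>n / B\<^sub>n\<close> with \<open>Z\<^sub>n = {f. \<delta> f \<in> Hom(F\<^sub>k\<^sub>+\<^sub>1, I\<^sup>nN)}\<close> and \<open>B\<^sub>n = B + Hom(F\<^sub>k, I\<^sup>nN)\<close>. An
  associated prime that contains \<open>I\<close> is the annihilator modulo \<open>B\<^sub>n\<close> of a homogeneous element of
  \<open>V\<^sub>n = {f \<in> Z\<^sub>n. I f \<subseteq> B\<^sub>n}\<close>. Multiplication by \<open>y\<^sub>j\<close> maps \<open>V\<^sub>n\<close> to \<open>V\<^sub>n\<^sub>+\<^sub>1\<close>, and for these operators of bidegree
  \<open>(1, d\<^sub>j)\<close> the family \<open>V / B\<close> satisfies the ascending chain condition: \<open>\<delta>\<close> embeds \<open>V / (V \<inter> Z)\<close> into the modules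
  \<open>Hom(F\<^sub>k\<^sub>+\<^sub>1, I\<^sup>nN)\<close>, for which Hilbert's basis argument works since \<open>I\<^sup>n\<^sup>+\<^sup>1N = J I\<^sup>nN\<close> for large \<open>n\<close>; and since
  \<open>(0 :\<^sub>H I) = 0\<close>, multiplication by generators of \<open>I\<close> embeds \<open>(V \<inter> Z) / B\<close> into copies of \<open>(B + Hom(F\<^sub>k, I\<^sup>nN) \<inter> Z) / B\<close>.

  For a prime \<open>p\<close>, the elements of \<open>V\<^sub>n\<close> with annihilator \<open>p\<close> form a difference \<open>X\<^sub>n - T\<^sub>n\<close> of two subfamilies, and the
  least degree in such a difference is eventually infinite or affine with slope some \<open>d\<^sub>j\<close>, by induction on the number
  of operators. This is (1). Under the hypothesis of (2) all associated primes contain \<open>I\<close>, and only finitely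
  many primes occur, so that \<open>v(H\<^sub>n)\<close> is a minimum of finitely many such functions.\<close>

section \<open>Eventually affine minima\<close>

text \<open>The obstacle is that the sum of all \<open>H_n\<close> is in general not Noetherian for
  the operators \<open>y_j\<close>: every \<open>H_n\<close> contains an image of the one module
  \<open>H\<close>, and already \<open>M[t]\<close> is in general not finitely generated over the
  Rees algebra. In the exact sequence from \<open>H\<close> to \<open>H_n\<close> to
  \<open>Ext^(k+1)(L, I^n N)\<close> the last term is harmless. The first is tamed by restricting to
  classes killed by \<open>I\<close>: if the image in \<open>H_n\<close> of a class in
  \<open>H\<close> is killed by \<open>I\<close>, then every generator of \<open>I\<close> carries
  that class into the image of \<open>Ext^k(L, I^n N)\<close>, and \<open>(0 :_H I) = 0\<close> says
  that nothing gets lost on the way. All modules \<open>H_n\<close> are handled inside one cochain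
  module with values in \<open>M\<close>; a quotient is a pair of nested families there, so that no
  maps between different quotients are needed. A slope \<open>d_j\<close> arises when, for large
  \<open>n\<close>, the least degree is attained by powers of \<open>y_j\<close> times an element of
  fixed bidegree.\<close>

abbreviation affine_min :: "nat \<Rightarrow> int \<Rightarrow> (nat \<Rightarrow> int \<Rightarrow> bool) \<Rightarrow> nat \<Rightarrow> bool" where
  "affine_min a b D n \<equiv> D n (int a * int n + b) \<and> (\<forall>e. D n e \<longrightarrow> int a * int n + b \<le> e)"

text \<open>\<open>D n e\<close> is to be read as: degree \<open>e\<close> is attained at index
  \<open>n\<close>. The first alternative stands for an infinite minimum, which has no slope of its
  own; admitting it lets families without any element of the required kind take part in finite
  minima.\<close>

definition ev_affine_min :: "nat set \<Rightarrow> (nat \<Rightarrow> int \<Rightarrow> bool) \<Rightarrow> bool" where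
  "ev_affine_min S D \<longleftrightarrow> (\<forall>\<^sub>F n in sequentially. \<forall>e. \<not> D n e) \<or>
     (\<exists>a\<in>S. \<exists>b. \<forall>\<^sub>F n in sequentially. affine_min a b D n)"

lemma ev_affine_min_none: "\<forall>\<^sub>F n in sequentially. \<forall>e. \<not> D n e \<Longrightarrow> ev_affine_min S D"
  by (simp add: ev_affine_min_def)

lemma ev_affine_minI: "a \<in> S \<Longrightarrow> \<forall>\<^sub>F n in sequentially. affine_min a b D n \<Longrightarrow> ev_affine_min S D"
  unfolding ev_affine_min_def by blast

lemma ev_affine_min_cases:
  assumes "ev_affine_min S D"
  obtains (none) "\<forall>\<^sub>F n in sequentially. \<forall>e. \<not> D n e"
    | (affine) a b where "a \<in> S" "\<forall>\<^sub>F n in sequentially. affine_min a b D n"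
  using assms unfolding ev_affine_min_def by blast

lemma ev_affine_min_mono: "ev_affine_min S D \<Longrightarrow> S \<subseteq> S' \<Longrightarrow> ev_affine_min S' D"
  unfolding ev_affine_min_def by blast

lemma ev_affine_min_disj_none:
  assumes "\<forall>\<^sub>F n in sequentially. \<forall>e. \<not> D1 n e" "ev_affine_min S D2"
  shows "ev_affine_min S (\<lambda>n e. D1 n e \<or> D2 n e)"
  using assms(2)
proof (cases rule: ev_affine_min_cases)
  case none
  with assms(1) have "\<forall>\<^sub>F n in sequentially. \<forall>e. \<not> (D1 n e \<or> D2 n e)" by eventually_elim auto
  then show ?thesis by (rule ev_affine_min_none)
next
  case (affine a b)
  from affine(2) assms(1) have "\<forall>\<^sub>F n in sequentially. affine_min a b (\<lambda>n e. D1 n e \<or> D2 n e) n"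
    by eventually_elim auto
  with affine(1) show ?thesis by (rule ev_affine_minI)
qed

lemma ev_affine_min_disj_less:
  assumes "a \<in> S"
    and "\<forall>\<^sub>F n in sequentially. affine_min a b D1 n" "\<forall>\<^sub>F n in sequentially. affine_min a' b' D2 n"
    and "\<forall>\<^sub>F n in sequentially. int a * int n + b \<le> int a' * int n + b'"
  shows "ev_affine_min S (\<lambda>n e. D1 n e \<or> D2 n e)"
proof -
  have "\<forall>\<^sub>F n in sequentially. affine_min a b (\<lambda>n e. D1 n e \<or> D2 n e) n"
    using assms(2-4) by eventually_elim force
  with assms(1) show ?thesis by (rule ev_affine_minI)
qed

text \<open>As \<open>a' - a\<close> is at least 1, the gap grows by at least 1 with each index and
  has absorbed the difference of the intercepts once \<open>n\<close> reaches
  \<open>|b - b'|\<close>.\<close>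

lemma eventually_affine_le:
  assumes "(a :: nat) < a'"
  shows "\<forall>\<^sub>F n in sequentially. int a * int n + b \<le> int a' * int n + b'"
  using eventually_ge_at_top[of "nat \<bar>b - b'\<bar>"]
proof eventually_elim
  fix n assume n: "nat \<bar>b - b'\<bar> \<le> n"
  have "int n * (int a + 1) \<le> int n * int a'" using assms by (intro mult_left_mono) auto
  then show "int a * int n + b \<le> int a' * int n + b'"
    using n by (simp add: algebra_simps)
qed

text \<open>Of two affine functions one is eventually at most the other, so the minimum does not
  alternate between them and keeps a slope from \<open>S\<close>.\<close>

lemma ev_affine_min_disj:
  assumes "ev_affine_min S D1" "ev_affine_min S D2"
  shows "ev_affine_min S (\<lambda>n e. D1 n e \<or> D2 n e)"
  using assms(1)
proof (cases rule: ev_affine_min_cases)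
  case none
  then show ?thesis using assms(2) by (rule ev_affine_min_disj_none)
next
  case 1: (affine a b)
  show ?thesis using assms(2)
  proof (cases rule: ev_affine_min_cases)
    case none
    then show ?thesis using ev_affine_min_disj_none[OF none assms(1)] by (simp add: disj_commute)
  next
    case 2: (affine a' b')
    have "(\<forall>\<^sub>F n in sequentially. int a * int n + b \<le> int a' * int n + b') \<or>
        (\<forall>\<^sub>F n in sequentially. int a' * int n + b' \<le> int a * int n + b)"
    proof (cases "a = a'")
      case True then show ?thesis by (cases "b \<le> b'") auto
    next
      case False then show ?thesis
        using eventually_affine_le[of a a' b b'] eventually_affine_le[of a' a b' b] by (cases "a < a'") auto
    qed
    then show ?thesis
      using ev_affine_min_disj_less[OF 1(1,2) 2(2)] ev_affine_min_disj_less[OF 2(1,2) 1(2)]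
      by (auto simp: disj_commute)
  qed
qed

lemma ev_affine_min_Bex:
  assumes "finite F" "\<And>k. k \<in> F \<Longrightarrow> ev_affine_min S (D k)"
  shows "ev_affine_min S (\<lambda>n e. \<exists>k\<in>F. D k n e)"
  using assms
proof (induction F rule: finite_induct)
  case empty then show ?case by (simp add: ev_affine_min_def)
next
  case (insert k F)
  then show ?case using ev_affine_min_disj[of S "D k" "\<lambda>n e. \<exists>k\<in>F. D k n e"] by simp
qed

text \<open>Translation by the bidegree \<open>(k, s)\<close> changes only the intercept, to
  \<open>b - a k + s\<close>. The conjunct \<open>k \<le> n\<close> excludes the indices at which
  subtraction on \<open>nat\<close> is truncated.\<close>

lemma ev_affine_min_shift:
  assumes "ev_affine_min S D"
  shows "ev_affine_min S (\<lambda>n e. k \<le> n \<and> D (n - k) (e - s))"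
proof -
  have sh: "\<forall>\<^sub>F n in sequentially. k \<le> n \<and> P (n - k)" if "eventually P sequentially" for P
    using that unfolding eventually_sequentially by (metis add_leD2 le_diff_conv2)
  from assms show ?thesis
  proof (cases rule: ev_affine_min_cases)
    case none
    from sh[OF this] have "\<forall>\<^sub>F n in sequentially. \<forall>e. \<not> (k \<le> n \<and> D (n - k) (e - s))"
      by eventually_elim auto
    then show ?thesis by (rule ev_affine_min_none)
  next
    case (affine a b)
    from sh[OF affine(2)] have "\<forall>\<^sub>F n in sequentially.
        affine_min a (b - int a * int k + s) (\<lambda>n e. k \<le> n \<and> D (n - k) (e - s)) n"
      by eventually_elim (fastforce simp: of_nat_diff algebra_simps)
    with affine(1) show ?thesis by (rule ev_affine_minI)
  qed
qed

lemma int_set_has_min: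
  fixes P :: "int \<Rightarrow> bool"
  assumes "P z" "\<And>x. P x \<Longrightarrow> b \<le> x"
  shows "\<exists>m. P m \<and> (\<forall>x. P x \<longrightarrow> m \<le> x)"
proof -
  define m where "m = (LEAST t. P (b + int t))"
  have "P (b + int (nat (z - b)))" using assms(1) assms(2)[OF assms(1)] by simp
  then have 1: "P (b + int m)" unfolding m_def by (rule LeastI)
  have "b + int m \<le> x" if "P x" for x
  proof -
    have "P (b + int (nat (x - b)))" using that assms(2)[OF that] by simp
    then have "m \<le> nat (x - b)" unfolding m_def by (rule Least_le)
    then show ?thesis using assms(2)[OF that] by simp
  qed
  then show ?thesis using 1 by blast
qed

text \<open>Let \<open>m(i)\<close> be the least degree in \<open>D i\<close>. The new least degree
  at \<open>n\<close> is \<open>n d\<close> plus the minimum of the excesses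
  \<open>m(i) - i d\<close> over \<open>i \<le> n - K\<close>. If the excesses are bounded below,
  their minimum is attained at some fixed index, and the slope is \<open>d\<close>. Otherwise
  \<open>m\<close> has a slope \<open>a < d\<close>, and for large \<open>n\<close> the smallest
  exponent \<open>k = K\<close> wins, which keeps the slope \<open>a\<close>.\<close>

lemma ev_affine_min_ray:
  assumes bdd: "\<And>n e. D n e \<Longrightarrow> e0 \<le> e" and D: "ev_affine_min S D"
  shows "ev_affine_min (insert d S) (\<lambda>n e. \<exists>k\<ge>K. k \<le> n \<and> D (n - k) (e - int k * int d))"
    (is "ev_affine_min _ ?E")
proof (cases "\<exists>n e. D n e")
  case False
  then show ?thesis by (simp add: ev_affine_min_def)
next
  case True
  show ?thesis
  proof (cases "\<exists>B. \<forall>n e. D n e \<longrightarrow> B \<le> e - int n * int d")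
    case True
    then obtain B where B: "\<And>n e. D n e \<Longrightarrow> B \<le> e - int n * int d" by blast
    let ?P = "\<lambda>x. \<exists>n e. D n e \<and> x = e - int n * int d"
    obtain n0 e' where "D n0 e'" using \<open>\<exists>n e. D n e\<close> by blast
    then have "?P (e' - int n0 * int d)" by blast
    from int_set_has_min[of ?P, OF this, of B] B
    obtain m where m: "?P m" "\<forall>x. ?P x \<longrightarrow> m \<le> x" by metis
    then have least: "m \<le> e - int n * int d" if "D n e" for n e using that by blast
    from m(1) obtain n1 e1 where ne: "D n1 e1" "m = e1 - int n1 * int d" by blast
    have "\<forall>\<^sub>F n in sequentially. ?E n (int d * int n + m) \<and> (\<forall>e. ?E n e \<longrightarrow> int d * int n + m \<le> e)"
      using eventually_ge_at_top[of "n1 + K"]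
    proof eventually_elim
      fix n assume n: "n1 + K \<le> n"
      have 1: "?E n (int d * int n + m)"
      proof (intro exI[of _ "n - n1"] conjI)
        have "int d * int n + m - int (n - n1) * int d = e1" "n - (n - n1) = n1"
          using ne n by (auto simp: of_nat_diff algebra_simps)
        then show "D (n - (n - n1)) (int d * int n + m - int (n - n1) * int d)"
          using ne(1) by (simp only:)
      qed (use n in auto)
      have "int d * int n + m \<le> e" if "?E n e" for e
      proof -
        from that obtain k where k: "k \<le> n" "D (n - k) (e - int k * int d)" by blast
        from least[OF k(2)] k(1) show ?thesis by (simp add: of_nat_diff algebra_simps)
      qed
      with 1 show "?E n (int d * int n + m) \<and> (\<forall>e. ?E n e \<longrightarrow> int d * int n + m \<le> e)" by blast
    qed
    then show ?thesis unfolding ev_affine_min_def by blast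
  next
    case False
    \<comment> \<open>The bound \<open>e0\<close> on degrees shows that only arbitrarily large
      indices can make the excess unbounded below.\<close>
    have small: "\<exists>B. \<forall>n e. n < j \<longrightarrow> D n e \<longrightarrow> B \<le> e - int n * int d" for j
    proof (intro exI allI impI)
      fix n e assume "n < j" "D n e"
      have "int n * int d \<le> int j * int d" using \<open>n < j\<close> by (intro mult_right_mono) auto
      then show "e0 - int j * int d \<le> e - int n * int d" using bdd[OF \<open>D n e\<close>] by simp
    qed
    have nempty: "\<not> (\<forall>\<^sub>F n in sequentially. \<forall>e. \<not> D n e)"
    proof
      assume "\<forall>\<^sub>F n in sequentially. \<forall>e. \<not> D n e"
      then obtain j where "\<And>n e. D n e \<Longrightarrow> n < j" unfolding eventually_sequentially by (metis not_less)
      with small[of j] False show False by metis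
    qed
    then obtain a b where a: "a \<in> S"
      and "\<forall>\<^sub>F n in sequentially. D n (int a * int n + b) \<and> (\<forall>e. D n e \<longrightarrow> int a * int n + b \<le> e)"
      using D unfolding ev_affine_min_def by blast
    then obtain j where j: "\<And>n. n \<ge> j \<Longrightarrow> D n (int a * int n + b)"
      "\<And>n e. n \<ge> j \<Longrightarrow> D n e \<Longrightarrow> int a * int n + b \<le> e"
      unfolding eventually_sequentially by blast
    \<comment> \<open>If the eventual slope were at least \<open>d\<close>, the excess would be
      bounded below by \<open>b\<close> from index \<open>j\<close> on, and by \<open>small\<close>
      before it.\<close>
    have ad: "a < d"
    proof (rule ccontr)
      assume "\<not> a < d"
      obtain B where B: "\<forall>n e. n < j \<longrightarrow> D n e \<longrightarrow> B \<le> e - int n * int d" using small by blast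
      have "min B b \<le> e - int n * int d" if "D n e" for n e
      proof (cases "n < j")
        case True then show ?thesis using B that by fastforce
      next
        case n: False
        have "int n * int d \<le> int n * int a" using \<open>\<not> a < d\<close> by (intro mult_left_mono) auto
        then show ?thesis using j(2)[of n e] n that by (simp add: algebra_simps)
      qed
      with False show False by blast
    qed
    \<comment> \<open>The intercept for \<open>k = K\<close>: the value
      \<open>a (n - K) + b\<close>, raised by \<open>K d\<close>.\<close>
    define b' where "b' = b - int a * int K + int K * int d"
    have "\<forall>\<^sub>F n in sequentially. ?E n (int a * int n + b') \<and> (\<forall>e. ?E n e \<longrightarrow> int a * int n + b' \<le> e)"
      \<comment> \<open>The last summand disposes of the \<open>k\<close> with
        \<open>n - k < j\<close>, where no formula for \<open>D\<close> is available: there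
        \<open>e\<close> is at least \<open>e0 + (n - j) d\<close>, hence at least
        \<open>e0 - j d + n (a + 1)\<close>, and this exceeds \<open>a n + b'\<close> as soon as
        \<open>n\<close> is at least \<open>b' - e0 + j d\<close>.\<close>
      using eventually_ge_at_top[of "j + K + nat \<bar>b' - e0 + int j * int d\<bar>"]
    proof eventually_elim
      fix n assume n: "j + K + nat \<bar>b' - e0 + int j * int d\<bar> \<le> n"
      have 1: "?E n (int a * int n + b')"
      proof (intro exI[of _ K] conjI)
        have "int a * int n + b' - int K * int d = int a * int (n - K) + b"
          using n by (simp add: b'_def of_nat_diff algebra_simps)
        then show "D (n - K) (int a * int n + b' - int K * int d)" using j(1)[of "n - K"] n by simp
      qed (use n in auto)
      have "int a * int n + b' \<le> e" if "?E n e" for e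
      proof -
        from that obtain k where k: "K \<le> k" "k \<le> n" "D (n - k) (e - int k * int d)" by blast
        show ?thesis
        proof (cases "j \<le> n - k")
          case True
          have "int a * int (n - k) + b \<le> e - int k * int d" using j(2)[OF True k(3)] .
          moreover have "(int k - int K) * int a \<le> (int k - int K) * int d"
            using k ad by (intro mult_left_mono) auto
          ultimately show ?thesis using k by (simp add: b'_def of_nat_diff algebra_simps)
        next
          case False
          have "e0 + int k * int d \<le> e" using bdd[OF k(3)] by simp
          moreover have "(int n - int j) * int d \<le> int k * int d"
            using False k by (intro mult_right_mono) auto
          moreover have "int n * (int a + 1) \<le> int n * int d" using ad by (intro mult_left_mono) auto
          ultimately show ?thesis using n by (simp add: algebra_simps)
        qed
      qed
      with 1 show "?E n (int a * int n + b') \<and> (\<forall>e. ?E n e \<longrightarrow> int a * int n + b' \<le> e)" by blast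
    qed
    then show ?thesis unfolding ev_affine_min_def using a by blast
  qed
qed

section \<open>Bigraded families with the ascending chain condition\<close>

text \<open>The component of bidegree \<open>(n, e)\<close> is the subgroup \<open>E n e\<close> of one fixed module; a pair \<open>(t, d)\<close> in \<open>Y\<close>
  is an operator of bidegree \<open>(1, d)\<close>. Such families stand in for bigraded modules over the Rees algebra.\<close>

definition bigraded_family ::
  "'a graded_ring \<Rightarrow> ('a, 'b, 'z) module_scheme \<Rightarrow> ('a \<times> nat) set \<Rightarrow> (nat \<Rightarrow> int \<Rightarrow> 'b set) \<Rightarrow> bool" where
  "bigraded_family R G Y E \<longleftrightarrow>
     (\<forall>n e. subgroup (E n e) (add_monoid G)) \<and>
     (\<forall>n e i. \<forall>r\<in>rcomp R i. \<forall>x\<in>E n e. r \<odot>\<^bsub>G\<^esub> x \<in> E n (e + i)) \<and>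
     (\<forall>(t, d)\<in>Y. \<forall>n e. \<forall>x\<in>E n e. t \<odot>\<^bsub>G\<^esub> x \<in> E (Suc n) (e + int d))"

text \<open>The ascending chain condition for the quotient of \<open>E\<close> by \<open>Z\<close>,
  expressed by families between the two. Fewer operators admit more chains, so the condition becomes
  stronger when \<open>Y\<close> shrinks; an induction that removes an operator therefore has to
  enlarge \<open>Z\<close> at the same time.\<close>

definition noetherian_between ::
  "'a graded_ring \<Rightarrow> ('a, 'b, 'z) module_scheme \<Rightarrow> ('a \<times> nat) set \<Rightarrow>
     (nat \<Rightarrow> int \<Rightarrow> 'b set) \<Rightarrow> (nat \<Rightarrow> int \<Rightarrow> 'b set) \<Rightarrow> bool" where
  "noetherian_between R G Y Z E \<longleftrightarrow>
     (\<forall>A :: nat \<Rightarrow> nat \<Rightarrow> int \<Rightarrow> 'b set.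
        mono A \<and> (\<forall>i. bigraded_family R G Y (A i) \<and> Z \<le> A i \<and> A i \<le> E) \<longrightarrow>
        (\<exists>N. \<forall>i\<ge>N. A i = A N))"

text \<open>The diagonal is constant from some \<open>K\<close> on. If \<open>i\<close> and
  \<open>j\<close> are both at least \<open>K\<close>, then \<open>F i j\<close> is squeezed between
  \<open>F K K\<close> and a later diagonal entry. The finitely many columns \<open>j < K\<close>
  are chains of their own, and the maximum of their bounds and \<open>K\<close> serves all
  columns.\<close>

lemma double_chain_stabilises:
  fixes F :: "nat \<Rightarrow> nat \<Rightarrow> 'x::order"
  assumes mono: "\<And>i i' j j'. i \<le> i' \<Longrightarrow> j \<le> j' \<Longrightarrow> F i j \<le> F i' j'"
    and acc: "\<And>A :: nat \<Rightarrow> 'x. mono A \<Longrightarrow> (\<And>k. \<exists>i j. A k = F i j) \<Longrightarrow> \<exists>N. \<forall>k\<ge>N. A k = A N"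
  shows "\<exists>N. \<forall>i\<ge>N. \<forall>j. F i j = F N j"
proof -
  have "\<exists>N. \<forall>k\<ge>N. F k k = F N N"
    using acc[of "\<lambda>k. F k k"] mono by (auto simp: mono_def)
  then obtain K where K: "\<And>k. k \<ge> K \<Longrightarrow> F k k = F K K" by blast
  have "\<forall>j. \<exists>N. \<forall>k\<ge>N. F k j = F N j"
    using acc[of "\<lambda>k. F k _"] mono by (auto simp: mono_def)
  then obtain Nj where Nj: "\<And>j k. k \<ge> Nj j \<Longrightarrow> F k j = F (Nj j) j" by metis
  define N where "N = Max (insert K (Nj ` {..<K}))"
  have NK: "K \<le> N" and NN: "\<And>j. j < K \<Longrightarrow> Nj j \<le> N" by (auto simp: N_def)
  have "F i j = F N j" if i: "i \<ge> N" for i j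
  proof (cases "j < K")
    case True
    then show ?thesis using Nj[of j i] Nj[of j N] NN[OF True] i by simp
  next
    case False
    have "F i j = F K K" if "i \<ge> K" for i
    proof (rule antisym)
      show "F i j \<le> F K K" using mono[of i "max i j" j "max i j"] K[of "max i j"] that by simp
      show "F K K \<le> F i j" using mono[of K i K j] that False by simp
    qed
    then show ?thesis using NK i by simp
  qed
  then show ?thesis by blast
qed

lemmas (in nat_graded_ring) R_gradingD = gradingD[OF grading abelian_group_axioms]

locale module_over_graded = nat_graded_ring R + module R G
  for R :: "'a graded_ring" (structure) and G :: "('a, 'b, 'z) module_scheme" (structure)
begin

abbreviation fam where "fam \<equiv> bigraded_family R G"
abbreviation noeth where "noeth \<equiv> noetherian_between R G"

lemma rcomp_carrier: "r \<in> rcomp R i \<Longrightarrow> r \<in> carrier R"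
  using R_gradingD(1) .

lemma smult_r_diff:
  "a \<in> carrier R \<Longrightarrow> x \<in> carrier G \<Longrightarrow> z \<in> carrier G \<Longrightarrow> a \<odot>\<^bsub>G\<^esub> (x \<ominus>\<^bsub>G\<^esub> z) = a \<odot>\<^bsub>G\<^esub> x \<ominus>\<^bsub>G\<^esub> a \<odot>\<^bsub>G\<^esub> z"
  by (simp add: a_minus_def smult_r_distr smult_r_minus)

lemma add_subgroupD:
  assumes "subgroup S (add_monoid G)"
  shows "x \<in> S \<Longrightarrow> x \<in> carrier G" "\<zero>\<^bsub>G\<^esub> \<in> S"
    "x \<in> S \<Longrightarrow> z \<in> S \<Longrightarrow> x \<oplus>\<^bsub>G\<^esub> z \<in> S" "x \<in> S \<Longrightarrow> z \<in> S \<Longrightarrow> x \<ominus>\<^bsub>G\<^esub> z \<in> S"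
proof -
  have add: "x \<in> S \<Longrightarrow> z \<in> S \<Longrightarrow> x \<oplus>\<^bsub>G\<^esub> z \<in> S" for x z
    using subgroup.m_closed[OF assms] by auto
  then show "x \<in> S \<Longrightarrow> z \<in> S \<Longrightarrow> x \<oplus>\<^bsub>G\<^esub> z \<in> S" .
  show "x \<in> S \<Longrightarrow> x \<in> carrier G" "\<zero>\<^bsub>G\<^esub> \<in> S"
    using subgroup.subset[OF assms] subgroup.one_closed[OF assms] by auto
  show "x \<in> S \<Longrightarrow> z \<in> S \<Longrightarrow> x \<ominus>\<^bsub>G\<^esub> z \<in> S"
    using add subgroup.m_inv_closed[OF assms, of z] by (simp add: a_minus_def a_inv_def)
qed

lemma famD:
  assumes "fam Y E"
  shows "subgroup (E n e) (add_monoid G)"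
    "r \<in> rcomp R i \<Longrightarrow> x \<in> E n e \<Longrightarrow> r \<odot>\<^bsub>G\<^esub> x \<in> E n (e + i)"
    "(t, d) \<in> Y \<Longrightarrow> x \<in> E n e \<Longrightarrow> t \<odot>\<^bsub>G\<^esub> x \<in> E (Suc n) (e + int d)"
    "x \<in> E n e \<Longrightarrow> x \<in> carrier G" "\<zero>\<^bsub>G\<^esub> \<in> E n e"
    "x \<in> E n e \<Longrightarrow> z \<in> E n e \<Longrightarrow> x \<oplus>\<^bsub>G\<^esub> z \<in> E n e"
    "x \<in> E n e \<Longrightarrow> z \<in> E n e \<Longrightarrow> x \<ominus>\<^bsub>G\<^esub> z \<in> E n e"
proof -
  show s: "subgroup (E n e) (add_monoid G)"
    "r \<in> rcomp R i \<Longrightarrow> x \<in> E n e \<Longrightarrow> r \<odot>\<^bsub>G\<^esub> x \<in> E n (e + i)"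
    "(t, d) \<in> Y \<Longrightarrow> x \<in> E n e \<Longrightarrow> t \<odot>\<^bsub>G\<^esub> x \<in> E (Suc n) (e + int d)"
    using assms by (auto simp: bigraded_family_def)
  from add_subgroupD[OF s(1)] show
    "x \<in> E n e \<Longrightarrow> x \<in> carrier G" "\<zero>\<^bsub>G\<^esub> \<in> E n e"
    "x \<in> E n e \<Longrightarrow> z \<in> E n e \<Longrightarrow> x \<oplus>\<^bsub>G\<^esub> z \<in> E n e"
    "x \<in> E n e \<Longrightarrow> z \<in> E n e \<Longrightarrow> x \<ominus>\<^bsub>G\<^esub> z \<in> E n e" by blast+
qed

lemma famI:
  assumes car: "\<And>n e x. x \<in> E n e \<Longrightarrow> x \<in> carrier G" and zero: "\<And>n e. \<zero>\<^bsub>G\<^esub> \<in> E n e"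
    and add: "\<And>n e x z. x \<in> E n e \<Longrightarrow> z \<in> E n e \<Longrightarrow> x \<oplus>\<^bsub>G\<^esub> z \<in> E n e"
    and smult: "\<And>n e i r x. r \<in> rcomp R i \<Longrightarrow> x \<in> E n e \<Longrightarrow> r \<odot>\<^bsub>G\<^esub> x \<in> E n (e + i)"
    and ops: "\<And>n e t d x. (t, d) \<in> Y \<Longrightarrow> x \<in> E n e \<Longrightarrow> t \<odot>\<^bsub>G\<^esub> x \<in> E (Suc n) (e + int d)"
  shows "fam Y E"
proof -
  have "subgroup (E n e) (add_monoid G)" for n e
  proof (rule M.add.subgroupI)
    show "E n e \<subseteq> carrier G" "E n e \<noteq> {}" using car zero by blast+
    show "x \<oplus>\<^bsub>G\<^esub> z \<in> E n e" if "x \<in> E n e" "z \<in> E n e" for x z using add that .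
    show "\<ominus>\<^bsub>G\<^esub> x \<in> E n e" if x: "x \<in> E n e" for x
    proof -
      \<comment> \<open>Negatives arise from multiplication by an element of degree 0, which does
        not move the bidegree.\<close>
      have "\<ominus> \<one> \<in> rcomp R 0"
        using R_gradingD(4)[OF one_degree] .
      from smult[OF this x] show ?thesis using car[OF x] by (simp add: smult_l_minus)
    qed
  qed
  then show ?thesis using smult ops by (auto simp: bigraded_family_def)
qed

lemma fam_subset: "fam Y E \<Longrightarrow> Y' \<subseteq> Y \<Longrightarrow> fam Y' E"
  unfolding bigraded_family_def by (meson subsetD)

lemma fam_pow:
  assumes "fam Y E" "(t, d) \<in> Y" "t \<in> carrier R" "x \<in> E n e"
  shows "(t [^] j) \<odot>\<^bsub>G\<^esub> x \<in> E (n + j) (e + int j * int d)"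
proof (induction j)
  case 0 then show ?case using assms famD(4)[OF assms(1,4)] by simp
next
  case (Suc j)
  have "(t [^] Suc j) \<odot>\<^bsub>G\<^esub> x = t \<odot>\<^bsub>G\<^esub> ((t [^] j) \<odot>\<^bsub>G\<^esub> x)"
    using assms(3) famD(4)[OF assms(1,4)] by (simp add: smult_assoc1[symmetric] m_comm)
  then show ?case using famD(3)[OF assms(1,2) Suc] by (simp add: algebra_simps)
qed

lemma noethD:
  fixes A :: "nat \<Rightarrow> nat \<Rightarrow> int \<Rightarrow> 'b set"
  assumes "noeth Y Z E" "mono A" "\<And>i. fam Y (A i)" "\<And>i. Z \<le> A i" "\<And>i. A i \<le> E"
  shows "\<exists>N. \<forall>i\<ge>N. A i = A N"
  using assms unfolding noetherian_between_def by blast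

lemma noethI:
  assumes "\<And>A :: nat \<Rightarrow> nat \<Rightarrow> int \<Rightarrow> 'b set. mono A \<Longrightarrow> (\<And>i. fam Y (A i)) \<Longrightarrow> (\<And>i. Z \<le> A i) \<Longrightarrow> (\<And>i. A i \<le> E) \<Longrightarrow> \<exists>N. \<forall>i\<ge>N. A i = A N"
  shows "noeth Y Z E"
  unfolding noetherian_between_def
proof (intro allI impI, elim conjE)
  fix A :: "nat \<Rightarrow> nat \<Rightarrow> int \<Rightarrow> 'b set" assume "mono A" "\<forall>i. fam Y (A i) \<and> Z \<le> A i \<and> A i \<le> E"
  then show "\<exists>N. \<forall>i\<ge>N. A i = A N" by (intro assms) auto
qed

lemma noeth_mono:
  assumes "noeth Y Z E" "Z \<le> Z'" "E' \<le> E"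
  shows "noeth Y Z' E'"
proof (rule noethI)
  fix A :: "nat \<Rightarrow> nat \<Rightarrow> int \<Rightarrow> 'b set" assume A: "mono A" "\<And>i. fam Y (A i)" "\<And>i. Z' \<le> A i" "\<And>i. A i \<le> E'"
  show "\<exists>N. \<forall>i\<ge>N. A i = A N"
    using A(3,4) by (intro noethD[OF assms(1) A(1,2)] order_trans[OF assms(2)] order_trans[OF _ assms(3)])
qed

lemma le_famI: "(\<And>n e x. x \<in> A n e \<Longrightarrow> x \<in> B n e) \<Longrightarrow> A \<le> (B :: nat \<Rightarrow> int \<Rightarrow> 'b set)"
  by (auto simp: le_fun_def)

lemma le_famD: "A \<le> (B :: nat \<Rightarrow> int \<Rightarrow> 'b set) \<Longrightarrow> x \<in> A n e \<Longrightarrow> x \<in> B n e"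
  by (auto simp: le_fun_def)

section \<open>Multiples, sums and leading families\<close>

definition mult_image :: "'a \<Rightarrow> nat \<Rightarrow> (nat \<Rightarrow> int \<Rightarrow> 'b set) \<Rightarrow> nat \<Rightarrow> int \<Rightarrow> 'b set" where
  "mult_image t d E n e = (case n of 0 \<Rightarrow> {\<zero>\<^bsub>G\<^esub>} | Suc n' \<Rightarrow> (\<lambda>g. t \<odot>\<^bsub>G\<^esub> g) ` E n' (e - int d))"

definition fam_plus :: "(nat \<Rightarrow> int \<Rightarrow> 'b set) \<Rightarrow> (nat \<Rightarrow> int \<Rightarrow> 'b set) \<Rightarrow> nat \<Rightarrow> int \<Rightarrow> 'b set" where
  "fam_plus A B n e = {x \<oplus>\<^bsub>G\<^esub> z |x z. x \<in> A n e \<and> z \<in> B n e}"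

lemma mult_image_subset:
  assumes "fam Y E" "(t, d) \<in> Y" shows "mult_image t d E \<le> E"
proof (rule le_famI)
  fix n e x assume "x \<in> mult_image t d E n e"
  then show "x \<in> E n e" using famD(5)[OF assms(1)] famD(3)[OF assms, of _ _ "e - int d"]
    by (auto simp: mult_image_def split: nat.splits)
qed

lemma fam_mult_image:
  assumes E: "fam Y E" and t: "t \<in> carrier R" and Y: "Y \<subseteq> carrier R \<times> UNIV"
  shows "fam Y (mult_image t d E)"
proof (rule famI)
  note D = famD[OF E]
  show "x \<in> carrier G" if "x \<in> mult_image t d E n e" for n e x
    using that t D(4) by (auto simp: mult_image_def split: nat.splits)
  show z: "\<zero>\<^bsub>G\<^esub> \<in> mult_image t d E n e" for n e
    using t D(5) by (auto simp: mult_image_def image_iff split: nat.splits intro!: bexI[of _ "\<zero>\<^bsub>G\<^esub>"])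
  show "x \<oplus>\<^bsub>G\<^esub> z \<in> mult_image t d E n e" if xz: "x \<in> mult_image t d E n e" "z \<in> mult_image t d E n e" for n e x z
  proof (cases n)
    case 0 then show ?thesis using xz by (simp add: mult_image_def)
  next
    case (Suc n')
    then obtain g h where gh: "g \<in> E n' (e - int d)" "h \<in> E n' (e - int d)" "x = t \<odot>\<^bsub>G\<^esub> g" "z = t \<odot>\<^bsub>G\<^esub> h"
      using xz by (auto simp: mult_image_def)
    then have "x \<oplus>\<^bsub>G\<^esub> z = t \<odot>\<^bsub>G\<^esub> (g \<oplus>\<^bsub>G\<^esub> h)" using t D(4) by (simp add: smult_r_distr)
    then show ?thesis using D(6)[OF gh(1,2)] Suc by (simp add: mult_image_def)
  qed
  show "r \<odot>\<^bsub>G\<^esub> x \<in> mult_image t d E n (e + i)" if r: "r \<in> rcomp R i" "x \<in> mult_image t d E n e" for n e i r x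
  proof (cases n)
    case 0 then show ?thesis using that rcomp_carrier[OF that(1)] by (simp add: mult_image_def)
  next
    case (Suc n')
    then obtain g where g: "g \<in> E n' (e - int d)" "x = t \<odot>\<^bsub>G\<^esub> g" using r by (auto simp: mult_image_def)
    then have "r \<odot>\<^bsub>G\<^esub> x = t \<odot>\<^bsub>G\<^esub> (r \<odot>\<^bsub>G\<^esub> g)"
      using t D(4) rcomp_carrier[OF that(1)] by (simp add: smult_assoc1[symmetric] m_comm)
    moreover have "E n' (e - int d + i) = E n' (e + i - int d)" by (simp add: algebra_simps)
    ultimately show ?thesis using D(2)[OF that(1) g(1)] Suc by (simp add: mult_image_def)
  qed
  show "s \<odot>\<^bsub>G\<^esub> x \<in> mult_image t d E (Suc n) (e + int d')"
    if s: "(s, d') \<in> Y" "x \<in> mult_image t d E n e" for n e s d' x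
  proof (cases n)
    case 0
    have "s \<in> carrier R" using s Y by auto
    moreover have "x = \<zero>\<^bsub>G\<^esub>" using 0 s by (simp add: mult_image_def)
    ultimately show ?thesis using z by simp
  next
    case (Suc n')
    then obtain g where g: "g \<in> E n' (e - int d)" "x = t \<odot>\<^bsub>G\<^esub> g" using s(2) by (auto simp: mult_image_def)
    have "s \<in> carrier R" using s Y by auto
    then have "s \<odot>\<^bsub>G\<^esub> x = t \<odot>\<^bsub>G\<^esub> (s \<odot>\<^bsub>G\<^esub> g)"
      using t D(4) g by (simp add: smult_assoc1[symmetric] m_comm)
    moreover have "E n (e - int d + int d') = E n (e + int d' - int d)" by (simp add: algebra_simps)
    ultimately show ?thesis using D(3)[OF s(1) g(1)] Suc by (simp add: mult_image_def)
  qed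
qed

lemma fam_fam_plus:
  assumes "fam Y A" "fam Y B" "Y \<subseteq> carrier R \<times> UNIV"
  shows "fam Y (fam_plus A B)"
proof (rule famI)
  note D = famD[OF assms(1)] and D' = famD[OF assms(2)]
  show "x \<in> carrier G" if "x \<in> fam_plus A B n e" for n e x
    using that D(4) D'(4) by (auto simp: fam_plus_def)
  show "\<zero>\<^bsub>G\<^esub> \<in> fam_plus A B n e" for n e
    using D(5)[of n e] D'(5)[of n e] by (auto simp: fam_plus_def intro!: exI[of _ "\<zero>\<^bsub>G\<^esub>"])
  show "x \<oplus>\<^bsub>G\<^esub> z \<in> fam_plus A B n e" if xz: "x \<in> fam_plus A B n e" "z \<in> fam_plus A B n e" for n e x z
  proof -
    from xz obtain a b a' b' where ab: "a \<in> A n e" "b \<in> B n e" "a' \<in> A n e" "b' \<in> B n e"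
      "x = a \<oplus>\<^bsub>G\<^esub> b" "z = a' \<oplus>\<^bsub>G\<^esub> b'" unfolding fam_plus_def by blast
    then have "x \<oplus>\<^bsub>G\<^esub> z = (a \<oplus>\<^bsub>G\<^esub> a') \<oplus>\<^bsub>G\<^esub> (b \<oplus>\<^bsub>G\<^esub> b')" using D(4) D'(4) by (simp add: M.a_ac)
    then show ?thesis using D(6) D'(6) ab unfolding fam_plus_def by blast
  qed
  show "r \<odot>\<^bsub>G\<^esub> x \<in> fam_plus A B n (e + i)" if "r \<in> rcomp R i" "x \<in> fam_plus A B n e" for n e i r x
  proof -
    from that obtain a b where ab: "a \<in> A n e" "b \<in> B n e" "x = a \<oplus>\<^bsub>G\<^esub> b" unfolding fam_plus_def by blast
    then have "r \<odot>\<^bsub>G\<^esub> x = r \<odot>\<^bsub>G\<^esub> a \<oplus>\<^bsub>G\<^esub> r \<odot>\<^bsub>G\<^esub> b" using rcomp_carrier[OF that(1)] D(4) D'(4) by (simp add: smult_r_distr)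
    then show ?thesis using D(2)[OF that(1) ab(1)] D'(2)[OF that(1) ab(2)] unfolding fam_plus_def by blast
  qed
  show "t \<odot>\<^bsub>G\<^esub> x \<in> fam_plus A B (Suc n) (e + int d)" if "(t, d) \<in> Y" "x \<in> fam_plus A B n e" for n e t d x
  proof -
    from that obtain a b where ab: "a \<in> A n e" "b \<in> B n e" "x = a \<oplus>\<^bsub>G\<^esub> b" unfolding fam_plus_def by blast
    then have "t \<odot>\<^bsub>G\<^esub> x = t \<odot>\<^bsub>G\<^esub> a \<oplus>\<^bsub>G\<^esub> t \<odot>\<^bsub>G\<^esub> b" using that(1) assms(3) D(4) D'(4) by (auto simp: smult_r_distr)
    then show ?thesis using D(3)[OF that(1) ab(1)] D'(3)[OF that(1) ab(2)] unfolding fam_plus_def by blast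
  qed
qed

lemma fam_plusI:
  "x \<in> A n e \<Longrightarrow> z \<in> B n e \<Longrightarrow> x \<oplus>\<^bsub>G\<^esub> z \<in> fam_plus A B n e"
  unfolding fam_plus_def by blast

lemma fam_plus_upper:
  assumes "fam Y A" "fam Y B" shows "A \<le> fam_plus A B" "B \<le> fam_plus A B"
proof -
  note D = famD[OF assms(1)] and D' = famD[OF assms(2)]
  show "A \<le> fam_plus A B"
    using fam_plusI[OF _ D'(5), of _ A] D(4) by (intro le_famI) fastforce
  show "B \<le> fam_plus A B"
    using fam_plusI[OF D(5), of _ B] D'(4) by (intro le_famI) fastforce
qed

lemma fam_plus_least:
  assumes "fam Y C" "A \<le> C" "B \<le> C" shows "fam_plus A B \<le> C"
  using famD(6)[OF assms(1)] le_famD[OF assms(2)] le_famD[OF assms(3)]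
  by (intro le_famI) (auto simp: fam_plus_def)

lemma diff_zero [simp]: "x \<in> carrier G \<Longrightarrow> x \<ominus>\<^bsub>G\<^esub> \<zero>\<^bsub>G\<^esub> = x"
  using M.add.inv_one by (simp add: a_minus_def a_inv_def)

text \<open>The counterpart of the ideals of leading coefficients: those \<open>u\<close> for which
  \<open>t^j u\<close> agrees with an element of \<open>A\<close> up to a term in
  \<open>t^(j+1) E\<close>. Allowing the correction \<open>g\<close> makes membership depend only on
  the class of \<open>u\<close> modulo \<open>t E\<close>.\<close>

definition leading :: "'a \<Rightarrow> nat \<Rightarrow> (nat \<Rightarrow> int \<Rightarrow> 'b set) \<Rightarrow> nat \<Rightarrow> (nat \<Rightarrow> int \<Rightarrow> 'b set) \<Rightarrow> nat \<Rightarrow> int \<Rightarrow> 'b set" where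
  "leading t d E j A n e = {u \<in> E n e. \<exists>g\<in>mult_image t d E n e.
     (t [^] j) \<odot>\<^bsub>G\<^esub> (u \<ominus>\<^bsub>G\<^esub> g) \<in> A (n + j) (e + int j * int d)}"

lemma fam_leading:
  assumes E: "fam Y E" and A: "fam Y A" and t: "t \<in> carrier R" and Y: "Y \<subseteq> carrier R \<times> UNIV"
  shows "fam Y (leading t d E j A)"
proof -
  note P = fam_mult_image[OF E t Y, of d]
  note DE = famD[OF E] and DA = famD[OF A] and DP = famD[OF P]
  have tj: "t [^] j \<in> carrier R" using t by simp
  have I: "u \<in> leading t d E j A n e"
    if "u \<in> E n e" "g \<in> mult_image t d E n e" "(t [^] j) \<odot>\<^bsub>G\<^esub> (u \<ominus>\<^bsub>G\<^esub> g) \<in> A (n + j) (e + int j * int d)"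
    for u n e g using that by (auto simp: leading_def)
  have sm: "(t [^] j) \<odot>\<^bsub>G\<^esub> (s \<odot>\<^bsub>G\<^esub> u \<ominus>\<^bsub>G\<^esub> s \<odot>\<^bsub>G\<^esub> g) = s \<odot>\<^bsub>G\<^esub> ((t [^] j) \<odot>\<^bsub>G\<^esub> (u \<ominus>\<^bsub>G\<^esub> g))"
    if "s \<in> carrier R" "u \<in> carrier G" "g \<in> carrier G" for s u g
    using that tj by (simp add: smult_r_diff[symmetric] smult_assoc1[symmetric] m_comm)
  show ?thesis
  proof (rule famI)
    show "u \<in> carrier G" if "u \<in> leading t d E j A n e" for u n e
      using that DE(4) by (auto simp: leading_def)
    show "\<zero>\<^bsub>G\<^esub> \<in> leading t d E j A n e" for n e
      using tj DA(5) by (intro I[OF DE(5) DP(5)]) simp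
  next
    fix u v n e assume "u \<in> leading t d E j A n e" "v \<in> leading t d E j A n e"
    then obtain g h where u: "u \<in> E n e" "v \<in> E n e"
      and g: "g \<in> mult_image t d E n e" "h \<in> mult_image t d E n e"
      and m: "(t [^] j) \<odot>\<^bsub>G\<^esub> (u \<ominus>\<^bsub>G\<^esub> g) \<in> A (n + j) (e + int j * int d)"
        "(t [^] j) \<odot>\<^bsub>G\<^esub> (v \<ominus>\<^bsub>G\<^esub> h) \<in> A (n + j) (e + int j * int d)"
      unfolding leading_def by blast
    note c = DE(4)[OF u(1)] DE(4)[OF u(2)] DP(4)[OF g(1)] DP(4)[OF g(2)]
    have "(u \<oplus>\<^bsub>G\<^esub> v) \<ominus>\<^bsub>G\<^esub> (g \<oplus>\<^bsub>G\<^esub> h) = (u \<ominus>\<^bsub>G\<^esub> g) \<oplus>\<^bsub>G\<^esub> (v \<ominus>\<^bsub>G\<^esub> h)"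
      using c by (simp add: a_minus_def M.minus_add M.a_ac)
    then have "(t [^] j) \<odot>\<^bsub>G\<^esub> ((u \<oplus>\<^bsub>G\<^esub> v) \<ominus>\<^bsub>G\<^esub> (g \<oplus>\<^bsub>G\<^esub> h)) =
       (t [^] j) \<odot>\<^bsub>G\<^esub> (u \<ominus>\<^bsub>G\<^esub> g) \<oplus>\<^bsub>G\<^esub> (t [^] j) \<odot>\<^bsub>G\<^esub> (v \<ominus>\<^bsub>G\<^esub> h)"
      using c tj by (simp add: smult_r_distr)
    then show "u \<oplus>\<^bsub>G\<^esub> v \<in> leading t d E j A n e"
      using DA(6)[OF m] by (intro I[OF DE(6)[OF u] DP(6)[OF g]]) simp
  next
    fix n e i r u assume r: "r \<in> rcomp R i" and "u \<in> leading t d E j A n e"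
    then obtain g where u: "u \<in> E n e" and g: "g \<in> mult_image t d E n e"
      and m: "(t [^] j) \<odot>\<^bsub>G\<^esub> (u \<ominus>\<^bsub>G\<^esub> g) \<in> A (n + j) (e + int j * int d)"
      unfolding leading_def by blast
    have ix: "e + int j * int d + i = e + i + int j * int d" by simp
    show "r \<odot>\<^bsub>G\<^esub> u \<in> leading t d E j A n (e + i)"
      using DA(2)[OF r m] unfolding ix sm[OF rcomp_carrier[OF r] DE(4)[OF u] DP(4)[OF g], symmetric]
      by (rule I[OF DE(2)[OF r u] DP(2)[OF r g]])
  next
    fix n e s d' u assume s: "(s, d') \<in> Y" and "u \<in> leading t d E j A n e"
    then obtain g where u: "u \<in> E n e" and g: "g \<in> mult_image t d E n e"
      and m: "(t [^] j) \<odot>\<^bsub>G\<^esub> (u \<ominus>\<^bsub>G\<^esub> g) \<in> A (n + j) (e + int j * int d)"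
      unfolding leading_def by blast
    have ix: "e + int j * int d + int d' = e + int d' + int j * int d" "Suc (n + j) = Suc n + j" by simp_all
    have "s \<in> carrier R" using s Y by auto
    from DA(3)[OF s m] show "s \<odot>\<^bsub>G\<^esub> u \<in> leading t d E j A (Suc n) (e + int d')"
      unfolding ix sm[OF \<open>s \<in> carrier R\<close> DE(4)[OF u] DP(4)[OF g], symmetric]
      by (rule I[OF DE(3)[OF s u] DP(3)[OF s g]])
  qed
qed

lemma leading_mono: "A \<le> A' \<Longrightarrow> leading t d E j A \<le> leading t d E j A'"
  by (intro le_famI) (auto simp: leading_def dest: le_famD)

text \<open>Multiplying the witness by \<open>t\<close> keeps it in \<open>A\<close>, just as
  multiplication by the variable makes leading ideals grow with the degree.\<close>

lemma leading_Suc: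
  assumes E: "fam Y E" and A: "fam Y A" and td: "(t, d) \<in> Y" and Y: "Y \<subseteq> carrier R \<times> UNIV"
  shows "leading t d E j A \<le> leading t d E (Suc j) A"
proof (rule le_famI)
  have t: "t \<in> carrier R" using td Y by auto
  fix n e u assume "u \<in> leading t d E j A n e"
  then obtain g where u: "u \<in> E n e" and g: "g \<in> mult_image t d E n e"
    and m: "(t [^] j) \<odot>\<^bsub>G\<^esub> (u \<ominus>\<^bsub>G\<^esub> g) \<in> A (n + j) (e + int j * int d)"
    unfolding leading_def by blast
  have "u \<in> carrier G" "g \<in> carrier G"
    using famD(4)[OF E u] famD(4)[OF fam_mult_image[OF E t Y] g] by auto
  then have "t \<odot>\<^bsub>G\<^esub> ((t [^] j) \<odot>\<^bsub>G\<^esub> (u \<ominus>\<^bsub>G\<^esub> g)) = (t [^] Suc j) \<odot>\<^bsub>G\<^esub> (u \<ominus>\<^bsub>G\<^esub> g)"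
    using t by (simp add: smult_assoc1[symmetric] m_comm)
  moreover have "e + int j * int d + int d = e + int (Suc j) * int d" "Suc (n + j) = n + Suc j"
    by (simp_all add: algebra_simps)
  ultimately have "(t [^] Suc j) \<odot>\<^bsub>G\<^esub> (u \<ominus>\<^bsub>G\<^esub> g) \<in> A (n + Suc j) (e + int (Suc j) * int d)"
    using famD(3)[OF A td m] by metis
  then show "u \<in> leading t d E (Suc j) A n e"
    using u g unfolding leading_def by blast
qed

text \<open>The correction \<open>g\<close> is 0 for elements of \<open>Z\<close> and the element
  itself for multiples of \<open>t\<close>. So leading families live above \<open>Z + t E\<close>,
  where \<open>t\<close> acts as zero on the quotient and only the remaining operators
  matter.\<close>

lemma leading_lower:
  assumes E: "fam Y E" and A: "fam Y A" and td: "(t, d) \<in> Y" and Y: "Y \<subseteq> carrier R \<times> UNIV"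
    and Z: "fam Y' Z" "Y' \<subseteq> Y" "Z \<le> A" "A \<le> E"
  shows "fam_plus Z (mult_image t d E) \<le> leading t d E j A"
proof (rule fam_plus_least)
  have t: "t \<in> carrier R" using td Y by auto
  note P = fam_mult_image[OF E t Y, of d]
  show "fam Y (leading t d E j A)" by (rule fam_leading[OF E A t Y])
  show "Z \<le> leading t d E j A"
  proof (rule le_famI)
    fix n e x assume "x \<in> Z n e"
    then have x: "x \<in> A n e" using Z by (auto dest: le_famD)
    then have "x \<in> E n e" "x \<in> carrier G" using Z(4) famD(4)[OF A] by (auto dest: le_famD)
    then show "x \<in> leading t d E j A n e"
      using fam_pow[OF A td t x, of j] famD(5)[OF P, of n e] unfolding leading_def
      by (auto intro!: bexI[of _ "\<zero>\<^bsub>G\<^esub>"])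
  qed
  show "mult_image t d E \<le> leading t d E j A"
  proof (rule le_famI)
    fix n e x assume x: "x \<in> mult_image t d E n e"
    then have "x \<in> E n e" "x \<in> carrier G"
      using le_famD[OF mult_image_subset[OF E td]] famD(4)[OF P] by auto
    then show "x \<in> leading t d E j A n e"
      using t x famD(5)[OF A] unfolding leading_def
      by (auto intro!: bexI[of _ x] simp: a_minus_def M.r_neg)
  qed
qed

text \<open>A bigraded form of Hilbert's basis theorem. Removing one operator \<open>t\<close> at a time, a family is
  determined by its leading families for the \<open>t\<close>-adic filtration.\<close>

lemma noeth_if_generated:
  assumes E: "fam Y0 E" and Y0: "Y0 \<subseteq> carrier R \<times> UNIV"
    and level: "\<And>n (A :: nat \<Rightarrow> int \<Rightarrow> 'b set). mono A \<Longrightarrow> (\<And>i. fam {} (\<lambda>_. A i)) \<Longrightarrow> (\<And>i. A i \<le> E n) \<Longrightarrow>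
       \<exists>N. \<forall>i\<ge>N. A i = A N"
    and "finite Y" "Y \<subseteq> Y0" "fam Y Z" "Z \<le> E"
    and "\<And>n e S. m \<le> n \<Longrightarrow> subgroup S (add_monoid G) \<Longrightarrow> Z (Suc n) e \<subseteq> S \<Longrightarrow>
       (\<And>t d x. (t, d) \<in> Y \<Longrightarrow> x \<in> E n (e - int d) \<Longrightarrow> t \<odot>\<^bsub>G\<^esub> x \<in> S) \<Longrightarrow> E (Suc n) e \<subseteq> S"
  shows "noeth Y Z E"
  using assms(4-)
proof (induction Y arbitrary: Z rule: finite_induct)
  case empty
  show ?case
  proof (rule noethI)
    fix A :: "nat \<Rightarrow> nat \<Rightarrow> int \<Rightarrow> 'b set"
    assume A: "mono A" "\<And>i. fam {} (A i)" "\<And>i. Z \<le> A i" "\<And>i. A i \<le> E"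
    have "\<exists>N. \<forall>i\<ge>N. A i n = A N n" for n
    proof (rule level)
      show "mono (\<lambda>i. A i n)" using A(1) by (auto simp: mono_def le_fun_def)
      show "fam {} (\<lambda>_. A i n)" for i using A(2)[of i] by (auto simp: bigraded_family_def)
      show "A i n \<le> E n" for i using A(4)[of i] by (auto simp: le_fun_def)
    qed
    then obtain Nn where Nn: "\<And>n i. i \<ge> Nn n \<Longrightarrow> A i n = A (Nn n) n" by metis
    \<comment> \<open>Without operators the generation hypothesis makes \<open>E\<close> and
      \<open>Z\<close> agree beyond index \<open>m\<close>, so only the levels up to
      \<open>m\<close> have to become constant.\<close>
    define N where "N = Max (Nn ` {..m})"
    have "A i n e = A N n e" if i: "i \<ge> N" for i n e
    proof (cases "n \<le> m")
      case True
      then have "Nn n \<le> N" by (auto simp: N_def)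
      then show ?thesis using Nn[of n i] Nn[of n N] i by simp
    next
      case False
      then obtain n' where n': "n = Suc n'" "m \<le> n'" by (cases n) auto
      have "E n e \<subseteq> Z n e"
        using empty.prems(4)[OF n'(2), of "Z n e" e] famD(1)[OF empty.prems(2)] n' by simp
      moreover have "Z n e \<subseteq> A i n e" "A i n e \<subseteq> E n e" for i
        using A(3)[of i] A(4)[of i] by (auto simp: le_fun_def)
      ultimately show ?thesis by blast
    qed
    then have "A i = A N" if "i \<ge> N" for i using that by (intro ext)
    then show "\<exists>N. \<forall>i\<ge>N. A i = A N" by blast
  qed
next
  case (insert q Y)
  obtain t d where q: "q = (t, d)" by (cases q)
  let ?Y = "insert q Y" and ?P = "mult_image t d E"
  have Yc: "?Y \<subseteq> carrier R \<times> UNIV" "Y \<subseteq> carrier R \<times> UNIV" and t: "t \<in> carrier R" and td: "(t, d) \<in> ?Y"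
    using insert.prems(1) Y0 q by auto
  have EY: "fam ?Y E" using fam_subset[OF E insert.prems(1)] .
  have ZY: "fam Y Z" using fam_subset[OF insert.prems(2)] by auto
  have PY: "fam Y ?P" using fam_subset[OF fam_mult_image[OF EY t Yc(1)]] by auto
  \<comment> \<open>With the multiples of \<open>t\<close> moved into the lower bound, the
    generation hypothesis survives the removal of \<open>t\<close>.\<close>
  let ?Z = "fam_plus Z ?P"
  note up = fam_plus_upper[OF ZY PY]
  have IH: "noeth Y ?Z E"
  proof (rule insert.IH)
    show "Y \<subseteq> Y0" using insert.prems(1) by auto
    show "fam Y ?Z" by (rule fam_fam_plus[OF ZY PY Yc(2)])
    show "?Z \<le> E" by (rule fam_plus_least[OF EY insert.prems(3) mult_image_subset[OF EY td]])
    fix n e S assume n: "m \<le> n" and S: "subgroup S (add_monoid G)" "?Z (Suc n) e \<subseteq> S"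
      and g: "\<And>t d x. (t, d) \<in> Y \<Longrightarrow> x \<in> E n (e - int d) \<Longrightarrow> t \<odot>\<^bsub>G\<^esub> x \<in> S"
    show "E (Suc n) e \<subseteq> S"
    proof (rule insert.prems(4)[OF n S(1)])
      show "Z (Suc n) e \<subseteq> S" using S(2) up(1) by (auto simp: le_fun_def)
      have "?P (Suc n) e \<subseteq> S" using S(2) up(2) by (auto simp: le_fun_def)
      then show "t' \<odot>\<^bsub>G\<^esub> x \<in> S" if "(t', d') \<in> ?Y" "x \<in> E n (e - int d')" for t' d' x
        using that g q by (auto simp: mult_image_def)
    qed
  qed
  show ?case
  proof (rule noethI)
    fix A :: "nat \<Rightarrow> nat \<Rightarrow> int \<Rightarrow> 'b set"
    assume A: "mono A" "\<And>i. fam ?Y (A i)" "\<And>i. Z \<le> A i" "\<And>i. A i \<le> E"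
    let ?L = "\<lambda>i j. leading t d E j (A i)"
    have Lj: "?L i j \<le> ?L i j'" if "j \<le> j'" for i j j'
      using that by (induction j' rule: dec_induct) (auto intro: order_trans leading_Suc[OF EY A(2) td Yc(1)])
    have "\<exists>N. \<forall>i\<ge>N. \<forall>j. ?L i j = ?L N j"
    proof (rule double_chain_stabilises)
      show "?L i j \<le> ?L i' j'" if "i \<le> i'" "j \<le> j'" for i i' j j'
        using order_trans[OF Lj[OF that(2)] leading_mono[OF monoD[OF A(1) that(1)]]] .
      fix B :: "nat \<Rightarrow> nat \<Rightarrow> int \<Rightarrow> 'b set" assume B: "mono B" "\<And>k. \<exists>i j. B k = ?L i j"
      show "\<exists>N. \<forall>k\<ge>N. B k = B N"
      proof (rule noethD[OF IH B(1)])
        fix k obtain i j where k: "B k = ?L i j" using B(2) by blast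
        show "fam Y (B k)" unfolding k using fam_subset[OF fam_leading[OF EY A(2) t Yc(1)]] by auto
        show "?Z \<le> B k" unfolding k by (rule leading_lower[OF EY A(2) td Yc(1) ZY _ A(3) A(4)]) auto
        show "B k \<le> E" unfolding k by (auto simp: leading_def intro!: le_famI)
      qed
    qed
    then obtain N where N: "\<And>i j. i \<ge> N \<Longrightarrow> ?L i j = ?L N j" by blast
    have "A i = A N" if i: "i \<ge> N" for i
    proof (rule antisym)
      show "A N \<le> A i" using monoD[OF A(1) i] .
      have AN: "A N n e \<subseteq> A i n e" for n e using monoD[OF A(1) i] by (auto simp: le_fun_def)
      \<comment> \<open>Division by \<open>t\<close>, by induction on the index: equality of the
        leading families yields \<open>g\<close> such that \<open>t^j (u - t g)\<close> lies in
        \<open>A N\<close>; what remains is \<open>t^(j+1) g\<close>, where \<open>g\<close> has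
        index one less. At index 0 the only multiple of \<open>t\<close> is zero, so nothing
        remains. The claim itself is the case \<open>j = 0\<close>.\<close>
      have *: "(t [^] j) \<odot>\<^bsub>G\<^esub> u \<in> A N (n + j) (e + int j * int d)"
        if "u \<in> E n e" "(t [^] j) \<odot>\<^bsub>G\<^esub> u \<in> A i (n + j) (e + int j * int d)" for n e u j
        using that
      proof (induction n arbitrary: e u j)
        case 0
        have tj: "t [^] j \<in> carrier R" using t by simp
        have u: "u \<in> carrier G" using 0 famD(4)[OF EY] by blast
        have "u \<in> ?L i j 0 e" using 0 u by (auto simp: leading_def mult_image_def)
        then have "u \<in> ?L N j 0 e" using N[OF i] by simp
        then show ?case using u by (auto simp: leading_def mult_image_def)
      next
        case (Suc n)
        have tj: "t [^] j \<in> carrier R" using t by simp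
        have u: "u \<in> carrier G" using Suc.prems famD(4)[OF EY] by blast
        have "u \<in> ?L i j (Suc n) e"
          using Suc.prems u famD(5)[OF EY, of n "e - int d"] t unfolding leading_def
          by (auto simp: mult_image_def intro!: bexI[of _ "\<zero>\<^bsub>G\<^esub>"])
        then have "u \<in> ?L N j (Suc n) e" using N[OF i] by simp
        then obtain g where g: "g \<in> E n (e - int d)"
          and ug: "(t [^] j) \<odot>\<^bsub>G\<^esub> (u \<ominus>\<^bsub>G\<^esub> t \<odot>\<^bsub>G\<^esub> g) \<in> A N (Suc n + j) (e + int j * int d)"
          by (auto simp: leading_def mult_image_def)
        have gc: "g \<in> carrier G" using famD(4)[OF EY g] .
        have eq: "(t [^] j) \<odot>\<^bsub>G\<^esub> (u \<ominus>\<^bsub>G\<^esub> t \<odot>\<^bsub>G\<^esub> g) = (t [^] j) \<odot>\<^bsub>G\<^esub> u \<ominus>\<^bsub>G\<^esub> (t [^] Suc j) \<odot>\<^bsub>G\<^esub> g"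
          using u gc t tj by (simp add: smult_r_diff smult_assoc1)
        have cc: "(t [^] j) \<odot>\<^bsub>G\<^esub> u \<in> carrier G" "(t [^] Suc j) \<odot>\<^bsub>G\<^esub> g \<in> carrier G"
          using u gc t by auto
        let ?x = "(t [^] j) \<odot>\<^bsub>G\<^esub> u" and ?z = "(t [^] Suc j) \<odot>\<^bsub>G\<^esub> g"
        have ix: "Suc n + j = n + Suc j" "e + int j * int d = (e - int d) + int (Suc j) * int d"
          by (simp_all add: algebra_simps)
        have "?x \<ominus>\<^bsub>G\<^esub> (?x \<ominus>\<^bsub>G\<^esub> ?z) \<in> A i (Suc n + j) (e + int j * int d)"
          using famD(7)[OF A(2) Suc.prems(2)] ug AN unfolding eq by blast
        moreover have "?x \<ominus>\<^bsub>G\<^esub> (?x \<ominus>\<^bsub>G\<^esub> ?z) = ?z"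
          using cc by (simp add: a_minus_def M.minus_add M.a_assoc[symmetric] M.r_neg)
        ultimately have "?z \<in> A N (n + Suc j) ((e - int d) + int (Suc j) * int d)"
          unfolding ix by (intro Suc.IH[OF g]) simp
        then have "(?x \<ominus>\<^bsub>G\<^esub> ?z) \<oplus>\<^bsub>G\<^esub> ?z \<in> A N (Suc n + j) (e + int j * int d)"
          using ug unfolding ix[symmetric] eq by (rule famD(6)[OF A(2), rotated])
        moreover have "(?x \<ominus>\<^bsub>G\<^esub> ?z) \<oplus>\<^bsub>G\<^esub> ?z = ?x"
          using cc by (simp add: a_minus_def M.a_assoc M.l_neg)
        ultimately show ?case by simp
      qed
      show "A i \<le> A N"
      proof (rule le_famI)
        fix n e x assume x: "x \<in> A i n e"
        then have "x \<in> E n e" "x \<in> carrier G" using A(4)[of i] famD(4)[OF A(2)] by (auto dest: le_famD)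
        then show "x \<in> A N n e" using *[of x n e 0] x by simp
      qed
    qed
    then show "\<exists>N. \<forall>i\<ge>N. A i = A N" by blast
  qed
qed

end

section \<open>Minimal degrees in Noetherian families\<close>

lemma acc_has_maximal:
  fixes S :: "'x::order set"
  assumes "x0 \<in> S" and acc: "\<And>A :: nat \<Rightarrow> 'x. mono A \<Longrightarrow> (\<And>i. A i \<in> S) \<Longrightarrow> \<exists>N. \<forall>i\<ge>N. A i = A N"
  shows "\<exists>m\<in>S. \<forall>x\<in>S. m \<le> x \<longrightarrow> x = m"
proof (rule ccontr)
  assume "\<not> ?thesis"
  then have step: "\<exists>y. y \<in> S \<and> x < y" if "x \<in> S" for x
    using that by (metis order_less_le)
  obtain A where A: "\<And>n :: nat. A n \<in> S" "\<And>n. A n < A (Suc n)"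
    using dependent_nat_choice[of "\<lambda>_ x. x \<in> S" "\<lambda>_ x y. x < y"] \<open>x0 \<in> S\<close> step by metis
  have "mono A" using A(2) by (intro incseq_SucI) (simp add: order_less_imp_le)
  from acc[OF this A(1)] obtain N where N: "\<And>i. i \<ge> N \<Longrightarrow> A i = A N" by blast
  show False using N[of "Suc N"] A(2)[of N] by simp
qed

lemma mod_hom_zero_diff:
  assumes "module R F" "module R M" "f \<in> mod_hom R F M"
  shows "f \<zero>\<^bsub>F\<^esub> = \<zero>\<^bsub>M\<^esub>"
    and "x \<in> carrier F \<Longrightarrow> y \<in> carrier F \<Longrightarrow> f (x \<ominus>\<^bsub>F\<^esub> y) = f x \<ominus>\<^bsub>M\<^esub> f y"
proof -
  interpret F: module R F by fact
  interpret M: module R M by fact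
  note fD = mod_homD[OF assms(3)]
  show "f \<zero>\<^bsub>F\<^esub> = \<zero>\<^bsub>M\<^esub>"
    using fD(3)[of "\<zero>\<^bsub>R\<^esub>" "\<zero>\<^bsub>F\<^esub>"] fD(1)[of "\<zero>\<^bsub>F\<^esub>"] by simp
  assume xy: "x \<in> carrier F" "y \<in> carrier F"
  have "\<ominus>\<^bsub>F\<^esub> y = (\<ominus>\<^bsub>R\<^esub> \<one>\<^bsub>R\<^esub>) \<odot>\<^bsub>F\<^esub> y" using xy by (simp add: F.smult_l_minus)
  then show "f (x \<ominus>\<^bsub>F\<^esub> y) = f x \<ominus>\<^bsub>M\<^esub> f y"
    using fD xy by (simp add: a_minus_def M.smult_l_minus)
qed

context module_over_graded
begin

section \<open>The chain condition along homomorphisms and sums\<close>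

lemma fam_image:
  assumes E: "fam Y E" and G': "module_over_graded R G'" and th: "\<theta> \<in> mod_hom R G G'" and Y: "Y \<subseteq> carrier R \<times> UNIV"
  shows "bigraded_family R G' Y (\<lambda>n e. \<theta> ` E n (e - s))"
proof -
  interpret T: module_over_graded R G' by fact
  note D = famD[OF E] and hD = mod_homD[OF th]
  show ?thesis
  proof (rule T.famI)
    show "x \<in> carrier G'" if "x \<in> \<theta> ` E n (e - s)" for n e x using that D(4) hD(1) by blast
    show "\<zero>\<^bsub>G'\<^esub> \<in> \<theta> ` E n (e - s)" for n e
      using D(5) mod_hom_zero_diff(1)[OF module_axioms T.module_axioms th] by (metis imageI)
    show "x \<oplus>\<^bsub>G'\<^esub> z \<in> \<theta> ` E n (e - s)" if xz: "x \<in> \<theta> ` E n (e - s)" "z \<in> \<theta> ` E n (e - s)" for n e x z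
    proof -
      from xz obtain u v where "u \<in> E n (e - s)" "v \<in> E n (e - s)" "x = \<theta> u" "z = \<theta> v" by blast
      then show ?thesis using D(4,6) hD(2) by (intro image_eqI[of _ _ "u \<oplus>\<^bsub>G\<^esub> v"]) auto
    qed
    show "r \<odot>\<^bsub>G'\<^esub> x \<in> \<theta> ` E n (e + i - s)" if r: "r \<in> rcomp R i" "x \<in> \<theta> ` E n (e - s)" for n e i r x
    proof -
      from r obtain u where u: "u \<in> E n (e - s)" "x = \<theta> u" by blast
      have "r \<odot>\<^bsub>G\<^esub> u \<in> E n (e + i - s)" using D(2)[OF r(1) u(1)] by (simp add: algebra_simps)
      then show ?thesis using hD(3)[OF rcomp_carrier[OF r(1)] D(4)[OF u(1)]] u(2) by (metis imageI)
    qed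
    show "t \<odot>\<^bsub>G'\<^esub> x \<in> \<theta> ` E (Suc n) (e + int d - s)" if t: "(t, d) \<in> Y" "x \<in> \<theta> ` E n (e - s)" for n e t d x
    proof -
      from t obtain u where u: "u \<in> E n (e - s)" "x = \<theta> u" by blast
      have "t \<odot>\<^bsub>G\<^esub> u \<in> E (Suc n) (e + int d - s)" using D(3)[OF t(1) u(1)] by (simp add: algebra_simps)
      moreover have "t \<in> carrier R" using t(1) Y by auto
      ultimately show ?thesis using hD(3)[OF _ D(4)[OF u(1)]] u(2) by (metis imageI)
    qed
  qed
qed

lemma fam_vimage:
  assumes E: "fam Y E" and G': "module_over_graded R G'" and Z': "bigraded_family R G' Y Z'"
    and th: "\<theta> \<in> mod_hom R G G'" and Y: "Y \<subseteq> carrier R \<times> UNIV"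
  shows "fam Y (\<lambda>n e. {x \<in> E n e. \<theta> x \<in> Z' n (e + s)})"
proof -
  interpret T: module_over_graded R G' by fact
  note D = famD[OF E] and hD = mod_homD[OF th] and D' = T.famD[OF Z']
  show ?thesis
  proof (rule famI; (elim CollectE conjE)?)
    show "\<zero>\<^bsub>G\<^esub> \<in> {x \<in> E n e. \<theta> x \<in> Z' n (e + s)}" for n e
      using D(5) D'(5) mod_hom_zero_diff(1)[OF module_axioms T.module_axioms th] by simp
    show "x \<in> carrier G" if "x \<in> E n e" for x n e using D(4) that .
    show "x \<oplus>\<^bsub>G\<^esub> z \<in> {x \<in> E n e. \<theta> x \<in> Z' n (e + s)}"
      if "x \<in> E n e" "z \<in> E n e" "\<theta> x \<in> Z' n (e + s)" "\<theta> z \<in> Z' n (e + s)" for n e x z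
      using that D(4,6) D'(6) hD(2) by auto
    show "r \<odot>\<^bsub>G\<^esub> x \<in> {x \<in> E n (e + i). \<theta> x \<in> Z' n (e + i + s)}"
      if r: "r \<in> rcomp R i" and x: "x \<in> E n e" "\<theta> x \<in> Z' n (e + s)" for n e i r x
      using D(2)[OF r x(1)] D'(2)[OF r x(2)] hD(3)[OF rcomp_carrier[OF r] D(4)[OF x(1)]]
      by (simp add: algebra_simps)
    show "t \<odot>\<^bsub>G\<^esub> x \<in> {x \<in> E (Suc n) (e + int d). \<theta> x \<in> Z' (Suc n) (e + int d + s)}"
      if t: "(t, d) \<in> Y" and x: "x \<in> E n e" "\<theta> x \<in> Z' n (e + s)" for n e t d x
    proof -
      have "t \<in> carrier R" using t Y by auto
      then show ?thesis
      using D(3)[OF t x(1)] D'(3)[OF t x(2)] hD(3)[OF _ D(4)[OF x(1)]]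
      by (simp add: algebra_simps)
    qed
  qed
qed

text \<open>A chain between \<open>Z\<close> and \<open>E\<close> is determined by its image modulo
  \<open>Z'\<close> and by its intersection with the preimage of \<open>Z'\<close>: two nested
  members that agree in both are equal, by subtracting an element with the same image. Both induced
  chains stop, the first by \<open>quot\<close> and the second by \<open>ker\<close>.\<close>

lemma noeth_extension:
  assumes E: "fam Y E" and G': "module_over_graded R G'" and th: "\<theta> \<in> mod_hom R G G'"
    and Y: "Y \<subseteq> carrier R \<times> UNIV"
    and thE: "\<And>n e x. x \<in> E n e \<Longrightarrow> \<theta> x \<in> E' n (e + s)"
    and thZ: "\<And>n e x. x \<in> Z n e \<Longrightarrow> \<theta> x \<in> Z' n (e + s)"
    and Z': "bigraded_family R G' Y Z'" "Z' \<le> E'" and E': "bigraded_family R G' Y E'"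
    and quot: "noetherian_between R G' Y Z' E'"
    and ker: "noeth Y Z (\<lambda>n e. {x \<in> E n e. \<theta> x \<in> Z' n (e + s)})"
  shows "noeth Y Z E"
proof (rule noethI)
  fix A :: "nat \<Rightarrow> nat \<Rightarrow> int \<Rightarrow> 'b set"
  assume A: "mono A" "\<And>i. fam Y (A i)" "\<And>i. Z \<le> A i" "\<And>i. A i \<le> E"
  interpret T: module_over_graded R G' by fact
  let ?I = "\<lambda>i n e. \<theta> ` A i n (e - s)"
  let ?B = "\<lambda>i. T.fam_plus Z' (?I i)" and ?K = "\<lambda>i n e. {x \<in> A i n e. \<theta> x \<in> Z' n (e + s)}"
  have I: "T.fam Y (?I i)" for i by (rule fam_image[OF A(2) G' th Y])
  have IE: "?I i \<le> E'" for i
  proof (rule T.le_famI)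
    fix n e x assume "x \<in> ?I i n e"
    then obtain u where u: "u \<in> A i n (e - s)" "x = \<theta> u" by blast
    then show "x \<in> E' n e" using thE[of u n "e - s"] le_famD[OF A(4) u(1)] by simp
  qed
  have "\<exists>N. \<forall>i\<ge>N. ?B i = ?B N"
  proof (rule T.noethD[OF quot])
    show "mono ?B" using A(1) by (auto simp: mono_def T.fam_plus_def le_fun_def) blast
    show "T.fam Y (?B i)" for i by (rule T.fam_fam_plus[OF Z'(1) I Y])
    show "Z' \<le> ?B i" for i by (rule T.fam_plus_upper(1)[OF Z'(1) I])
    show "?B i \<le> E'" for i by (rule T.fam_plus_least[OF E' Z'(2) IE])
  qed
  then obtain N1 where N1: "\<And>i. i \<ge> N1 \<Longrightarrow> ?B i = ?B N1" by blast
  have "\<exists>N. \<forall>i\<ge>N. ?K i = ?K N"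
  proof (rule noethD[OF ker])
    show "mono ?K" using le_famD[OF monoD[OF A(1)]] by (auto intro!: monoI le_famI)
    show "fam Y (?K i)" for i by (rule fam_vimage[OF A(2) G' Z'(1) th Y])
    show "Z \<le> ?K i" for i using A(3)[of i] thZ by (auto simp: le_fun_def)
    show "?K i \<le> (\<lambda>n e. {x \<in> E n e. \<theta> x \<in> Z' n (e + s)})" for i using A(4)[of i] by (auto simp: le_fun_def)
  qed
  then obtain N2 where N2: "\<And>i. i \<ge> N2 \<Longrightarrow> ?K i = ?K N2" by blast
  define N where "N = max N1 N2"
  have "A i = A N" if i: "i \<ge> N" for i
  proof (rule antisym)
    show "A N \<le> A i" using monoD[OF A(1) i] .
    show "A i \<le> A N"
    proof (rule le_famI)
      fix n e x assume x: "x \<in> A i n e"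
      have xc: "x \<in> carrier G" using famD(4)[OF A(2) x] .
      have "\<theta> x \<in> ?I i n (e + s)" using x by simp
      then have "\<theta> x \<in> ?B i n (e + s)" using T.le_famD[OF T.fam_plus_upper(2)[OF Z'(1) I]] by blast
      also have "?B i = ?B N" using N1[of i] N1[of N] i by (simp add: N_def)
      finally obtain z x0 where z: "z \<in> Z' n (e + s)" "x0 \<in> A N n e" "\<theta> x = z \<oplus>\<^bsub>G'\<^esub> \<theta> x0"
        by (auto simp: T.fam_plus_def)
      have x0: "x0 \<in> A i n e" "x0 \<in> carrier G"
        using le_famD[OF monoD[OF A(1) i] z(2)] famD(4)[OF A(2) z(2)] by auto
      have "\<theta> (x \<ominus>\<^bsub>G\<^esub> x0) = \<theta> x \<ominus>\<^bsub>G'\<^esub> \<theta> x0"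
        using mod_hom_zero_diff(2)[OF module_axioms T.module_axioms th xc x0(2)] .
      also have "\<dots> = z" unfolding z(3) using T.famD(4)[OF Z'(1) z(1)] mod_homD(1)[OF th x0(2)]
        by (simp add: a_minus_def T.M.a_assoc T.M.r_neg)
      finally have "x \<ominus>\<^bsub>G\<^esub> x0 \<in> ?K i n e" using famD(7)[OF A(2) x x0(1)] z(1) by simp
      also have "?K i = ?K N" using N2[of i] N2[of N] i by (simp add: N_def)
      finally have "(x \<ominus>\<^bsub>G\<^esub> x0) \<oplus>\<^bsub>G\<^esub> x0 \<in> A N n e" using famD(6)[OF A(2) _ z(2)] by blast
      moreover have "(x \<ominus>\<^bsub>G\<^esub> x0) \<oplus>\<^bsub>G\<^esub> x0 = x" using xc x0 by (simp add: a_minus_def M.a_assoc M.l_neg)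
      ultimately show "x \<in> A N n e" by simp
    qed
  qed
  then show "\<exists>N. \<forall>i\<ge>N. A i = A N" by blast
qed

text \<open>The maps \<open>\<theta> j\<close> jointly embed the quotient of \<open>E\<close> by
  \<open>Z\<close> into \<open>r\<close> copies of the quotient of \<open>E'\<close> by
  \<open>Z'\<close>, with a degree shift of its own for each copy. No product is formed: one map is
  split off at a time, and its kernel takes the role of \<open>E\<close>.\<close>

lemma noeth_iterated_extension:
  assumes G': "module_over_graded R G'" and Y: "Y \<subseteq> carrier R \<times> UNIV"
    and Z': "bigraded_family R G' Y Z'" "Z' \<le> E'" and E': "bigraded_family R G' Y E'"
    and quot: "noetherian_between R G' Y Z' E'"
    and th: "\<And>j. j < (r :: nat) \<Longrightarrow> \<theta> j \<in> mod_hom R G G'"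
    and thZ: "\<And>j n e x. j < r \<Longrightarrow> x \<in> Z n e \<Longrightarrow> \<theta> j x \<in> Z' n (e + s j)"
    and "fam Y E" and "Z \<le> E"
    and "\<And>j n e x. j < r \<Longrightarrow> x \<in> E n e \<Longrightarrow> \<theta> j x \<in> E' n (e + s j)"
    and "\<And>n e x. x \<in> E n e \<Longrightarrow> (\<And>j. j < r \<Longrightarrow> \<theta> j x \<in> Z' n (e + s j)) \<Longrightarrow> x \<in> Z n e"
  shows "noeth Y Z E"
  using assms(7-)
proof (induction r arbitrary: E)
  case 0
  have "Z = E" using 0(4,6) by (intro antisym[OF _ le_famI]) auto
  then show ?case using antisym[of "_ :: nat \<Rightarrow> int \<Rightarrow> 'b set" E] by (intro noethI exI[of _ 0]) metis
next
  case (Suc r)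
  let ?E = "\<lambda>n e. {x \<in> E n e. \<theta> r x \<in> Z' n (e + s r)}"
  have "noeth Y Z ?E"
  proof (rule Suc.IH)
    show "fam Y ?E" by (rule fam_vimage[OF Suc.prems(3) G' Z'(1) Suc.prems(1) Y]) simp
    show "Z \<le> ?E" using le_famD[OF Suc.prems(4)] Suc.prems(2) by (auto intro!: le_famI)
    show "\<theta> j \<in> mod_hom R G G'" if "j < r" for j using Suc.prems(1) that by simp
    show "\<theta> j x \<in> Z' n (e + s j)" if "j < r" "x \<in> Z n e" for j n e x using Suc.prems(2) that by simp
    show "\<theta> j x \<in> E' n (e + s j)" if "j < r" "x \<in> ?E n e" for j n e x using Suc.prems(5) that by simp
    show "x \<in> Z n e" if "x \<in> ?E n e" "\<And>j. j < r \<Longrightarrow> \<theta> j x \<in> Z' n (e + s j)" for x n e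
      using Suc.prems(6) that less_Suc_eq by auto
  qed
  then show ?case
    using Suc.prems by (intro noeth_extension[OF Suc.prems(3) G' _ Y _ _ Z' E' quot, of "\<theta> r" "s r"]) auto
qed

text \<open>The quotient of \<open>B + P\<close> by \<open>B\<close> is a quotient of
  \<open>P\<close> by \<open>Z\<close>. Concretely, the modular law recovers a family
  \<open>A\<close> between \<open>B\<close> and \<open>B + P\<close> as the sum of \<open>B\<close>
  and the intersection of \<open>A\<close> with \<open>P\<close>.\<close>

lemma noeth_plus:
  assumes B: "fam Y B" and P: "fam Y P" and Z: "Z \<le> B" "Z \<le> P" and n: "noeth Y Z P"
  shows "noeth Y B (fam_plus B P)"
proof (rule noethI)
  fix A :: "nat \<Rightarrow> nat \<Rightarrow> int \<Rightarrow> 'b set"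
  assume A: "mono A" "\<And>i. fam Y (A i)" "\<And>i. B \<le> A i" "\<And>i. A i \<le> fam_plus B P"
  let ?K = "\<lambda>i n e. A i n e \<inter> P n e"
  have "\<exists>N. \<forall>i\<ge>N. ?K i = ?K N"
  proof (rule noethD[OF n])
    show "mono ?K" using le_famD[OF monoD[OF A(1)]] by (auto intro!: monoI le_famI)
    show "fam Y (?K i)" for i
      using famD[OF A(2)[of i]] famD[OF P] by (intro famI) auto
    show "Z \<le> ?K i" for i using order_trans[OF Z(1) A(3)[of i]] Z(2) by (auto simp: le_fun_def)
    show "?K i \<le> P" for i by (auto simp: le_fun_def)
  qed
  then obtain N where N: "\<And>i. i \<ge> N \<Longrightarrow> ?K i = ?K N" by blast
  have "A i = A N" if i: "i \<ge> N" for i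
  proof (rule antisym)
    show "A N \<le> A i" using monoD[OF A(1) i] .
    show "A i \<le> A N"
    proof (rule le_famI)
      fix n e x assume x: "x \<in> A i n e"
      from le_famD[OF A(4) x] obtain b p where b: "b \<in> B n e" "p \<in> P n e" "x = b \<oplus>\<^bsub>G\<^esub> p"
        by (auto simp: fam_plus_def)
      note c = famD(4)[OF B b(1)] famD(4)[OF P b(2)]
      have "x \<ominus>\<^bsub>G\<^esub> b = p" unfolding b(3) using c by (simp add: a_minus_def M.a_comm[of b p] M.a_assoc M.r_neg)
      moreover have "x \<ominus>\<^bsub>G\<^esub> b \<in> A i n e" using famD(7)[OF A(2) x] le_famD[OF A(3) b(1)] by blast
      ultimately have "p \<in> ?K i n e" using b(2) by simp
      then have "p \<in> A N n e" using N[OF i] by (metis IntD1)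
      then show "x \<in> A N n e" using famD(6)[OF A(2)] le_famD[OF A(3) b(1)] b(3) by blast
    qed
  qed
  then show "\<exists>N. \<forall>i\<ge>N. A i = A N" by blast
qed

text \<open>The minimal degrees modulo \<open>tX + (T : t^k)\<close>, for all \<open>k\<close>, determine those modulo \<open>T\<close>: write an
  element as \<open>t^k g\<close> modulo \<open>T\<close> with \<open>k\<close> as large as possible.\<close>

lemma ev_affine_min_degree:
  assumes X: "fam Y0 X" and Y0: "Y0 \<subseteq> carrier R \<times> UNIV"
    and "finite Y" "Y \<subseteq> Y0" "fam Y T" "T \<le> X" "noeth Y T X"
    and "\<And>n e x. x \<in> X n e \<Longrightarrow> x \<notin> T n e \<Longrightarrow> e0 \<le> e"
  shows "ev_affine_min (snd ` Y) (\<lambda>n e. \<exists>x\<in>X n e. x \<notin> T n e)"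
  using assms(3-)
proof (induction Y arbitrary: T rule: finite_induct)
  case empty
  have X0: "fam {} X" by (rule fam_subset[OF X]) simp
  \<comment> \<open>Without operators the indices do not interact, so \<open>T\<close> may be
    replaced by \<open>X\<close> at the indices up to \<open>i\<close> alone. That this chain stops
    means that \<open>X\<close> and \<open>T\<close> agree at all large indices.\<close>
  let ?A = "\<lambda>i n. if n \<le> i then X n else T n"
  have TX: "T n e \<subseteq> X n e" for n e using empty.prems(3) by (auto simp: le_fun_def)
  have "\<exists>N. \<forall>i\<ge>N. ?A i = ?A N"
  proof (rule noethD[OF empty.prems(4)])
    show "mono ?A" using TX by (auto simp: mono_def le_fun_def)
    show "fam {} (?A i)" for i using X0 empty.prems(2) by (simp add: bigraded_family_def)
    show "T \<le> ?A i" "?A i \<le> X" for i using TX by (auto simp: le_fun_def)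
  qed
  then obtain N where N: "\<And>i. i \<ge> N \<Longrightarrow> ?A i = ?A N" by blast
  have "X n e = T n e" if "n > N" for n e
    using fun_cong[OF fun_cong[OF N[of n]], of n e] that by simp
  then have "\<forall>\<^sub>F n in sequentially. \<forall>e. \<not> (\<exists>x\<in>X n e. x \<notin> T n e)"
    by (intro eventually_mono[OF eventually_gt_at_top[of N]]) blast
  then show ?case by (simp add: ev_affine_min_def)
next
  case (insert q Y)
  obtain t d where q: "q = (t, d)" by (cases q)
  let ?Y = "insert q Y" and ?P = "mult_image t d X"
  have Yc: "?Y \<subseteq> carrier R \<times> UNIV" and t: "t \<in> carrier R" and td: "(t, d) \<in> ?Y"
    using insert.prems(1) Y0 q by auto
  have tk: "t [^] k \<in> carrier R" for k :: nat using t by simp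
  note XY = fam_subset[OF X insert.prems(1)]
  note TY = insert.prems(2)
  note DX = famD[OF XY] and DT = famD[OF TY]
  note P = fam_mult_image[OF XY t Yc, of d] and PX = mult_image_subset[OF XY td]
  define Q where "Q k n e = {x \<in> X n e. (t [^] k) \<odot>\<^bsub>G\<^esub> x \<in> T (n + k) (e + int k * int d)}" for k :: nat and n e
  have Q: "fam ?Y (Q k)" for k
  proof (rule famI)
    show "x \<in> carrier G" if "x \<in> Q k n e" for x n e using that DX(4) by (auto simp: Q_def)
    show "\<zero>\<^bsub>G\<^esub> \<in> Q k n e" for n e using DX(5) DT(5) tk by (simp add: Q_def)
    show "x \<oplus>\<^bsub>G\<^esub> z \<in> Q k n e" if "x \<in> Q k n e" "z \<in> Q k n e" for x z n e
      using that DX(4,6) DT(6) tk by (auto simp: Q_def smult_r_distr)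
    show "r \<odot>\<^bsub>G\<^esub> x \<in> Q k n (e + i)" if r: "r \<in> rcomp R i" and x: "x \<in> Q k n e" for r i x n e
    proof -
      have xx: "x \<in> X n e" "(t [^] k) \<odot>\<^bsub>G\<^esub> x \<in> T (n + k) (e + int k * int d)" using x by (auto simp: Q_def)
      have "(t [^] k) \<odot>\<^bsub>G\<^esub> (r \<odot>\<^bsub>G\<^esub> x) = r \<odot>\<^bsub>G\<^esub> ((t [^] k) \<odot>\<^bsub>G\<^esub> x)"
        using DX(4)[OF xx(1)] rcomp_carrier[OF r] tk by (simp add: smult_assoc1[symmetric] m_comm)
      moreover have "e + int k * int d + i = e + i + int k * int d" by simp
      ultimately have "(t [^] k) \<odot>\<^bsub>G\<^esub> (r \<odot>\<^bsub>G\<^esub> x) \<in> T (n + k) (e + i + int k * int d)"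
        using DT(2)[OF r xx(2)] by metis
      then show ?thesis using DX(2)[OF r xx(1)] by (simp add: Q_def)
    qed
    show "u \<odot>\<^bsub>G\<^esub> x \<in> Q k (Suc n) (e + int d')" if u: "(u, d') \<in> ?Y" and x: "x \<in> Q k n e" for u d' x n e
    proof -
      have xx: "x \<in> X n e" "(t [^] k) \<odot>\<^bsub>G\<^esub> x \<in> T (n + k) (e + int k * int d)" using x by (auto simp: Q_def)
      have "u \<in> carrier R" using u Yc by auto
      then have "(t [^] k) \<odot>\<^bsub>G\<^esub> (u \<odot>\<^bsub>G\<^esub> x) = u \<odot>\<^bsub>G\<^esub> ((t [^] k) \<odot>\<^bsub>G\<^esub> x)"
        using DX(4)[OF xx(1)] tk by (simp add: smult_assoc1[symmetric] m_comm)
      moreover have "e + int k * int d + int d' = e + int d' + int k * int d" "Suc (n + k) = Suc n + k" by simp_all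
      ultimately have "(t [^] k) \<odot>\<^bsub>G\<^esub> (u \<odot>\<^bsub>G\<^esub> x) \<in> T (Suc n + k) (e + int d' + int k * int d)"
        using DT(3)[OF u xx(2)] by metis
      then show ?thesis using DX(3)[OF u xx(1)] by (simp add: Q_def)
    qed
  qed
  have QX: "Q k \<le> X" for k by (auto simp: Q_def le_fun_def)
  have TQ: "T \<le> Q k" for k
  proof (rule le_famI)
    fix n e x assume x: "x \<in> T n e"
    then show "x \<in> Q k n e" using le_famD[OF insert.prems(3) x] fam_pow[OF TY td t x, of k] by (simp add: Q_def)
  qed
  have QS: "Q k \<le> Q (Suc k)" for k
  proof (rule le_famI)
    fix n e x assume "x \<in> Q k n e"
    then have xx: "x \<in> X n e" "(t [^] k) \<odot>\<^bsub>G\<^esub> x \<in> T (n + k) (e + int k * int d)" by (auto simp: Q_def)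
    have "t \<odot>\<^bsub>G\<^esub> ((t [^] k) \<odot>\<^bsub>G\<^esub> x) = (t [^] Suc k) \<odot>\<^bsub>G\<^esub> x"
      using t DX(4)[OF xx(1)] by (simp add: smult_assoc1[symmetric] m_comm)
    moreover have "e + int k * int d + int d = e + int (Suc k) * int d" by (simp add: algebra_simps)
    ultimately have "(t [^] Suc k) \<odot>\<^bsub>G\<^esub> x \<in> T (n + Suc k) (e + int (Suc k) * int d)"
      using DT(3)[OF td xx(2)] by (metis add_Suc_right)
    then show "x \<in> Q (Suc k) n e" using xx(1) by (simp add: Q_def)
  qed
  define T' where "T' k = fam_plus ?P (Q k)" for k
  have T'Y: "fam ?Y (T' k)" for k unfolding T'_def by (rule fam_fam_plus[OF P Q Yc])
  have up: "?P \<le> T' k" "Q k \<le> T' k" for k unfolding T'_def by (rule fam_plus_upper[OF P Q])+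
  have T'X: "T' k \<le> X" for k unfolding T'_def by (rule fam_plus_least[OF XY PX QX])
  have TT': "T \<le> T' k" for k using order_trans[OF TQ up(2)] .
  have "\<exists>N. \<forall>k\<ge>N. T' k = T' N"
  proof (rule noethD[OF insert.prems(4) _ T'Y TT' T'X])
    have "T' k \<le> T' (Suc k)" for k
      unfolding T'_def[of k] by (rule fam_plus_least[OF T'Y up(1) order_trans[OF QS up(2)]])
    then show "mono T'" by (rule incseq_SucI)
  qed
  then obtain K where K: "\<And>k. k \<ge> K \<Longrightarrow> T' k = T' K" by blast
  define D where "D k n e \<longleftrightarrow> (\<exists>x\<in>X n e. x \<notin> T' k n e)" for k n e
  \<comment> \<open>Since \<open>T' k\<close> is constant from \<open>K\<close> on, infinitely many
    exponents contribute only finitely many translates and one ray.\<close>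
  have DK: "D k = D K" if "k \<ge> K" for k using K[OF that] by (simp add: D_def fun_eq_iff)
  have bdd: "e0 \<le> e" if "D k n e" for k n e
    using that insert.prems(5) le_famD[OF TT'] unfolding D_def by metis
  have good: "ev_affine_min (snd ` Y) (D k)" for k
    unfolding D_def
  proof (rule insert.IH[OF _ _ T'X])
    show "Y \<subseteq> Y0" using insert.prems(1) by auto
    show "fam Y (T' k)" using fam_subset[OF T'Y] by auto
    show "noeth Y (T' k) X"
    proof (rule noethI)
      fix A :: "nat \<Rightarrow> nat \<Rightarrow> int \<Rightarrow> 'b set"
      assume A: "mono A" "\<And>i. fam Y (A i)" "\<And>i. T' k \<le> A i" "\<And>i. A i \<le> X"
      \<comment> \<open>A family between \<open>t X\<close> and \<open>X\<close> is automatically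
        stable under \<open>t\<close>; this is why the chain condition survives the removal of
        \<open>t\<close> here.\<close>
      have AY: "fam ?Y (A i)" for i
      proof -
        have "t \<odot>\<^bsub>G\<^esub> x \<in> A i (Suc n) (e + int d)" if "x \<in> A i n e" for n e x
          using le_famD[OF A(4) that] le_famD[OF order_trans[OF up(1) A(3)[of i]], of "t \<odot>\<^bsub>G\<^esub> x" "Suc n" "e + int d"]
          by (auto simp: mult_image_def)
        then show ?thesis using A(2)[of i] q by (auto simp: bigraded_family_def)
      qed
      show "\<exists>N. \<forall>i\<ge>N. A i = A N"
        by (rule noethD[OF insert.prems(4) A(1) AY order_trans[OF TT' A(3)] A(4)])
    qed
    show "e0 \<le> e" if "x \<in> X n e" "x \<notin> T' k n e" for n e x
      using bdd[of k n e] that by (auto simp: D_def)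
  qed
  \<comment> \<open>If \<open>u\<close> lies in \<open>T' k\<close>, then \<open>u = t h + z\<close>
    with \<open>t^k z\<close> in \<open>T\<close>, hence \<open>t^(k+1) h\<close> is not in
    \<open>T\<close> and \<open>h\<close> has index one less. The exponent can grow only until the
    index reaches 0, where the multiple of \<open>t\<close> vanishes.\<close>
  have descend: "\<exists>k'\<ge>k. k' \<le> m + k \<and> D k' (m + k - k') (e + int k * int d - int k' * int d)"
    if "u \<in> X m e" "(t [^] k) \<odot>\<^bsub>G\<^esub> u \<notin> T (m + k) (e + int k * int d)" for m k e u
    using that
  proof (induction m arbitrary: k e u)
    case 0
    have "u \<notin> T' k 0 e"
    proof
      assume "u \<in> T' k 0 e"
      then obtain z where z: "z \<in> Q k 0 e" "u = \<zero>\<^bsub>G\<^esub> \<oplus>\<^bsub>G\<^esub> z"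
        by (auto simp: T'_def fam_plus_def mult_image_def)
      moreover have "z \<in> carrier G" using famD(4)[OF Q z(1)] .
      ultimately show False using 0(2) by (simp add: Q_def)
    qed
    then show ?case using 0(1) by (intro exI[of _ k]) (auto simp: D_def)
  next
    case (Suc m)
    show ?case
    proof (cases "u \<in> T' k (Suc m) e")
      case False
      then show ?thesis using Suc.prems(1) by (intro exI[of _ k]) (auto simp: D_def)
    next
      case True
      then obtain h z where h: "h \<in> X m (e - int d)" and z: "z \<in> Q k (Suc m) e" and u: "u = t \<odot>\<^bsub>G\<^esub> h \<oplus>\<^bsub>G\<^esub> z"
        by (auto simp: T'_def fam_plus_def mult_image_def)
      have c: "h \<in> carrier G" "z \<in> carrier G" using DX(4)[OF h] famD(4)[OF Q z] by auto
      have "(t [^] k) \<odot>\<^bsub>G\<^esub> u = (t [^] Suc k) \<odot>\<^bsub>G\<^esub> h \<oplus>\<^bsub>G\<^esub> (t [^] k) \<odot>\<^bsub>G\<^esub> z"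
        using c t tk by (simp add: u smult_r_distr smult_assoc1)
      moreover have "(t [^] k) \<odot>\<^bsub>G\<^esub> z \<in> T (Suc m + k) (e + int k * int d)" using z by (simp add: Q_def)
      ultimately have "(t [^] Suc k) \<odot>\<^bsub>G\<^esub> h \<notin> T (Suc m + k) (e + int k * int d)"
        using Suc.prems(2) DT(6) by metis
      moreover have ix: "Suc m + k = m + Suc k" "e + int k * int d = (e - int d) + int (Suc k) * int d"
        by (simp_all add: algebra_simps)
      ultimately have "(t [^] Suc k) \<odot>\<^bsub>G\<^esub> h \<notin> T (m + Suc k) ((e - int d) + int (Suc k) * int d)" by metis
      from Suc.IH[OF h this] show ?thesis unfolding ix[symmetric] using Suc_leD by blast
    qed
  qed
  have up_D: "\<exists>x\<in>X n e. x \<notin> T n e" if D: "k \<le> n" "D k (n - k) (e - int k * int d)" for k n e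
  proof -
    obtain x where x: "x \<in> X (n - k) (e - int k * int d)" "x \<notin> T' k (n - k) (e - int k * int d)"
      using D(2) by (auto simp: D_def)
    then have "x \<notin> Q k (n - k) (e - int k * int d)" using le_famD[OF up(2)] by blast
    then have "(t [^] k) \<odot>\<^bsub>G\<^esub> x \<notin> T n e" using x(1) D(1) by (simp add: Q_def)
    moreover have "(t [^] k) \<odot>\<^bsub>G\<^esub> x \<in> X n e" using fam_pow[OF XY td t x(1), of k] D(1) by simp
    ultimately show ?thesis by blast
  qed
  have eq: "(\<exists>x\<in>X n e. x \<notin> T n e) \<longleftrightarrow>
      (\<exists>k\<in>{..<K}. k \<le> n \<and> D k (n - k) (e - int k * int d)) \<or>
      (\<exists>k\<ge>K. k \<le> n \<and> D K (n - k) (e - int k * int d))" (is "?l \<longleftrightarrow> ?r") for n e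
  proof
    assume ?l
    then obtain u where u: "u \<in> X n e" "u \<notin> T n e" by blast
    then obtain k where k: "k \<le> n" "D k (n - k) (e - int k * int d)"
      using descend[of u n e 0] DX(4) by auto
    show ?r
    proof (cases "k < K")
      case True then show ?thesis using k by blast
    next
      case False then show ?thesis using k DK[of k] by (metis not_less)
    qed
  next
    assume ?r
    then obtain k where "k \<le> n" "D k (n - k) (e - int k * int d)"
    proof (elim disjE bexE exE conjE)
      fix k assume "K \<le> k" "k \<le> n" "D K (n - k) (e - int k * int d)"
      then show thesis using that[of k] DK[of k] by simp
    qed
    then show ?l by (rule up_D)
  qed
  show ?case unfolding eq
  proof (rule ev_affine_min_disj)
    show "ev_affine_min (snd ` ?Y) (\<lambda>n e. \<exists>k\<in>{..<K}. k \<le> n \<and> D k (n - k) (e - int k * int d))"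
    proof (rule ev_affine_min_Bex[OF finite_lessThan])
      show "ev_affine_min (snd ` ?Y) (\<lambda>n e. k \<le> n \<and> D k (n - k) (e - int k * int d))" for k
        by (rule ev_affine_min_shift, rule ev_affine_min_mono[OF good]) auto
    qed
    have sndY: "snd ` ?Y = insert d (snd ` Y)" using q by simp
    show "ev_affine_min (snd ` ?Y) (\<lambda>n e. \<exists>k\<ge>K. k \<le> n \<and> D K (n - k) (e - int k * int d))"
      unfolding sndY by (rule ev_affine_min_ray[where ?e0.0 = e0, OF _ good]) (rule bdd)
  qed
qed

end

section \<open>Homogeneous components and associated primes\<close>

definition hcomp :: "('b, 'z) ring_scheme \<Rightarrow> (int \<Rightarrow> 'b set) \<Rightarrow> int \<Rightarrow> 'b \<Rightarrow> 'b" where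
  "hcomp G C e x = (THE f. decomposes G C x f) e"

text \<open>Abstracts the additive group with its grading, so that the same rules for components
  serve the ring and the modules.\<close>

locale graded_group = abelian_group G for G :: "('b, 'z) ring_scheme" (structure) +
  fixes C :: "int \<Rightarrow> 'b set"
  assumes group_grading: "is_grading G C"
begin

lemmas gD = gradingD[OF group_grading abelian_group_axioms]

lemma hcomp_eq: "x \<in> carrier G \<Longrightarrow> decomposes G C x f \<Longrightarrow> hcomp G C e x = f e"
  unfolding hcomp_def using gD(6) by (metis (mono_tags, lifting) theI)

lemma hcomp_decomposes: "x \<in> carrier G \<Longrightarrow> decomposes G C x (\<lambda>e. hcomp G C e x)"
  using gD(5)[of x] hcomp_eq[of x] by (metis (no_types, lifting) ext)

lemma hcomp_mem: "x \<in> carrier G \<Longrightarrow> hcomp G C e x \<in> C e"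
  using hcomp_decomposes by (simp add: decomposes_def)

lemma hcomp_carrier [simp]: "x \<in> carrier G \<Longrightarrow> hcomp G C e x \<in> carrier G"
  using hcomp_mem gD(1) by blast

lemma hcomp_finite: "x \<in> carrier G \<Longrightarrow> finite {e. hcomp G C e x \<noteq> \<zero>}"
  using hcomp_decomposes by (simp add: decomposes_def)

lemma hcomp_sum: "x \<in> carrier G \<Longrightarrow> x = (\<Oplus>e\<in>{e. hcomp G C e x \<noteq> \<zero>}. hcomp G C e x)"
  using hcomp_decomposes by (simp add: decomposes_def)

lemma component_subset: "C e \<subseteq> carrier G" using gD(1) by blast

lemma hcomp_add:
  assumes "x \<in> carrier G" "z \<in> carrier G"
  shows "hcomp G C e (x \<oplus> z) = hcomp G C e x \<oplus> hcomp G C e z"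
proof -
  let ?f = "\<lambda>e. hcomp G C e x" and ?g = "\<lambda>e. hcomp G C e z"
  let ?A = "{e. ?f e \<noteq> \<zero>} \<union> {e. ?g e \<noteq> \<zero>}"
  have fin: "finite ?A" using hcomp_finite assms by simp
  have "x = finsum G ?f ?A" "z = finsum G ?g ?A"
    using assms fin component_subset hcomp_decomposes
    by (auto intro!: decomposes_sum[OF abelian_group_axioms, where C = C])
  then have "x \<oplus> z = finsum G ?f ?A \<oplus> finsum G ?g ?A" by simp
  also have "\<dots> = (\<Oplus>e\<in>?A. ?f e \<oplus> ?g e)"
    using assms by (intro finsum_addf[symmetric]) auto
  finally have "decomposes G C (x \<oplus> z) (\<lambda>e. ?f e \<oplus> ?g e)"
    using fin hcomp_mem assms gD(3) component_subset
    by (intro decomposesI[OF abelian_group_axioms, where A = ?A]) auto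
  then show ?thesis using assms by (intro hcomp_eq) auto
qed

lemma hcomp_homogeneous:
  assumes "x \<in> C d"
  shows "hcomp G C e x = (if e = d then x else \<zero>)"
proof -
  have xc: "x \<in> carrier G" using assms gD(1) by blast
  have "x = finsum G (\<lambda>e. if d = e then x else \<zero>) {d}" using xc by simp
  then have "decomposes G C x (\<lambda>e. if d = e then x else \<zero>)"
    using assms gD(2) component_subset by (intro decomposesI[OF abelian_group_axioms, where A = "{d}"]) auto
  from hcomp_eq[OF xc this] show ?thesis by simp
qed

lemma hcomp_zero [simp]: "hcomp G C e \<zero> = \<zero>"
  using hcomp_homogeneous[OF gD(2)] by simp

lemma hcomp_finsum:
  assumes "finite A" "g \<in> A \<rightarrow> carrier G"
  shows "hcomp G C e (finsum G g A) = (\<Oplus>i\<in>A. hcomp G C e (g i))"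
  using assms
proof (induction A rule: finite_induct)
  case (insert a A)
  then have "finsum G g A \<in> carrier G" "g a \<in> carrier G" by (auto intro: finsum_closed)
  then show ?case using insert by (auto simp: hcomp_add Pi_iff)
qed simp

lemma hcomp_minus:
  assumes "x \<in> carrier G"
  shows "hcomp G C e (\<ominus> x) = \<ominus> hcomp G C e x"
proof -
  have "hcomp G C e (\<ominus> x) \<oplus> hcomp G C e x = \<zero>"
    using hcomp_add[of "\<ominus> x" x e] assms by (simp add: l_neg)
  then show ?thesis using assms by (intro minus_equality[symmetric]) auto
qed

end

lemma (in nat_graded_ring) ring_graded_group: "graded_group R (rcomp R)"
  by (intro graded_group.intro graded_group_axioms.intro abelian_group_axioms grading)

locale graded_module_over = module_over_graded R G + graded_module R G
  for R :: "'a graded_ring" (structure) and G :: "('a, 'b) graded_module" (structure)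
begin

sublocale gr: graded_group G "mcomp G"
  by (intro graded_group.intro graded_group_axioms.intro M.abelian_group_axioms module_grading)

sublocale rg: graded_group R "rcomp R" by (rule ring_graded_group)

abbreviation hc where "hc e x \<equiv> hcomp G (mcomp G) e x"
abbreviation rc where "rc i a \<equiv> hcomp R (rcomp R) i a"

lemma hcomp_smult_homogeneous:
  assumes r: "r \<in> rcomp R i" and x: "x \<in> carrier G"
  shows "hc e (r \<odot>\<^bsub>G\<^esub> x) = r \<odot>\<^bsub>G\<^esub> hc (e - i) x"
proof -
  have rcar: "r \<in> carrier R" using rcomp_carrier[OF r] .
  let ?A = "{e. hc e x \<noteq> \<zero>\<^bsub>G\<^esub>}"
  have "hc e (r \<odot>\<^bsub>G\<^esub> x) = hc e (\<Oplus>\<^bsub>G\<^esub>j\<in>?A. r \<odot>\<^bsub>G\<^esub> hc j x)"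
    using gr.hcomp_sum[OF x] gr.hcomp_finite[OF x] x rcar by (simp flip: finsum_smult_ldistr)
  also have "\<dots> = (\<Oplus>\<^bsub>G\<^esub>j\<in>?A. hc e (r \<odot>\<^bsub>G\<^esub> hc j x))"
    using gr.hcomp_finite[OF x] x rcar by (intro gr.hcomp_finsum) auto
  also have "\<dots> = (\<Oplus>\<^bsub>G\<^esub>j\<in>?A. if e - i = j then r \<odot>\<^bsub>G\<^esub> hc j x else \<zero>\<^bsub>G\<^esub>)"
    using x rcar gr.hcomp_homogeneous[OF smult_degree[OF r gr.hcomp_mem[OF x]]]
    by (intro M.finsum_cong') auto
  also have "\<dots> = r \<odot>\<^bsub>G\<^esub> hc (e - i) x"
  proof (cases "e - i \<in> ?A")
    case True
    then show ?thesis using gr.hcomp_finite[OF x] x rcar by (intro M.finsum_singleton) auto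
  next
    case False
    then have "(\<Oplus>\<^bsub>G\<^esub>j\<in>?A. if e - i = j then r \<odot>\<^bsub>G\<^esub> hc j x else \<zero>\<^bsub>G\<^esub>) = (\<Oplus>\<^bsub>G\<^esub>j\<in>?A. \<zero>\<^bsub>G\<^esub>)"
      by (intro M.finsum_cong') auto
    then show ?thesis using False rcar by simp
  qed
  finally show ?thesis .
qed

lemma finsum_smult_rdistr:
  assumes "finite A" "g \<in> A \<rightarrow> carrier R" "x \<in> carrier G"
  shows "(\<Oplus>i\<in>A. g i) \<odot>\<^bsub>G\<^esub> x = (\<Oplus>\<^bsub>G\<^esub>i\<in>A. g i \<odot>\<^bsub>G\<^esub> x)"
  using assms(1,2)
proof (induction A rule: finite_induct)
  case (insert a A)
  then have "finsum R g A \<in> carrier R" "g a \<in> carrier R" by (auto intro: finsum_closed)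
  then show ?case using insert assms(3) by (auto simp: smult_l_distr Pi_iff)
qed (simp add: assms(3))

lemma hcomp_smult:
  assumes r: "r \<in> carrier R" and x: "x \<in> carrier G"
  shows "hc e (r \<odot>\<^bsub>G\<^esub> x) = (\<Oplus>\<^bsub>G\<^esub>i\<in>{i. rc i r \<noteq> \<zero>}. rc i r \<odot>\<^bsub>G\<^esub> hc (e - i) x)"
proof -
  let ?A = "{i. rc i r \<noteq> \<zero>}"
  have fin: "finite ?A" by (rule rg.hcomp_finite[OF r])
  have "r \<odot>\<^bsub>G\<^esub> x = (\<Oplus>i\<in>?A. rc i r) \<odot>\<^bsub>G\<^esub> x" using rg.hcomp_sum[OF r] by simp
  also have "\<dots> = (\<Oplus>\<^bsub>G\<^esub>i\<in>?A. rc i r \<odot>\<^bsub>G\<^esub> x)"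
    using fin x r by (intro finsum_smult_rdistr) auto
  finally have "hc e (r \<odot>\<^bsub>G\<^esub> x) = (\<Oplus>\<^bsub>G\<^esub>i\<in>?A. hc e (rc i r \<odot>\<^bsub>G\<^esub> x))"
    using gr.hcomp_finsum[OF fin, of "\<lambda>i. rc i r \<odot>\<^bsub>G\<^esub> x"] x r by simp
  also have "\<dots> = (\<Oplus>\<^bsub>G\<^esub>i\<in>?A. rc i r \<odot>\<^bsub>G\<^esub> hc (e - i) x)"
    using x r hcomp_smult_homogeneous[OF rg.hcomp_mem[OF r] x] by (intro M.finsum_cong') auto
  finally show ?thesis .
qed

lemma add_subgroup_finsum:
  assumes "subgroup S (add_monoid G)" "finite A" "g \<in> A \<rightarrow> S"
  shows "finsum G g A \<in> S"
  using assms(2,3)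
proof (induction A rule: finite_induct)
  case (insert a A)
  then have "g \<in> A \<rightarrow> carrier G" "g a \<in> carrier G" using add_subgroupD(1)[OF assms(1)] by auto
  then show ?case using insert add_subgroupD(3)[OF assms(1)] by auto
qed (simp add: add_subgroupD(2)[OF assms(1)])

lemma smult_closed_if_homogeneous:
  assumes S: "subgroup S (add_monoid G)"
    and h: "\<And>i r x. r \<in> rcomp R i \<Longrightarrow> x \<in> S \<Longrightarrow> r \<odot>\<^bsub>G\<^esub> x \<in> S"
    and r: "r \<in> carrier R" and x: "x \<in> S"
  shows "r \<odot>\<^bsub>G\<^esub> x \<in> S"
proof -
  let ?A = "{i. rc i r \<noteq> \<zero>}"
  have fin: "finite ?A" by (rule rg.hcomp_finite[OF r])
  have xc: "x \<in> carrier G" using add_subgroupD(1)[OF S x] .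
  have "r \<odot>\<^bsub>G\<^esub> x = (\<Oplus>i\<in>?A. rc i r) \<odot>\<^bsub>G\<^esub> x" using rg.hcomp_sum[OF r] by simp
  also have "\<dots> = (\<Oplus>\<^bsub>G\<^esub>i\<in>?A. rc i r \<odot>\<^bsub>G\<^esub> x)"
    using fin xc r by (intro finsum_smult_rdistr) auto
  also have "\<dots> \<in> S" using h[OF rg.hcomp_mem[OF r] x] by (intro add_subgroup_finsum[OF S fin]) auto
  finally show ?thesis .
qed

lemma hcomp_in_homogeneous_subset:
  assumes "homogeneous_subset G (mcomp G) K" "K \<subseteq> carrier G" "x \<in> K"
  shows "hc e x \<in> K"
proof -
  obtain f where f: "decomposes G (\<lambda>n. K \<inter> mcomp G n) x f"
    using assms by (auto simp: homogeneous_subset_def)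
  then have "decomposes G (mcomp G) x f" by (auto simp: decomposes_def)
  then have "hc e x = f e" using gr.hcomp_eq assms by blast
  then show ?thesis using f by (auto simp: decomposes_def)
qed

lemma submodule_smult_homogeneous:
  assumes B: "submodule B R G" "\<And>x e. x \<in> B \<Longrightarrow> hc e x \<in> B"
    and x: "x \<in> carrier G" and a: "a \<in> rcomp R i" "a \<odot>\<^bsub>G\<^esub> x \<in> B"
  shows "a \<odot>\<^bsub>G\<^esub> hc e x \<in> B"
  using B(2)[OF a(2), of "e + i"] hcomp_smult_homogeneous[OF a(1) x, of "e + i"] by simp

text \<open>Let \<open>e0\<close> be the least degree for which \<open>(B : f\<^sub>e\<^sub>0)\<close> is contained in \<open>p\<close>; it exists since otherwise
  \<open>f\<close> would be killed by some element outside \<open>p\<close>. Comparing least components shows that \<open>p\<close> is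
  homogeneous, and then \<open>p = (B : f\<^sub>e\<^sub>0)\<close>.\<close>

lemma prime_colon_homogeneous:
  assumes B: "submodule B R G" "\<And>x e. x \<in> B \<Longrightarrow> hc e x \<in> B"
    and f: "f \<in> carrier G" and p: "primeideal p R" "p = {a \<in> carrier R. a \<odot>\<^bsub>G\<^esub> f \<in> B}"
  shows "\<exists>e. p = {a \<in> carrier R. a \<odot>\<^bsub>G\<^esub> hc e f \<in> B}"
proof -
  interpret p: primeideal p R by fact
  note BE = submoduleE[OF B(1)]
  have pI: "a \<in> p" if "a \<in> carrier R" "a \<odot>\<^bsub>G\<^esub> f \<in> B" for a using that by (subst p(2)) simp
  have pD: "a \<odot>\<^bsub>G\<^esub> f \<in> B" if "a \<in> p" for a using that by (subst (asm) p(2)) simp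
  have one: "\<one> \<notin> p" using p.one_imp_carrier p.I_notcarr by blast
  have fc: "hc e f \<in> carrier G" for e using f by simp
  \<comment> \<open>\<open>bad e\<close> expresses that the colon ideal \<open>(B : f_e)\<close> is
    contained in \<open>p\<close>.\<close>
  define bad where "bad e \<longleftrightarrow> (\<forall>t\<in>carrier R - p. t \<odot>\<^bsub>G\<^esub> hc e f \<notin> B)" for e
  \<comment> \<open>Multiplying elements outside the prime \<open>p\<close> gives an element outside
    \<open>p\<close>, so finitely many components that are not bad have a common killer
    there.\<close>
  have kill: "\<exists>t\<in>carrier R - p. \<forall>e\<in>D. t \<odot>\<^bsub>G\<^esub> hc e f \<in> B" if "finite D" "\<And>e. e \<in> D \<Longrightarrow> \<not> bad e" for D
    using that
  proof (induction D rule: finite_induct)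
    case empty then show ?case using one by blast
  next
    case (insert e D)
    then obtain t where t: "t \<in> carrier R - p" "\<And>e. e \<in> D \<Longrightarrow> t \<odot>\<^bsub>G\<^esub> hc e f \<in> B" by blast
    obtain s where s: "s \<in> carrier R - p" "s \<odot>\<^bsub>G\<^esub> hc e f \<in> B" using insert.prems[of e] by (auto simp: bad_def)
    have "s \<otimes> t \<in> carrier R - p" using s t p.I_prime[of s t] by auto
    moreover have "(s \<otimes> t) \<odot>\<^bsub>G\<^esub> hc e' f \<in> B" if "e' \<in> insert e D" for e'
    proof (cases "e' = e")
      case True
      have "(t \<otimes> s) \<odot>\<^bsub>G\<^esub> hc e f \<in> B" using s t fc BE(4) by (simp add: smult_assoc1)
      then show ?thesis using True s t by (simp add: m_comm)
    next
      case False
      then show ?thesis using s t fc BE(4) that by (simp add: smult_assoc1)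
    qed
    ultimately show ?case by blast
  qed
  let ?F = "{e. hc e f \<noteq> \<zero>\<^bsub>G\<^esub>}"
  have finF: "finite ?F" by (rule gr.hcomp_finite[OF f])
  have B0: "\<zero>\<^bsub>G\<^esub> \<in> B" using submodule_finsum[OF B(1), of "{}"] by simp
  have badF: "{e. bad e} \<subseteq> ?F" using one B0 by (force simp: bad_def)
  have "\<exists>e. bad e"
  proof (rule ccontr)
    assume "\<not> ?thesis"
    then obtain t where t: "t \<in> carrier R - p" "\<And>e. e \<in> ?F \<Longrightarrow> t \<odot>\<^bsub>G\<^esub> hc e f \<in> B"
      using kill[OF finF] by blast
    have "t \<odot>\<^bsub>G\<^esub> f = (\<Oplus>\<^bsub>G\<^esub>e\<in>?F. t \<odot>\<^bsub>G\<^esub> hc e f)"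
      using gr.hcomp_sum[OF f] t finF fc by (subst finsum_smult_ldistr[symmetric]) auto
    also have "\<dots> \<in> B" using t by (intro submodule_finsum[OF B(1) finF]) auto
    finally have "t \<in> p" using t(1) pI by blast
    then show False using t(1) by blast
  qed
  define e0 where "e0 = Min {e. bad e}"
  have finbad: "finite {e. bad e}" using finite_subset[OF badF finF] .
  then have e0: "bad e0" using Min_in[OF finbad] \<open>\<exists>e. bad e\<close> by (auto simp: e0_def)
  have below: "\<not> bad e" if "e < e0" for e using Min_le[OF finbad, of e] that by (auto simp: e0_def)
  \<comment> \<open>Let \<open>a_s\<close> be the lowest component of \<open>a\<close> outside
    \<open>p\<close> and look at degree \<open>s + e0\<close> of \<open>a f\<close>. Components of
    \<open>a\<close> below \<open>s\<close> lie in \<open>p\<close> and contribute elements of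
    \<open>B\<close>; those above \<open>s\<close> meet components of \<open>f\<close> below
    \<open>e0\<close>, which a common \<open>t\<close> outside \<open>p\<close> sends into
    \<open>B\<close>. Only \<open>t a_s f_e0\<close> is left, so it lies in \<open>B\<close> as
    well, although \<open>t a_s\<close> is outside \<open>p\<close> and \<open>e0\<close> is
    bad.\<close>
  have hom: "rc i a \<in> p" if a: "a \<in> p" for a i
  proof (rule ccontr)
    assume i: "rc i a \<notin> p"
    have ac: "a \<in> carrier R" using a p.a_subset by blast
    let ?A = "{i. rc i a \<noteq> \<zero>}"
    have finA: "finite ?A" by (rule rg.hcomp_finite[OF ac])
    have sub: "{i. rc i a \<notin> p} \<subseteq> ?A" using p.a_subgroup additive_subgroup.zero_closed p.is_additive_subgroup by force
    define s where "s = Min {i. rc i a \<notin> p}"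
    have fins: "finite {i. rc i a \<notin> p}" using finite_subset[OF sub finA] .
    have s: "rc s a \<notin> p" using Min_in[OF fins] i by (auto simp: s_def)
    have sl: "rc i a \<in> p" if "i < s" for i using Min_le[OF fins, of i] that by (auto simp: s_def)
    have rcc: "rc i a \<in> carrier R" for i using ac by simp
    have "\<exists>t\<in>carrier R - p. \<forall>e\<in>(\<lambda>i. s + e0 - i) ` (?A - {..s}). t \<odot>\<^bsub>G\<^esub> hc e f \<in> B"
      using finA by (intro kill) (auto intro!: below)
    then obtain t where t1: "t \<in> carrier R - p"
      and t2: "\<forall>e\<in>(\<lambda>i. s + e0 - i) ` (?A - {..s}). t \<odot>\<^bsub>G\<^esub> hc e f \<in> B" by (elim bexE)
    have t: "t \<in> carrier R - p" "\<And>i. i \<in> ?A - {..s} \<Longrightarrow> t \<odot>\<^bsub>G\<^esub> hc (s + e0 - i) f \<in> B"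
      using t1 t2 by auto
    let ?g = "\<lambda>i. rc i a \<odot>\<^bsub>G\<^esub> hc (s + e0 - i) f"
    have gc: "?g i \<in> carrier G" for i using rcc fc by simp
    have g: "t \<odot>\<^bsub>G\<^esub> ?g i \<in> B" if "i \<in> ?A - {s}" for i
    proof (cases "i < s")
      case True
      then have "rc i a \<odot>\<^bsub>G\<^esub> f \<in> B" using sl pD by blast
      then show ?thesis
        using submodule_smult_homogeneous[OF B f rg.hcomp_mem[OF ac]] t BE(4) by auto
    next
      case False
      then have "rc i a \<odot>\<^bsub>G\<^esub> (t \<odot>\<^bsub>G\<^esub> hc (s + e0 - i) f) \<in> B"
        using t(2)[of i] that rcc BE(4) by auto
      then show ?thesis using t(1) rcc fc by (simp add: smult_assoc1[symmetric] m_comm)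
    qed
    have "a \<odot>\<^bsub>G\<^esub> f \<in> B" using a pD by blast
    then have "hc (s + e0) (a \<odot>\<^bsub>G\<^esub> f) \<in> B" by (rule B(2))
    then have "t \<odot>\<^bsub>G\<^esub> finsum G ?g ?A \<in> B" using hcomp_smult[OF ac f] t(1) BE(4) by auto
    moreover have sA: "s \<in> ?A" using s sub by blast
    have "finsum G ?g ?A = ?g s \<oplus>\<^bsub>G\<^esub> finsum G ?g (?A - {s})"
    proof -
      have "finsum G ?g (insert s (?A - {s})) = ?g s \<oplus>\<^bsub>G\<^esub> finsum G ?g (?A - {s})"
        using finA gc gc[of s] by (intro M.finsum_insert) auto
      then show ?thesis using sA by (simp only: insert_Diff)
    qed
    moreover have "t \<odot>\<^bsub>G\<^esub> finsum G ?g (?A - {s}) \<in> B"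
    proof -
      have "t \<odot>\<^bsub>G\<^esub> finsum G ?g (?A - {s}) = (\<Oplus>\<^bsub>G\<^esub>i\<in>?A - {s}. t \<odot>\<^bsub>G\<^esub> ?g i)"
        using t(1) finA gc by (intro finsum_smult_ldistr) auto
      then show ?thesis using submodule_finsum[OF B(1), of "?A - {s}"] g finA by auto
    qed
    moreover have cc: "finsum G ?g (?A - {s}) \<in> carrier G" using gc by (intro M.finsum_closed) auto
    ultimately have "(t \<odot>\<^bsub>G\<^esub> ?g s \<oplus>\<^bsub>G\<^esub> t \<odot>\<^bsub>G\<^esub> finsum G ?g (?A - {s})) \<oplus>\<^bsub>G\<^esub> \<ominus>\<^bsub>G\<^esub> (t \<odot>\<^bsub>G\<^esub> finsum G ?g (?A - {s})) \<in> B"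
      using t(1) gc gc[of s] BE(3,5) by (simp add: smult_r_distr)
    then have "t \<odot>\<^bsub>G\<^esub> ?g s \<in> B"
      using t(1) gc[of s] cc by (simp add: M.a_assoc M.r_neg)
    then have "(t \<otimes> rc s a) \<odot>\<^bsub>G\<^esub> hc e0 f \<in> B" using t(1) rcc fc by (simp add: smult_assoc1)
    moreover have "t \<otimes> rc s a \<in> carrier R - p" using t(1) s rcc p.I_prime[of t "rc s a"] by auto
    ultimately show False using e0 by (auto simp: bad_def)
  qed
  have "p = {a \<in> carrier R. a \<odot>\<^bsub>G\<^esub> hc e0 f \<in> B}"
  proof (intro equalityI subsetI)
    fix a assume a: "a \<in> p"
    then have ac: "a \<in> carrier R" using p.a_subset by blast
    let ?A = "{i. rc i a \<noteq> \<zero>}"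
    have "rc i a \<odot>\<^bsub>G\<^esub> hc e0 f \<in> B" for i
      using submodule_smult_homogeneous[OF B f rg.hcomp_mem[OF ac] pD[OF hom[OF a]]] .
    then have "(\<Oplus>\<^bsub>G\<^esub>i\<in>?A. rc i a \<odot>\<^bsub>G\<^esub> hc e0 f) \<in> B"
      using submodule_finsum[OF B(1) rg.hcomp_finite[OF ac]] by auto
    moreover have "(\<Oplus>\<^bsub>G\<^esub>i\<in>?A. rc i a \<odot>\<^bsub>G\<^esub> hc e0 f) = (\<Oplus>i\<in>?A. rc i a) \<odot>\<^bsub>G\<^esub> hc e0 f"
      using rg.hcomp_finite[OF ac] fc ac by (intro finsum_smult_rdistr[symmetric]) auto
    ultimately show "a \<in> {a \<in> carrier R. a \<odot>\<^bsub>G\<^esub> hc e0 f \<in> B}"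
      using rg.hcomp_sum[OF ac] ac by simp
  next
    fix a assume "a \<in> {a \<in> carrier R. a \<odot>\<^bsub>G\<^esub> hc e0 f \<in> B}"
    then show "a \<in> p" using e0 by (auto simp: bad_def)
  qed
  then show ?thesis by blast
qed

text \<open>The submodule \<open>K i\<close> of all elements with every component in
  \<open>A i\<close> recovers \<open>A i\<close> by intersection with the homogeneous parts, which
  reduces the claim to chains of ordinary submodules.\<close>

lemma homogeneous_chain_stabilises:
  assumes acc: "\<And>K :: nat \<Rightarrow> 'b set. mono K \<Longrightarrow> (\<And>i. submodule (K i) R G) \<Longrightarrow> \<exists>N. \<forall>i\<ge>N. K i = K N"
    and A: "mono A" "\<And>i. fam {} (\<lambda>_. A i)" "\<And>i. A i \<le> mcomp G"
  shows "\<exists>N. \<forall>i\<ge>N. A i = A (N :: nat)"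
proof -
  define K where "K i = {x \<in> carrier G. \<forall>e. hc e x \<in> A i e}" for i
  have K: "submodule (K i) R G" for i
  proof -
    note D = famD[OF A(2)[of i]]
    have sg: "subgroup (K i) (add_monoid G)"
    proof (rule M.add.subgroupI)
      show "K i \<subseteq> carrier G" by (auto simp: K_def)
      have "\<zero>\<^bsub>G\<^esub> \<in> K i" using D(5) by (auto simp: K_def)
      then show "K i \<noteq> {}" by blast
      show "\<ominus>\<^bsub>G\<^esub> x \<in> K i" if "x \<in> K i" for x
        using that D(7)[OF D(5)] by (fastforce simp: K_def gr.hcomp_minus a_minus_def)
      show "x \<oplus>\<^bsub>G\<^esub> z \<in> K i" if "x \<in> K i" "z \<in> K i" for x z
        using that D(6) by (auto simp: K_def gr.hcomp_add)
    qed
    have h: "r \<odot>\<^bsub>G\<^esub> x \<in> K i" if "r \<in> rcomp R j" "x \<in> K i" for r j x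
      unfolding K_def
    proof (intro CollectI conjI allI)
      have x: "x \<in> carrier G" "hc e x \<in> A i e" for e using that by (auto simp: K_def)
      show "r \<odot>\<^bsub>G\<^esub> x \<in> carrier G" using rcomp_carrier[OF that(1)] x by simp
      show "hc e (r \<odot>\<^bsub>G\<^esub> x) \<in> A i e" for e
        using D(2)[OF that(1) x(2)[of "e - j"]] hcomp_smult_homogeneous[OF that(1) x(1)] by simp
    qed
    show ?thesis
      using sg smult_closed_if_homogeneous[OF sg h] by (auto intro!: submodule.intro simp: submodule_axioms_def)
  qed
  have AK: "A i e = K i \<inter> mcomp G e" for i e
  proof (intro equalityI subsetI IntI)
    fix x assume x: "x \<in> A i e"
    show xe: "x \<in> mcomp G e" using A(3)[of i] x by (auto simp: le_fun_def)
    show "x \<in> K i" using gr.gD(1)[OF xe] x famD(5)[OF A(2)[of i]] by (auto simp: K_def gr.hcomp_homogeneous[OF xe])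
  next
    fix x assume x: "x \<in> K i \<inter> mcomp G e"
    then have "hc e x \<in> A i e" by (auto simp: K_def)
    then show "x \<in> A i e" using x gr.hcomp_homogeneous[of x e e] by simp
  qed
  have "\<exists>N. \<forall>i\<ge>N. K i = K N"
  proof (rule acc[OF _ K])
    show "mono K" using A(1) by (auto simp: mono_def le_fun_def K_def) blast
  qed
  then obtain N where N: "\<And>i. i \<ge> N \<Longrightarrow> K i = K N" by blast
  have "A i = A N" if "i \<ge> N" for i using N[OF that] by (intro ext) (simp only: AK)
  then show ?thesis by blast
qed

end

section \<open>Chain conditions for submodules and homogeneous ideals\<close>

lemma (in module) submodule_criterion:
  assumes "S \<subseteq> carrier M" "\<zero>\<^bsub>M\<^esub> \<in> S"
    and add: "\<And>x z. x \<in> S \<Longrightarrow> z \<in> S \<Longrightarrow> x \<oplus>\<^bsub>M\<^esub> z \<in> S"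
    and smult: "\<And>a x. a \<in> carrier R \<Longrightarrow> x \<in> S \<Longrightarrow> a \<odot>\<^bsub>M\<^esub> x \<in> S"
  shows "submodule S R M"
proof (rule submoduleI)
  show "\<ominus>\<^bsub>M\<^esub> x \<in> S" if "x \<in> S" for x
    using smult[of "\<ominus> \<one>" x] that assms(1) by (auto simp: smult_l_minus)
qed (use assms in auto)

lemma (in cring) ideal_criterion:
  assumes "I \<subseteq> carrier R" "\<zero> \<in> I"
    and add: "\<And>a b. a \<in> I \<Longrightarrow> b \<in> I \<Longrightarrow> a \<oplus> b \<in> I"
    and mult: "\<And>r a. r \<in> carrier R \<Longrightarrow> a \<in> I \<Longrightarrow> r \<otimes> a \<in> I"
  shows "ideal I R"
proof (rule idealI)
  show "subgroup I (add_monoid R)"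
  proof (rule add.subgroupI)
    show "\<ominus> a \<in> I" if "a \<in> I" for a
      using mult[of "\<ominus> \<one>" a] that assms(1) by (auto simp: l_minus)
  qed (use assms in auto)
  show "a \<otimes> r \<in> I" if "a \<in> I" "r \<in> carrier R" for a r
    using mult[OF that(2,1)] that assms(1) m_comm[of r a] by auto
qed (use ring_axioms mult in auto)

lemma (in module) submodule_chain_stabilises:
  assumes fg: "\<And>K. submodule K R M \<Longrightarrow> \<exists>A. finite A \<and> A \<subseteq> K \<and> K = ideal_smult M (carrier R) A"
    and K: "mono K" "\<And>i :: nat. submodule (K i) R M"
  shows "\<exists>N. \<forall>i\<ge>N. K i = K N"
proof -
  note KE = submoduleE[OF K(2)]
  have up: "x \<in> K (max i j)" if "x \<in> K i \<or> x \<in> K j" for x i j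
    using that monoD[OF K(1), of i "max i j"] monoD[OF K(1), of j "max i j"] by auto
  have "submodule (\<Union>i. K i) R M"
  proof (rule submodule_criterion)
    show "(\<Union>i. K i) \<subseteq> carrier M" using KE(1) by blast
    show "\<zero>\<^bsub>M\<^esub> \<in> (\<Union>i. K i)" using submodule_finsum[OF K(2), of "{}"] by auto
    show "a \<odot>\<^bsub>M\<^esub> x \<in> (\<Union>i. K i)" if "a \<in> carrier R" "x \<in> (\<Union>i. K i)" for a x using that KE(4) by blast
    show "x \<oplus>\<^bsub>M\<^esub> z \<in> (\<Union>i. K i)" if "x \<in> (\<Union>i. K i)" "z \<in> (\<Union>i. K i)" for x z
    proof -
      from that obtain i j where "x \<in> K i" "z \<in> K j" by blast
      then show ?thesis using KE(5)[of x "max i j" z] up[of x i j] up[of z i j] by blast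
    qed
  qed
  from fg[OF this] obtain A where A: "finite A" "A \<subseteq> (\<Union>i. K i)" "(\<Union>i. K i) = ideal_smult M (carrier R) A" by blast
  have "\<exists>N. A \<subseteq> K N" using A(1,2)
  proof (induction A rule: finite_induct)
    case (insert a A)
    then obtain N i where "A \<subseteq> K N" "a \<in> K i" by auto
    then have "insert a A \<subseteq> K (max N i)" using up by blast
    then show ?case ..
  qed simp
  then obtain N where "A \<subseteq> K N" ..
  then have N: "(\<Union>i. K i) \<subseteq> K N" unfolding A(3) by (rule ideal_smult_least[OF K(2)])
  have "K i = K N" if "i \<ge> N" for i using monoD[OF K(1) that] N by blast
  then show ?thesis by blast
qed

context nat_graded_ring
begin

lemma free_submodule_chain_stabilises:
  assumes "noetherian_ring R" "mono K" "\<And>i :: nat. submodule (K i) R (graded_free R bs)"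
  shows "\<exists>N. \<forall>i\<ge>N. K i = K N"
proof -
  interpret B: module R "graded_free R bs" by (rule free_module)
  show ?thesis
  proof (rule B.submodule_chain_stabilises[OF _ assms(2,3)])
    fix K assume K: "submodule K R (graded_free R bs)"
    show "\<exists>A. finite A \<and> A \<subseteq> K \<and> K = ideal_smult (graded_free R bs) (carrier R) A"
    proof (rule B.submodule_fg[where p = "\<lambda>j v. v j" and n = "length bs", OF assms(1) _ _ _ _ K])
      show "x = \<zero>\<^bsub>graded_free R bs\<^esub>"
        if "x \<in> carrier (graded_free R bs)" "\<And>j. j < length bs \<Longrightarrow> x j = \<zero>" for x
        using that by (auto simp: graded_free_simps PiE_iff extensional_def fun_eq_iff)
    qed (auto simp: graded_free_simps PiE_iff)
  qed
qed

text \<open>The chain is pulled back along a surjection from a graded free module; by surjectivity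
  each submodule is the image of its preimage.\<close>

lemma fg_submodule_chain_stabilises:
  assumes "noetherian_ring R" and M: "graded_module R M" "finitely_generated R M"
    and K: "mono K" "\<And>i :: nat. submodule (K i) R M"
  shows "\<exists>N. \<forall>i\<ge>N. K i = K N"
proof -
  interpret M: graded_module R M by (rule M(1))
  obtain A where A: "finite A" "A \<subseteq> carrier M" "carrier M = ideal_smult M (carrier R) A"
    using M(2) by (auto simp: finitely_generated_def)
  have "(\<lambda>n. carrier M \<inter> mcomp M n) = mcomp M"
    using gradingD(1)[OF M.module_grading M.M.abelian_group_axioms] by blast
  then have "graded_submodule R M (carrier M)"
    using M.carrier_is_submodule gradingD(5)[OF M.module_grading M.M.abelian_group_axioms]
    by (simp add: graded_submodule_def homogeneous_subset_def)
  from free_cover[OF M(1) this A] obtain bs h where h: "h \<in> mod_hom R (graded_free R bs) M"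
    "h ` carrier (graded_free R bs) = carrier M" by auto
  interpret F: module R "graded_free R bs" by (rule free_module)
  note hD = mod_homD[OF h(1)] and hz = mod_hom_zero_diff[OF F.module_axioms M.module_axioms h(1)]
  define P where "P i = {v \<in> carrier (graded_free R bs). h v \<in> K i}" for i
  have "\<exists>N. \<forall>i\<ge>N. P i = P N"
  proof (rule free_submodule_chain_stabilises[OF assms(1)])
    show "mono P" using K(1) by (auto simp: mono_def P_def)
    show "submodule (P i) R (graded_free R bs)" for i
    proof (rule F.submodule_criterion)
      note E = M.submoduleE[OF K(2)[of i]]
      have z: "\<zero>\<^bsub>M\<^esub> \<in> K i" using M.submodule_finsum[OF K(2)[of i], of "{}"] by simp
      then show "\<zero>\<^bsub>graded_free R bs\<^esub> \<in> P i" using hz(1) by (simp add: P_def)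
      show "P i \<subseteq> carrier (graded_free R bs)" by (auto simp: P_def)
      show "a \<odot>\<^bsub>graded_free R bs\<^esub> v \<in> P i" if "a \<in> carrier R" "v \<in> P i" for a v
        using that hD(3) E(4) by (auto simp: P_def)
      show "v \<oplus>\<^bsub>graded_free R bs\<^esub> w \<in> P i" if "v \<in> P i" "w \<in> P i" for v w
        using that hD(2) E(5) by (auto simp: P_def)
    qed
  qed
  then obtain N where N: "\<And>i. i \<ge> N \<Longrightarrow> P i = P N" by blast
  have KP: "K i = h ` P i" for i
  proof (intro equalityI subsetI)
    fix x assume x: "x \<in> K i"
    then have "x \<in> carrier M" using M.submoduleE(1)[OF K(2)] by blast
    then obtain v where "v \<in> carrier (graded_free R bs)" "x = h v" using h(2) by blast
    then show "x \<in> h ` P i" using x by (auto simp: P_def)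
  qed (auto simp: P_def)
  have "K i = K N" if "i \<ge> N" for i using N[OF that] by (simp only: KP)
  then show ?thesis by blast
qed

text \<open>The ring is viewed as the free module of rank one with its generator in degree 0, so
  that the argument for modules applies. The chains in question are those of homogeneous colon
  ideals.\<close>

lemma homogeneous_ideal_chain_stabilises:
  fixes A :: "nat \<Rightarrow> int \<Rightarrow> 'a set"
  assumes noeth: "noetherian_ring R" and A: "mono A" "\<And>k i. A k i \<subseteq> rcomp R i" "\<And>k i. \<zero> \<in> A k i"
    "\<And>k i a b. a \<in> A k i \<Longrightarrow> b \<in> A k i \<Longrightarrow> a \<oplus> b \<in> A k i"
    "\<And>k i j r a. r \<in> rcomp R j \<Longrightarrow> a \<in> A k i \<Longrightarrow> r \<otimes> a \<in> A k (i + j)"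
  shows "\<exists>N. \<forall>k\<ge>N. A k = A N"
proof -
  let ?F = "graded_free R [0]"
  interpret F: graded_module R ?F by (rule free_graded)
  interpret F: graded_module_over R ?F by unfold_locales
  define B where "B k i = {v \<in> carrier ?F. v 0 \<in> A k i}" for k i
  have "\<exists>N. \<forall>k\<ge>N. B k = B N"
  proof (rule F.homogeneous_chain_stabilises)
    show "\<exists>N. \<forall>i\<ge>N. K i = K N" if "mono K" "\<And>i. submodule (K i) R ?F" for K :: "nat \<Rightarrow> _"
      using free_submodule_chain_stabilises[OF noeth that] .
    show "mono B" using A(1) by (auto simp: mono_def le_fun_def B_def)
    show "F.fam {} (\<lambda>_. B k)" for k
    proof (rule F.famI)
      show "\<zero>\<^bsub>?F\<^esub> \<in> B k e" for e using A(3) by (auto simp: B_def graded_free_simps(1,2))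
      show "x \<oplus>\<^bsub>?F\<^esub> z \<in> B k e" if "x \<in> B k e" "z \<in> B k e" for x z e
        using that A(4) by (auto simp: B_def graded_free_simps PiE_iff)
      show "r \<odot>\<^bsub>?F\<^esub> x \<in> B k (e + i)" if "r \<in> rcomp R i" "x \<in> B k e" for x e r i
        using that A(5) F.rcomp_carrier by (auto simp: B_def graded_free_simps PiE_iff)
    qed (auto simp: B_def)
    show "B k \<le> mcomp ?F" for k
      using subsetD[OF A(2)] by (auto simp: B_def le_fun_def graded_free_simps PiE_iff extensional_def)
  qed
  then obtain N where N: "\<And>k. k \<ge> N \<Longrightarrow> B k = B N" by blast
  have AB: "A k i = {a \<in> carrier R. (\<lambda>j\<in>{..<length [0::int]}. a) \<in> B k i}" for k i
    using A(2)[of k i] R_gradingD(1)[of _ i] by (auto simp: B_def graded_free_simps)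
  have "A k = A N" if "k \<ge> N" for k using N[OF that] by (intro ext) (simp only: AB)
  then show ?thesis by blast
qed

end

section \<open>Annihilators modulo a filtration\<close>

context graded_module_over
begin

lemma hcomp_smult_of_homogeneous:
  assumes a: "a \<in> carrier R" and f: "f \<in> mcomp G e"
  shows "hc (e + i) (a \<odot>\<^bsub>G\<^esub> f) = rc i a \<odot>\<^bsub>G\<^esub> f"
proof -
  let ?A = "{j. rc j a \<noteq> \<zero>}"
  have fc: "f \<in> carrier G" using gr.gD(1)[OF f] .
  have "hc (e + i) (a \<odot>\<^bsub>G\<^esub> f) = (\<Oplus>\<^bsub>G\<^esub>j\<in>?A. rc j a \<odot>\<^bsub>G\<^esub> hc (e + i - j) f)"
    by (rule hcomp_smult[OF a fc])
  also have "\<dots> = (\<Oplus>\<^bsub>G\<^esub>j\<in>?A. if i = j then rc j a \<odot>\<^bsub>G\<^esub> f else \<zero>\<^bsub>G\<^esub>)"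
    using a fc by (intro M.finsum_cong') (auto simp: gr.hcomp_homogeneous[OF f])
  also have "\<dots> = rc i a \<odot>\<^bsub>G\<^esub> f"
  proof (cases "i \<in> ?A")
    case True
    then show ?thesis using rg.hcomp_finite[OF a] a fc by (intro M.finsum_singleton) auto
  next
    case False
    then have "(\<Oplus>\<^bsub>G\<^esub>j\<in>?A. if i = j then rc j a \<odot>\<^bsub>G\<^esub> f else \<zero>\<^bsub>G\<^esub>) = (\<Oplus>\<^bsub>G\<^esub>j\<in>?A. \<zero>\<^bsub>G\<^esub>)"
      by (intro M.finsum_cong') auto
    then show ?thesis using False fc by simp
  qed
  finally show ?thesis .
qed

lemma smult_in_submodule_if_components:
  assumes B: "submodule B R G" and a: "a \<in> carrier R" and f: "f \<in> carrier G"
    and c: "\<And>i. rc i a \<odot>\<^bsub>G\<^esub> f \<in> B"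
  shows "a \<odot>\<^bsub>G\<^esub> f \<in> B"
proof -
  let ?A = "{i. rc i a \<noteq> \<zero>}"
  have "a \<odot>\<^bsub>G\<^esub> f = (\<Oplus>i\<in>?A. rc i a) \<odot>\<^bsub>G\<^esub> f" using rg.hcomp_sum[OF a] by simp
  also have "\<dots> = (\<Oplus>\<^bsub>G\<^esub>i\<in>?A. rc i a \<odot>\<^bsub>G\<^esub> f)"
    using rg.hcomp_finite[OF a] f a by (intro finsum_smult_rdistr) auto
  also have "\<dots> \<in> B" using c rg.hcomp_finite[OF a] by (intro submodule_finsum[OF B]) auto
  finally show ?thesis .
qed

end

text \<open>Isolates what the study of annihilators uses. \<open>B n\<close> is a full submodule, so
  that \<open>(B n : f)\<close> is an ideal of \<open>R\<close>, whereas \<open>V\<close> enters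
  only through homogeneous elements.\<close>

locale graded_filtration = graded_module_over R G
  for R :: "'a graded_ring" (structure) and G :: "('a, 'b) graded_module" (structure) +
  fixes Y :: "('a \<times> nat) set" and B :: "nat \<Rightarrow> 'b set" and V :: "nat \<Rightarrow> int \<Rightarrow> 'b set"
  assumes Y: "finite Y" "Y \<subseteq> carrier R \<times> UNIV"
    and B_submodule: "\<And>n. submodule (B n) R G"
    and B_homogeneous: "\<And>n x e. x \<in> B n \<Longrightarrow> hcomp G (mcomp G) e x \<in> B n"
    and B_ops: "\<And>t d n x. (t, d) \<in> Y \<Longrightarrow> x \<in> B n \<Longrightarrow> t \<odot>\<^bsub>G\<^esub> x \<in> B (Suc n)"
    and V: "bigraded_family R G Y V" "\<And>n e. V n e \<subseteq> mcomp G e"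
    and B_le_V: "\<And>n e. B n \<inter> mcomp G e \<subseteq> V n e"
    and noeth_V: "noetherian_between R G Y (\<lambda>n e. B n \<inter> mcomp G e) V"
begin

abbreviation Bf where "Bf \<equiv> \<lambda>n e. B n \<inter> mcomp G e"

lemmas BE = submoduleE[OF B_submodule]

lemma B_zero: "\<zero>\<^bsub>G\<^esub> \<in> B n" using submodule_finsum[OF B_submodule, of "{}"] by simp

lemma V_carrier: "f \<in> V n e \<Longrightarrow> f \<in> carrier G" using V(2) gr.gD(1) by blast

lemma fam_Bf: "fam Y Bf"
proof (rule famI)
  show "t \<odot>\<^bsub>G\<^esub> x \<in> Bf (Suc n) (e + int d)" if "(t, d) \<in> Y" "x \<in> Bf n e" for t d x n e
    using that B_ops[of t d x n] famD(3)[OF V(1) that(1)] B_le_V V(2) by blast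
  show "r \<odot>\<^bsub>G\<^esub> x \<in> Bf n (e + i)" if "r \<in> rcomp R i" "x \<in> Bf n e" for r i x n e
    using that BE(4) rcomp_carrier smult_degree[of r i x e] by (simp add: add.commute)
qed (use gr.gD(1-3) BE(5) B_zero in auto)

text \<open>\<open>X\<close> collects the elements killed by \<open>p\<close> modulo
  \<open>B\<close>, and \<open>T\<close> those of them that are also killed by something outside
  \<open>p\<close>; what lies in \<open>X\<close> but not in \<open>T\<close> has annihilator
  exactly \<open>p\<close>. Primality makes \<open>T\<close> closed under sums: the product of two
  killers outside \<open>p\<close> is again outside \<open>p\<close>.\<close>

lemma ev_affine_min_colon:
  assumes p: "primeideal p R" and bounded: "\<And>e. e < e0 \<Longrightarrow> mcomp G e = {\<zero>\<^bsub>G\<^esub>}"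
  shows "ev_affine_min (snd ` Y) (\<lambda>n e. \<exists>f\<in>V n e. p = {a \<in> carrier R. a \<odot>\<^bsub>G\<^esub> f \<in> B n})"
proof -
  interpret p: primeideal p R by fact
  have one: "\<one> \<notin> p" using p.one_imp_carrier p.I_notcarr by blast
  have pc: "a \<in> carrier R" if "a \<in> p" for a using that p.a_subset by blast
  define X where "X n e = {f \<in> V n e. \<forall>a\<in>p. a \<odot>\<^bsub>G\<^esub> f \<in> B n}" for n e
  define T where "T n e = {f \<in> X n e. \<exists>s\<in>carrier R - p. s \<odot>\<^bsub>G\<^esub> f \<in> B n}" for n e
  note DV = famD[OF V(1)]
  have comm: "a \<odot>\<^bsub>G\<^esub> (r \<odot>\<^bsub>G\<^esub> f) = r \<odot>\<^bsub>G\<^esub> (a \<odot>\<^bsub>G\<^esub> f)"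
    if "a \<in> carrier R" "r \<in> carrier R" "f \<in> V n e" for a r f n e
    using that V_carrier by (simp add: smult_assoc1[symmetric] m_comm)
  have X: "fam Y X"
  proof (rule famI)
    show "\<zero>\<^bsub>G\<^esub> \<in> X n e" for n e using DV(5) B_zero pc by (auto simp: X_def)
    show "x \<oplus>\<^bsub>G\<^esub> z \<in> X n e" if "x \<in> X n e" "z \<in> X n e" for x z n e
      using that DV(6) BE(5) pc V_carrier by (auto simp: X_def smult_r_distr)
    show "r \<odot>\<^bsub>G\<^esub> x \<in> X n (e + i)" if "r \<in> rcomp R i" "x \<in> X n e" for r i x n e
    proof -
      have "a \<odot>\<^bsub>G\<^esub> (r \<odot>\<^bsub>G\<^esub> x) \<in> B n" if a: "a \<in> p" for a
        using \<open>x \<in> X n e\<close> comm[OF pc[OF a] rcomp_carrier[OF \<open>r \<in> rcomp R i\<close>]] BE(4) a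
          rcomp_carrier[OF \<open>r \<in> rcomp R i\<close>] by (auto simp: X_def)
      then show ?thesis using that DV(2) by (auto simp: X_def)
    qed
    show "t \<odot>\<^bsub>G\<^esub> x \<in> X (Suc n) (e + int d)" if "(t, d) \<in> Y" "x \<in> X n e" for t d x n e
    proof -
      have t: "t \<in> carrier R" using that(1) Y by auto
      have "a \<odot>\<^bsub>G\<^esub> (t \<odot>\<^bsub>G\<^esub> x) \<in> B (Suc n)" if a: "a \<in> p" for a
        using \<open>x \<in> X n e\<close> comm[OF pc[OF a] t] B_ops[OF \<open>(t, d) \<in> Y\<close>] a by (auto simp: X_def)
      then show ?thesis using that DV(3) by (auto simp: X_def)
    qed
  qed (use V_carrier in \<open>auto simp: X_def\<close>)
  note DX = famD[OF X]
  have T: "fam Y T"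
  proof (rule famI)
    show "\<zero>\<^bsub>G\<^esub> \<in> T n e" for n e using DX(5) B_zero one by (auto simp: T_def intro!: bexI[of _ \<one>])
    show "x \<oplus>\<^bsub>G\<^esub> z \<in> T n e" if xz: "x \<in> T n e" "z \<in> T n e" for x z n e
    proof -
      from xz obtain s s' where s: "s \<in> carrier R - p" "s \<odot>\<^bsub>G\<^esub> x \<in> B n" "s' \<in> carrier R - p" "s' \<odot>\<^bsub>G\<^esub> z \<in> B n"
        and X: "x \<in> X n e" "z \<in> X n e" by (auto simp: T_def)
      have c: "x \<in> V n e" "z \<in> V n e" "x \<in> carrier G" "z \<in> carrier G" using X V_carrier by (auto simp: X_def)
      have "(s \<otimes> s') \<odot>\<^bsub>G\<^esub> (x \<oplus>\<^bsub>G\<^esub> z) = s' \<odot>\<^bsub>G\<^esub> (s \<odot>\<^bsub>G\<^esub> x) \<oplus>\<^bsub>G\<^esub> s \<odot>\<^bsub>G\<^esub> (s' \<odot>\<^bsub>G\<^esub> z)"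
        using s c comm by (simp add: smult_r_distr smult_assoc1)
      also have "\<dots> \<in> B n" using s BE(4,5) by auto
      finally have "(s \<otimes> s') \<odot>\<^bsub>G\<^esub> (x \<oplus>\<^bsub>G\<^esub> z) \<in> B n" .
      moreover have "s \<otimes> s' \<in> carrier R - p" using s p.I_prime[of s s'] by auto
      ultimately show ?thesis using DX(6)[OF X] by (auto simp: T_def)
    qed
    show "r \<odot>\<^bsub>G\<^esub> x \<in> T n (e + i)" if "r \<in> rcomp R i" "x \<in> T n e" for r i x n e
    proof -
      from that obtain s where s: "s \<in> carrier R - p" "s \<odot>\<^bsub>G\<^esub> x \<in> B n" "x \<in> X n e" by (auto simp: T_def)
      then have "s \<odot>\<^bsub>G\<^esub> (r \<odot>\<^bsub>G\<^esub> x) \<in> B n"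
        using comm[of s r x n e] rcomp_carrier[OF that(1)] BE(4) by (auto simp: X_def)
      then show ?thesis using DX(2)[OF that(1) s(3)] s by (auto simp: T_def)
    qed
    show "t \<odot>\<^bsub>G\<^esub> x \<in> T (Suc n) (e + int d)" if "(t, d) \<in> Y" "x \<in> T n e" for t d x n e
    proof -
      from that obtain s where s: "s \<in> carrier R - p" "s \<odot>\<^bsub>G\<^esub> x \<in> B n" "x \<in> X n e" by (auto simp: T_def)
      have "t \<in> carrier R" using that(1) Y by auto
      then have "s \<odot>\<^bsub>G\<^esub> (t \<odot>\<^bsub>G\<^esub> x) \<in> B (Suc n)"
        using comm[of s t x n e] B_ops[OF that(1) s(2)] s by (auto simp: X_def)
      then show ?thesis using DX(3)[OF that(1) s(3)] s by (auto simp: T_def)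
    qed
  qed (use DX(4) in \<open>auto simp: T_def\<close>)
  have noethTX: "noeth Y T X"
  proof (rule noeth_mono[OF noeth_V])
    show "Bf \<le> T"
    proof (rule le_famI)
      fix n e x assume x: "x \<in> Bf n e"
      then have "x \<in> X n e" using B_le_V BE(4) pc by (auto simp: X_def)
      then show "x \<in> T n e" using one x gr.gD(1) by (auto simp: T_def intro!: bexI[of _ \<one>])
    qed
    show "X \<le> V" by (auto simp: X_def le_fun_def)
  qed
  have "ev_affine_min (snd ` Y) (\<lambda>n e. \<exists>x\<in>X n e. x \<notin> T n e)"
  proof (rule ev_affine_min_degree[OF X Y(2,1) order_refl T _ noethTX])
    show "T \<le> X" by (auto simp: T_def le_fun_def)
    \<comment> \<open>Below \<open>e0\<close> only zero is left, and zero belongs to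
      \<open>T\<close>.\<close>
    show "e0 \<le> e" if x: "x \<in> X n e" "x \<notin> T n e" for n e x
    proof (rule ccontr)
      assume "\<not> e0 \<le> e"
      then have "mcomp G e = {\<zero>\<^bsub>G\<^esub>}" using bounded by auto
      then have "x = \<zero>\<^bsub>G\<^esub>" using x(1) V(2) by (auto simp: X_def)
      then show False using x(2) famD(5)[OF T] by simp
    qed
  qed
  moreover have "(\<exists>x\<in>X n e. x \<notin> T n e) \<longleftrightarrow> (\<exists>f\<in>V n e. p = {a \<in> carrier R. a \<odot>\<^bsub>G\<^esub> f \<in> B n})" for n e
    using pc by (auto simp: X_def T_def)
  ultimately show ?thesis by simp
qed

text \<open>Take a family \<open>W\<close> with finitely many associated primes that is maximal for this. If \<open>W \<noteq> V\<close>, enlarge it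
  by the elements killed modulo \<open>W\<close> by a maximal annihilator \<open>h\<close>; the only new prime is the one with homogeneous
  elements \<open>h\<close>.\<close>

lemma finite_prime_colons:
  assumes noeth: "noetherian_ring R"
  shows "finite {p. primeideal p R \<and> (\<exists>n e. \<exists>f\<in>V n e. p = {a \<in> carrier R. a \<odot>\<^bsub>G\<^esub> f \<in> B n})}"
proof -
  define ass where "ass W = {p. primeideal p R \<and> (\<exists>n e. \<exists>f\<in>W n e. p = {a \<in> carrier R. a \<odot>\<^bsub>G\<^esub> f \<in> B n})}"
    for W :: "nat \<Rightarrow> int \<Rightarrow> 'b set"
  have one: "\<one> \<notin> p" if "primeideal p R" for p
    using primeideal.I_notcarr[OF that] ideal.one_imp_carrier[OF primeideal.axioms(1)[OF that]] by blast
  define S where "S = {W. fam Y W \<and> Bf \<le> W \<and> W \<le> V \<and> finite (ass W)}"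
  have "ass Bf = {}"
  proof -
    have "\<one> \<in> {a \<in> carrier R. a \<odot>\<^bsub>G\<^esub> f \<in> B n}" if "f \<in> Bf n e" for f n e
      using that gr.gD(1)[of f e] by simp
    then show ?thesis using one unfolding ass_def by blast
  qed
  moreover have "Bf \<le> V" using B_le_V by (auto simp: le_fun_def)
  ultimately have BS: "Bf \<in> S" using fam_Bf by (simp add: S_def)
  have "\<exists>W\<in>S. \<forall>W'\<in>S. W \<le> W' \<longrightarrow> W' = W"
  proof (rule acc_has_maximal[OF BS])
    fix A :: "nat \<Rightarrow> nat \<Rightarrow> int \<Rightarrow> 'b set" assume "mono A" "\<And>i. A i \<in> S"
    then show "\<exists>N. \<forall>i\<ge>N. A i = A N" by (intro noethD[OF noeth_V]) (auto simp: S_def)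
  qed
  then obtain W where W: "W \<in> S" "\<And>W'. W' \<in> S \<Longrightarrow> W \<le> W' \<Longrightarrow> W' = W" by blast
  have WY: "fam Y W" and BW: "Bf \<le> W" and WV: "W \<le> V" and Wfin: "finite (ass W)" using W(1) by (auto simp: S_def)
  note DW = famD[OF WY] and DV = famD[OF V(1)]
  \<comment> \<open>The homogeneous elements of the colon \<open>(W : x)\<close>, sorted by degree.
    As \<open>W\<close> is known only through its bigraded pieces, this replaces the colon ideal
    when a maximal one is chosen.\<close>
  define hcol where "hcol n e x i = {a \<in> rcomp R i. a \<odot>\<^bsub>G\<^esub> x \<in> W n (e + i)}" for n e x and i :: int
  have "W = V"
  proof (rule ccontr)
    assume "W \<noteq> V"
    then obtain n0 e0 x0 where "x0 \<in> V n0 e0" "x0 \<notin> W n0 e0"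
      using WV by (meson antisym le_famI)
    define H where "H = {hcol n e x |n e x. x \<in> V n e \<and> x \<notin> W n e}"
    have "\<exists>h\<in>H. \<forall>h'\<in>H. h \<le> h' \<longrightarrow> h' = h"
    proof (rule acc_has_maximal)
      show "hcol n0 e0 x0 \<in> H" using \<open>x0 \<in> V n0 e0\<close> \<open>x0 \<notin> W n0 e0\<close> by (auto simp: H_def)
      fix A :: "nat \<Rightarrow> int \<Rightarrow> 'a set" assume A: "mono A" "\<And>i. A i \<in> H"
      have ex: "\<exists>n e x. A k = hcol n e x \<and> x \<in> V n e" for k using A(2)[of k] by (auto simp: H_def)
      show "\<exists>N. \<forall>k\<ge>N. A k = A N"
      proof (rule homogeneous_ideal_chain_stabilises[OF noeth A(1)])
        fix k i
        obtain n e x where Ak: "A k = hcol n e x" and x: "x \<in> carrier G" using ex[of k] V_carrier by blast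
        show "A k i \<subseteq> rcomp R i" "\<zero> \<in> A k i"
          using x DW(5) R_gradingD(2) by (auto simp: Ak hcol_def)
        show "a \<oplus> b \<in> A k i" if "a \<in> A k i" "b \<in> A k i" for a b
          using that x DW(6) R_gradingD(3) rcomp_carrier by (auto simp: Ak hcol_def smult_l_distr)
        show "r \<otimes> a \<in> A k (i + j)" if r: "r \<in> rcomp R j" and a: "a \<in> A k i" for r a j
        proof -
          have "r \<odot>\<^bsub>G\<^esub> (a \<odot>\<^bsub>G\<^esub> x) \<in> W n (e + i + j)" using DW(2)[OF r] a by (auto simp: Ak hcol_def)
          moreover have "a \<in> rcomp R i" using a by (auto simp: Ak hcol_def)
          ultimately show ?thesis using mult_degree[OF r, of a i] x rcomp_carrier[OF r] rcomp_carrier[of a i]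
            by (simp add: Ak hcol_def smult_assoc1 algebra_simps)
        qed
      qed
    qed
    then obtain h where h: "h \<in> H" "\<And>h'. h' \<in> H \<Longrightarrow> h \<le> h' \<Longrightarrow> h' = h" by blast
    obtain n1 e1 x1 where x1: "x1 \<in> V n1 e1" "x1 \<notin> W n1 e1" "h = hcol n1 e1 x1" using h(1) by (auto simp: H_def)
    have hR: "a \<in> rcomp R i" "a \<in> carrier R" if "a \<in> h i" for a i
      using that rcomp_carrier by (auto simp: x1(3) hcol_def)
    define W' where "W' n e = {f \<in> V n e. \<forall>i. \<forall>a\<in>h i. a \<odot>\<^bsub>G\<^esub> f \<in> W n (e + i)}" for n e
    have comm: "a \<odot>\<^bsub>G\<^esub> (r \<odot>\<^bsub>G\<^esub> f) = r \<odot>\<^bsub>G\<^esub> (a \<odot>\<^bsub>G\<^esub> f)"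
      if "a \<in> carrier R" "r \<in> carrier R" "f \<in> carrier G" for a r f
      using that by (simp add: smult_assoc1[symmetric] m_comm)
    have W'Y: "fam Y W'"
    proof (rule famI)
      show "x \<in> carrier G" if "x \<in> W' n e" for x n e using that V_carrier by (auto simp: W'_def)
      show "\<zero>\<^bsub>G\<^esub> \<in> W' n e" for n e using DV(5) DW(5) hR by (auto simp: W'_def)
      show "x \<oplus>\<^bsub>G\<^esub> z \<in> W' n e" if "x \<in> W' n e" "z \<in> W' n e" for x z n e
        using that DV(6) DW(6) hR V_carrier by (auto simp: W'_def smult_r_distr)
      show "r \<odot>\<^bsub>G\<^esub> x \<in> W' n (e + j)" if r: "r \<in> rcomp R j" and x: "x \<in> W' n e" for r x n e j
      proof -
        have xV: "x \<in> V n e" and xW: "\<And>i a. a \<in> h i \<Longrightarrow> a \<odot>\<^bsub>G\<^esub> x \<in> W n (e + i)" using x by (auto simp: W'_def)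
        have "a \<odot>\<^bsub>G\<^esub> (r \<odot>\<^bsub>G\<^esub> x) \<in> W n (e + j + i)" if a: "a \<in> h i" for a i
          using DW(2)[OF r xW[OF a]] comm[OF hR(2)[OF a] rcomp_carrier[OF r] V_carrier[OF xV]]
          by (simp add: algebra_simps)
        then show ?thesis using DV(2)[OF r xV] by (auto simp: W'_def)
      qed
      show "t \<odot>\<^bsub>G\<^esub> x \<in> W' (Suc n) (e + int d)" if t: "(t, d) \<in> Y" and x: "x \<in> W' n e" for t x n e d
      proof -
        have tc: "t \<in> carrier R" using t Y by auto
        have xV: "x \<in> V n e" and xW: "\<And>i a. a \<in> h i \<Longrightarrow> a \<odot>\<^bsub>G\<^esub> x \<in> W n (e + i)" using x by (auto simp: W'_def)
        have "a \<odot>\<^bsub>G\<^esub> (t \<odot>\<^bsub>G\<^esub> x) \<in> W (Suc n) (e + int d + i)" if a: "a \<in> h i" for a i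
          using DW(3)[OF t xW[OF a]] comm[OF hR(2)[OF a] tc V_carrier[OF xV]]
          by (simp add: algebra_simps)
        then show ?thesis using DV(3)[OF t xV] by (auto simp: W'_def)
      qed
    qed
    have WW': "W \<le> W'"
      using le_famD[OF WV] DW(2) hR(1) by (intro le_famI) (auto simp: W'_def)
    \<comment> \<open>If some homogeneous multiple \<open>r f\<close> lies in \<open>W\<close> but
      not in \<open>B n\<close>, then \<open>r\<close> is outside \<open>q\<close>, and primality
      gives \<open>(B : r f) = (B : f) = q\<close>, an old prime. Otherwise colons of
      \<open>f\<close> into \<open>W\<close> and into \<open>B\<close> have the same homogeneous
      elements; \<open>f\<close> is not in \<open>W\<close>, its colon contains \<open>h\<close>,
      and maximality of \<open>h\<close> determines \<open>q\<close>.\<close>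
    have q: "q \<in> ass W \<or> q = {a \<in> carrier R. \<forall>i. rc i a \<in> h i}" if q: "q \<in> ass W'" for q
    proof -
      obtain n e f where f: "f \<in> W' n e" and qf: "q = {a \<in> carrier R. a \<odot>\<^bsub>G\<^esub> f \<in> B n}" and qp: "primeideal q R"
        using q by (auto simp: ass_def)
      interpret q: primeideal q R by fact
      have qI: "a \<in> q" if "a \<in> carrier R" "a \<odot>\<^bsub>G\<^esub> f \<in> B n" for a using that by (subst qf) simp
      have qD: "a \<odot>\<^bsub>G\<^esub> f \<in> B n" if "a \<in> q" for a using that by (subst (asm) qf) simp
      have fV: "f \<in> V n e" using f by (simp add: W'_def)
      have fm: "f \<in> mcomp G e" and fc: "f \<in> carrier G" using fV V(2) V_carrier by blast+
      show ?thesis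
      proof (cases "\<exists>i. \<exists>r\<in>rcomp R i. r \<odot>\<^bsub>G\<^esub> f \<in> W n (e + i) \<and> r \<odot>\<^bsub>G\<^esub> f \<notin> B n")
        case True
        then obtain i r where r: "r \<in> rcomp R i" "r \<odot>\<^bsub>G\<^esub> f \<in> W n (e + i)" "r \<odot>\<^bsub>G\<^esub> f \<notin> B n" by blast
        have rcar: "r \<in> carrier R" and rq: "r \<notin> q" using rcomp_carrier[OF r(1)] r(3) qD by blast+
        have "a \<in> q \<longleftrightarrow> a \<odot>\<^bsub>G\<^esub> (r \<odot>\<^bsub>G\<^esub> f) \<in> B n" if a: "a \<in> carrier R" for a
        proof
          assume "a \<in> q"
          then show "a \<odot>\<^bsub>G\<^esub> (r \<odot>\<^bsub>G\<^esub> f) \<in> B n" using comm[OF a rcar fc] BE(4)[OF rcar qD] by simp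
        next
          assume "a \<odot>\<^bsub>G\<^esub> (r \<odot>\<^bsub>G\<^esub> f) \<in> B n"
          then have "a \<otimes> r \<in> q" using a rcar fc by (intro qI) (simp_all add: smult_assoc1)
          then show "a \<in> q" using q.I_prime[OF a rcar] rq by blast
        qed
        then have "q = {a \<in> carrier R. a \<odot>\<^bsub>G\<^esub> (r \<odot>\<^bsub>G\<^esub> f) \<in> B n}" using q.a_subset by blast
        then show ?thesis using qp r(2) unfolding ass_def by blast
      next
        case False
        then have in_B: "r \<odot>\<^bsub>G\<^esub> f \<in> B n" if "r \<in> rcomp R i" "r \<odot>\<^bsub>G\<^esub> f \<in> W n (e + i)" for r i using that by blast
        have "f \<notin> W n e"
        proof
          assume "f \<in> W n e"
          then have "\<one> \<in> q" using in_B[OF one_degree] fc by (intro qI) simp_all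
          then show False using one[OF qp] by blast
        qed
        then have "hcol n e f \<in> H" using fV by (auto simp: H_def)
        moreover have "h \<le> hcol n e f" using f hR(1) by (auto simp: le_fun_def hcol_def W'_def)
        ultimately have hf: "h = hcol n e f" using h(2) by blast
        have "a \<in> q \<longleftrightarrow> (\<forall>i. rc i a \<in> h i)" if a: "a \<in> carrier R" for a
        proof
          assume "a \<in> q"
          then have "a \<odot>\<^bsub>G\<^esub> f \<in> B n" by (rule qD)
          then have b: "rc i a \<odot>\<^bsub>G\<^esub> f \<in> B n" for i
            using B_homogeneous[of "a \<odot>\<^bsub>G\<^esub> f" n "e + i"] hcomp_smult_of_homogeneous[OF a fm] by simp
          have "rc i a \<odot>\<^bsub>G\<^esub> f \<in> mcomp G (e + i)" for i
            using smult_degree[OF rg.hcomp_mem[OF a, of i] fm] by (simp add: add.commute)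
          then have "rc i a \<odot>\<^bsub>G\<^esub> f \<in> W n (e + i)" for i using b le_famD[OF BW] by simp
          then show "\<forall>i. rc i a \<in> h i" using rg.hcomp_mem[OF a] by (simp add: hf hcol_def)
        next
          assume "\<forall>i. rc i a \<in> h i"
          then have "rc i a \<odot>\<^bsub>G\<^esub> f \<in> B n" for i using in_B by (auto simp: hf hcol_def)
          then have "a \<odot>\<^bsub>G\<^esub> f \<in> B n" by (rule smult_in_submodule_if_components[OF B_submodule a fc])
          then show "a \<in> q" by (rule qI[OF a])
        qed
        then show ?thesis using q.a_subset by blast
      qed
    qed
    have "finite (ass W')"
      by (rule finite_subset[of _ "insert {a \<in> carrier R. \<forall>i. rc i a \<in> h i} (ass W)"]) (use q Wfin in auto)
    then have "W' \<in> S" using W'Y order_trans[OF BW WW'] by (auto simp: S_def W'_def le_fun_def)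
    then have "W' = W" using W(2) WW' by blast
    moreover have "x1 \<in> W' n1 e1" using x1 by (auto simp: W'_def hcol_def)
    ultimately show False using x1(2) by simp
  qed
  then show ?thesis using Wfin by (simp add: ass_def)
qed

end

section \<open>Quotients and homomorphisms from free modules\<close>

lemma graded_quot_simps:
  "carrier (graded_quot M N) = a_rcosets\<^bsub>M\<^esub> N" "\<zero>\<^bsub>graded_quot M N\<^esub> = N"
  "S \<oplus>\<^bsub>graded_quot M N\<^esub> S' = S <+>\<^bsub>M\<^esub> S'"
  "a \<odot>\<^bsub>graded_quot M N\<^esub> S = (\<Union>x\<in>S. N +>\<^bsub>M\<^esub> (a \<odot>\<^bsub>M\<^esub> x))"
  "mcomp (graded_quot M N) n = (\<lambda>x. N +>\<^bsub>M\<^esub> x) ` mcomp M n"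
  by (simp_all add: graded_quot_def)

locale quotient_module = module R M for R :: "'a graded_ring" (structure) and M :: "('a, 'b) graded_module" (structure) +
  fixes N :: "'b set"
  assumes N: "submodule N R M"
begin

abbreviation Q where "Q \<equiv> graded_quot M N"
abbreviation cl where "cl x \<equiv> N +>\<^bsub>M\<^esub> x"

lemmas NE = submoduleE[OF N]

sublocale ns: abelian_subgroup N M
  using N by (intro abelian_subgroupI3 additive_subgroup.intro M.abelian_group_axioms) (simp add: submodule.axioms(1))

lemma quot_carrier: "carrier Q = cl ` carrier M"
  by (auto simp: graded_quot_simps A_RCOSETS_def RCOSETS_def a_r_coset_def)

lemma cl_eq_iff: "x \<in> carrier M \<Longrightarrow> y \<in> carrier M \<Longrightarrow> cl x = cl y \<longleftrightarrow> x \<ominus>\<^bsub>M\<^esub> y \<in> N"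
proof
  assume c: "x \<in> carrier M" "y \<in> carrier M"
  assume "cl x = cl y"
  then have "cl (x \<oplus>\<^bsub>M\<^esub> \<ominus>\<^bsub>M\<^esub> y) = N" using M.a_coset_add_inv2[OF _ c NE(1)] by blast
  then show "x \<ominus>\<^bsub>M\<^esub> y \<in> N" using M.a_coset_join1[of N] c ns.a_subgroup by (simp add: a_minus_def)
next
  assume c: "x \<in> carrier M" "y \<in> carrier M"
  assume "x \<ominus>\<^bsub>M\<^esub> y \<in> N"
  then have "cl (x \<oplus>\<^bsub>M\<^esub> \<ominus>\<^bsub>M\<^esub> y) = N" using M.a_coset_join2[of _ N] c ns.a_subgroup by (simp add: a_minus_def)
  then show "cl x = cl y" using M.a_coset_add_inv1[OF _ c NE(1)] by blast
qed

lemma cl_eq_zero_iff: "x \<in> carrier M \<Longrightarrow> cl x = N \<longleftrightarrow> x \<in> N"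
  using M.a_coset_join1[of N x] M.a_coset_join2[of x N] ns.a_subgroup by blast

lemma cl_add: "x \<in> carrier M \<Longrightarrow> y \<in> carrier M \<Longrightarrow> cl x \<oplus>\<^bsub>Q\<^esub> cl y = cl (x \<oplus>\<^bsub>M\<^esub> y)"
  by (simp add: graded_quot_simps ns.a_rcos_sum)

lemma cl_smult:
  assumes "a \<in> carrier R" "x \<in> carrier M"
  shows "a \<odot>\<^bsub>Q\<^esub> cl x = cl (a \<odot>\<^bsub>M\<^esub> x)"
proof -
  have sub: "cl x \<subseteq> carrier M" using assms NE(1) by (simp add: M.a_r_coset_subset_G)
  have eq: "cl (a \<odot>\<^bsub>M\<^esub> z) = cl (a \<odot>\<^bsub>M\<^esub> x)" if z: "z \<in> cl x" for z
  proof -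
    have zc: "z \<in> carrier M" using z sub by blast
    have "cl z = cl x" using M.a_repr_independence[OF z assms(2) ns.a_subgroup] by simp
    then have "z \<ominus>\<^bsub>M\<^esub> x \<in> N" using cl_eq_iff zc assms by blast
    then have "a \<odot>\<^bsub>M\<^esub> (z \<ominus>\<^bsub>M\<^esub> x) \<in> N" using NE(4) assms by blast
    then have "a \<odot>\<^bsub>M\<^esub> z \<ominus>\<^bsub>M\<^esub> a \<odot>\<^bsub>M\<^esub> x \<in> N"
      using assms zc by (simp add: a_minus_def smult_r_distr smult_r_minus)
    then show ?thesis using cl_eq_iff assms zc by simp
  qed
  have "(\<Union>z\<in>cl x. cl (a \<odot>\<^bsub>M\<^esub> z)) = (\<Union>z\<in>cl x. cl (a \<odot>\<^bsub>M\<^esub> x))" by (rule SUP_cong[OF refl eq])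
  moreover have "x \<in> cl x" using ns.a_rcos_self assms by blast
  ultimately show ?thesis unfolding graded_quot_simps(4) by blast
qed

lemma quot_zero: "\<zero>\<^bsub>Q\<^esub> = cl \<zero>\<^bsub>M\<^esub>"
  using NE(1) by (simp add: graded_quot_simps)

lemma quot_module: "module R Q"
proof (rule moduleI)
  show "cring R" by (rule R.is_cring)
  show "abelian_group Q"
  proof (rule abelian_groupI)
    fix x assume "x \<in> carrier Q"
    then obtain u where u: "u \<in> carrier M" "x = cl u" by (auto simp: quot_carrier)
    show "\<exists>y\<in>carrier Q. y \<oplus>\<^bsub>Q\<^esub> x = \<zero>\<^bsub>Q\<^esub>"
      using u by (intro bexI[of _ "cl (\<ominus>\<^bsub>M\<^esub> u)"]) (auto simp: cl_add quot_zero quot_carrier M.l_neg)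
  qed (auto simp: quot_carrier cl_add quot_zero M.a_ac)
qed (auto simp: quot_carrier cl_add cl_smult smult_l_distr smult_r_distr smult_assoc1)

lemma cl_hom: "cl \<in> mod_hom R M Q"
  by (auto simp: mod_hom_def hom_def quot_carrier cl_add cl_smult)

end

section \<open>Homomorphisms from graded free modules\<close>

lemma graded_hom_simps:
  "carrier (graded_hom R F M) = mod_hom R F M \<inter> extensional (carrier F)"
  "\<zero>\<^bsub>graded_hom R F M\<^esub> = (\<lambda>x\<in>carrier F. \<zero>\<^bsub>M\<^esub>)"
  "f \<oplus>\<^bsub>graded_hom R F M\<^esub> g = (\<lambda>x\<in>carrier F. f x \<oplus>\<^bsub>M\<^esub> g x)"
  "a \<odot>\<^bsub>graded_hom R F M\<^esub> f = (\<lambda>x\<in>carrier F. a \<odot>\<^bsub>M\<^esub> f x)"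
  "mcomp (graded_hom R F M) n = {f \<in> mod_hom R F M \<inter> extensional (carrier F). has_degree F M f n}"
  by (simp_all add: graded_hom_def)

lemma mod_homI:
  assumes "\<And>x. x \<in> carrier F \<Longrightarrow> f x \<in> carrier M"
    "\<And>x y. x \<in> carrier F \<Longrightarrow> y \<in> carrier F \<Longrightarrow> f (x \<oplus>\<^bsub>F\<^esub> y) = f x \<oplus>\<^bsub>M\<^esub> f y"
    "\<And>a x. a \<in> carrier R \<Longrightarrow> x \<in> carrier F \<Longrightarrow> f (a \<odot>\<^bsub>F\<^esub> x) = a \<odot>\<^bsub>M\<^esub> f x"
  shows "f \<in> mod_hom R F M"
  using assms by (auto simp: mod_hom_def hom_def)

lemma graded_hom_module:
  assumes "module R F" "module R M"
  shows "module R (graded_hom R F M)"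
proof -
  interpret F: module R F by fact
  interpret M: module R M by fact
  let ?H = "graded_hom R F M"
  have smc: "(\<lambda>x\<in>carrier F. a \<odot>\<^bsub>M\<^esub> f x) \<in> mod_hom R F M" if "a \<in> carrier R" "f \<in> mod_hom R F M" for a f
    using mod_homD[OF that(2)] that(1)
    by (intro mod_homI) (auto simp: M.smult_r_distr M.smult_assoc1[symmetric] F.R.m_comm)
  have addc: "(\<lambda>x\<in>carrier F. f x \<oplus>\<^bsub>M\<^esub> g x) \<in> mod_hom R F M" if "f \<in> mod_hom R F M" "g \<in> mod_hom R F M" for f g
    using mod_homD[OF that(1)] mod_homD[OF that(2)]
    by (intro mod_homI) (auto simp: M.smult_r_distr M.M.a_ac)
  have zc: "(\<lambda>x\<in>carrier F. \<zero>\<^bsub>M\<^esub>) \<in> mod_hom R F M" by (intro mod_homI) auto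
  have D: "f \<in> extensional (carrier F)" "\<forall>x\<in>carrier F. f x \<in> carrier M" if "f \<in> carrier ?H" for f
    using that mod_homD(1)[of f R F M] by (auto simp: graded_hom_simps)
  have closed: "f \<oplus>\<^bsub>?H\<^esub> g \<in> carrier ?H" "a \<odot>\<^bsub>?H\<^esub> f \<in> carrier ?H" "\<zero>\<^bsub>?H\<^esub> \<in> carrier ?H"
    if "f \<in> carrier ?H" "g \<in> carrier ?H" "a \<in> carrier R" for f g a
    using that addc zc smc by (auto simp: graded_hom_simps)
  note simps = graded_hom_simps(2-4)
  show ?thesis
  proof (rule moduleI)
    show "cring R" by (rule F.R.is_cring)
    show "abelian_group ?H"
    proof (rule abelian_groupI)
      fix f assume f: "f \<in> carrier ?H"
      show "\<exists>g\<in>carrier ?H. g \<oplus>\<^bsub>?H\<^esub> f = \<zero>\<^bsub>?H\<^esub>"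
        using closed(2)[OF f f, of "\<ominus>\<^bsub>R\<^esub> \<one>\<^bsub>R\<^esub>"] D[OF f]
        by (intro bexI[of _ "(\<ominus>\<^bsub>R\<^esub> \<one>\<^bsub>R\<^esub>) \<odot>\<^bsub>?H\<^esub> f"])
          (auto simp: simps M.smult_l_minus M.M.l_neg intro!: restrict_ext)
      show "\<zero>\<^bsub>?H\<^esub> \<oplus>\<^bsub>?H\<^esub> f = f" using D[OF f] by (auto simp: simps extensional_def fun_eq_iff)
      fix g assume g: "g \<in> carrier ?H"
      show "f \<oplus>\<^bsub>?H\<^esub> g \<in> carrier ?H" using closed f g by blast
      show "f \<oplus>\<^bsub>?H\<^esub> g = g \<oplus>\<^bsub>?H\<^esub> f" using D[OF f] D[OF g] by (auto simp: simps M.M.a_comm fun_eq_iff)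
      fix h assume h: "h \<in> carrier ?H"
      show "f \<oplus>\<^bsub>?H\<^esub> g \<oplus>\<^bsub>?H\<^esub> h = f \<oplus>\<^bsub>?H\<^esub> (g \<oplus>\<^bsub>?H\<^esub> h)"
        using D[OF f] D[OF g] D[OF h] by (auto simp: simps M.M.a_assoc fun_eq_iff)
    next
      show "\<zero>\<^bsub>?H\<^esub> \<in> carrier ?H" using zc by (simp add: graded_hom_simps)
    qed
  next
    show "\<one>\<^bsub>R\<^esub> \<odot>\<^bsub>?H\<^esub> f = f" if "f \<in> carrier ?H" for f
      using D[OF that] by (auto simp: simps extensional_def fun_eq_iff)
    fix a f assume a: "a \<in> carrier R" and f: "f \<in> carrier ?H"
    show "a \<odot>\<^bsub>?H\<^esub> f \<in> carrier ?H" using closed a f by blast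
    { fix b assume b: "b \<in> carrier R"
      show "(a \<oplus>\<^bsub>R\<^esub> b) \<odot>\<^bsub>?H\<^esub> f = a \<odot>\<^bsub>?H\<^esub> f \<oplus>\<^bsub>?H\<^esub> b \<odot>\<^bsub>?H\<^esub> f"
        "(a \<otimes>\<^bsub>R\<^esub> b) \<odot>\<^bsub>?H\<^esub> f = a \<odot>\<^bsub>?H\<^esub> (b \<odot>\<^bsub>?H\<^esub> f)"
        using D[OF f] a b by (auto simp: simps M.smult_l_distr M.smult_assoc1 fun_eq_iff) }
    fix g assume g: "g \<in> carrier ?H"
    show "a \<odot>\<^bsub>?H\<^esub> (f \<oplus>\<^bsub>?H\<^esub> g) = a \<odot>\<^bsub>?H\<^esub> f \<oplus>\<^bsub>?H\<^esub> a \<odot>\<^bsub>?H\<^esub> g"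
      using D[OF f] D[OF g] a by (auto simp: simps M.smult_r_distr fun_eq_iff)
  qed
qed

context nat_graded_ring
begin

definition basis_vec :: "int list \<Rightarrow> nat \<Rightarrow> nat \<Rightarrow> 'a" where
  "basis_vec as j = (\<lambda>i\<in>{..<length as}. if i = j then \<one> else \<zero>)"

lemma basis_vec_carrier [simp]: "basis_vec as j \<in> carrier (graded_free R as)"
  by (auto simp: basis_vec_def graded_free_simps)

lemma basis_vec_degree: "basis_vec as j \<in> mcomp (graded_free R as) (as ! j)"
  using one_degree R_gradingD(2) by (auto simp: basis_vec_def graded_free_simps)

lemma free_carrier: "v \<in> carrier (graded_free R as) \<Longrightarrow> j < length as \<Longrightarrow> v j \<in> carrier R"
  by (auto simp: graded_free_simps PiE_iff)

lemma basis_expansion: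
  assumes v: "v \<in> carrier (graded_free R as)"
  shows "v = (\<Oplus>\<^bsub>graded_free R as\<^esub>j\<in>{..<length as}. v j \<odot>\<^bsub>graded_free R as\<^esub> basis_vec as j)"
proof -
  interpret F: module R "graded_free R as" by (rule free_module)
  let ?s = "\<Oplus>\<^bsub>graded_free R as\<^esub>j\<in>{..<length as}. v j \<odot>\<^bsub>graded_free R as\<^esub> basis_vec as j"
  have c: "(\<lambda>j. v j \<odot>\<^bsub>graded_free R as\<^esub> basis_vec as j) \<in> {..<length as} \<rightarrow> carrier (graded_free R as)"
    using free_carrier[OF v] by auto
  show ?thesis
  proof (rule extensionalityI[of _ "{..<length as}"])
    show "v \<in> extensional {..<length as}" using v by (auto simp: graded_free_simps PiE_iff)
    have "?s \<in> carrier (graded_free R as)" using c by (rule F.M.finsum_closed)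
    then show "?s \<in> extensional {..<length as}" by (auto simp: graded_free_simps PiE_iff)
    fix i assume "i \<in> {..<length as}"
    then have i: "i < length as" by simp
    have "?s i = (\<Oplus>j\<in>{..<length as}. (v j \<odot>\<^bsub>graded_free R as\<^esub> basis_vec as j) i)"
      by (rule finsum_free[OF _ c i]) simp
    also have "\<dots> = (\<Oplus>j\<in>{..<length as}. if i = j then v j else \<zero>)"
      using i free_carrier[OF v] by (intro finsum_cong') (auto simp: graded_free_simps(4) basis_vec_def)
    also have "\<dots> = v i" using i free_carrier[OF v] by (intro finsum_singleton) auto
    finally show "v i = ?s i" by simp
  qed
qed

text \<open>The homomorphism with prescribed values \<open>m j\<close> on the basis, made undefined
  outside the carrier because \<open>graded_hom\<close> consists of extensional functions.\<close>

definition free_lift :: "int list \<Rightarrow> ('a, 'b) graded_module \<Rightarrow> (nat \<Rightarrow> 'b) \<Rightarrow> (nat \<Rightarrow> 'a) \<Rightarrow> 'b" where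
  "free_lift as M m = (\<lambda>v\<in>carrier (graded_free R as). \<Oplus>\<^bsub>M\<^esub>j\<in>{..<length as}. v j \<odot>\<^bsub>M\<^esub> m j)"

abbreviation Hom where "Hom as M \<equiv> graded_hom R (graded_free R as) M"

end

locale free_hom = nat_graded_ring R + module R M
  for R :: "'a graded_ring" (structure) and M :: "('a, 'b) graded_module" (structure) +
  fixes as :: "int list"
begin

abbreviation F where "F \<equiv> graded_free R as"
abbreviation H where "H \<equiv> Hom as M"
abbreviation bv where "bv j \<equiv> basis_vec as j"

sublocale F: module R F by (rule free_module)
sublocale H: module R H by (rule graded_hom_module[OF free_module module_axioms])

lemma HD:
  assumes "f \<in> carrier H"
  shows "f \<in> mod_hom R F M" "f \<in> extensional (carrier F)" "\<And>x. x \<in> carrier F \<Longrightarrow> f x \<in> carrier M"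
  using assms mod_homD(1)[of f R F M] by (auto simp: graded_hom_simps)

lemma hom_expansion:
  assumes f: "f \<in> carrier H" and v: "v \<in> carrier F"
  shows "f v = (\<Oplus>\<^bsub>M\<^esub>j\<in>{..<length as}. v j \<odot>\<^bsub>M\<^esub> f (bv j))"
proof -
  have "f v = f (\<Oplus>\<^bsub>F\<^esub>j\<in>{..<length as}. v j \<odot>\<^bsub>F\<^esub> bv j)" using basis_expansion[OF v] by simp
  also have "\<dots> = (\<Oplus>\<^bsub>M\<^esub>j\<in>{..<length as}. f (v j \<odot>\<^bsub>F\<^esub> bv j))"
    using free_carrier[OF v] by (intro mod_hom_finsum[OF F.module_axioms module_axioms HD(1)[OF f]]) auto
  also have "\<dots> = (\<Oplus>\<^bsub>M\<^esub>j\<in>{..<length as}. v j \<odot>\<^bsub>M\<^esub> f (bv j))"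
    using free_carrier[OF v] HD[OF f] mod_homD(3)[OF HD(1)[OF f]] by (intro M.finsum_cong') auto
  finally show ?thesis .
qed

lemma hom_eqI:
  assumes "f \<in> carrier H" "g \<in> carrier H" "\<And>j. j < length as \<Longrightarrow> f (bv j) = g (bv j)"
  shows "f = g"
proof (rule extensionalityI[OF HD(2)[OF assms(1)] HD(2)[OF assms(2)]])
  fix v assume v: "v \<in> carrier F"
  show "f v = g v" unfolding hom_expansion[OF assms(1) v] hom_expansion[OF assms(2) v]
    using assms(3) HD(3)[OF assms(2)] free_carrier[OF v] by (intro M.finsum_cong') auto
qed

lemma free_lift:
  assumes m: "\<And>j. j < length as \<Longrightarrow> m j \<in> carrier M"
  shows "free_lift as M m \<in> carrier H" "\<And>j. j < length as \<Longrightarrow> free_lift as M m (bv j) = m j"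
proof -
  note fc = free_carrier[of _ as]
  have "free_lift as M m \<in> mod_hom R F M"
  proof (rule mod_homI)
    show "free_lift as M m x \<in> carrier M" if "x \<in> carrier F" for x
      using that fc m by (auto simp: free_lift_def intro!: M.finsum_closed)
    fix x assume x: "x \<in> carrier F"
    { fix z assume z: "z \<in> carrier F"
      have "(\<Oplus>\<^bsub>M\<^esub>j\<in>{..<length as}. (x \<oplus>\<^bsub>F\<^esub> z) j \<odot>\<^bsub>M\<^esub> m j) =
          (\<Oplus>\<^bsub>M\<^esub>j\<in>{..<length as}. x j \<odot>\<^bsub>M\<^esub> m j \<oplus>\<^bsub>M\<^esub> z j \<odot>\<^bsub>M\<^esub> m j)"
        using fc[OF x] fc[OF z] m by (intro M.finsum_cong') (auto simp: graded_free_simps(3) smult_l_distr)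
      also have "\<dots> = (\<Oplus>\<^bsub>M\<^esub>j\<in>{..<length as}. x j \<odot>\<^bsub>M\<^esub> m j) \<oplus>\<^bsub>M\<^esub> (\<Oplus>\<^bsub>M\<^esub>j\<in>{..<length as}. z j \<odot>\<^bsub>M\<^esub> m j)"
        using fc[OF x] fc[OF z] m by (intro M.finsum_addf) auto
      finally show "free_lift as M m (x \<oplus>\<^bsub>F\<^esub> z) = free_lift as M m x \<oplus>\<^bsub>M\<^esub> free_lift as M m z"
        using x z by (simp add: free_lift_def) }
    fix a assume a: "a \<in> carrier R"
    have "(\<Oplus>\<^bsub>M\<^esub>j\<in>{..<length as}. (a \<odot>\<^bsub>F\<^esub> x) j \<odot>\<^bsub>M\<^esub> m j) = (\<Oplus>\<^bsub>M\<^esub>j\<in>{..<length as}. a \<odot>\<^bsub>M\<^esub> (x j \<odot>\<^bsub>M\<^esub> m j))"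
      using fc[OF x] a m by (intro M.finsum_cong') (auto simp: graded_free_simps(4) smult_assoc1)
    also have "\<dots> = a \<odot>\<^bsub>M\<^esub> (\<Oplus>\<^bsub>M\<^esub>j\<in>{..<length as}. x j \<odot>\<^bsub>M\<^esub> m j)"
      using fc[OF x] a m by (intro finsum_smult_ldistr[symmetric]) auto
    finally show "free_lift as M m (a \<odot>\<^bsub>F\<^esub> x) = a \<odot>\<^bsub>M\<^esub> free_lift as M m x"
      using x a by (simp add: free_lift_def)
  qed
  then show "free_lift as M m \<in> carrier H" by (simp add: graded_hom_simps free_lift_def)
  fix i assume i: "i < length as"
  have "free_lift as M m (bv i) = (\<Oplus>\<^bsub>M\<^esub>j\<in>{..<length as}. if i = j then m j else \<zero>\<^bsub>M\<^esub>)"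
    unfolding free_lift_def restrict_apply'[OF basis_vec_carrier]
    using m by (intro M.finsum_cong') (auto simp: basis_vec_def)
  also have "\<dots> = m i" using i m by (intro M.finsum_singleton) auto
  finally show "free_lift as M m (bv i) = m i" .
qed

lemma eval_hom: "v \<in> carrier F \<Longrightarrow> (\<lambda>f. f v) \<in> mod_hom R H M"
  using HD(3) by (intro mod_homI) (auto simp: graded_hom_simps(3,4))

lemma hom_values_in_submodule_iff:
  assumes P: "submodule P R M" and f: "f \<in> carrier H"
  shows "(\<forall>v\<in>carrier F. f v \<in> P) \<longleftrightarrow> (\<forall>j<length as. f (bv j) \<in> P)"
proof
  assume P': "\<forall>j<length as. f (bv j) \<in> P"
  show "\<forall>v\<in>carrier F. f v \<in> P"
  proof
    fix v assume v: "v \<in> carrier F"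
    show "f v \<in> P" unfolding hom_expansion[OF f v]
      using P' free_carrier[OF v] submoduleE(4)[OF P] by (intro submodule_finsum[OF P]) auto
  qed
qed auto

lemma hom_into_submodule:
  assumes P: "submodule P R M"
  shows "submodule {f \<in> carrier H. \<forall>v\<in>carrier F. f v \<in> P} R H" (is "submodule ?S R H")
proof (rule H.submodule_criterion)
  note PE = submoduleE[OF P]
  have "\<zero>\<^bsub>M\<^esub> \<in> P" using submodule_finsum[OF P, of "{}"] by simp
  then show "\<zero>\<^bsub>H\<^esub> \<in> ?S" using H.M.zero_closed by (auto simp: graded_hom_simps(2))
  show "f \<oplus>\<^bsub>H\<^esub> g \<in> ?S" if "f \<in> ?S" "g \<in> ?S" for f g
    using that PE(5) H.M.add.m_closed[of f g] by (auto simp: graded_hom_simps(3))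
  show "a \<odot>\<^bsub>H\<^esub> f \<in> ?S" if "a \<in> carrier R" "f \<in> ?S" for a f
    using that PE(4) H.smult_closed[of a f] by (auto simp: graded_hom_simps(4))
qed auto

end

lemma hcomp_hom:
  assumes G: "graded_module_over R G" and G': "graded_module_over R G'" and th: "\<theta> \<in> mod_hom R G G'"
    and deg: "\<And>e x. x \<in> mcomp G e \<Longrightarrow> \<theta> x \<in> mcomp G' (e + s)" and x: "x \<in> carrier G"
  shows "hcomp G' (mcomp G') (e + s) (\<theta> x) = \<theta> (hcomp G (mcomp G) e x)"
proof -
  interpret G: graded_module_over R G by fact
  interpret G': graded_module_over R G' by fact
  let ?A = "{e. G.hc e x \<noteq> \<zero>\<^bsub>G\<^esub>}"
  note fin = G.gr.hcomp_finite[OF x] and thD = mod_homD[OF th]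
  have tc: "\<theta> (G.hc i x) \<in> carrier G'" for i using thD(1) x by simp
  have z: "\<theta> \<zero>\<^bsub>G\<^esub> = \<zero>\<^bsub>G'\<^esub>" by (rule mod_hom_zero_diff(1)[OF G.module_axioms G'.module_axioms th])
  have "\<theta> x = \<theta> (\<Oplus>\<^bsub>G\<^esub>i\<in>?A. G.hc i x)" using G.gr.hcomp_sum[OF x] by simp
  also have "\<dots> = (\<Oplus>\<^bsub>G'\<^esub>i\<in>?A. \<theta> (G.hc i x))"
    using x by (intro mod_hom_finsum[OF G.module_axioms G'.module_axioms th fin]) auto
  finally have "G'.hc (e + s) (\<theta> x) = (\<Oplus>\<^bsub>G'\<^esub>i\<in>?A. G'.hc (e + s) (\<theta> (G.hc i x)))"
    using G'.gr.hcomp_finsum[OF fin, of "\<lambda>i. \<theta> (G.hc i x)"] tc by simp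
  also have "\<dots> = (\<Oplus>\<^bsub>G'\<^esub>i\<in>?A. if e = i then \<theta> (G.hc i x) else \<zero>\<^bsub>G'\<^esub>)"
    using tc G'.gr.hcomp_homogeneous[OF deg[OF G.gr.hcomp_mem[OF x]]] by (intro G'.M.finsum_cong') auto
  also have "\<dots> = \<theta> (G.hc e x)"
  proof (cases "e \<in> ?A")
    case True
    then show ?thesis using fin tc by (intro G'.M.finsum_singleton) auto
  next
    case False
    then have "(\<Oplus>\<^bsub>G'\<^esub>i\<in>?A. if e = i then \<theta> (G.hc i x) else \<zero>\<^bsub>G'\<^esub>) = (\<Oplus>\<^bsub>G'\<^esub>i\<in>?A. \<zero>\<^bsub>G'\<^esub>)"
      by (intro G'.M.finsum_cong') auto
    then show ?thesis using False z by simp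
  qed
  finally show ?thesis .
qed

locale graded_free_hom = graded_module_over R M + free_hom R M as
  for R :: "'a graded_ring" (structure) and M :: "('a, 'b) graded_module" (structure) and as :: "int list"
begin

lemma mcomp_subgroup: "subgroup (mcomp M e) (add_monoid M)"
  using module_grading by (simp add: is_grading_def)

text \<open>The degree of a homomorphism can be tested on the basis: \<open>bv j\<close> has degree
  \<open>as ! j\<close>, and the coordinate \<open>v j\<close> of an element of degree
  \<open>m\<close> has degree \<open>m - as ! j\<close>, so the shifts cancel.\<close>

lemma H_mcomp_iff:
  assumes f: "f \<in> carrier H"
  shows "f \<in> mcomp H n \<longleftrightarrow> (\<forall>j<length as. f (bv j) \<in> mcomp M (as ! j + n))"
proof
  assume "f \<in> mcomp H n"
  then show "\<forall>j<length as. f (bv j) \<in> mcomp M (as ! j + n)"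
    using basis_vec_degree[of as] by (fastforce simp: graded_hom_simps has_degree_def image_subset_iff)
next
  assume b: "\<forall>j<length as. f (bv j) \<in> mcomp M (as ! j + n)"
  have "f v \<in> mcomp M (m + n)" if v: "v \<in> mcomp F m" for v m
  proof -
    have vc: "v \<in> carrier F" using v R_gradingD(1) by (auto simp: graded_free_simps PiE_iff)
    have "v j \<odot>\<^bsub>M\<^esub> f (bv j) \<in> mcomp M (m + n)" if j: "j < length as" for j
    proof -
      have "v j \<in> rcomp R (m - as ! j)" using v j by (auto simp: graded_free_simps)
      from smult_degree[OF this, of "f (bv j)" "as ! j + n"] b j show ?thesis by simp
    qed
    then show ?thesis unfolding hom_expansion[OF f vc]
      by (intro add_subgroup_finsum[OF mcomp_subgroup]) auto
  qed
  then show "f \<in> mcomp H n" using f by (auto simp: graded_hom_simps has_degree_def)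
qed

definition hom_component :: "((nat \<Rightarrow> 'a) \<Rightarrow> 'b) \<Rightarrow> int \<Rightarrow> (nat \<Rightarrow> 'a) \<Rightarrow> 'b" where
  "hom_component f e = free_lift as M (\<lambda>j. hc (as ! j + e) (f (bv j)))"

lemma hom_component:
  assumes f: "f \<in> carrier H"
  shows "hom_component f e \<in> carrier H" "hom_component f e \<in> mcomp H e"
    "\<And>j. j < length as \<Longrightarrow> hom_component f e (bv j) = hc (as ! j + e) (f (bv j))"
proof -
  have fc: "f (bv j) \<in> carrier M" for j using HD(3)[OF f] by simp
  show c: "hom_component f e \<in> carrier H" and
    b: "\<And>j. j < length as \<Longrightarrow> hom_component f e (bv j) = hc (as ! j + e) (f (bv j))"
    unfolding hom_component_def using fc by (auto intro!: free_lift)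
  show "hom_component f e \<in> mcomp H e"
    using b gr.hcomp_mem fc by (simp add: H_mcomp_iff[OF c])
qed

lemma mcomp_H_carrier: "f \<in> mcomp H e \<Longrightarrow> f \<in> carrier H"
  by (auto simp: graded_hom_simps)

lemma eval_finsum:
  assumes "finite A" "g \<in> A \<rightarrow> carrier H"
  shows "finsum H g A (bv j) = (\<Oplus>\<^bsub>M\<^esub>e\<in>A. g e (bv j))"
  using mod_hom_finsum[OF H.module_axioms module_axioms eval_hom[OF basis_vec_carrier] assms] by simp

lemma hom_component_decomposes:
  assumes f: "f \<in> carrier H"
  shows "decomposes H (mcomp H) f (hom_component f)"
proof -
  have fc: "f (bv j) \<in> carrier M" for j using HD(3)[OF f] by simp
  \<comment> \<open>The candidate degrees, namely the supports of the values
    \<open>f (bv j)\<close>, each shifted by the degree of \<open>bv j\<close>. The set is finite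
    because the basis is.\<close>
  define A where "A = (\<Union>j<length as. (\<lambda>e. e - as ! j) ` {e. hc e (f (bv j)) \<noteq> \<zero>\<^bsub>M\<^esub>})"
  have fin: "finite A" using gr.hcomp_finite[OF fc] by (simp add: A_def)
  have gc: "hom_component f \<in> A \<rightarrow> carrier H" using hom_component(1)[OF f] by blast
  have A0: "hc (as ! j + e) (f (bv j)) = \<zero>\<^bsub>M\<^esub>" if "e \<notin> A" "j < length as" for e j
    using that by (force simp: A_def image_iff)
  have zb: "\<zero>\<^bsub>H\<^esub> (bv j) = \<zero>\<^bsub>M\<^esub>" for j by (simp add: graded_hom_simps(2))
  have "f = finsum H (hom_component f) A"
  proof (rule hom_eqI[OF f])
    show "finsum H (hom_component f) A \<in> carrier H" using gc by (rule H.M.finsum_closed)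
    fix j assume j: "j < length as"
    let ?S = "{e. hc e (f (bv j)) \<noteq> \<zero>\<^bsub>M\<^esub>}"
    have "f (bv j) = (\<Oplus>\<^bsub>M\<^esub>e\<in>(\<lambda>e. as ! j + e) ` A. hc e (f (bv j)))"
    proof (rule decomposes_sum[OF M.abelian_group_axioms gr.hcomp_decomposes[OF fc]])
      show "finite ((\<lambda>e. as ! j + e) ` A)" using fin by simp
      show "?S \<subseteq> (\<lambda>e. as ! j + e) ` A"
      proof
        fix e assume "e \<in> ?S"
        then have "e - as ! j \<in> A" using j by (auto simp: A_def)
        then show "e \<in> (\<lambda>e. as ! j + e) ` A" by (intro image_eqI[of _ _ "e - as ! j"]) auto
      qed
    qed (rule gr.component_subset)
    also have "\<dots> = (\<Oplus>\<^bsub>M\<^esub>e\<in>A. hc (as ! j + e) (f (bv j)))"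
      using fc by (intro M.add.finprod_reindex) (auto simp: inj_on_def)
    also have "\<dots> = (\<Oplus>\<^bsub>M\<^esub>e\<in>A. hom_component f e (bv j))"
      using fc j hom_component(3)[OF f j] by (intro M.finsum_cong') auto
    also have "\<dots> = finsum H (hom_component f) A (bv j)" by (rule eval_finsum[OF fin gc, symmetric])
    finally show "f (bv j) = finsum H (hom_component f) A (bv j)" .
  qed
  then show ?thesis
  proof (intro decomposesI[OF H.M.abelian_group_axioms _ fin])
    show "hom_component f e = \<zero>\<^bsub>H\<^esub>" if "e \<notin> A" for e
      by (rule hom_eqI[OF hom_component(1)[OF f] H.M.zero_closed])
        (simp add: hom_component(3)[OF f] A0[OF that] zb)
  qed (use hom_component[OF f] mcomp_H_carrier in auto)
qed

text \<open>Evaluation at \<open>bv j\<close> turns a decomposition of \<open>f\<close> into one of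
  \<open>f (bv j)\<close>, shifted by \<open>as ! j\<close>, so uniqueness is inherited from
  \<open>M\<close>.\<close>

lemma decomposes_hom_unique:
  assumes f: "f \<in> carrier H" and g: "decomposes H (mcomp H) f g"
  shows "g = hom_component f"
proof
  fix e
  have gm: "g e \<in> mcomp H e" for e using g by (simp add: decomposes_def)
  have gcar: "g e \<in> carrier H" for e using mcomp_H_carrier[OF gm] .
  let ?A = "{e. g e \<noteq> \<zero>\<^bsub>H\<^esub>}"
  have fin: "finite ?A" using g by (simp add: decomposes_def)
  have fs: "f = finsum H g ?A" using g by (simp add: decomposes_def)
  show "g e = hom_component f e"
  proof (rule hom_eqI[OF gcar hom_component(1)[OF f]])
    fix j assume j: "j < length as"
    have fc: "f (bv j) \<in> carrier M" using HD(3)[OF f] by simp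
    have gb: "g e (bv j) \<in> mcomp M (as ! j + e)" for e using gm gcar H_mcomp_iff j by blast
    have gbc: "g e (bv j) \<in> carrier M" for e using gr.gD(1)[OF gb] .
    let ?h = "\<lambda>i. g (i - as ! j) (bv j)"
    have "f (bv j) = (\<Oplus>\<^bsub>M\<^esub>e\<in>?A. g e (bv j))" using eval_finsum[OF fin, of g j] gcar fs by simp
    also have "\<dots> = (\<Oplus>\<^bsub>M\<^esub>e\<in>?A. ?h (as ! j + e))" by simp
    also have "\<dots> = finsum M ?h ((\<lambda>e. as ! j + e) ` ?A)"
      using gbc by (intro M.add.finprod_reindex[symmetric]) (auto simp: inj_on_def)
    finally have s: "f (bv j) = finsum M ?h ((\<lambda>e. as ! j + e) ` ?A)" .
    have "decomposes M (mcomp M) (f (bv j)) ?h"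
    proof (rule decomposesI[OF M.abelian_group_axioms _ _ _ s gr.component_subset])
      show "?h n \<in> mcomp M n" for n using gb[of "n - as ! j"] by simp
      show "finite ((\<lambda>e. as ! j + e) ` ?A)" using fin by simp
      show "?h n = \<zero>\<^bsub>M\<^esub>" if "n \<notin> (\<lambda>e. as ! j + e) ` ?A" for n
      proof -
        have "n - as ! j \<notin> ?A" using that by (auto simp: image_iff)
        then show ?thesis by (simp add: graded_hom_simps(2))
      qed
    qed
    from gr.hcomp_eq[OF fc this, of "as ! j + e"]
    show "g e (bv j) = hom_component f e (bv j)" using hom_component(3)[OF f j] by simp
  qed
qed

lemma hom_graded_module: "graded_module R H"
proof (intro graded_module.intro H.module_axioms graded_module_axioms.intro)
  have "subgroup (mcomp H n) (add_monoid H)" for n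
  proof (rule H.M.add.subgroupI)
    show "mcomp H n \<subseteq> carrier H" using mcomp_H_carrier by blast
    have "\<zero>\<^bsub>H\<^esub> \<in> mcomp H n"
      using gr.gD(2) by (simp add: H_mcomp_iff[OF H.M.zero_closed]) (simp add: graded_hom_simps(2))
    then show "mcomp H n \<noteq> {}" by blast
    show "\<ominus>\<^bsub>H\<^esub> f \<in> mcomp H n" if f: "f \<in> mcomp H n" for f
    proof -
      have fc: "f \<in> carrier H" using mcomp_H_carrier[OF f] .
      have "\<ominus>\<^bsub>H\<^esub> f = (\<ominus> \<one>) \<odot>\<^bsub>H\<^esub> f" using fc by (simp add: H.smult_l_minus)
      then have "(\<ominus>\<^bsub>H\<^esub> f) (bv j) = \<ominus>\<^bsub>M\<^esub> f (bv j)" for j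
        using HD(3)[OF fc] by (simp add: graded_hom_simps(4) smult_l_minus)
      then show ?thesis using f fc gr.gD(4) by (simp add: H_mcomp_iff)
    qed
    show "f \<oplus>\<^bsub>H\<^esub> g \<in> mcomp H n" if "f \<in> mcomp H n" "g \<in> mcomp H n" for f g
    proof -
      have fc: "f \<in> carrier H" "g \<in> carrier H" using mcomp_H_carrier that by auto
      then have "f \<oplus>\<^bsub>H\<^esub> g \<in> carrier H" by simp
      moreover have "(f \<oplus>\<^bsub>H\<^esub> g) (bv j) = f (bv j) \<oplus>\<^bsub>M\<^esub> g (bv j)" for j by (simp add: graded_hom_simps(3))
      ultimately show ?thesis using that fc gr.gD(3) by (simp add: H_mcomp_iff)
    qed
  qed
  then show "is_grading H (mcomp H)"
    unfolding is_grading_def using hom_component_decomposes decomposes_hom_unique by blast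
  show "a \<odot>\<^bsub>H\<^esub> f \<in> mcomp H (m + n)" if "a \<in> rcomp R m" "f \<in> mcomp H n" for m n a f
  proof -
    have fc: "f \<in> carrier H" using mcomp_H_carrier that by auto
    then have "a \<odot>\<^bsub>H\<^esub> f \<in> carrier H" using rcomp_carrier[OF that(1)] by simp
    moreover have "(a \<odot>\<^bsub>H\<^esub> f) (bv j) = a \<odot>\<^bsub>M\<^esub> f (bv j)" for j by (simp add: graded_hom_simps(4))
    moreover have "a \<odot>\<^bsub>M\<^esub> f (bv j) \<in> mcomp M (as ! j + (m + n))" if "j < length as" for j
      using smult_degree[OF \<open>a \<in> rcomp R m\<close>, of "f (bv j)" "as ! j + n"] \<open>f \<in> mcomp H n\<close> fc that
      by (simp add: H_mcomp_iff algebra_simps)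
    ultimately show ?thesis by (simp add: H_mcomp_iff)
  qed
qed

sublocale HG: graded_module_over R H
  by (intro graded_module_over.intro module_over_graded.intro hom_graded_module nat_graded_ring_axioms H.module_axioms)

lemma hom_into_submodule_homogeneous:
  assumes P: "submodule P R M" "\<And>x e. x \<in> P \<Longrightarrow> hc e x \<in> P"
    and f: "f \<in> carrier H" "\<forall>v\<in>carrier F. f v \<in> P"
  shows "\<forall>v\<in>carrier F. HG.hc e f v \<in> P"
proof -
  have "HG.hc e f = hom_component f e"
    by (rule HG.gr.hcomp_eq[OF f(1) hom_component_decomposes[OF f(1)]])
  then show ?thesis
    using hom_values_in_submodule_iff[OF P(1)] hom_component(1,3)[OF f(1)] P(2) f by simp
qed

end

lemma (in nat_graded_ring) precompose_hom:
  assumes M: "module R M" and ph: "\<phi> \<in> mod_hom R (graded_free R as') (graded_free R as)"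
  shows "(\<lambda>f. compose (carrier (graded_free R as')) f \<phi>) \<in> mod_hom R (Hom as M) (Hom as' M)"
proof -
  interpret M: module R M by fact
  interpret A: free_hom R M as by (intro free_hom.intro nat_graded_ring_axioms M)
  interpret B: free_hom R M as' by (intro free_hom.intro nat_graded_ring_axioms M)
  note phD = mod_homD[OF ph]
  show ?thesis
  proof (rule mod_homI)
    fix f assume f: "f \<in> carrier A.H"
    note fD = mod_homD[OF A.HD(1)[OF f]]
    have "compose (carrier B.F) f \<phi> \<in> mod_hom R B.F M"
      using phD fD by (intro mod_homI) (auto simp: compose_def)
    then show "compose (carrier B.F) f \<phi> \<in> carrier B.H" by (simp add: graded_hom_simps compose_def)
  qed (use phD in \<open>auto simp: graded_hom_simps compose_def fun_eq_iff\<close>)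
qed

lemma precompose_degree:
  assumes "has_degree F' F \<phi> 0" "\<phi> \<in> mod_hom R F' F" "f \<in> mcomp (graded_hom R F M) n"
    and "(\<lambda>f. compose (carrier F') f \<phi>) \<in> mod_hom R (graded_hom R F M) (graded_hom R F' M)"
    and "\<And>m. mcomp F' m \<subseteq> carrier F'"
  shows "compose (carrier F') f \<phi> \<in> mcomp (graded_hom R F' M) n"
proof -
  have "compose (carrier F') f \<phi> \<in> carrier (graded_hom R F' M)"
    using mod_homD(1)[OF assms(4), of f] assms(3) by (simp add: graded_hom_simps)
  moreover have "compose (carrier F') f \<phi> v \<in> mcomp M (m + n)" if v: "v \<in> mcomp F' m" for v m
    using assms(1,3,5) v by (fastforce simp: graded_hom_simps has_degree_def compose_def image_subset_iff)
  ultimately show ?thesis by (auto simp: graded_hom_simps has_degree_def)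
qed

section \<open>Powers of an ideal\<close>

context module
begin

lemma ideal_smult_least_subgroup:
  assumes "subgroup K (add_monoid M)" "\<And>a x. a \<in> A \<Longrightarrow> x \<in> N \<Longrightarrow> a \<odot>\<^bsub>M\<^esub> x \<in> K"
  shows "ideal_smult M A N \<subseteq> K"
  unfolding ideal_smult_def using assms by (intro M.add.generate_subgroup_incl) auto

lemma ideal_smult_incl: "a \<in> A \<Longrightarrow> x \<in> N \<Longrightarrow> a \<odot>\<^bsub>M\<^esub> x \<in> ideal_smult M A N"
  unfolding ideal_smult_def by (intro generate.incl) auto

lemma ideal_smult_subgroup:
  assumes "A \<subseteq> carrier R" "N \<subseteq> carrier M"
  shows "subgroup (ideal_smult M A N) (add_monoid M)"
  unfolding ideal_smult_def using assms by (intro M.add.generate_is_subgroup) auto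

text \<open>Allows a containment of \<open>a Q\<close> in \<open>S\<close>, for an additively
  generated \<open>Q\<close>, to be checked on the generators of \<open>Q\<close>.\<close>

lemma vimage_smult_subgroup:
  assumes S: "subgroup S (add_monoid M)" and a: "a \<in> carrier R"
  shows "subgroup {z \<in> carrier M. a \<odot>\<^bsub>M\<^esub> z \<in> S} (add_monoid M)"
proof (rule M.add.subgroupI)
  have "\<zero>\<^bsub>M\<^esub> \<in> S" using subgroup.one_closed[OF S] by simp
  then show "{z \<in> carrier M. a \<odot>\<^bsub>M\<^esub> z \<in> S} \<noteq> {}" using a by (auto intro!: exI[of _ "\<zero>\<^bsub>M\<^esub>"])
  show "\<ominus>\<^bsub>M\<^esub> z \<in> {z \<in> carrier M. a \<odot>\<^bsub>M\<^esub> z \<in> S}" if "z \<in> {z \<in> carrier M. a \<odot>\<^bsub>M\<^esub> z \<in> S}" for z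
    using that a subgroup.m_inv_closed[OF S, of "a \<odot>\<^bsub>M\<^esub> z"] by (auto simp: smult_r_minus a_inv_def[symmetric])
  show "x \<oplus>\<^bsub>M\<^esub> z \<in> {z \<in> carrier M. a \<odot>\<^bsub>M\<^esub> z \<in> S}"
    if "x \<in> {z \<in> carrier M. a \<odot>\<^bsub>M\<^esub> z \<in> S}" "z \<in> {z \<in> carrier M. a \<odot>\<^bsub>M\<^esub> z \<in> S}" for x z
    using that a subgroup.m_closed[OF S] by (auto simp: smult_r_distr)
qed auto

lemma ideal_smult_submodule:
  assumes A: "ideal A R" and N: "N \<subseteq> carrier M"
  shows "submodule (ideal_smult M A N) R M"
proof -
  interpret A: ideal A R by fact
  have Ac: "A \<subseteq> carrier R" using A.a_subset .
  note S = ideal_smult_subgroup[OF Ac N]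
  have "r \<odot>\<^bsub>M\<^esub> x \<in> ideal_smult M A N" if r: "r \<in> carrier R" and x: "x \<in> ideal_smult M A N" for r x
  proof -
    have "ideal_smult M A N \<subseteq> {z \<in> carrier M. r \<odot>\<^bsub>M\<^esub> z \<in> ideal_smult M A N}"
    proof (rule ideal_smult_least_subgroup[OF vimage_smult_subgroup[OF S r]])
      fix a z assume a: "a \<in> A" and z: "z \<in> N"
      then have "r \<odot>\<^bsub>M\<^esub> (a \<odot>\<^bsub>M\<^esub> z) = (r \<otimes> a) \<odot>\<^bsub>M\<^esub> z" using r Ac N by (subst smult_assoc1) auto
      then show "a \<odot>\<^bsub>M\<^esub> z \<in> {z \<in> carrier M. r \<odot>\<^bsub>M\<^esub> z \<in> ideal_smult M A N}"
        using ideal_smult_incl[OF A.I_l_closed[OF a r] z] a z Ac N by auto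
    qed
    then show ?thesis using x by blast
  qed
  then show ?thesis using S by (auto intro!: submodule.intro simp: submodule_axioms_def)
qed

lemma ideal_smult_prod:
  assumes A: "ideal A R" and B: "ideal B R" and N: "N \<subseteq> carrier M"
  shows "ideal_smult M (ideal_prod R A B) N = ideal_smult M A (ideal_smult M B N)"
proof (intro equalityI)
  have Ac: "A \<subseteq> carrier R" and Bc: "B \<subseteq> carrier R"
    using A B by (auto dest: additive_subgroup.a_subset ideal.axioms(1))
  note BN = ideal_smult_submodule[OF B N]
  have BNc: "ideal_smult M B N \<subseteq> carrier M" using submoduleE(1)[OF BN] .
  note S = ideal_smult_subgroup[OF Ac BNc]
  show "ideal_smult M (ideal_prod R A B) N \<subseteq> ideal_smult M A (ideal_smult M B N)"
  proof (rule ideal_smult_least_subgroup[OF S])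
    fix c x assume c: "c \<in> ideal_prod R A B" and x: "x \<in> N"
    have xc: "x \<in> carrier M" using x N by blast
    from c have "c \<in> carrier R \<and> c \<odot>\<^bsub>M\<^esub> x \<in> ideal_smult M A (ideal_smult M B N)"
    proof (induction rule: ideal_prod.induct)
      case (prod i j)
      have ij: "i \<in> carrier R" "j \<in> carrier R" using prod Ac Bc by auto
      have "i \<odot>\<^bsub>M\<^esub> (j \<odot>\<^bsub>M\<^esub> x) \<in> ideal_smult M A (ideal_smult M B N)"
        using ideal_smult_incl[OF prod(1) ideal_smult_incl[OF prod(2) x]] .
      then show ?case using ij xc by (simp add: smult_assoc1)
    next
      case (sum s1 s2)
      then show ?case using xc subgroup.m_closed[OF S] by (auto simp: smult_l_distr)
    qed
    then show "c \<odot>\<^bsub>M\<^esub> x \<in> ideal_smult M A (ideal_smult M B N)" ..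
  qed
  have Pc: "ideal_prod R A B \<subseteq> carrier R" by (rule R.ideal_prod_in_carrier[OF A B])
  note T = ideal_smult_subgroup[OF Pc N]
  show "ideal_smult M A (ideal_smult M B N) \<subseteq> ideal_smult M (ideal_prod R A B) N"
  proof (rule ideal_smult_least_subgroup[OF T])
    fix a z assume a: "a \<in> A" and z: "z \<in> ideal_smult M B N"
    have ac: "a \<in> carrier R" using a Ac by blast
    have "ideal_smult M B N \<subseteq> {z \<in> carrier M. a \<odot>\<^bsub>M\<^esub> z \<in> ideal_smult M (ideal_prod R A B) N}"
    proof (rule ideal_smult_least_subgroup[OF vimage_smult_subgroup[OF T ac]])
      fix b x assume b: "b \<in> B" and x: "x \<in> N"
      have bx: "b \<in> carrier R" "x \<in> carrier M" using b x Bc N by auto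
      have "(a \<otimes> b) \<odot>\<^bsub>M\<^esub> x \<in> ideal_smult M (ideal_prod R A B) N"
        by (intro ideal_smult_incl ideal_prod.prod a b x)
      then show "b \<odot>\<^bsub>M\<^esub> x \<in> {z \<in> carrier M. a \<odot>\<^bsub>M\<^esub> z \<in> ideal_smult M (ideal_prod R A B) N}"
        using ac bx by (simp add: smult_assoc1)
    qed
    then show "a \<odot>\<^bsub>M\<^esub> z \<in> ideal_smult M (ideal_prod R A B) N" using z by blast
  qed
qed

end

context cring
begin

lemma ideal_power_ideal: "ideal I R \<Longrightarrow> ideal (ideal_power R I n) R"
  using monoid.nat_pow_closed[OF comm_monoid.axioms(1)[OF ideals_set_is_comm_monoid], of I n]
  by (simp add: ideals_set_def)

lemma ideal_power_0: "ideal_power R I (0 :: nat) = carrier R"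
  by (simp add: nat_pow_def ideals_set_def)

lemma ideal_power_Suc: "ideal I R \<Longrightarrow> ideal_power R I (Suc n) = ideal_prod R I (ideal_power R I n)"
proof -
  assume I: "ideal I R"
  have "ideal_power R I (Suc n) = ideal_prod R (ideal_power R I n) I"
    by (simp add: nat_pow_def ideals_set_def)
  then show ?thesis using ideal_prod_commute[OF ideal_power_ideal[OF I] I] by simp
qed

lemma ideal_power_add:
  assumes I: "ideal I R"
  shows "ideal_power R I (m + n) = ideal_prod R (ideal_power R I m) (ideal_power R I n)"
  using monoid.nat_pow_mult[OF comm_monoid.axioms(1)[OF ideals_set_is_comm_monoid], of I m n] I
  by (simp add: ideals_set_def)

text \<open>The equation \<open>J I^m = I^(m+1)\<close> is multiplied by
  \<open>I^(n-m)\<close>.\<close>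

lemma reduction_eventually:
  assumes I: "ideal I R" and J: "ideal J R"
    and red: "ideal_prod R J (ideal_power R I m) = ideal_power R I (m + 1)" and n: "m \<le> n"
  shows "ideal_power R I (Suc n) = ideal_prod R J (ideal_power R I n)"
proof -
  note p = ideal_power_ideal[OF I]
  obtain k where k: "n = m + k" using n le_Suc_ex by blast
  have "ideal_power R I (Suc n) = ideal_power R I ((m + 1) + k)" by (simp add: k)
  also have "\<dots> = ideal_prod R (ideal_prod R J (ideal_power R I m)) (ideal_power R I k)"
    unfolding ideal_power_add[OF I, of "m + 1" k] red ..
  also have "\<dots> = ideal_prod R J (ideal_prod R (ideal_power R I m) (ideal_power R I k))"
    by (rule ideal_prod_assoc[OF J p p])
  finally show ?thesis by (simp add: k ideal_power_add[OF I])
qed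

lemma pow_in_ideal_power:
  assumes I: "ideal I R" and a: "a \<in> I"
  shows "a [^] (n :: nat) \<in> ideal_power R I n"
proof (induction n)
  case 0 then show ?case unfolding ideal_power_0 by simp
next
  case (Suc n)
  have ac: "a \<in> carrier R" using a additive_subgroup.a_subset[OF ideal.axioms(1)[OF I]] by blast
  have "a \<otimes> a [^] n \<in> ideal_prod R I (ideal_power R I n)" using a Suc by (rule ideal_prod.prod)
  then show ?case unfolding ideal_power_Suc[OF I] using ac by (simp add: m_comm)
qed

end

locale graded_powers = graded_module_over R M
  for R :: "'a graded_ring" (structure) and M :: "('a, 'b) graded_module" (structure) +
  fixes N :: "'b set" and I :: "'a set"
  assumes graded_N: "graded_submodule R M N" and homogeneous_I: "homogeneous_ideal R I"
begin

definition P :: "nat \<Rightarrow> 'b set" where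
  "P n = ideal_smult M (ideal_power R I n) N"

lemma I_ideal: "ideal I R" using homogeneous_I by (simp add: homogeneous_ideal_def)

lemma I_carrier: "a \<in> I \<Longrightarrow> a \<in> carrier R"
  using additive_subgroup.a_subset[OF ideal.axioms(1)[OF I_ideal]] by blast

lemma I_component: "a \<in> I \<Longrightarrow> rc i a \<in> I"
proof -
  assume a: "a \<in> I"
  obtain f where f: "decomposes R (\<lambda>n. I \<inter> rcomp R n) a f"
    using homogeneous_I a by (auto simp: homogeneous_ideal_def homogeneous_subset_def)
  then have "decomposes R (rcomp R) a f" by (auto simp: decomposes_def)
  then have "rc i a = f i" using rg.hcomp_eq[OF I_carrier[OF a]] by blast
  then show "rc i a \<in> I" using f by (auto simp: decomposes_def)
qed

lemma N_submodule: "submodule N R M" using graded_N by (simp add: graded_submodule_def)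

lemma N_carrier: "N \<subseteq> carrier M" using submoduleE(1)[OF N_submodule] .

lemma P_submodule: "submodule (P n) R M"
  unfolding P_def by (rule ideal_smult_submodule[OF ideal_power_ideal[OF I_ideal] N_carrier])

lemma P_carrier: "P n \<subseteq> carrier M" using submoduleE(1)[OF P_submodule] .

lemma P_Suc: "P (Suc n) = ideal_smult M I (P n)"
  unfolding P_def ideal_power_Suc[OF I_ideal]
  by (rule ideal_smult_prod[OF I_ideal ideal_power_ideal[OF I_ideal] N_carrier])

lemma P_0: "P 0 = N"
proof -
  have "N \<subseteq> ideal_smult M (carrier R) N" using ideal_smult_carrier_submodule(2)[OF N_carrier] .
  moreover have "ideal_smult M (carrier R) N \<subseteq> N" using ideal_smult_least[OF N_submodule] by blast
  ultimately show ?thesis unfolding P_def ideal_power_0 by (rule antisym[rotated])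
qed

lemma smult_P: "a \<in> I \<Longrightarrow> x \<in> P n \<Longrightarrow> a \<odot>\<^bsub>M\<^esub> x \<in> P (Suc n)"
  unfolding P_Suc by (rule ideal_smult_incl)

lemma component_vimage_subgroup:
  assumes S: "subgroup S (add_monoid M)"
  shows "subgroup {x \<in> carrier M. hc e x \<in> S} (add_monoid M)"
proof (rule M.add.subgroupI)
  note D = add_subgroupD[OF S]
  show "{x \<in> carrier M. hc e x \<in> S} \<noteq> {}" using D(2) by (auto intro!: exI[of _ "\<zero>\<^bsub>M\<^esub>"])
  show "\<ominus>\<^bsub>M\<^esub> x \<in> {x \<in> carrier M. hc e x \<in> S}" if "x \<in> {x \<in> carrier M. hc e x \<in> S}" for x
    using that subgroup.m_inv_closed[OF S, of "hc e x"] by (auto simp: gr.hcomp_minus a_inv_def[symmetric])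
  show "x \<oplus>\<^bsub>M\<^esub> z \<in> {x \<in> carrier M. hc e x \<in> S}"
    if "x \<in> {x \<in> carrier M. hc e x \<in> S}" "z \<in> {x \<in> carrier M. hc e x \<in> S}" for x z
    using that D(3) by (auto simp: gr.hcomp_add)
qed auto

text \<open>A component of \<open>a z\<close> is a finite sum of products of components of
  \<open>a\<close> and \<open>z\<close>, which stay in \<open>I\<close> and
  \<open>P n\<close>.\<close>

lemma P_homogeneous: "x \<in> P n \<Longrightarrow> hc e x \<in> P n"
proof (induction n arbitrary: x e)
  case 0
  then show ?case using hcomp_in_homogeneous_subset[of N] graded_N N_carrier
    by (auto simp: P_0 graded_submodule_def)
next
  case (Suc n)
  have S: "subgroup (P (Suc n)) (add_monoid M)" by (rule submodule.axioms(1)[OF P_submodule])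
  have "P (Suc n) \<subseteq> {x \<in> carrier M. hc e x \<in> P (Suc n)}"
    unfolding P_Suc[of n]
  proof (rule ideal_smult_least_subgroup[OF component_vimage_subgroup[OF S], unfolded P_Suc])
    fix a z assume a: "a \<in> I" and z: "z \<in> P n"
    have c: "a \<in> carrier R" "z \<in> carrier M" using I_carrier a z P_carrier by auto
    have "hc e (a \<odot>\<^bsub>M\<^esub> z) \<in> P (Suc n)"
      unfolding hcomp_smult[OF c] using smult_P[OF I_component[OF a] Suc.IH[OF z]]
      by (intro submodule_finsum[OF P_submodule rg.hcomp_finite[OF c(1)]]) auto
    then show "a \<odot>\<^bsub>M\<^esub> z \<in> {x \<in> carrier M. hc e x \<in> ideal_smult M I (P n)}"
      using c by (simp add: P_Suc)
  qed
  then show ?case using Suc.prems by blast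
qed

text \<open>From the reduction exponent on, \<open>P (Suc n)\<close> is \<open>J\<close> times
  \<open>P n\<close>. Coefficients from \<open>R\<close> are absorbed by \<open>P n\<close>, so a
  homogeneous piece is generated additively by the \<open>y i\<close> times homogeneous pieces. This
  is the form of generation that the basis theorem above asks for.\<close>

lemma P_generated:
  assumes J: "is_reduction R J I" and y: "\<forall>i\<in>A. y i \<in> rcomp R (int (dg i))" and JI: "J = Idl (y ` A)"
  shows "\<exists>m. \<forall>n\<ge>m. \<forall>e S. subgroup S (add_monoid M) \<longrightarrow>
    (\<forall>i\<in>A. \<forall>x\<in>P n \<inter> mcomp M (e - int (dg i)). y i \<odot>\<^bsub>M\<^esub> x \<in> S) \<longrightarrow> P (Suc n) \<inter> mcomp M e \<subseteq> S"
proof -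
  obtain m where m: "ideal_prod R J (ideal_power R I m) = ideal_power R I (m + 1)" and Jid: "ideal J R"
    using J by (auto simp: is_reduction_def)
  show ?thesis
  proof (intro exI[of _ m] allI impI subsetI)
    fix n e S x
    assume n: "m \<le> n" and S: "subgroup S (add_monoid M)"
      and gen: "\<forall>i\<in>A. \<forall>x\<in>P n \<inter> mcomp M (e - int (dg i)). y i \<odot>\<^bsub>M\<^esub> x \<in> S"
      and x: "x \<in> P (Suc n) \<inter> mcomp M e"
    note SD = add_subgroupD[OF S]
    let ?Q = "{x \<in> carrier M. hc e x \<in> S}"
    note Q = component_vimage_subgroup[OF S, of e]
    note QD = add_subgroupD[OF Q]
    have PJ: "P (Suc n) = ideal_smult M J (P n)"
      unfolding P_def reduction_eventually[OF I_ideal Jid m n]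
      by (rule ideal_smult_prod[OF Jid ideal_power_ideal[OF I_ideal] N_carrier])
    \<comment> \<open>The ring elements that send \<open>P n\<close> into the elements whose degree
      \<open>e\<close> component lies in \<open>S\<close>. They form an ideal, so it suffices to
      find the generators \<open>y i\<close> of \<open>J\<close> in it.\<close>
    let ?K = "{j \<in> carrier R. \<forall>z\<in>P n. j \<odot>\<^bsub>M\<^esub> z \<in> ?Q}"
    have zc: "z \<in> carrier M" if "z \<in> P n" for z using that P_carrier by blast
    have K: "ideal ?K R"
    proof (rule ideal_criterion)
      show "\<zero> \<in> ?K" using QD(2) zc SD(2) by auto
    next
      fix i j assume ij: "i \<in> ?K" "j \<in> ?K"
      show "i \<oplus> j \<in> ?K"
      proof (intro CollectI conjI ballI)
        show "i \<oplus> j \<in> carrier R" using ij by simp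
        fix z assume z: "z \<in> P n"
        have "i \<odot>\<^bsub>M\<^esub> z \<oplus>\<^bsub>M\<^esub> j \<odot>\<^bsub>M\<^esub> z \<in> ?Q" using QD(3)[of "i \<odot>\<^bsub>M\<^esub> z" "j \<odot>\<^bsub>M\<^esub> z"] ij z by blast
        moreover have "(i \<oplus> j) \<odot>\<^bsub>M\<^esub> z = i \<odot>\<^bsub>M\<^esub> z \<oplus>\<^bsub>M\<^esub> j \<odot>\<^bsub>M\<^esub> z" using ij zc[OF z] by (simp add: smult_l_distr)
        ultimately show "(i \<oplus> j) \<odot>\<^bsub>M\<^esub> z \<in> carrier M" "hc e ((i \<oplus> j) \<odot>\<^bsub>M\<^esub> z) \<in> S" by auto
      qed
    next
      fix r j assume r: "r \<in> carrier R" and j: "j \<in> ?K"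
      show "r \<otimes> j \<in> ?K"
      proof (intro CollectI conjI ballI)
        show "r \<otimes> j \<in> carrier R" using r j by simp
        fix z assume z: "z \<in> P n"
        have "r \<odot>\<^bsub>M\<^esub> z \<in> P n" using submoduleE(4)[OF P_submodule] r z by blast
        then have "j \<odot>\<^bsub>M\<^esub> (r \<odot>\<^bsub>M\<^esub> z) \<in> ?Q" using j by blast
        moreover have "(r \<otimes> j) \<odot>\<^bsub>M\<^esub> z = j \<odot>\<^bsub>M\<^esub> (r \<odot>\<^bsub>M\<^esub> z)"
          using r j zc[OF z] by (simp add: m_comm smult_assoc1)
        ultimately show "(r \<otimes> j) \<odot>\<^bsub>M\<^esub> z \<in> carrier M" "hc e ((r \<otimes> j) \<odot>\<^bsub>M\<^esub> z) \<in> S" by auto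
      qed
    qed auto
    have "y ` A \<subseteq> ?K"
    proof
      fix j assume "j \<in> y ` A"
      then obtain i where i: "i \<in> A" "j = y i" by blast
      have yi: "y i \<in> rcomp R (int (dg i))" using y i by blast
      have "hc e (y i \<odot>\<^bsub>M\<^esub> z) \<in> S" if z: "z \<in> P n" for z
        using gen i P_homogeneous[OF z] gr.hcomp_mem[OF zc[OF z]] hcomp_smult_homogeneous[OF yi zc[OF z]] by simp
      then show "j \<in> ?K" using i rcomp_carrier[OF yi] zc by auto
    qed
    from genideal_minimal[OF K this] have "J \<subseteq> ?K" by (simp add: JI)
    then have "P (Suc n) \<subseteq> ?Q" unfolding PJ by (intro ideal_smult_least_subgroup[OF Q]) blast
    then have "hc e x \<in> S" using x by blast
    then show "x \<in> S" using x gr.hcomp_homogeneous[of x e e] by simp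
  qed
qed

end

context graded_module_over
begin

text \<open>Ring elements have no components of negative degree, so multiplication cannot go below
  the least degree that occurs in finitely many generators.\<close>

lemma degrees_bounded_below:
  assumes "finitely_generated R G"
  shows "\<exists>e0. \<forall>e<e0. mcomp G e = {\<zero>\<^bsub>G\<^esub>}"
proof -
  obtain A where A: "finite A" "A \<subseteq> carrier G" "ideal_smult G (carrier R) A = carrier G"
    using assms by (auto simp: finitely_generated_def)
  define D where "D = (\<Union>x\<in>A. {e. hc e x \<noteq> \<zero>\<^bsub>G\<^esub>})"
  have fin: "finite D" using A gr.hcomp_finite by (auto simp: D_def)
  \<comment> \<open>Inserting 0 makes the minimum defined when all generators are zero.\<close>
  define e0 where "e0 = Min (insert 0 D)"
  let ?K = "{x \<in> carrier G. \<forall>e<e0. hc e x = \<zero>\<^bsub>G\<^esub>}"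
  have sm: "r \<odot>\<^bsub>G\<^esub> x \<in> ?K" if r: "r \<in> carrier R" and x: "x \<in> ?K" for r x
  proof (intro CollectI conjI allI impI)
    show "r \<odot>\<^bsub>G\<^esub> x \<in> carrier G" using r x by simp
    fix e assume e: "e < e0"
    have "rc i r \<odot>\<^bsub>G\<^esub> hc (e - i) x = \<zero>\<^bsub>G\<^esub>" for i
    proof (cases "i < 0")
      case True
      then have "rc i r = \<zero>" using rg.hcomp_mem[OF r, of i] negative_degree by blast
      then show ?thesis using x by simp
    next
      case False
      then show ?thesis using x e r by simp
    qed
    then show "hc e (r \<odot>\<^bsub>G\<^esub> x) = \<zero>\<^bsub>G\<^esub>" using hcomp_smult[OF r, of x e] x by simp
  qed
  have "submodule ?K R G"
  proof (rule submodule_criterion)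
    show "x \<oplus>\<^bsub>G\<^esub> z \<in> ?K" if "x \<in> ?K" "z \<in> ?K" for x z using that by (auto simp: gr.hcomp_add)
  qed (use sm in auto)
  moreover have "A \<subseteq> ?K"
  proof
    fix x assume x: "x \<in> A"
    have "hc e x = \<zero>\<^bsub>G\<^esub>" if "e < e0" for e
    proof (rule ccontr)
      assume "hc e x \<noteq> \<zero>\<^bsub>G\<^esub>"
      then have "e \<in> insert 0 D" using x by (auto simp: D_def)
      then have "e0 \<le> e" unfolding e0_def using fin by (intro Min_le) auto
      then show False using that by simp
    qed
    then show "x \<in> ?K" using x A by auto
  qed
  ultimately have K: "carrier G \<subseteq> ?K" using ideal_smult_least[of ?K A] A(3) by simp
  have "mcomp G e = {\<zero>\<^bsub>G\<^esub>}" if e: "e < e0" for e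
  proof
    show "mcomp G e \<subseteq> {\<zero>\<^bsub>G\<^esub>}"
    proof
      fix x assume x: "x \<in> mcomp G e"
      then have "hc e x = \<zero>\<^bsub>G\<^esub>" using K gr.gD(1)[OF x] e by blast
      then show "x \<in> {\<zero>\<^bsub>G\<^esub>}" using gr.hcomp_homogeneous[OF x, of e] by simp
    qed
  qed (use gr.gD(2) in simp)
  then show ?thesis by blast
qed

end

section \<open>The cohomology modules\<close>

lemma (in module) submodule_sum:
  assumes A: "submodule A R M" and B: "submodule B R M"
  shows "submodule {x \<oplus>\<^bsub>M\<^esub> z |x z. x \<in> A \<and> z \<in> B} R M" (is "submodule ?S R M")
proof -
  note AE = submoduleE[OF A] and BE = submoduleE[OF B]
  have sm: "a \<odot>\<^bsub>M\<^esub> w \<in> ?S" if a: "a \<in> carrier R" and w: "w \<in> ?S" for a w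
  proof -
    from w obtain x z where xz: "x \<in> A" "z \<in> B" "w = x \<oplus>\<^bsub>M\<^esub> z" by blast
    have "x \<in> carrier M" "z \<in> carrier M" using xz AE(1) BE(1) by auto
    then have "a \<odot>\<^bsub>M\<^esub> w = a \<odot>\<^bsub>M\<^esub> x \<oplus>\<^bsub>M\<^esub> a \<odot>\<^bsub>M\<^esub> z" using a xz(3) by (simp add: smult_r_distr)
    then show ?thesis using AE(4)[OF a xz(1)] BE(4)[OF a xz(2)] by blast
  qed
  have Sc: "?S \<subseteq> carrier M" using AE(1) BE(1) by auto
  show ?thesis
  proof (rule submodule_criterion[OF Sc])
    have "\<zero>\<^bsub>M\<^esub> \<in> A" "\<zero>\<^bsub>M\<^esub> \<in> B" using submodule_finsum[OF A, of "{}"] submodule_finsum[OF B, of "{}"] by simp_all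
    then show "\<zero>\<^bsub>M\<^esub> \<in> ?S" by (auto intro!: exI[of _ "\<zero>\<^bsub>M\<^esub>"])
    show "w \<oplus>\<^bsub>M\<^esub> w' \<in> ?S" if ww: "w \<in> ?S" "w' \<in> ?S" for w w'
    proof -
      from ww obtain x z x' z' where xz: "x \<in> A" "z \<in> B" "w = x \<oplus>\<^bsub>M\<^esub> z" "x' \<in> A" "z' \<in> B" "w' = x' \<oplus>\<^bsub>M\<^esub> z'" by blast
      then have "x \<in> carrier M" "z \<in> carrier M" "x' \<in> carrier M" "z' \<in> carrier M" using AE(1) BE(1) by auto
      then have "w \<oplus>\<^bsub>M\<^esub> w' = (x \<oplus>\<^bsub>M\<^esub> x') \<oplus>\<^bsub>M\<^esub> (z \<oplus>\<^bsub>M\<^esub> z')" using xz by (simp add: M.a_ac)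
      then show ?thesis using AE(5)[OF xz(1,4)] BE(5)[OF xz(2,5)] by blast
    qed
  qed (use sm in blast)
qed

lemma image_submodule:
  assumes "module R F" "module R M" "f \<in> mod_hom R F M" "submodule K R F"
  shows "submodule (f ` K) R M"
proof -
  interpret F: module R F by fact
  interpret M: module R M by fact
  note fD = mod_homD[OF assms(3)] and KE = F.submoduleE[OF assms(4)]
  have sm: "a \<odot>\<^bsub>M\<^esub> w \<in> f ` K" if a: "a \<in> carrier R" and w: "w \<in> f ` K" for a w
  proof -
    from w obtain x where x: "x \<in> K" "w = f x" by blast
    then have "a \<odot>\<^bsub>M\<^esub> w = f (a \<odot>\<^bsub>F\<^esub> x)" using fD(3)[OF a] KE(1) by auto
    then show ?thesis using KE(4)[OF a x(1)] by blast
  qed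
  have Kc: "f ` K \<subseteq> carrier M" using fD(1) KE(1) by blast
  show ?thesis
  proof (rule M.submodule_criterion[OF Kc])
    have "\<zero>\<^bsub>F\<^esub> \<in> K" using F.submodule_finsum[OF assms(4), of "{}"] by simp
    then show "\<zero>\<^bsub>M\<^esub> \<in> f ` K" using mod_hom_zero_diff(1)[OF assms(1-3)] by (metis imageI)
    show "w \<oplus>\<^bsub>M\<^esub> w' \<in> f ` K" if ww: "w \<in> f ` K" "w' \<in> f ` K" for w w'
    proof -
      from ww obtain x x' where x: "x \<in> K" "w = f x" "x' \<in> K" "w' = f x'" by blast
      then have "w \<oplus>\<^bsub>M\<^esub> w' = f (x \<oplus>\<^bsub>F\<^esub> x')" using fD(2)[OF subsetD[OF KE(1)] subsetD[OF KE(1)]] by simp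
      then show ?thesis using KE(5)[OF x(1,3)] by blast
    qed
  qed (use sm in blast)
qed

lemma graded_sub_simps:
  "carrier (graded_sub G K) = K" "B +>\<^bsub>graded_sub G K\<^esub> x = B +>\<^bsub>G\<^esub> x" "\<zero>\<^bsub>graded_sub G K\<^esub> = \<zero>\<^bsub>G\<^esub>"
  "a \<odot>\<^bsub>graded_sub G K\<^esub> x = a \<odot>\<^bsub>G\<^esub> x" "mcomp (graded_sub G K) n = K \<inter> mcomp G n"
  by (simp_all add: graded_sub_def a_r_coset_def r_coset_def)

text \<open>Cosets formed inside \<open>K\<close> are the same sets as cosets formed in
  \<open>M\<close>. Hence cohomology, a quotient of a submodule of cocycles, can be computed with
  the class map of the whole cochain module.\<close>

lemma (in quotient_module) subquotient_simps:
  assumes "K \<subseteq> carrier M"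
  shows "carrier (graded_quot (graded_sub M K) N) = cl ` K"
    "mcomp (graded_quot (graded_sub M K) N) e = cl ` (K \<inter> mcomp M e)"
    "\<zero>\<^bsub>graded_quot (graded_sub M K) N\<^esub> = N"
    "a \<in> carrier R \<Longrightarrow> x \<in> K \<Longrightarrow> a \<odot>\<^bsub>graded_quot (graded_sub M K) N\<^esub> cl x = cl (a \<odot>\<^bsub>M\<^esub> x)"
proof -
  show "carrier (graded_quot (graded_sub M K) N) = cl ` K"
    by (auto simp: graded_quot_simps A_RCOSETS_def RCOSETS_def a_r_coset_def graded_sub_def r_coset_def)
  show "a \<odot>\<^bsub>graded_quot (graded_sub M K) N\<^esub> cl x = cl (a \<odot>\<^bsub>M\<^esub> x)" if "a \<in> carrier R" "x \<in> K"
    using cl_smult[OF that(1), of x] that assms by (auto simp: graded_quot_simps graded_sub_simps)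
qed (simp_all add: graded_quot_simps graded_sub_simps)

section \<open>Cochains with values in M and in its submodules\<close>

locale ext_data = graded_powers R M N I
  for R :: "'a graded_ring" (structure) and M :: "('a, 'm) graded_module" (structure) and N I +
  fixes Fr :: "('a, 'l) resolution" and k :: nat
  assumes diff_hom: "\<And>i. diff Fr i \<in> mod_hom R (res_term R Fr (Suc i)) (res_term R Fr i)"
    and diff_degree: "\<And>i. has_degree (res_term R Fr (Suc i)) (res_term R Fr i) (diff Fr i) 0"
    and diff_diff: "\<And>i v. v \<in> carrier (res_term R Fr (Suc (Suc i))) \<Longrightarrow>
       diff Fr i (diff Fr (Suc i) v) = \<zero>\<^bsub>res_term R Fr i\<^esub>"
begin

abbreviation T where "T i \<equiv> res_term R Fr i"
abbreviation C where "C i \<equiv> hom_cochains R Fr M i"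
abbreviation \<delta> where "\<delta> i \<equiv> hom_codiff R Fr i"

lemma C_free_hom: "graded_free_hom R M"
  by (intro graded_free_hom.intro graded_module_over_axioms free_hom.intro nat_graded_ring_axioms module_axioms)

lemma C_graded: "graded_module_over R (C i)"
proof -
  interpret C: graded_free_hom R M "basis_degs Fr i" by (rule C_free_hom)
  show ?thesis unfolding hom_cochains_def by (rule C.HG.graded_module_over_axioms)
qed

sublocale Ck: graded_module_over R "C i" for i by (rule C_graded)

lemma term_module: "module R (T i)" by (rule free_module)

lemma CD:
  assumes "f \<in> carrier (C i)"
  shows "f \<in> mod_hom R (T i) M" "v \<in> carrier (T i) \<Longrightarrow> f v \<in> carrier M"
  using assms mod_homD(1)[of f R "T i" M v] by (auto simp: hom_cochains_def graded_hom_simps)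

lemma C_simps:
  "v \<in> carrier (T i) \<Longrightarrow> (f \<oplus>\<^bsub>C i\<^esub> g) v = f v \<oplus>\<^bsub>M\<^esub> g v"
  "v \<in> carrier (T i) \<Longrightarrow> (a \<odot>\<^bsub>C i\<^esub> f) v = a \<odot>\<^bsub>M\<^esub> f v"
  by (simp_all add: hom_cochains_def graded_hom_simps)

lemma codiff_hom:
  assumes "module R M'"
  shows "\<delta> i \<in> mod_hom R (hom_cochains R Fr M' i) (hom_cochains R Fr M' (Suc i))"
  using precompose_hom[OF assms diff_hom] by (simp add: hom_codiff_def[abs_def] hom_cochains_def)

lemmas \<delta>_hom = codiff_hom[OF module_axioms]
lemmas \<delta>D = mod_homD[OF \<delta>_hom]

lemma \<delta>_degree: "f \<in> mcomp (C i) e \<Longrightarrow> \<delta> i f \<in> mcomp (C (Suc i)) e"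
  using precompose_degree[OF diff_degree diff_hom, of f i M e] precompose_hom[OF module_axioms diff_hom]
    R_gradingD(1)
  by (auto simp: hom_codiff_def hom_cochains_def graded_free_simps PiE_iff)

lemma \<delta>_apply: "v \<in> carrier (T (Suc i)) \<Longrightarrow> \<delta> i f v = f (diff Fr i v)"
  by (simp add: hom_codiff_def compose_def)

lemma \<delta>\<delta>:
  assumes f: "f \<in> carrier (C i)"
  shows "\<delta> (Suc i) (\<delta> i f) = \<zero>\<^bsub>C (Suc (Suc i))\<^esub>"
proof -
  have z: "f \<zero>\<^bsub>T i\<^esub> = \<zero>\<^bsub>M\<^esub>" by (rule mod_hom_zero_diff(1)[OF term_module module_axioms CD(1)[OF f]])
  have "\<delta> (Suc i) (\<delta> i f) v = \<zero>\<^bsub>M\<^esub>" if v: "v \<in> carrier (T (Suc (Suc i)))" for v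
    using \<delta>_apply[OF v, of "\<delta> i f"] \<delta>_apply[OF mod_homD(1)[OF diff_hom v], of f] diff_diff[OF v] z by simp
  then show ?thesis
    by (auto simp: hom_codiff_def hom_cochains_def graded_hom_simps compose_def fun_eq_iff restrict_def)
qed

text \<open>The module Hom(F_i, I^n N) inside Hom(F_i, M). It is the kernel of the passage to
  cochains with values in the quotient of \<open>M\<close> by \<open>P n\<close>.\<close>

definition Cn :: "nat \<Rightarrow> nat \<Rightarrow> ((nat \<Rightarrow> 'a) \<Rightarrow> 'm) set" where
  "Cn i n = {f \<in> carrier (C i). \<forall>v\<in>carrier (T i). f v \<in> P n}"

lemma Cn_submodule: "submodule (Cn i n) R (C i)"
proof -
  interpret C: graded_free_hom R M "basis_degs Fr i" by (rule C_free_hom)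
  show ?thesis using C.hom_into_submodule[OF P_submodule] by (simp add: Cn_def hom_cochains_def)
qed

lemma Cn_homogeneous: "f \<in> Cn i n \<Longrightarrow> Ck.hc i e f \<in> Cn i n"
proof -
  interpret C: graded_free_hom R M "basis_degs Fr i" by (rule C_free_hom)
  assume "f \<in> Cn i n"
  then have f: "f \<in> carrier C.H" "\<forall>v\<in>carrier C.F. f v \<in> P n" by (auto simp: Cn_def hom_cochains_def)
  show "Ck.hc i e f \<in> Cn i n"
    using C.hom_into_submodule_homogeneous[OF P_submodule P_homogeneous f, of e] C.HG.gr.hcomp_carrier[OF f(1), of e]
    by (simp add: Cn_def hom_cochains_def)
qed

lemma smult_Cn: "a \<in> I \<Longrightarrow> f \<in> Cn i n \<Longrightarrow> a \<odot>\<^bsub>C i\<^esub> f \<in> Cn i (Suc n)"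
  using smult_P I_carrier by (simp add: Cn_def C_simps)

lemma \<delta>_Cn: "f \<in> Cn i n \<Longrightarrow> \<delta> i f \<in> Cn (Suc i) n"
  using \<delta>D(1) mod_homD(1)[OF diff_hom] by (simp add: Cn_def \<delta>_apply)

lemma submodule_zero: "submodule S R (C i) \<Longrightarrow> \<zero>\<^bsub>C i\<^esub> \<in> S"
  using Ck.submodule_finsum[of S i "{}"] by simp

definition Z :: "((nat \<Rightarrow> 'a) \<Rightarrow> 'm) set" where "Z = hom_cocycles R Fr M k"
definition B :: "((nat \<Rightarrow> 'a) \<Rightarrow> 'm) set" where "B = hom_coboundaries R Fr M k"

lemma Z_iff: "f \<in> Z \<longleftrightarrow> f \<in> carrier (C k) \<and> \<delta> k f = \<zero>\<^bsub>C (Suc k)\<^esub>"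
  by (auto simp: Z_def hom_cocycles_def a_kernel_def kernel_def)

lemma Z_submodule: "submodule Z R (C k)"
  unfolding Z_def hom_cocycles_def by (rule kernel_submodule[OF Ck.module_axioms Ck.module_axioms \<delta>_hom])

lemma B_0: "k = 0 \<Longrightarrow> B = {\<zero>\<^bsub>C k\<^esub>}" and B_Suc: "k = Suc j \<Longrightarrow> B = \<delta> j ` carrier (C j)"
  unfolding B_def hom_coboundaries_def by simp_all

lemma B_submodule: "submodule B R (C k)"
proof (cases k)
  case 0
  show ?thesis unfolding B_0[OF 0] by (rule Ck.submoduleI) auto
next
  case (Suc j)
  show ?thesis unfolding B_Suc[OF Suc] unfolding Suc
    by (rule image_submodule[OF Ck.module_axioms Ck.module_axioms \<delta>_hom Ck.carrier_is_submodule])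
qed

lemma B_sub_Z: "B \<subseteq> Z"
proof (cases k)
  case 0
  show ?thesis unfolding B_0[OF 0] using submodule_zero[OF Z_submodule] by simp
next
  case (Suc j)
  have "\<delta> j g \<in> carrier (C k)" "\<delta> k (\<delta> j g) = \<zero>\<^bsub>C (Suc k)\<^esub>" if "g \<in> carrier (C j)" for g
    using \<delta>D(1)[OF that] \<delta>\<delta>[OF that] unfolding Suc by simp_all
  then show ?thesis unfolding B_Suc[OF Suc] by (auto simp: Z_iff)
qed

lemma \<delta>_component: "f \<in> carrier (C i) \<Longrightarrow> Ck.hc (Suc i) e (\<delta> i f) = \<delta> i (Ck.hc i e f)"
  using hcomp_hom[OF C_graded C_graded \<delta>_hom, of i 0 f e] \<delta>_degree by simp

lemma B_homogeneous: "f \<in> B \<Longrightarrow> Ck.hc k e f \<in> B"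
proof (cases k)
  case 0
  show "f \<in> B \<Longrightarrow> Ck.hc k e f \<in> B" unfolding B_0[OF 0] by simp
next
  case (Suc j)
  assume "f \<in> B"
  then obtain g where g: "g \<in> carrier (C j)" "f = \<delta> j g" unfolding B_Suc[OF Suc] by blast
  have "Ck.hc k e f = \<delta> j (Ck.hc j e g)" unfolding g(2) using \<delta>_component[OF g(1)] unfolding Suc .
  then show "Ck.hc k e f \<in> B" using g unfolding B_Suc[OF Suc] by simp
qed

lemma Z_homogeneous: "f \<in> Z \<Longrightarrow> Ck.hc k e f \<in> Z"
  using \<delta>_component[of f k e] by (simp add: Z_iff)

text \<open>\<open>Zn n / Bt n\<close> is isomorphic to \<open>Ext\<^sup>k(L, M / I\<^sup>nN)\<close>, and \<open>V n\<close> consists of the homogeneous elements whose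
  classes are killed by \<open>I\<close>.\<close>

definition Bt :: "nat \<Rightarrow> ((nat \<Rightarrow> 'a) \<Rightarrow> 'm) set" where
  "Bt n = {b \<oplus>\<^bsub>C k\<^esub> c |b c. b \<in> B \<and> c \<in> Cn k n}"

definition Zn :: "nat \<Rightarrow> ((nat \<Rightarrow> 'a) \<Rightarrow> 'm) set" where
  "Zn n = {f \<in> carrier (C k). \<delta> k f \<in> Cn (Suc k) n}"

definition V :: "nat \<Rightarrow> int \<Rightarrow> ((nat \<Rightarrow> 'a) \<Rightarrow> 'm) set" where
  "V n e = {f \<in> mcomp (C k) e. f \<in> Zn n \<and> (\<forall>a\<in>I. a \<odot>\<^bsub>C k\<^esub> f \<in> Bt n)}"

lemmas BE = Ck.submoduleE[OF B_submodule]
lemmas CnE = Ck.submoduleE[OF Cn_submodule]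
lemmas ZE = Ck.submoduleE[OF Z_submodule]

lemma Bt_submodule: "submodule (Bt n) R (C k)"
  unfolding Bt_def by (rule Ck.submodule_sum[OF B_submodule Cn_submodule])

lemmas BtE = Ck.submoduleE[OF Bt_submodule]

lemma Bt_homogeneous: "f \<in> Bt n \<Longrightarrow> Ck.hc k e f \<in> Bt n"
proof -
  assume "f \<in> Bt n"
  then obtain b c where bc: "b \<in> B" "c \<in> Cn k n" "f = b \<oplus>\<^bsub>C k\<^esub> c" by (auto simp: Bt_def)
  then have "Ck.hc k e f = Ck.hc k e b \<oplus>\<^bsub>C k\<^esub> Ck.hc k e c" using subsetD[OF BE(1) bc(1)] subsetD[OF CnE(1) bc(2)] by (simp add: Ck.gr.hcomp_add)
  then show "Ck.hc k e f \<in> Bt n" using B_homogeneous[OF bc(1)] Cn_homogeneous[OF bc(2)] unfolding Bt_def by blast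
qed

lemma smult_Bt: "a \<in> I \<Longrightarrow> f \<in> Bt n \<Longrightarrow> a \<odot>\<^bsub>C k\<^esub> f \<in> Bt (Suc n)"
proof -
  assume a: "a \<in> I" and "f \<in> Bt n"
  then obtain b c where bc: "b \<in> B" "c \<in> Cn k n" "f = b \<oplus>\<^bsub>C k\<^esub> c" by (auto simp: Bt_def)
  have "a \<odot>\<^bsub>C k\<^esub> f = a \<odot>\<^bsub>C k\<^esub> b \<oplus>\<^bsub>C k\<^esub> a \<odot>\<^bsub>C k\<^esub> c"
    unfolding bc(3) using I_carrier[OF a] subsetD[OF BE(1) bc(1)] subsetD[OF CnE(1) bc(2)] by (rule Ck.smult_r_distr)
  then show "a \<odot>\<^bsub>C k\<^esub> f \<in> Bt (Suc n)"
    using BE(4)[OF I_carrier[OF a] bc(1)] smult_Cn[OF a bc(2)] unfolding Bt_def by blast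
qed

lemma Zn_submodule: "submodule (Zn n) R (C k)"
proof (rule Ck.submodule_criterion)
  show "\<zero>\<^bsub>C k\<^esub> \<in> Zn n"
    using mod_hom_zero_diff(1)[OF Ck.module_axioms Ck.module_axioms \<delta>_hom] submodule_zero[OF Cn_submodule]
    by (simp add: Zn_def)
  show "f \<oplus>\<^bsub>C k\<^esub> g \<in> Zn n" if "f \<in> Zn n" "g \<in> Zn n" for f g
    using that \<delta>D(2) CnE(5) by (simp add: Zn_def)
  show "a \<odot>\<^bsub>C k\<^esub> f \<in> Zn n" if "a \<in> carrier R" "f \<in> Zn n" for a f
    using that \<delta>D(3) CnE(4) by (simp add: Zn_def)
qed (auto simp: Zn_def)

lemmas ZnE = Ck.submoduleE[OF Zn_submodule]

lemma Zn_homogeneous: "f \<in> Zn n \<Longrightarrow> Ck.hc k e f \<in> Zn n"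
  using Cn_homogeneous[of "\<delta> k f" "Suc k" n e] \<delta>_component[of f k e] by (simp add: Zn_def)

lemma Z_sub_Zn: "Z \<subseteq> Zn n"
  using submodule_zero[OF Cn_submodule] by (auto simp: Z_iff Zn_def)

lemma Bt_sub_Zn: "Bt n \<subseteq> Zn n"
proof
  fix f assume "f \<in> Bt n"
  then obtain b c where bc: "b \<in> B" "c \<in> Cn k n" "f = b \<oplus>\<^bsub>C k\<^esub> c" by (auto simp: Bt_def)
  have "b \<in> Zn n" using bc(1) B_sub_Z Z_sub_Zn by blast
  moreover have "c \<in> Zn n" using \<delta>_Cn[OF bc(2)] subsetD[OF CnE(1) bc(2)] by (simp add: Zn_def)
  ultimately show "f \<in> Zn n" using ZnE(5) bc(3) by blast
qed

lemma B_sub_Bt: "B \<subseteq> Bt n"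
proof
  fix b assume b: "b \<in> B"
  have "b = b \<oplus>\<^bsub>C k\<^esub> \<zero>\<^bsub>C k\<^esub>" using subsetD[OF BE(1) b] by simp
  then show "b \<in> Bt n" using b submodule_zero[OF Cn_submodule] unfolding Bt_def by blast
qed

lemma Cn_sub_Bt: "Cn k n \<subseteq> Bt n"
proof
  fix c assume c: "c \<in> Cn k n"
  have "c = \<zero>\<^bsub>C k\<^esub> \<oplus>\<^bsub>C k\<^esub> c" using subsetD[OF CnE(1) c] by simp
  then show "c \<in> Bt n" using c submodule_zero[OF B_submodule] unfolding Bt_def by blast
qed

lemma V_memI: "f \<in> mcomp (C k) e \<Longrightarrow> f \<in> Zn n \<Longrightarrow> I \<subseteq> {a \<in> carrier R. a \<odot>\<^bsub>C k\<^esub> f \<in> Bt n} \<Longrightarrow> f \<in> V n e"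
  by (auto simp: V_def)

end

section \<open>Chain conditions for the cochain families\<close>

context graded_module_over
begin

lemma fam_graded_submodules:
  assumes S: "\<And>n. submodule (S n) R G"
    and Y: "\<And>t d. (t, d) \<in> Y \<Longrightarrow> t \<in> rcomp R (int d)"
    and ops: "\<And>t d n x. (t, d) \<in> Y \<Longrightarrow> x \<in> S n \<Longrightarrow> t \<odot>\<^bsub>G\<^esub> x \<in> S (Suc n)"
  shows "fam Y (\<lambda>n e. S n \<inter> mcomp G e)"
proof (rule famI)
  note SE = submoduleE[OF S]
  show "x \<in> carrier G" if "x \<in> S n \<inter> mcomp G e" for x n e using that SE(1) by blast
  show "\<zero>\<^bsub>G\<^esub> \<in> S n \<inter> mcomp G e" for n e using submodule_finsum[OF S, of "{}"] gr.gD(2) by simp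
  show "r \<odot>\<^bsub>G\<^esub> x \<in> S n \<inter> mcomp G (e + i)" if "r \<in> rcomp R i" "x \<in> S n \<inter> mcomp G e" for r i x n e
    using that SE(4) rcomp_carrier smult_degree[of r i x e] by (simp add: add.commute)
  show "t \<odot>\<^bsub>G\<^esub> x \<in> S (Suc n) \<inter> mcomp G (e + int d)" if "(t, d) \<in> Y" "x \<in> S n \<inter> mcomp G e" for t d x n e
    using that ops[of t d x n] smult_degree[OF Y, of t d x e] by (simp add: add.commute)
  show "x \<oplus>\<^bsub>G\<^esub> z \<in> S n \<inter> mcomp G e" if "x \<in> S n \<inter> mcomp G e" "z \<in> S n \<inter> mcomp G e" for x z n e
    using that SE(5) gr.gD(3) by blast
qed

lemma zero_submodule: "submodule {\<zero>\<^bsub>G\<^esub>} R G"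
  by (rule submoduleI) auto

lemma fam_zero:
  assumes Y: "\<And>t d. (t, d) \<in> Y \<Longrightarrow> t \<in> rcomp R (int d)"
  shows "fam Y (\<lambda>n e. {\<zero>\<^bsub>G\<^esub>})"
proof -
  have "t \<odot>\<^bsub>G\<^esub> x = \<zero>\<^bsub>G\<^esub>" if "(t, d) \<in> Y" "x = \<zero>\<^bsub>G\<^esub>" for t d x
    using rcomp_carrier[OF Y[OF that(1)]] that(2) by simp
  then have "fam Y (\<lambda>n e. {\<zero>\<^bsub>G\<^esub>} \<inter> mcomp G e)"
    using Y by (intro fam_graded_submodules[where S = "\<lambda>_. {\<zero>\<^bsub>G\<^esub>}"] zero_submodule) auto
  moreover have "{\<zero>\<^bsub>G\<^esub>} \<inter> mcomp G e = {\<zero>\<^bsub>G\<^esub>}" for e using gr.gD(2) by blast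
  ultimately show ?thesis by simp
qed

lemma smult_mod_hom: "a \<in> carrier R \<Longrightarrow> (\<lambda>x. a \<odot>\<^bsub>G\<^esub> x) \<in> mod_hom R G G"
  by (intro mod_homI) (auto simp: smult_r_distr smult_assoc1[symmetric] m_comm)

end

text \<open>The components of finitely many generators lie in the homogeneous ideal and generate it.
  They are listed with their degrees so as to number the multiplication maps and to provide their
  degree shifts.\<close>

lemma (in nat_graded_ring) homogeneous_generators:
  assumes "noetherian_ring R" and I: "homogeneous_ideal R I"
  shows "\<exists>gs. (\<forall>(g, s)\<in>set gs. g \<in> I \<and> g \<in> rcomp R s) \<and> I = Idl (fst ` set gs)"
proof -
  interpret nr: noetherian_ring R by fact
  interpret rg: graded_group R "rcomp R" by (rule ring_graded_group)
  have Iid: "ideal I R" using I by (simp add: homogeneous_ideal_def)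
  interpret I: ideal I R by (rule Iid)
  obtain A where A: "A \<subseteq> carrier R" "finite A" "I = Idl A" using nr.finetely_gen[OF Iid] by blast
  have AI: "A \<subseteq> I" using A genideal_self by blast
  let ?c = "\<lambda>i a. hcomp R (rcomp R) i a"
  have cI: "?c i a \<in> I" if a: "a \<in> I" for i a
  proof -
    obtain f where f: "decomposes R (\<lambda>n. I \<inter> rcomp R n) a f"
      using I a by (auto simp: homogeneous_ideal_def homogeneous_subset_def)
    then have "decomposes R (rcomp R) a f" by (auto simp: decomposes_def)
    then have "?c i a = f i" using rg.hcomp_eq I.a_subset a by blast
    then show ?thesis using f by (auto simp: decomposes_def)
  qed
  let ?D = "\<Union>a\<in>A. (\<lambda>i. (?c i a, i)) ` {i. ?c i a \<noteq> \<zero>}"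
  have "finite ?D" using A rg.hcomp_finite by auto
  from finite_list[OF this] obtain gs where gs: "set gs = ?D" by (elim exE)
  have 1: "\<forall>(g, s)\<in>set gs. g \<in> I \<and> g \<in> rcomp R s"
  proof (intro ballI, clarify)
    fix g s assume "(g, s) \<in> set gs"
    then obtain a where a: "a \<in> A" "g = ?c s a" unfolding gs by blast
    then show "g \<in> I \<and> g \<in> rcomp R s" using cI AI rg.hcomp_mem A(1) by blast
  qed
  have sub: "fst ` set gs \<subseteq> I" using 1 by auto
  then have gc: "fst ` set gs \<subseteq> carrier R" using I.a_subset by blast
  interpret K: ideal "Idl (fst ` set gs)" R by (rule genideal_ideal[OF gc])
  have "a \<in> Idl (fst ` set gs)" if a: "a \<in> A" for a
  proof -
    have ac: "a \<in> carrier R" using a A by blast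
    have m: "?c i a \<in> Idl (fst ` set gs)" for i
    proof (cases "?c i a = \<zero>")
      case False
      then have "(?c i a, i) \<in> set gs" unfolding gs using a by blast
      then have "?c i a \<in> fst ` set gs" by force
      then show ?thesis using genideal_self[OF gc] by blast
    qed simp
    have "finsum R (\<lambda>i. ?c i a) D \<in> Idl (fst ` set gs)" if "finite D" for D
      using that
    proof (induction D rule: finite_induct)
      case (insert i D)
      then show ?case using m ac by (subst finsum_insert) auto
    qed simp
    then show ?thesis using rg.hcomp_sum[OF ac] rg.hcomp_finite[OF ac] by metis
  qed
  then have "Idl A \<subseteq> Idl (fst ` set gs)" by (intro genideal_minimal K.is_ideal) blast
  moreover have "Idl (fst ` set gs) \<subseteq> I" by (rule genideal_minimal[OF Iid sub])
  ultimately show ?thesis using 1 A(3) by (intro exI[of _ gs]) auto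
qed

text \<open>\<open>torsion_free\<close> is the condition \<open>(0 :_H I) = 0\<close> in terms of
  cocycles modulo coboundaries, which keeps cosets out of the chain arguments.\<close>

locale ext_reduction = ext_data R M N I Fr k
  for R :: "'a graded_ring" (structure) and M :: "('a, 'm) graded_module" (structure) and N I
    and Fr :: "('a, 'l) resolution" and k +
  fixes J :: "'a set" and y :: "nat \<Rightarrow> 'a" and dg :: "nat \<Rightarrow> nat" and A :: "nat set"
  assumes noetherian: "noetherian_ring R" and fg_M: "finitely_generated R M"
    and J: "is_reduction R J I" and A: "finite A"
    and y: "\<forall>i\<in>A. y i \<in> rcomp R (int (dg i))" and J_gen: "J = Idl (y ` A)"
    and torsion_free: "\<And>f. f \<in> Z \<Longrightarrow> \<forall>a\<in>I. a \<odot>\<^bsub>C k\<^esub> f \<in> B \<Longrightarrow> f \<in> B"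
begin

definition Y :: "('a \<times> nat) set" where "Y = (\<lambda>i. (y i, dg i)) ` A"

lemma Y_rcomp: "(t, d) \<in> Y \<Longrightarrow> t \<in> rcomp R (int d)" using y by (auto simp: Y_def)

lemma Y_carrier: "Y \<subseteq> carrier R \<times> UNIV" using Y_rcomp rcomp_carrier by auto

lemma Y_finite: "finite Y" using A by (simp add: Y_def)

lemma Y_I: "(t, d) \<in> Y \<Longrightarrow> t \<in> I"
proof -
  assume "(t, d) \<in> Y"
  then have "t \<in> y ` A" by (auto simp: Y_def)
  moreover have "y ` A \<subseteq> carrier R" using y rcomp_carrier by blast
  ultimately have "t \<in> J" unfolding J_gen using genideal_self by blast
  then show "t \<in> I" using J by (auto simp: is_reduction_def)
qed

lemma fam_P: "fam Y (\<lambda>n e. P n \<inter> mcomp M e)"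
  by (rule fam_graded_submodules[where S = P, OF P_submodule Y_rcomp])
    (simp_all add: smult_P[OF Y_I])

text \<open>Hilbert's argument for the Rees module with pieces \<open>I^n N\<close>: each level
  satisfies the chain condition since \<open>M\<close> does, and beyond the reduction exponent the
  operators generate everything from the level before.\<close>

lemma noeth_P: "noeth Y (\<lambda>n e. {\<zero>\<^bsub>M\<^esub>}) (\<lambda>n e. P n \<inter> mcomp M e)"
proof -
  obtain m where m: "\<And>n e S. m \<le> n \<Longrightarrow> subgroup S (add_monoid M) \<Longrightarrow>
    (\<And>i x. i \<in> A \<Longrightarrow> x \<in> P n \<inter> mcomp M (e - int (dg i)) \<Longrightarrow> y i \<odot>\<^bsub>M\<^esub> x \<in> S) \<Longrightarrow> P (Suc n) \<inter> mcomp M e \<subseteq> S"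
    using P_generated[OF J y J_gen] by meson
  show ?thesis
  proof (rule noeth_if_generated[where m = m, OF _ Y_carrier _ Y_finite order_refl])
    show "fam Y (\<lambda>n e. P n \<inter> mcomp M e)"
      by (rule fam_P)
    show "fam Y (\<lambda>n e. {\<zero>\<^bsub>M\<^esub>})" by (rule fam_zero[OF Y_rcomp])
    show "(\<lambda>n e. {\<zero>\<^bsub>M\<^esub>}) \<le> (\<lambda>n e. P n \<inter> mcomp M e)"
      using submodule_finsum[OF P_submodule, of "{}"] gr.gD(2) by (auto simp: le_fun_def)
    show "\<exists>N. \<forall>i\<ge>N. U i = U N"
      if U: "mono U" "\<And>i. fam {} (\<lambda>_. U i)" "\<And>i. U i \<le> (\<lambda>e. P n \<inter> mcomp M e)" for n and U :: "nat \<Rightarrow> int \<Rightarrow> 'm set"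
    proof (rule homogeneous_chain_stabilises[OF _ U(1,2)])
      show "\<exists>N. \<forall>i\<ge>N. K i = K N" if "mono K" "\<And>i. submodule (K i) R M" for K :: "nat \<Rightarrow> 'm set"
        using fg_submodule_chain_stabilises[OF noetherian graded_module_axioms fg_M that] .
      show "U i \<le> mcomp M" for i using U(3)[of i] by (auto simp: le_fun_def)
    qed
    show "P (Suc n) \<inter> mcomp M e \<subseteq> S"
      if "m \<le> n" "subgroup S (add_monoid M)" "\<And>t d x. (t, d) \<in> Y \<Longrightarrow> x \<in> P n \<inter> mcomp M (e - int d) \<Longrightarrow> t \<odot>\<^bsub>M\<^esub> x \<in> S"
      for n e S
      using that(3) by (intro m[OF that(1,2)]) (auto simp: Y_def)
  qed
qed

lemma fam_Cn: "Ck.fam i Y (\<lambda>n e. Cn i n \<inter> mcomp (C i) e)"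
  by (rule Ck.fam_graded_submodules[where S = "Cn i", OF Cn_submodule Y_rcomp])
    (simp_all add: smult_Cn[OF Y_I])

text \<open>Evaluation at the basis vectors embeds \<open>Cn i\<close> into finitely many copies of
  the family \<open>P\<close>, one for each basis element and shifted by its degree.\<close>

lemma noeth_Cn: "Ck.noeth i Y (\<lambda>n e. {\<zero>\<^bsub>C i\<^esub>}) (\<lambda>n e. Cn i n \<inter> mcomp (C i) e)"
proof -
  let ?as = "basis_degs Fr i"
  interpret C: graded_free_hom R M ?as by (rule C_free_hom)
  have Ceq: "C i = C.H" by (simp add: hom_cochains_def)
  show ?thesis
  proof (rule Ck.noeth_iterated_extension[where r = "length ?as" and \<theta> = "\<lambda>j f. f (basis_vec ?as j)"
        and s = "\<lambda>j. ?as ! j", OF module_over_graded_axioms Y_carrier _ _ _ noeth_P])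
    show "bigraded_family R M Y (\<lambda>n e. {\<zero>\<^bsub>M\<^esub>})" by (rule fam_zero[OF Y_rcomp])
    show "(\<lambda>n e. {\<zero>\<^bsub>M\<^esub>}) \<le> (\<lambda>n e. P n \<inter> mcomp M e)"
      using submodule_finsum[OF P_submodule, of "{}"] gr.gD(2) by (auto simp: le_fun_def)
    show "bigraded_family R M Y (\<lambda>n e. P n \<inter> mcomp M e)"
      by (rule fam_P)
    show "(\<lambda>f. f (basis_vec ?as j)) \<in> mod_hom R (C i) M" for j
      unfolding Ceq by (rule C.eval_hom[OF basis_vec_carrier])
    show "x (basis_vec ?as j) \<in> {\<zero>\<^bsub>M\<^esub>}" if "x \<in> {\<zero>\<^bsub>C i\<^esub>}" for j x
      using that by (simp add: Ceq graded_hom_simps(2))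
    show "Ck.fam i Y (\<lambda>n e. Cn i n \<inter> mcomp (C i) e)" by (rule fam_Cn)
    show "(\<lambda>n e. {\<zero>\<^bsub>C i\<^esub>}) \<le> (\<lambda>n e. Cn i n \<inter> mcomp (C i) e)"
      using submodule_zero[OF Cn_submodule] Ck.gr.gD(2) by (auto simp: le_fun_def)
    show "x (basis_vec ?as j) \<in> P n \<inter> mcomp M (e + ?as ! j)"
      if "j < length ?as" "x \<in> Cn i n \<inter> mcomp (C i) e" for j n e x
      using that C.H_mcomp_iff[of x e] unfolding Cn_def Ceq by (simp add: add.commute)
    show "x \<in> {\<zero>\<^bsub>C i\<^esub>}"
      if x: "x \<in> Cn i n \<inter> mcomp (C i) e" "\<And>j. j < length ?as \<Longrightarrow> x (basis_vec ?as j) \<in> {\<zero>\<^bsub>M\<^esub>}" for n e x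
    proof -
      have xc: "x \<in> carrier C.H" using x(1) by (simp add: Cn_def Ceq)
      have "x (basis_vec ?as j) = \<zero>\<^bsub>C.H\<^esub> (basis_vec ?as j)" if "j < length ?as" for j
        using x(2)[OF that] by (simp add: graded_hom_simps(2))
      from C.hom_eqI[OF xc C.H.M.zero_closed this] have "x = \<zero>\<^bsub>C.H\<^esub>" .
      then show ?thesis by (simp add: Ceq)
    qed
  qed
qed

abbreviation B0 where "B0 \<equiv> \<lambda>(n :: nat) e. B \<inter> mcomp (C k) e"

lemma fam_B0: "Ck.fam k Y B0"
  using BE(4) Y_carrier by (intro Ck.fam_graded_submodules[where S = "\<lambda>_. B", OF B_submodule Y_rcomp]) auto

lemma fam_V: "Ck.fam k Y V"
proof (rule Ck.famI)
  have comm: "a \<odot>\<^bsub>C k\<^esub> (r \<odot>\<^bsub>C k\<^esub> f) = r \<odot>\<^bsub>C k\<^esub> (a \<odot>\<^bsub>C k\<^esub> f)"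
    if "a \<in> I" "r \<in> carrier R" "f \<in> carrier (C k)" for a r f
    using that I_carrier by (simp add: Ck.smult_assoc1[symmetric] m_comm)
  have Vc: "f \<in> carrier (C k)" if "f \<in> V n e" for f n e using that by (simp add: V_def Zn_def)
  show "f \<in> carrier (C k)" if "f \<in> V n e" for f n e using Vc[OF that] .
  show "\<zero>\<^bsub>C k\<^esub> \<in> V n e" for n e
    using Ck.gr.gD(2) submodule_zero[OF Zn_submodule] submodule_zero[OF Bt_submodule] I_carrier by (simp add: V_def)
  show "f \<oplus>\<^bsub>C k\<^esub> g \<in> V n e" if fg: "f \<in> V n e" "g \<in> V n e" for f g n e
    using fg Vc[OF fg(1)] Vc[OF fg(2)] Ck.gr.gD(3) ZnE(5) BtE(5) I_carrier by (simp add: V_def Ck.smult_r_distr)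
  show "r \<odot>\<^bsub>C k\<^esub> f \<in> V n (e + i)" if r: "r \<in> rcomp R i" and f: "f \<in> V n e" for r f n e i
    using f comm[OF _ rcomp_carrier[OF r] Vc[OF f]] Ck.smult_degree[OF r, of f k e] ZnE(4) BtE(4) rcomp_carrier[OF r]
    by (simp add: V_def add.commute)
  show "t \<odot>\<^bsub>C k\<^esub> f \<in> V (Suc n) (e + int d)" if t: "(t, d) \<in> Y" and f: "f \<in> V n e" for t d f n e
  proof -
    have tc: "t \<in> carrier R" using rcomp_carrier[OF Y_rcomp[OF t]] .
    \<comment> \<open>Since \<open>t\<close> lies in \<open>I\<close>, it carries values in
      \<open>I^n N\<close> to values in \<open>I^(n+1) N\<close>; the condition modulo
      \<open>Bt\<close> moves up by one for the same reason.\<close>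
    have "\<delta> k (t \<odot>\<^bsub>C k\<^esub> f) \<in> Cn (Suc k) (Suc n)"
      using smult_Cn[OF Y_I[OF t], of "\<delta> k f" "Suc k" n] f \<delta>D(3)[OF tc Vc[OF f]] by (simp add: V_def Zn_def)
    then have "t \<odot>\<^bsub>C k\<^esub> f \<in> Zn (Suc n)" using tc Vc[OF f] by (simp add: Zn_def)
    then show ?thesis
      using f comm[OF _ tc Vc[OF f]] smult_Bt[OF Y_I[OF t]] Ck.smult_degree[OF Y_rcomp[OF t], of f k e]
      by (simp add: V_def add.commute)
  qed
qed

text \<open>Multiplication by generators of \<open>I\<close> embeds the cocycles in \<open>V\<close> modulo \<open>B\<close> into copies of
  \<open>(B + Cn) / B\<close> because \<open>H\<close> has no \<open>I\<close>-torsion; the remaining quotient of \<open>V\<close> embeds by \<open>\<delta>\<close>.\<close>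

lemma noeth_cocycles: "Ck.noeth k Y B0 (\<lambda>n e. V n e \<inter> Z)"
proof -
  obtain gs where gs: "\<forall>(g, s)\<in>set gs. g \<in> I \<and> g \<in> rcomp R s" and Igs: "I = Idl (fst ` set gs)"
    using homogeneous_generators[OF noetherian homogeneous_I] by blast
  have g: "fst (gs ! j) \<in> I" "fst (gs ! j) \<in> rcomp R (snd (gs ! j))" if "j < length gs" for j
    using gs nth_mem[OF that] by (auto simp: case_prod_beta)
  have CZ: "submodule (Cn k n \<inter> Z) R (C k)" for n
    using CnE ZE submodule_zero[OF Cn_submodule] submodule_zero[OF Z_submodule] by (intro Ck.submoduleI) auto
  let ?CZ = "\<lambda>n e. Cn k n \<inter> Z \<inter> mcomp (C k) e"
  have famCZ: "Ck.fam k Y ?CZ"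
    using smult_Cn[OF Y_I] ZE(4) Y_carrier by (intro Ck.fam_graded_submodules[OF CZ Y_rcomp]) auto
  have zero_le: "(\<lambda>n e. {\<zero>\<^bsub>C k\<^esub>}) \<le> B0" "(\<lambda>n e. {\<zero>\<^bsub>C k\<^esub>}) \<le> ?CZ"
    using submodule_zero[OF B_submodule] submodule_zero[OF CZ] Ck.gr.gD(2) by (auto simp: le_fun_def)
  have "Ck.noeth k Y (\<lambda>n e. {\<zero>\<^bsub>C k\<^esub>}) ?CZ"
    by (rule Ck.noeth_mono[OF noeth_Cn order_refl]) (auto simp: le_fun_def)
  then have quot: "Ck.noeth k Y B0 (Ck.fam_plus k B0 ?CZ)"
    by (rule Ck.noeth_plus[OF fam_B0 famCZ zero_le])
  have VZ: "Ck.fam k Y (\<lambda>n e. V n e \<inter> Z)"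
    using Ck.famD[OF fam_V] ZE(4,5) submodule_zero[OF Z_submodule] rcomp_carrier rcomp_carrier[OF Y_rcomp]
    by (intro Ck.famI) auto
  \<comment> \<open>Unlike the operators in \<open>Y\<close>, multiplication by a generator of
    \<open>I\<close> keeps the index \<open>n\<close> and shifts only the degree: by definition of
    \<open>V\<close> the product falls into \<open>Bt n\<close>, not merely into
    \<open>Bt (Suc n)\<close>.\<close>
  show ?thesis
  proof (rule Ck.noeth_iterated_extension[where r = "length gs" and \<theta> = "\<lambda>j f. fst (gs ! j) \<odot>\<^bsub>C k\<^esub> f"
        and s = "\<lambda>j. snd (gs ! j)", OF Ck.module_over_graded_axioms Y_carrier fam_B0 _ _ quot])
    show "B0 \<le> Ck.fam_plus k B0 ?CZ" by (rule Ck.fam_plus_upper(1)[OF fam_B0 famCZ])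
    show "Ck.fam k Y (Ck.fam_plus k B0 ?CZ)" by (rule Ck.fam_fam_plus[OF fam_B0 famCZ Y_carrier])
    show "(\<lambda>f. fst (gs ! j) \<odot>\<^bsub>C k\<^esub> f) \<in> mod_hom R (C k) (C k)" if "j < length gs" for j
      using g(1)[OF that] I_carrier by (intro Ck.smult_mod_hom) auto
    show "fst (gs ! j) \<odot>\<^bsub>C k\<^esub> f \<in> B0 n (e + snd (gs ! j))" if "j < length gs" "f \<in> B0 n e" for j n e f
      using that BE(4) I_carrier[OF g(1)] Ck.smult_degree[OF g(2), of j f k e] by (simp add: add.commute)
    show "Ck.fam k Y (\<lambda>n e. V n e \<inter> Z)" by (rule VZ)
    show "B0 \<le> (\<lambda>n e. V n e \<inter> Z)"
    proof (rule Ck.le_famI)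
      fix n e f assume f: "f \<in> B0 n e"
      have "a \<odot>\<^bsub>C k\<^esub> f \<in> Bt n" if "a \<in> I" for a using f BE(4)[OF I_carrier[OF that]] B_sub_Bt by blast
      then show "f \<in> V n e \<inter> Z" using f B_sub_Z Z_sub_Zn by (auto simp: V_def)
    qed
    show "fst (gs ! j) \<odot>\<^bsub>C k\<^esub> f \<in> Ck.fam_plus k B0 ?CZ n (e + snd (gs ! j))"
      if j: "j < length gs" and f: "f \<in> V n e \<inter> Z" for j n e f
    proof -
      let ?a = "fst (gs ! j)" and ?s = "snd (gs ! j)"
      let ?w = "?a \<odot>\<^bsub>C k\<^esub> f"
      have ac: "?a \<in> carrier R" using I_carrier[OF g(1)[OF j]] .
      have w: "?w \<in> Bt n" "?w \<in> Z" "?w \<in> mcomp (C k) (e + ?s)"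
        using f g(1)[OF j] ZE(4)[OF ac] Ck.smult_degree[OF g(2)[OF j], of f k e] by (auto simp: V_def add.commute)
      obtain b c where bc: "b \<in> B" "c \<in> Cn k n" "?w = b \<oplus>\<^bsub>C k\<^esub> c" using w(1) by (auto simp: Bt_def)
      have car: "b \<in> carrier (C k)" "c \<in> carrier (C k)" using subsetD[OF BE(1) bc(1)] subsetD[OF CnE(1) bc(2)] by auto
      \<comment> \<open>As a difference of cocycles \<open>c\<close> is a cocycle. The summands
        \<open>b\<close> and \<open>c\<close> need not be homogeneous, so both are replaced by their
        components in the degree of \<open>?w\<close>.\<close>
      have "c = ?w \<oplus>\<^bsub>C k\<^esub> \<ominus>\<^bsub>C k\<^esub> b" unfolding bc(3) using car by (simp add: Ck.M.a_comm[OF car] Ck.M.a_assoc Ck.M.r_neg)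
      then have cZ: "c \<in> Z" using w(2) ZE(3,5) B_sub_Z bc(1) by (metis subsetD)
      let ?e = "e + ?s"
      have "?w = Ck.hc k ?e ?w" using Ck.gr.hcomp_homogeneous[OF w(3), of ?e] by simp
      also have "\<dots> = Ck.hc k ?e b \<oplus>\<^bsub>C k\<^esub> Ck.hc k ?e c" unfolding bc(3) using car by (rule Ck.gr.hcomp_add)
      finally have w': "?w = Ck.hc k ?e b \<oplus>\<^bsub>C k\<^esub> Ck.hc k ?e c" .
      have b: "Ck.hc k ?e b \<in> B0 n ?e" using B_homogeneous[OF bc(1)] Ck.gr.hcomp_mem[OF car(1)] by blast
      have c: "Ck.hc k ?e c \<in> ?CZ n ?e"
        using Cn_homogeneous[OF bc(2)] Z_homogeneous[OF cZ] Ck.gr.hcomp_mem[OF car(2)] by blast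
      show ?thesis unfolding w' using b c by (intro Ck.fam_plusI)
    qed
    show "f \<in> B0 n e"
      if f: "f \<in> V n e \<inter> Z" and gf: "\<And>j. j < length gs \<Longrightarrow> fst (gs ! j) \<odot>\<^bsub>C k\<^esub> f \<in> B0 n (e + snd (gs ! j))" for n e f
    proof -
      have fc: "f \<in> carrier (C k)" using f ZE(1) by blast
      \<comment> \<open>The condition is known for the generators of \<open>I\<close> only; since
        the elements sending \<open>f\<close> into \<open>B\<close> form an ideal, it extends to all
        of \<open>I\<close>, as \<open>torsion_free\<close> requires.\<close>
      let ?K = "{a \<in> carrier R. a \<odot>\<^bsub>C k\<^esub> f \<in> B}"
      have "ideal ?K R"
        using fc BE(4,5) submodule_zero[OF B_submodule]
        by (intro ideal_criterion) (auto simp: Ck.smult_l_distr Ck.smult_assoc1)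
      moreover have "fst ` set gs \<subseteq> ?K"
        using gf g I_carrier by (auto simp: in_set_conv_nth) (metis IntD1 fst_conv)+
      ultimately have "I \<subseteq> ?K" unfolding Igs by (rule genideal_minimal)
      then have "f \<in> B" using torsion_free[of f] f by blast
      then show ?thesis using f by (simp add: V_def)
    qed
  qed
qed

lemma noeth_V: "Ck.noeth k Y B0 V"
proof (rule Ck.noeth_extension[where s = 0, OF fam_V Ck.module_over_graded_axioms \<delta>_hom Y_carrier _ _ _ _ fam_Cn noeth_Cn])
  show "\<delta> k f \<in> Cn (Suc k) n \<inter> mcomp (C (Suc k)) (e + 0)" if "f \<in> V n e" for n e f
    using that \<delta>_degree by (auto simp: V_def Zn_def)
  show "\<delta> k f \<in> {\<zero>\<^bsub>C (Suc k)\<^esub>}" if "f \<in> B0 n e" for n e f using that B_sub_Z by (auto simp: Z_iff)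
  show "Ck.fam (Suc k) Y (\<lambda>n e. {\<zero>\<^bsub>C (Suc k)\<^esub>})" by (rule Ck.fam_zero[OF Y_rcomp])
  show "(\<lambda>n e. {\<zero>\<^bsub>C (Suc k)\<^esub>}) \<le> (\<lambda>n e. Cn (Suc k) n \<inter> mcomp (C (Suc k)) e)"
    using submodule_zero[OF Cn_submodule] Ck.gr.gD(2) by (auto simp: le_fun_def)
  have "{f \<in> V n e. \<delta> k f \<in> {\<zero>\<^bsub>C (Suc k)\<^esub>}} = V n e \<inter> Z" for n e by (auto simp: Z_iff V_def Zn_def)
  then show "Ck.noeth k Y B0 (\<lambda>n e. {f \<in> V n e. \<delta> k f \<in> {\<zero>\<^bsub>C (Suc k)\<^esub>}})" using noeth_cocycles by simp
qed

sublocale filt: graded_filtration R "C k" Y Bt V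
proof (intro graded_filtration.intro graded_filtration_axioms.intro)
  show "graded_module_over R (C k)" by (rule C_graded)
  show "V n e \<subseteq> mcomp (C k) e" for n e by (auto simp: V_def)
  show "Bt n \<inter> mcomp (C k) e \<subseteq> V n e" for n e
    using Bt_sub_Zn BtE(4) I_carrier by (auto simp: V_def)
  \<comment> \<open>Enlarging the lower bound from \<open>B\<close> to \<open>Bt n\<close> leaves
    fewer chains to consider.\<close>
  show "Ck.noeth k Y (\<lambda>n e. Bt n \<inter> mcomp (C k) e) V"
    using B_sub_Bt by (intro Ck.noeth_mono[OF noeth_V]) (auto simp: le_fun_def)
qed (use Y_finite Y_carrier Bt_submodule Bt_homogeneous smult_Bt[OF Y_I] fam_V in auto)

lemma cochain_degrees_bounded: "\<exists>e0. \<forall>e<e0. mcomp (C k) e = {\<zero>\<^bsub>C k\<^esub>}"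
proof -
  let ?as = "basis_degs Fr k"
  interpret C: graded_free_hom R M ?as by (rule C_free_hom)
  have Ceq: "C k = C.H" by (simp add: hom_cochains_def)
  obtain e0 where e0: "\<And>e. e < e0 \<Longrightarrow> mcomp M e = {\<zero>\<^bsub>M\<^esub>}" using degrees_bounded_below[OF fg_M] by blast
  define e1 where "e1 = Min (insert 0 ((\<lambda>a. e0 - a) ` set ?as))"
  have "mcomp C.H e = {\<zero>\<^bsub>C.H\<^esub>}" if e: "e < e1" for e
  proof (intro equalityI subsetI)
    fix f assume f: "f \<in> mcomp C.H e"
    have fc: "f \<in> carrier C.H" using C.mcomp_H_carrier[OF f] .
    have "f (basis_vec ?as j) = \<zero>\<^bsub>M\<^esub>" if j: "j < length ?as" for j
    proof -
      have "e1 \<le> e0 - ?as ! j" unfolding e1_def using j by (intro Min_le) auto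
      then have "mcomp M (?as ! j + e) = {\<zero>\<^bsub>M\<^esub>}" using e by (intro e0) simp
      then show ?thesis using f C.H_mcomp_iff[OF fc] j by blast
    qed
    then show "f \<in> {\<zero>\<^bsub>C.H\<^esub>}" using C.hom_eqI[OF fc C.H.M.zero_closed] by (auto simp: graded_hom_simps(2))
  qed (use C.HG.gr.gD(2) in simp)
  then show ?thesis unfolding Ceq by blast
qed

end

section \<open>Comparison with Ext into the quotients of M\<close>

context ext_data
begin

text \<open>The class of such an \<open>f\<close> is an \<open>I\<close>-torsion element of the
  cohomology, hence zero. This brings the hypothesis on \<open>H\<close> down to cochains.\<close>

lemma cohomology_torsion_free:
  assumes tors: "ideal_torsion (hom_cohomology R Fr M k) I = {\<zero>\<^bsub>hom_cohomology R Fr M k\<^esub>}"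
    and f: "f \<in> Z" "\<forall>a\<in>I. a \<odot>\<^bsub>C k\<^esub> f \<in> B"
  shows "f \<in> B"
proof -
  interpret q: quotient_module R "C k" B
    by (intro quotient_module.intro quotient_module_axioms.intro B_submodule Ck.module_axioms)
  have H: "hom_cohomology R Fr M k = graded_quot (graded_sub (C k) Z) B"
    by (simp add: hom_cohomology_def Z_def B_def)
  note S = q.subquotient_simps[OF ZE(1)]
  have fc: "f \<in> carrier (C k)" using f(1) ZE(1) by blast
  have "a \<odot>\<^bsub>graded_quot (graded_sub (C k) Z) B\<^esub> q.cl f = B" if "a \<in> I" for a
    using S(4)[OF I_carrier[OF that] f(1)] q.cl_eq_zero_iff[of "a \<odot>\<^bsub>C k\<^esub> f"] f(2) that fc I_carrier[OF that] by simp
  then have "q.cl f \<in> ideal_torsion (hom_cohomology R Fr M k) I"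
    unfolding H ideal_torsion_def using f(1) by (auto simp: S(1,3))
  then have "q.cl f = B" unfolding tors unfolding H S(3) by simp
  then show ?thesis using q.cl_eq_zero_iff[OF fc] by simp
qed

definition Mq :: "nat \<Rightarrow> ('a, 'm set) graded_module" where "Mq n = graded_quot M (P n)"
abbreviation Cq where "Cq n i \<equiv> hom_cochains R Fr (Mq n) i"

definition \<pi> :: "nat \<Rightarrow> nat \<Rightarrow> ((nat \<Rightarrow> 'a) \<Rightarrow> 'm) \<Rightarrow> (nat \<Rightarrow> 'a) \<Rightarrow> 'm set" where
  "\<pi> n i f = (\<lambda>v\<in>carrier (T i). P n +>\<^bsub>M\<^esub> f v)"

lemma quot_M: "quotient_module R M (P n)"
  by (intro quotient_module.intro quotient_module_axioms.intro P_submodule module_axioms)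

lemma Mq_module: "module R (Mq n)"
  unfolding Mq_def by (rule quotient_module.quot_module[OF quot_M])

lemma Cq_module: "module R (Cq n i)"
  unfolding hom_cochains_def by (rule graded_hom_module[OF term_module Mq_module])

lemma \<pi>_hom: "\<pi> n i \<in> mod_hom R (C i) (Cq n i)"
proof -
  interpret q: quotient_module R M "P n" by (rule quot_M)
  note qD = mod_homD[OF q.cl_hom, folded Mq_def]
  show ?thesis
  proof (rule mod_homI)
    show "\<pi> n i f \<in> carrier (Cq n i)" if f: "f \<in> carrier (C i)" for f
    proof -
      interpret Ti: module R "T i" by (rule term_module)
      note fD = mod_homD[OF CD(1)[OF f]]
      have "\<pi> n i f \<in> mod_hom R (T i) (Mq n)"
        using fD qD by (intro mod_homI) (auto simp: \<pi>_def)
      then show ?thesis by (simp add: hom_cochains_def graded_hom_simps \<pi>_def)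
    qed
    show "\<pi> n i (f \<oplus>\<^bsub>C i\<^esub> g) = \<pi> n i f \<oplus>\<^bsub>Cq n i\<^esub> \<pi> n i g" if "f \<in> carrier (C i)" "g \<in> carrier (C i)" for f g
      using qD(2)[OF CD(2)[OF that(1)] CD(2)[OF that(2)]]
      by (auto simp: \<pi>_def hom_cochains_def graded_hom_simps intro!: restrict_ext)
    show "\<pi> n i (a \<odot>\<^bsub>C i\<^esub> f) = a \<odot>\<^bsub>Cq n i\<^esub> \<pi> n i f" if "a \<in> carrier R" "f \<in> carrier (C i)" for a f
      using qD(3)[OF that(1) CD(2)[OF that(2)]]
      by (auto simp: \<pi>_def hom_cochains_def graded_hom_simps intro!: restrict_ext)
  qed
qed

lemmas \<pi>D = mod_homD[OF \<pi>_hom]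

lemma \<pi>_eq_zero_iff:
  assumes f: "f \<in> carrier (C i)"
  shows "\<pi> n i f = \<zero>\<^bsub>Cq n i\<^esub> \<longleftrightarrow> f \<in> Cn i n"
proof -
  interpret q: quotient_module R M "P n" by (rule quot_M)
  have "\<pi> n i f = \<zero>\<^bsub>Cq n i\<^esub> \<longleftrightarrow> (\<forall>v\<in>carrier (T i). P n +>\<^bsub>M\<^esub> f v = P n)"
    by (auto simp: \<pi>_def hom_cochains_def graded_hom_simps Mq_def graded_quot_simps fun_eq_iff restrict_def)
  also have "\<dots> \<longleftrightarrow> f \<in> Cn i n" using q.cl_eq_zero_iff CD(2)[OF f] f by (simp add: Cn_def)
  finally show ?thesis .
qed

lemma \<pi>_degree: "f \<in> mcomp (C i) e \<Longrightarrow> \<pi> n i f \<in> mcomp (Cq n i) e"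
proof -
  assume f: "f \<in> mcomp (C i) e"
  then have "f \<in> carrier (C i)" by (rule Ck.gr.gD(1))
  from \<pi>D(1)[OF this] have "\<pi> n i f \<in> mod_hom R (T i) (Mq n) \<inter> extensional (carrier (T i))"
    by (simp add: hom_cochains_def graded_hom_simps)
  moreover have "\<pi> n i f v \<in> mcomp (Mq n) (m + e)" if v: "v \<in> mcomp (T i) m" for v m
  proof -
    have "v \<in> carrier (T i)" using v R_gradingD(1) by (auto simp: graded_free_simps PiE_iff)
    moreover have "f v \<in> mcomp M (m + e)" using f v by (auto simp: hom_cochains_def graded_hom_simps has_degree_def)
    ultimately show ?thesis by (simp add: \<pi>_def Mq_def graded_quot_simps)
  qed
  ultimately show ?thesis by (auto simp: hom_cochains_def graded_hom_simps has_degree_def)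
qed

text \<open>Freeness: any choice of representatives for the values on the basis extends to a
  homomorphism, and reducing it agrees with \<open>g\<close> on the basis, hence everywhere.\<close>

lemma \<pi>_lift:
  assumes g: "g \<in> carrier (Cq n i)" and m: "\<And>j. j < length (basis_degs Fr i) \<Longrightarrow> m j \<in> carrier M"
    and gm: "\<And>j. j < length (basis_degs Fr i) \<Longrightarrow> g (basis_vec (basis_degs Fr i) j) = P n +>\<^bsub>M\<^esub> m j"
  shows "free_lift (basis_degs Fr i) M m \<in> carrier (C i)" "\<pi> n i (free_lift (basis_degs Fr i) M m) = g"
proof -
  let ?as = "basis_degs Fr i"
  interpret C: graded_free_hom R M ?as by (rule C_free_hom)
  interpret D: free_hom R "Mq n" ?as by (intro free_hom.intro nat_graded_ring_axioms Mq_module)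
  note L = C.free_lift[of m, OF m]
  show c: "free_lift ?as M m \<in> carrier (C i)" using L(1) by (simp add: hom_cochains_def)
  show "\<pi> n i (free_lift ?as M m) = g"
  proof (rule D.hom_eqI)
    show "\<pi> n i (free_lift ?as M m) \<in> carrier D.H" using \<pi>D(1)[OF c, of n] by (simp add: hom_cochains_def)
    show "g \<in> carrier D.H" using g by (simp add: hom_cochains_def)
    show "\<pi> n i (free_lift ?as M m) (basis_vec ?as j) = g (basis_vec ?as j)" if "j < length ?as" for j
      using C.free_lift(2)[of m j] m that gm[OF that] by (simp add: \<pi>_def)
  qed
qed

lemma \<pi>_surj:
  assumes g: "g \<in> carrier (Cq n i)"
  shows "\<exists>f\<in>carrier (C i). \<pi> n i f = g"
proof -
  let ?as = "basis_degs Fr i"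
  interpret q: quotient_module R M "P n" by (rule quot_M)
  interpret D: free_hom R "Mq n" ?as by (intro free_hom.intro nat_graded_ring_axioms Mq_module)
  have "g (basis_vec ?as j) \<in> carrier (Mq n)" for j
    using g by (intro D.HD(3)) (simp_all add: hom_cochains_def)
  then have "\<forall>j. \<exists>m. m \<in> carrier M \<and> g (basis_vec ?as j) = P n +>\<^bsub>M\<^esub> m"
    by (auto simp: Mq_def q.quot_carrier)
  then obtain m where "\<And>j. m j \<in> carrier M \<and> g (basis_vec ?as j) = P n +>\<^bsub>M\<^esub> m j" by metis
  then show ?thesis using \<pi>_lift[OF g, of m] by blast
qed

text \<open>Homogeneous classes in the quotient have homogeneous representatives of the same degree,
  and the degree of a lift is read off on the basis.\<close>

lemma \<pi>_surj_degree:
  assumes g: "g \<in> mcomp (Cq n i) e"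
  shows "\<exists>f\<in>mcomp (C i) e. \<pi> n i f = g"
proof -
  let ?as = "basis_degs Fr i"
  interpret C: graded_free_hom R M ?as by (rule C_free_hom)
  have gc: "g \<in> carrier (Cq n i)" using g by (simp add: hom_cochains_def graded_hom_simps)
  have "g (basis_vec ?as j) \<in> mcomp (Mq n) (?as ! j + e)" for j
    using g basis_vec_degree[of ?as j] by (fastforce simp: hom_cochains_def graded_hom_simps has_degree_def image_subset_iff)
  then have "\<forall>j. \<exists>m. m \<in> mcomp M (?as ! j + e) \<and> g (basis_vec ?as j) = P n +>\<^bsub>M\<^esub> m"
    by (auto simp: Mq_def graded_quot_simps)
  then obtain m where m: "\<And>j. m j \<in> mcomp M (?as ! j + e)" "\<And>j. g (basis_vec ?as j) = P n +>\<^bsub>M\<^esub> m j" by metis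
  have mc: "m j \<in> carrier M" for j using gr.gD(1)[OF m(1)] .
  note L = \<pi>_lift[OF gc, of m, OF mc m(2)]
  have "free_lift ?as M m \<in> mcomp C.H e"
    using C.free_lift[of m, OF mc] m(1) by (simp add: C.H_mcomp_iff)
  then show ?thesis using L(2) by (auto simp: hom_cochains_def)
qed

lemma \<pi>_codiff: "hom_codiff R Fr i (\<pi> n i f) = \<pi> n (Suc i) (\<delta> i f)"
  using mod_homD(1)[OF diff_hom] by (auto simp: \<pi>_def hom_codiff_def compose_def intro!: restrict_ext)

definition Zq where "Zq n = hom_cocycles R Fr (Mq n) k"
definition Bq where "Bq n = hom_coboundaries R Fr (Mq n) k"

text \<open>Reduction commutes with the codifferential, so the reduced cochain is a cocycle exactly
  when \<open>\<delta> k f\<close> is killed by reduction, that is, has values in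
  \<open>P n\<close>.\<close>

lemma \<pi>_cocycle_iff: "f \<in> carrier (C k) \<Longrightarrow> \<pi> n k f \<in> Zq n \<longleftrightarrow> f \<in> Zn n"
  using \<pi>_eq_zero_iff[OF \<delta>D(1)] \<pi>D(1)
  by (simp add: Zq_def hom_cocycles_def a_kernel_def kernel_def \<pi>_codiff Zn_def)

lemma Zq_eq: "Zq n = \<pi> n k ` Zn n"
proof (intro equalityI subsetI)
  fix g assume g: "g \<in> Zq n"
  then have "g \<in> carrier (Cq n k)" by (simp add: Zq_def hom_cocycles_def a_kernel_def kernel_def)
  from \<pi>_surj[OF this] obtain f where "f \<in> carrier (C k)" "\<pi> n k f = g" by blast
  then show "g \<in> \<pi> n k ` Zn n" using g \<pi>_cocycle_iff[of f n] by blast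
next
  fix g assume "g \<in> \<pi> n k ` Zn n"
  then show "g \<in> Zq n" using \<pi>_cocycle_iff ZnE(1) by blast
qed

lemma Zq_degree: "Zq n \<inter> mcomp (Cq n k) e = \<pi> n k ` (Zn n \<inter> mcomp (C k) e)"
proof (intro equalityI subsetI)
  fix g assume g: "g \<in> Zq n \<inter> mcomp (Cq n k) e"
  then obtain f where "f \<in> mcomp (C k) e" "\<pi> n k f = g" using \<pi>_surj_degree by blast
  then show "g \<in> \<pi> n k ` (Zn n \<inter> mcomp (C k) e)" using g \<pi>_cocycle_iff[of f n] Ck.gr.gD(1) by blast
next
  fix g assume "g \<in> \<pi> n k ` (Zn n \<inter> mcomp (C k) e)"
  then show "g \<in> Zq n \<inter> mcomp (Cq n k) e" using Zq_eq \<pi>_degree by blast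
qed

lemma Bq_eq: "Bq n = \<pi> n k ` B"
proof (cases k)
  case 0
  have "\<pi> n k \<zero>\<^bsub>C k\<^esub> = \<zero>\<^bsub>Cq n k\<^esub>" by (rule mod_hom_zero_diff(1)[OF Ck.module_axioms Cq_module \<pi>_hom])
  then show ?thesis unfolding B_0[OF 0] Bq_def hom_coboundaries_def using 0 by simp
next
  case (Suc j)
  have "Bq n = hom_codiff R Fr j ` carrier (Cq n j)" unfolding Bq_def hom_coboundaries_def using Suc by simp
  also have "carrier (Cq n j) = \<pi> n j ` carrier (C j)" using \<pi>_surj \<pi>D(1) by blast
  also have "hom_codiff R Fr j ` \<dots> = \<pi> n k ` \<delta> j ` carrier (C j)" unfolding image_image \<pi>_codiff Suc ..
  finally show ?thesis unfolding B_Suc[OF Suc] .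
qed

lemma Bq_submodule: "submodule (Bq n) R (Cq n k)"
  unfolding Bq_eq by (rule image_submodule[OF Ck.module_axioms Cq_module \<pi>_hom B_submodule])

text \<open>All coboundaries of the quotient lift to \<open>B\<close>, and two lifts differ by an
  element of \<open>Cn k n\<close>, the kernel of reduction.\<close>

lemma \<pi>_coboundary_iff:
  assumes f: "f \<in> carrier (C k)"
  shows "\<pi> n k f \<in> Bq n \<longleftrightarrow> f \<in> Bt n"
proof
  note pd = mod_hom_zero_diff(2)[OF Ck.module_axioms Cq_module \<pi>_hom, of _ k]
  interpret Q: module R "Cq n k" by (rule Cq_module)
  { assume "\<pi> n k f \<in> Bq n"
    then obtain b where b: "b \<in> B" "\<pi> n k f = \<pi> n k b" unfolding Bq_eq by blast
    have bc: "b \<in> carrier (C k)" using BE(1) b by blast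
    have "\<pi> n k (f \<ominus>\<^bsub>C k\<^esub> b) = \<zero>\<^bsub>Cq n k\<^esub>"
      using pd[OF f bc] b(2) \<pi>D(1)[OF bc] by (simp add: a_minus_def Q.M.r_neg)
    then have "f \<ominus>\<^bsub>C k\<^esub> b \<in> Cn k n" using \<pi>_eq_zero_iff f bc by simp
    moreover have "f = b \<oplus>\<^bsub>C k\<^esub> (f \<ominus>\<^bsub>C k\<^esub> b)"
      using f bc by (simp add: a_minus_def Ck.M.a_lcomm[of b] Ck.M.r_neg)
    ultimately show "f \<in> Bt n" using b(1) unfolding Bt_def by blast }
  assume "f \<in> Bt n"
  then obtain b c where bc: "b \<in> B" "c \<in> Cn k n" "f = b \<oplus>\<^bsub>C k\<^esub> c" by (auto simp: Bt_def)
  have car: "b \<in> carrier (C k)" "c \<in> carrier (C k)" using subsetD[OF BE(1) bc(1)] subsetD[OF CnE(1) bc(2)] by auto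
  have "\<pi> n k c = \<zero>\<^bsub>Cq n k\<^esub>" using \<pi>_eq_zero_iff[OF car(2)] bc(2) by blast
  then have "\<pi> n k f = \<pi> n k b"
    using bc(3) \<pi>D(2)[OF car, of n] Q.M.r_zero[OF \<pi>D(1)[OF car(1)]] by simp
  then show "\<pi> n k f \<in> Bq n" using bc(1) by (simp add: Bq_eq)
qed

abbreviation Hq where "Hq n \<equiv> hom_cohomology R Fr (graded_quot M (P n)) k"

abbreviation colon where "colon n f \<equiv> {a \<in> carrier R. a \<odot>\<^bsub>C k\<^esub> f \<in> Bt n}"

text \<open>Components and annihilators of the cohomology for each \<open>n\<close> are expressed by
  cochains with values in \<open>M\<close>. After this only the pair \<open>Zn n\<close>,
  \<open>Bt n\<close> inside the fixed module \<open>C k\<close> is used.\<close>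

lemma cohomology_description:
  shows "carrier (Hq n) = (\<lambda>f. Bq n +>\<^bsub>Cq n k\<^esub> \<pi> n k f) ` Zn n" (is ?c)
    and "mcomp (Hq n) e = (\<lambda>f. Bq n +>\<^bsub>Cq n k\<^esub> \<pi> n k f) ` (Zn n \<inter> mcomp (C k) e)" (is ?m)
    and "f \<in> Zn n \<Longrightarrow> annih R (Hq n) (Bq n +>\<^bsub>Cq n k\<^esub> \<pi> n k f) = colon n f"
proof -
  interpret q: quotient_module R "Cq n k" "Bq n"
    by (intro quotient_module.intro quotient_module_axioms.intro Bq_submodule Cq_module)
  have H: "Hq n = graded_quot (graded_sub (Cq n k) (Zq n)) (Bq n)"
    by (simp add: hom_cohomology_def Zq_def Bq_def Mq_def)
  have Zc: "Zq n \<subseteq> carrier (Cq n k)" unfolding Zq_eq using \<pi>D(1) ZnE(1) by blast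
  note S = q.subquotient_simps[OF Zc]
  have "carrier (Hq n) = q.cl ` Zq n" unfolding H by (rule S(1))
  then show ?c by (simp only: Zq_eq image_image)
  have "mcomp (Hq n) e = q.cl ` (Zq n \<inter> mcomp (Cq n k) e)" unfolding H by (rule S(2))
  then show ?m by (simp only: Zq_degree image_image)
  assume f: "f \<in> Zn n"
  have fc: "f \<in> carrier (C k)" and pf: "\<pi> n k f \<in> Zq n" using f ZnE(1) Zq_eq by blast+
  have "a \<odot>\<^bsub>Hq n\<^esub> q.cl (\<pi> n k f) = \<zero>\<^bsub>Hq n\<^esub> \<longleftrightarrow> a \<odot>\<^bsub>C k\<^esub> f \<in> Bt n" if a: "a \<in> carrier R" for a
  proof -
    have "a \<odot>\<^bsub>Hq n\<^esub> q.cl (\<pi> n k f) = q.cl (\<pi> n k (a \<odot>\<^bsub>C k\<^esub> f))"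
      unfolding H using S(4)[OF a pf] \<pi>D(3)[OF a fc] by simp
    moreover have "\<zero>\<^bsub>Hq n\<^esub> = Bq n" unfolding H by (rule S(3))
    moreover have "a \<odot>\<^bsub>C k\<^esub> f \<in> carrier (C k)" using a fc by simp
    ultimately show ?thesis using q.cl_eq_zero_iff[OF \<pi>D(1)] \<pi>_coboundary_iff by simp
  qed
  then show "annih R (Hq n) (Bq n +>\<^bsub>Cq n k\<^esub> \<pi> n k f) = colon n f" by (auto simp: annih_def)
qed

lemma Ass_cohomology: "p \<in> Ass R (Hq n) \<longleftrightarrow> primeideal p R \<and> (\<exists>f\<in>Zn n. p = colon n f)"
  by (auto simp: Ass_def cohomology_description)

lemma local_v_number_cohomology:
  "local_v_number R p (Hq n) = Inf {ereal (real_of_int e) |e. \<exists>f\<in>Zn n \<inter> mcomp (C k) e. p = colon n f}"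
proof -
  have "(\<exists>x\<in>mcomp (Hq n) e. p = annih R (Hq n) x) \<longleftrightarrow> (\<exists>f\<in>Zn n \<inter> mcomp (C k) e. p = colon n f)" for e
    unfolding cohomology_description(2) using cohomology_description(3) by auto
  then show ?thesis by (simp add: local_v_number_def)
qed

end

section \<open>Asymptotic behaviour of the v-numbers\<close>

lemma Inf_ereal_int:
  assumes "D m" "\<And>e. D e \<Longrightarrow> m \<le> e"
  shows "Inf {ereal (real_of_int e) |e. D e} = ereal (real_of_int m)"
  using assms by (intro antisym Inf_lower Inf_greatest) auto

context ext_reduction
begin

definition D :: "'a set \<Rightarrow> nat \<Rightarrow> int \<Rightarrow> bool" where
  "D p n e \<longleftrightarrow> (\<exists>f\<in>V n e. p = colon n f)"

text \<open>If \<open>p\<close> contains \<open>I\<close>, then an \<open>f\<close> with colon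
  \<open>p\<close> satisfies the condition on \<open>I\<close> in the definition of \<open>V\<close>
  automatically.\<close>

lemma D_iff: "I \<subseteq> p \<Longrightarrow> D p n e \<longleftrightarrow> (\<exists>f\<in>Zn n \<inter> mcomp (C k) e. p = colon n f)"
  using V_memI by (auto simp: D_def V_def)

lemma local_v_number_D: "I \<subseteq> p \<Longrightarrow> local_v_number R p (Hq n) = Inf {ereal (real_of_int e) |e. D p n e}"
  by (simp add: local_v_number_cohomology D_iff)

text \<open>An associated prime is given as the annihilator of an arbitrary class. Passing to a
  suitable homogeneous component, which is again in \<open>Zn n\<close>, provides a degree.\<close>

lemma D_nonempty:
  assumes p: "p \<in> Ass R (Hq n)" "I \<subseteq> p"
  shows "\<exists>e. D p n e"
proof -
  obtain f where f: "f \<in> Zn n" "p = colon n f" and pp: "primeideal p R" using p(1) by (auto simp: Ass_cohomology)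
  have fc: "f \<in> carrier (C k)" using f ZnE(1) by blast
  obtain e where "p = colon n (Ck.hc k e f)"
    using Ck.prime_colon_homogeneous[OF Bt_submodule Bt_homogeneous fc pp f(2)] by blast
  then have "D p n e" unfolding D_iff[OF p(2)] using Zn_homogeneous[OF f(1)] Ck.gr.hcomp_mem[OF fc] by blast
  then show ?thesis ..
qed

lemma snd_Y: "snd ` Y = dg ` A" by (simp add: Y_def image_image)

lemma ev_affine_min_D: "primeideal p R \<Longrightarrow> ev_affine_min (dg ` A) (D p)"
  using cochain_degrees_bounded filt.ev_affine_min_colon[of p] unfolding snd_Y D_def[abs_def] by blast

text \<open>Of the two alternatives for the least degree, the empty one is impossible since
  \<open>p\<close> is associated for almost all \<open>n\<close>; the affine one gives slope and
  intercept.\<close>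

lemma local_v_number_asymptotic:
  assumes ev: "\<forall>\<^sub>F n in sequentially. p \<in> Ass R (Hq n)" and I: "I \<subseteq> p"
  shows "\<exists>a\<in>dg ` A. \<exists>b::int. \<forall>\<^sub>F n in sequentially. local_v_number R p (Hq n) = ereal (real a * real n + real_of_int b)"
proof -
  obtain n0 where "p \<in> Ass R (Hq n0)" using eventually_happens[OF ev] by auto
  then have "ev_affine_min (dg ` A) (D p)" using ev_affine_min_D by (auto simp: Ass_cohomology)
  moreover have "\<not> (\<forall>\<^sub>F n in sequentially. \<forall>e. \<not> D p n e)"
  proof
    assume "\<forall>\<^sub>F n in sequentially. \<forall>e. \<not> D p n e"
    with ev have "\<forall>\<^sub>F n in sequentially. False" by eventually_elim (use D_nonempty I in blast)
    then show False by simp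
  qed
  ultimately obtain a b where ab: "a \<in> dg ` A" and
    "\<forall>\<^sub>F n in sequentially. D p n (int a * int n + b) \<and> (\<forall>e. D p n e \<longrightarrow> int a * int n + b \<le> e)"
    unfolding ev_affine_min_def by blast
  from this(2) have "\<forall>\<^sub>F n in sequentially. local_v_number R p (Hq n) = ereal (real a * real n + real_of_int b)"
  proof eventually_elim
    case (elim n)
    then show ?case unfolding local_v_number_D[OF I] by (subst Inf_ereal_int[of _ "int a * int n + b"]) auto
  qed
  then show ?thesis using ab by blast
qed

text \<open>For \<open>a\<close> in \<open>I\<close>, the power of exponent \<open>n0\<close> moves
  \<open>M\<close> into \<open>N\<close> and a further \<open>n\<close> factors move
  \<open>N\<close> into \<open>P n\<close>. So a power of \<open>a\<close> kills the cohomology at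
  index \<open>n\<close>, and a prime annihilator contains \<open>a\<close>.\<close>

lemma I_sub_Ass:
  assumes n0: "ideal_smult M (ideal_power R I n0) (carrier M) \<subseteq> N" and p: "p \<in> Ass R (Hq n)"
  shows "I \<subseteq> p"
proof
  fix a assume a: "a \<in> I"
  have ac: "a \<in> carrier R" using I_carrier[OF a] .
  obtain f where f: "f \<in> Zn n" "p = colon n f" and pp: "primeideal p R" using p by (auto simp: Ass_cohomology)
  interpret p: primeideal p R by (rule pp)
  have fc: "f \<in> carrier (C k)" using f ZnE(1) by blast
  let ?b = "a [^] n \<otimes> a [^] n0"
  have bc: "a [^] n \<in> carrier R" "a [^] n0 \<in> carrier R" using ac by simp_all
  have "?b \<odot>\<^bsub>M\<^esub> x \<in> P n" if x: "x \<in> carrier M" for x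
  proof -
    have "a [^] n0 \<odot>\<^bsub>M\<^esub> x \<in> N" using ideal_smult_incl[OF pow_in_ideal_power[OF I_ideal a] x] n0 by blast
    then have "a [^] n \<odot>\<^bsub>M\<^esub> (a [^] n0 \<odot>\<^bsub>M\<^esub> x) \<in> P n"
      unfolding P_def by (rule ideal_smult_incl[OF pow_in_ideal_power[OF I_ideal a]])
    then show ?thesis using bc x by (simp add: smult_assoc1)
  qed
  then have "?b \<odot>\<^bsub>C k\<^esub> f \<in> Cn k n" using bc fc CD(2)[OF fc] by (simp add: Cn_def C_simps)
  then have "?b \<in> colon n f" using Cn_sub_Bt bc by auto
  then have "a [^] n \<in> p \<or> a [^] n0 \<in> p" using p.I_prime[OF bc] f(2) by blast
  moreover have "a \<in> p" if "a [^] m \<in> p" for m :: nat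
    using that
  proof (induction m)
    case 0
    then show ?case using p.one_imp_carrier p.I_notcarr by simp
  next
    case (Suc m)
    then show ?case using p.I_prime[of "a [^] m" a] ac by auto
  qed
  ultimately show "a \<in> p" by blast
qed

lemma v_number_asymptotic:
  assumes n0: "ideal_smult M (ideal_power R I n0) (carrier M) \<subseteq> N" and A_nonempty: "A \<noteq> {}"
  shows "\<exists>a\<in>dg ` A. \<exists>b\<in>range (\<lambda>z::int. ereal (real_of_int z)) \<union> {\<infinity>}. \<forall>\<^sub>F n in sequentially.
    v_number R (Hq n) = ereal (real a * real n) + b"
proof -
  define PP where "PP = {p. primeideal p R \<and> (\<exists>n e. D p n e)}"
  have fin: "finite PP"
    using filt.finite_prime_colons[OF noetherian] by (simp add: PP_def D_def)
  \<comment> \<open>Finiteness of \<open>PP\<close> makes the least degree over all its primes a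
    minimum of finitely many eventually affine functions, from one common index on.\<close>
  have good: "ev_affine_min (dg ` A) (\<lambda>n e. \<exists>p\<in>PP. D p n e)"
    using ev_affine_min_D by (intro ev_affine_min_Bex[OF fin]) (simp add: PP_def)
  have Ass_PP: "p \<in> PP \<and> I \<subseteq> p \<and> (\<exists>e. D p n e)" if "p \<in> Ass R (Hq n)" for p n
    using D_nonempty[OF that I_sub_Ass[OF n0 that]] I_sub_Ass[OF n0 that] that by (auto simp: PP_def Ass_cohomology)
  have PP_Ass: "p \<in> Ass R (Hq n)" if "p \<in> PP" "D p n e" for p n e
    using that by (auto simp: PP_def D_def V_def Ass_cohomology)
  have v_inf: "v_number R (Hq n) = \<infinity>" if none: "\<forall>e. \<not> (\<exists>p\<in>PP. D p n e)" for n
  proof -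
    have "Ass R (Hq n) = {}" using Ass_PP none by blast
    then show ?thesis by (simp add: v_number_def top_ereal_def)
  qed
  have v_min: "v_number R (Hq n) = ereal (real_of_int m)"
    if m: "\<exists>p\<in>PP. D p n m" "\<forall>e. (\<exists>p\<in>PP. D p n e) \<longrightarrow> m \<le> e" for n m
  proof (rule antisym)
    obtain p where p: "p \<in> PP" "D p n m" using m(1) by blast
    have pa: "p \<in> Ass R (Hq n)" using PP_Ass[OF p] .
    then have "local_v_number R p (Hq n) = ereal (real_of_int m)"
      unfolding local_v_number_D[OF I_sub_Ass[OF n0 pa]] using p m(2) by (intro Inf_ereal_int) auto
    then show "v_number R (Hq n) \<le> ereal (real_of_int m)"
      unfolding v_number_def using pa by (intro Inf_lower) force
    show "ereal (real_of_int m) \<le> v_number R (Hq n)"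
      unfolding v_number_def
    proof (rule Inf_greatest, clarify)
      fix q assume q: "q \<in> Ass R (Hq n)"
      show "ereal (real_of_int m) \<le> local_v_number R q (Hq n)"
        unfolding local_v_number_D[OF I_sub_Ass[OF n0 q]]
        using Ass_PP[OF q] m(2) by (intro Inf_greatest) auto
    qed
  qed
  from good show ?thesis unfolding ev_affine_min_def
  proof (elim disjE)
    assume "\<forall>\<^sub>F n in sequentially. \<forall>e. \<not> (\<exists>p\<in>PP. D p n e)"
    then have "\<forall>\<^sub>F n in sequentially. v_number R (Hq n) = \<infinity>" by eventually_elim (rule v_inf)
    \<comment> \<open>No associated primes are left for large \<open>n\<close>. With infinite
      intercept any slope is correct, and one is available because \<open>A\<close> is
      nonempty.\<close>
    then have "\<forall>\<^sub>F n in sequentially. v_number R (Hq n) = ereal (real a * real n) + \<infinity>" for a :: nat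
      by simp
    then show ?thesis using A_nonempty by blast
  next
    assume "\<exists>a\<in>dg ` A. \<exists>b. \<forall>\<^sub>F n in sequentially. (\<exists>p\<in>PP. D p n (int a * int n + b)) \<and>
      (\<forall>e. (\<exists>p\<in>PP. D p n e) \<longrightarrow> int a * int n + b \<le> e)"
    then obtain a b where a: "a \<in> dg ` A" and
      "\<forall>\<^sub>F n in sequentially. (\<exists>p\<in>PP. D p n (int a * int n + b)) \<and>
      (\<forall>e. (\<exists>p\<in>PP. D p n e) \<longrightarrow> int a * int n + b \<le> e)" by blast
    from this(2) have "\<forall>\<^sub>F n in sequentially. v_number R (Hq n) = ereal (real a * real n) + ereal (real_of_int b)"
    proof eventually_elim
      case (elim n)
      then have "v_number R (Hq n) = ereal (real_of_int (int a * int n + b))" by (intro v_min) blast+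
      then show ?case by simp
    qed
    then show ?thesis using a by blast
  qed
qed

end

theorem theorem3p9:
  fixes R :: "'a graded_ring"
    and L :: "('a, 'l) graded_module"
    and M :: "('a, 'm) graded_module"
    and N :: "'m set"
    and I J :: "'a set"
    and xs :: "nat \<Rightarrow> 'a" and d :: nat
    and y :: "nat \<Rightarrow> 'a" and c :: nat and dg :: "nat \<Rightarrow> nat"
    and k :: nat
    and H :: "('a, ((nat \<Rightarrow> 'a) \<Rightarrow> 'm) set) graded_module"
    and Hn :: "nat \<Rightarrow> ('a, ((nat \<Rightarrow> 'a) \<Rightarrow> 'm set) set) graded_module"
  assumes R: "nat_graded_ring R" "noetherian_ring R"
    and x_homogeneous: "\<forall>i\<in>{1..d}. \<exists>n. xs i \<in> rcomp R n"
    and R_generated: "carrier R = generate_ring R (rcomp R 0 \<union> xs ` {1..d})"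
    and L: "graded_module R L" "finitely_generated R L"
    and M: "graded_module R M" "finitely_generated R M"
    and N: "graded_submodule R M N"
    and I: "homogeneous_ideal R I"
    and J: "is_reduction R J I"
    and c: "1 \<le> c"
    and y_homogeneous: "\<forall>i\<in>{1..c}. y i \<in> rcomp R (int (dg i))"
    and J_generated: "J = Idl\<^bsub>R\<^esub> (y ` {1..c})"
    and dg_mono: "mono_on {1..c} dg"
    and H_def: "H = graded_Ext R k L M"
    and Hn_def: "\<And>n. Hn n = graded_Ext R k L (graded_quot M (ideal_smult M (ideal_power R I n) N))"
    and torsion_free: "ideal_torsion H I = {\<zero>\<^bsub>H\<^esub>}"
  shows
    "(\<forall>p. (\<forall>\<^sub>F n in sequentially. p \<in> Ass R (Hn n)) \<and> I \<subseteq> p \<longrightarrow>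
        (\<exists>a\<in>dg ` {1..c}. \<exists>b::int. \<forall>\<^sub>F n in sequentially.
           local_v_number R p (Hn n) = ereal (real a * real n + real_of_int b)))
   \<and> ((\<exists>n0. ideal_smult M (ideal_power R I n0) (carrier M) \<subseteq> N) \<longrightarrow>
        (\<exists>a\<in>dg ` {1..c}. \<exists>b\<in>range (\<lambda>z::int. ereal (real_of_int z)) \<union> {\<infinity>}. \<forall>\<^sub>F n in sequentially.
           v_number R (Hn n) = ereal (real a * real n) + b))"
proof -
  interpret nat_graded_ring R by (rule R(1))
  interpret M: graded_module R M by (rule M(1))
  \<comment> \<open>\<open>graded_Ext\<close> selects its resolution from \<open>L\<close> alone, so
    \<open>H\<close> and every \<open>Hn n\<close> are computed from this same \<open>Fr\<close>.
    One cochain module can therefore serve for all \<open>n\<close>.\<close>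
  define Fr where "Fr = (SOME F. graded_free_resolution R L F)"
  have Fr: "graded_free_resolution R L Fr"
    unfolding Fr_def using someI_ex[OF ex_graded_free_resolution[OF R(2) L]] .
  have diff_diff: "diff Fr i (diff Fr (Suc i) v) = \<zero>\<^bsub>res_term R Fr i\<^esub>"
    if v: "v \<in> carrier (res_term R Fr (Suc (Suc i)))" for i v
  proof -
    have "diff Fr (Suc i) v \<in> a_kernel (res_term R Fr (Suc i)) (res_term R Fr i) (diff Fr i)"
      using Fr v by (auto simp: graded_free_resolution_def)
    then show ?thesis by (simp add: a_kernel_def kernel_def)
  qed
  interpret E: ext_data R M N I Fr k
  proof (intro ext_data.intro graded_powers.intro graded_module_over.intro module_over_graded.intro
      graded_powers_axioms.intro ext_data_axioms.intro)
    show "diff Fr i \<in> mod_hom R (res_term R Fr (Suc i)) (res_term R Fr i)"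
      "has_degree (res_term R Fr (Suc i)) (res_term R Fr i) (diff Fr i) 0" for i
      using Fr by (auto simp: graded_free_resolution_def)
  qed (fact nat_graded_ring_axioms M.module_axioms M(1) N I diff_diff)+
  have H: "H = hom_cohomology R Fr M k" by (simp add: H_def graded_Ext_def Fr_def)
  have Hn: "Hn n = E.Hq n" for n by (simp add: Hn_def graded_Ext_def Fr_def E.P_def)
  interpret E: ext_reduction R M N I Fr k J y dg "{1..c}"
  proof (intro ext_reduction.intro ext_reduction_axioms.intro E.ext_data_axioms R(2) M(2) J finite_atLeastAtMost
      y_homogeneous J_generated)
    show "f \<in> E.B" if "f \<in> E.Z" "\<forall>a\<in>I. a \<odot>\<^bsub>E.C k\<^esub> f \<in> E.B" for f
      using E.cohomology_torsion_free[OF torsion_free[unfolded H] that] .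
  qed
  have "{1..c} \<noteq> {}" using c by simp
  then show ?thesis
    unfolding Hn using E.local_v_number_asymptotic E.v_number_asymptotic by blast
qed

end
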